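(* Let $M=G/H$ be a complex Banach homogeneous space with associated subalgebra $\mathfrak q\subseteq\mathfrak g_{\mathbb C}$. Suppose that the unitary representation $(\pi,\mathcal H_V)$ of $G$ is holomorphically induced from the representation $(\rho,\beta)$ of $(H,\mathfrak q)$ on the Hilbert space $V$, and regard $V$ as a closed subspace of $\mathcal H_V$. Let $$B_{H,\mathfrak q}(V):=\{A\in B_H(V)\colon (\forall x\in\mathfrak q)\ A\beta(x)=\beta(x)A,\ A^*\beta(x)=\beta(x)A^*\}$$ be the involutive commutant of $\rho(H)$ and $\beta(\mathfrak q)$, where $B_H(V)=\rho(H)'$. If $V$ is invariant under the commutant $B_G(\mathcal H_V)=\pi(G)'$, then the map $$R\colon B_G(\mathcal H_V)\to B_{H,\mathfrak q}(V),\qquad A\mapsto A|_V,$$ is an isomorphism of von Neumann algebras.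
   Context: Setting: $G$ is a real Banach–Lie group with Lie algebra $\mathfrak g$, $H\subseteq G$ is a split Lie subgroup (its Lie algebra $\mathfrak h$ has a closed complement in $\mathfrak g$), and $M=G/H$ carries the structure of a complex manifold such that $q_M\colon G\to G/H$ is a smooth $H$-principal bundle and $G$ acts on $M$ by holomorphic maps. $\mathfrak q\subseteq\mathfrak g_{\mathbb C}$ is the kernel of the complex linear extension to $\mathfrak g_{\mathbb C}$ of $\mathfrak g\to T_{\mathbf 1H}(G/H)$, a closed $\mathrm{Ad}(H)$-invariant complex subalgebra containing $\mathfrak h_{\mathbb C}$. Representations of $(H,\mathfrak q)$: $V$ is a complex Hilbert space, $\rho\colon H\to \mathrm U(V)$ a norm continuous (bounded) unitary representation, and $\beta\colon\mathfrak q\to\mathfrak{gl}(V)=B(V)$ an extension of $\rho$, i.e. a continuous morphism of complex Banach–Lie algebras with $\mathrm d\rho=\beta|_{\mathfrak h}$ and $\beta(\mathrm{Ad}(h)x)=\rho(h)\beta(x)\rho(h)^{-1}$ for $h\in H,x\in\mathfrak q$. Bundle: $\mathbb V=G\times_HV$ carries the $G$-invariant holomorphic bundle structure determined by $\beta$, whose holomorphic sections $s\colon M\to\mathbb V$, written $s(gH)=[g,\hat s(g)]$, are those for which $\hat s\colon G\to V$ is smooth with $\hat s(gh)=\rho(h)^{-1}\hat s(g)$ for $h\in H$ and $L_x\hat s=-\beta(x)\hat s$ for $x\in\mathfrak q$; here $(L_xf)(g)=\frac{d}{dt}|_{t=0}f(g\exp tx)$ for $x\in\mathfrak g$, extended complex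 linearly. $\Gamma(\mathbb V)$ is the space of holomorphic sections, with $G$-action $(g.s)(m)=g.s(g^{-1}m)$. A Hilbert space $\mathcal K\subseteq\Gamma(\mathbb V)$ has continuous point evaluations if all maps $\mathrm{ev}_m\colon\mathcal K\to\mathbb V_m$, $s\mapsto s(m)$, are continuous and $m\mapsto\|\mathrm{ev}_m\|$ is locally bounded; it is $G$-invariant if it is preserved by $G$ and $G$ acts on it unitarily. Holomorphically induced: a unitary representation $(\pi,\mathcal H)$ of $G$ is holomorphically induced from $(\rho,\beta)$ if there is a $G$-equivariant linear injection $\Psi\colon\mathcal H\to\Gamma(\mathbb V)$ identifying $\mathcal H$ with a $G$-invariant Hilbert space with continuous point evaluations such that the map $\mathrm{ev}_{\mathbf 1}\colon\mathcal H\to V$, $v\mapsto\widehat{\Psi(v)}(\mathbf 1)$, satisfies $\mathrm{ev}_{\mathbf 1}\mathrm{ev}_{\mathbf 1}^*=\mathrm{id}_V$. Then $V$ is identified with a closed subspace of $\mathcal H$ via the isometric embedding $\mathrm{ev}_{\mathbf 1}^*\colon V\to\mathcal H$.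
   Formalization: The formal theorem assumes in addition that M = G/H is connected; without this the claim fails, e.g. for G = Z/2, H trivial, V = H_V = C^2, π = diag(1, sign), where R maps the diagonal matrices into M_2(C) and is not onto. *)

theory Defs
  imports "HOL-Analysis.Analysis" "HOL-Algebra.Left_Coset"
begin

section \<open>Complex Banach and Hilbert spaces\<close>

class cbanach = banach +
  fixes scaleC :: "complex \<Rightarrow> 'a \<Rightarrow> 'a"  (infixr \<open>*\<^sub>C\<close> 75)
  assumes scaleC_add_right: "c *\<^sub>C (x + y) = c *\<^sub>C x + c *\<^sub>C y"
    and scaleC_add_left: "(c + d) *\<^sub>C x = c *\<^sub>C x + d *\<^sub>C x"
    and scaleC_scaleC: "c *\<^sub>C (d *\<^sub>C x) = (c * d) *\<^sub>C x"
    and scaleC_of_real: "complex_of_real r *\<^sub>C x = r *\<^sub>R x"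
    and norm_scaleC: "norm (c *\<^sub>C x) = cmod c * norm x"

text \<open>The inner product is linear in the first argument.\<close>

class chilbert = cbanach +
  fixes cinner :: "'a \<Rightarrow> 'a \<Rightarrow> complex"
  assumes cinner_commute: "cinner x y = cnj (cinner y x)"
    and cinner_add_left: "cinner (x + y) z = cinner x z + cinner y z"
    and cinner_scaleC_left: "cinner (c *\<^sub>C x) y = c * cinner x y"
    and cinner_self: "cinner x x = complex_of_real ((norm x)\<^sup>2)"

instantiation complex :: chilbert
begin

definition scaleC_complex :: "complex \<Rightarrow> complex \<Rightarrow> complex"
  where "scaleC_complex c x = c * x"

definition cinner_complex :: "complex \<Rightarrow> complex \<Rightarrow> complex"
  where "cinner_complex x y = x * cnj y"

instance
  by standard
    (auto simp: scaleC_complex_def cinner_complex_def algebra_simps norm_mult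
      scaleR_conv_of_real complex_norm_square[symmetric] simp flip: of_real_power)

end

definition is_clinear :: "('v::cbanach \<Rightarrow> 'w::cbanach) \<Rightarrow> bool"
  where "is_clinear f \<longleftrightarrow>
    (\<forall>x y. f (x + y) = f x + f y) \<and> (\<forall>c x. f (c *\<^sub>C x) = c *\<^sub>C f x)"

definition cadj :: "('v::chilbert \<Rightarrow> 'w::chilbert) \<Rightarrow> 'w \<Rightarrow> 'v"
  where "cadj f = (THE g. \<forall>v w. cinner (f v) w = cinner v (g w))"

subsection \<open>Bounded operators and von Neumann algebras\<close>

text \<open>\<^typ>\<open>'v \<Rightarrow>\<^sub>L 'v\<close> consists of the bounded real linear maps; \<open>bounded_ops\<close> is the algebra
  $B(V)$ of complex linear ones.\<close>

definition bounded_ops :: "('v::cbanach \<Rightarrow>\<^sub>L 'v) set"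
  where "bounded_ops = {A. is_clinear (blinfun_apply A)}"

definition op_scaleC :: "complex \<Rightarrow> ('v::cbanach \<Rightarrow>\<^sub>L 'v) \<Rightarrow> ('v \<Rightarrow>\<^sub>L 'v)"
  where "op_scaleC c A = Blinfun (\<lambda>v. c *\<^sub>C blinfun_apply A v)"

definition op_adj :: "('v::chilbert \<Rightarrow>\<^sub>L 'v) \<Rightarrow> ('v \<Rightarrow>\<^sub>L 'v)"
  where "op_adj A = Blinfun (cadj (blinfun_apply A))"

definition unitary_op :: "('v::chilbert \<Rightarrow>\<^sub>L 'v) \<Rightarrow> bool"
  where "unitary_op U \<longleftrightarrow> U \<in> bounded_ops \<and>
    op_adj U o\<^sub>L U = id_blinfun \<and> U o\<^sub>L op_adj U = id_blinfun"

definition commutant :: "('v::cbanach \<Rightarrow>\<^sub>L 'v) set \<Rightarrow> ('v \<Rightarrow>\<^sub>L 'v) set"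
  where "commutant S = {A \<in> bounded_ops. \<forall>B\<in>S. A o\<^sub>L B = B o\<^sub>L A}"

definition von_neumann_algebra :: "('v::chilbert \<Rightarrow>\<^sub>L 'v) set \<Rightarrow> bool"
  where "von_neumann_algebra \<A> \<longleftrightarrow> \<A> \<subseteq> bounded_ops \<and>
    (\<forall>A\<in>\<A>. op_adj A \<in> \<A>) \<and> commutant (commutant \<A>) = \<A>"

definition von_neumann_iso ::
  "('v::chilbert \<Rightarrow>\<^sub>L 'v) set \<Rightarrow> ('w::chilbert \<Rightarrow>\<^sub>L 'w) set \<Rightarrow> (('v \<Rightarrow>\<^sub>L 'v) \<Rightarrow> ('w \<Rightarrow>\<^sub>L 'w)) \<Rightarrow> bool"
  where "von_neumann_iso \<A> \<B> R \<longleftrightarrow>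
    von_neumann_algebra \<A> \<and> von_neumann_algebra \<B> \<and> bij_betw R \<A> \<B> \<and>
    (\<forall>A\<in>\<A>. \<forall>B\<in>\<A>. R (A + B) = R A + R B) \<and>
    (\<forall>c. \<forall>A\<in>\<A>. R (op_scaleC c A) = op_scaleC c (R A)) \<and>
    (\<forall>A\<in>\<A>. \<forall>B\<in>\<A>. R (A o\<^sub>L B) = R A o\<^sub>L R B) \<and>
    (\<forall>A\<in>\<A>. R (op_adj A) = op_adj (R A))"


section \<open>Smooth and holomorphic maps on open subsets of Banach spaces\<close>

definition bounded_multilinear :: "nat \<Rightarrow> ('a::real_normed_vector list \<Rightarrow> 'b::real_normed_vector) \<Rightarrow> bool"
  where "bounded_multilinear n T \<longleftrightarrow>
    (\<forall>vs i. length vs = n \<longrightarrow> i < n \<longrightarrow> linear (\<lambda>v. T (vs[i := v]))) \<and>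
    (\<exists>K. \<forall>vs. length vs = n \<longrightarrow> norm (T vs) \<le> K * prod_list (map norm vs))"

text \<open>Smooth means $C^\infty$ in the Frechet sense.  \<open>D x\<close> restricted to lists of length \<open>n\<close> is the
  \<open>n\<close>-th derivative at \<open>x\<close>, a bounded \<open>n\<close>-linear map.  The last clause says that the \<open>n\<close>-th
  derivative is Frechet differentiable with respect to the norm of bounded \<open>n\<close>-linear maps, with
  derivative given by \<open>D\<close> on lists of length \<open>n + 1\<close>.\<close>

definition frechet_smooth_on :: "'a::banach set \<Rightarrow> ('a \<Rightarrow> 'b::banach) \<Rightarrow> bool"
  where "frechet_smooth_on S f \<longleftrightarrow> open S \<and>
    (\<exists>D. (\<forall>x\<in>S. D x [] = f x) \<and>
      (\<forall>n. \<forall>x\<in>S. bounded_multilinear n (D x) \<and>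
        (\<forall>\<epsilon>>0. \<exists>\<delta>>0. \<forall>y\<in>S. norm (y - x) < \<delta> \<longrightarrow>
          (\<forall>vs. length vs = n \<longrightarrow>
            norm (D y vs - D x vs - D x ((y - x) # vs))
              \<le> \<epsilon> * norm (y - x) * prod_list (map norm vs)))))"

definition cholomorphic_on :: "'m::cbanach set \<Rightarrow> ('m \<Rightarrow> 'n::cbanach) \<Rightarrow> bool"
  where "cholomorphic_on S f \<longleftrightarrow> open S \<and>
    (\<forall>z\<in>S. \<exists>f'. (f has_derivative f') (at z) \<and> is_clinear f')"


section \<open>Banach manifolds\<close>

text \<open>The parameter \<open>R\<close> is the class of admissible maps between open subsets of the model spaces,
  \<^const>\<open>frechet_smooth_on\<close> or \<^const>\<open>cholomorphic_on\<close>.  The topology of a manifold is the one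
  determined by its atlas.\<close>

type_synonym ('x, 'e) chart = "'x set \<times> ('x \<Rightarrow> 'e)"

definition chart_on :: "'x set \<Rightarrow> ('x, 'e::banach) chart \<Rightarrow> bool"
  where "chart_on X = (\<lambda>(U, \<phi>). U \<subseteq> X \<and> inj_on \<phi> U \<and> open (\<phi> ` U))"

definition compatible_charts ::
  "('e set \<Rightarrow> ('e \<Rightarrow> 'e) \<Rightarrow> bool) \<Rightarrow> ('x, 'e::banach) chart \<Rightarrow> ('x, 'e) chart \<Rightarrow> bool"
  where "compatible_charts R = (\<lambda>(U, \<phi>) (V, \<psi>).
    R (\<phi> ` (U \<inter> V)) (\<psi> \<circ> inv_into U \<phi>) \<and> R (\<psi> ` (U \<inter> V)) (\<phi> \<circ> inv_into V \<psi>))"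

definition mfd_top :: "'x set \<Rightarrow> ('x, 'e::banach) chart set \<Rightarrow> 'x topology"
  where "mfd_top X \<A> = topology (\<lambda>S. S \<subseteq> X \<and> (\<forall>(U, \<phi>)\<in>\<A>. open (\<phi> ` (S \<inter> U))))"

definition banach_manifold ::
  "('e set \<Rightarrow> ('e \<Rightarrow> 'e) \<Rightarrow> bool) \<Rightarrow> 'x set \<Rightarrow> ('x, 'e::banach) chart set \<Rightarrow> bool"
  where "banach_manifold R X \<A> \<longleftrightarrow>
    (\<forall>c\<in>\<A>. chart_on X c) \<and> \<Union>(fst ` \<A>) = X \<and>
    (\<forall>c\<in>\<A>. \<forall>c'\<in>\<A>. compatible_charts R c c') \<and>
    Hausdorff_space (mfd_top X \<A>)"

text \<open>Charts of the maximal atlas generated by \<open>\<A>\<close>.\<close>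

definition admissible_chart ::
  "('e set \<Rightarrow> ('e \<Rightarrow> 'e) \<Rightarrow> bool) \<Rightarrow> 'x set \<Rightarrow> ('x, 'e::banach) chart set \<Rightarrow> ('x, 'e) chart \<Rightarrow> bool"
  where "admissible_chart R X \<A> c \<longleftrightarrow> chart_on X c \<and> (\<forall>c'\<in>\<A>. compatible_charts R c c')"

definition mfd_map ::
  "('e set \<Rightarrow> ('e \<Rightarrow> 'f) \<Rightarrow> bool) \<Rightarrow> 'x set \<Rightarrow> ('x, 'e::banach) chart set
    \<Rightarrow> 'y set \<Rightarrow> ('y, 'f::banach) chart set \<Rightarrow> ('x \<Rightarrow> 'y) \<Rightarrow> bool"
  where "mfd_map R X \<A> Y \<B> f \<longleftrightarrow>
    continuous_map (mfd_top X \<A>) (mfd_top Y \<B>) f \<and>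
    (\<forall>(U, \<phi>)\<in>\<A>. \<forall>(V, \<psi>)\<in>\<B>.
      R (\<phi> ` {x \<in> U. f x \<in> V}) (\<psi> \<circ> f \<circ> inv_into U \<phi>))"

definition vec_atlas :: "('e, 'e::banach) chart set"
  where "vec_atlas = {(UNIV, id)}"

definition prod_atlas ::
  "('x, 'e::banach) chart set \<Rightarrow> ('y, 'f::banach) chart set \<Rightarrow> ('x \<times> 'y, 'e \<times> 'f) chart set"
  where "prod_atlas \<A> \<B> = {(U \<times> V, map_prod \<phi> \<psi>) | U \<phi> V \<psi>. (U, \<phi>) \<in> \<A> \<and> (V, \<psi>) \<in> \<B>}"

definition restrict_atlas :: "'x set \<Rightarrow> ('x, 'e::banach) chart set \<Rightarrow> ('x, 'e) chart set"
  where "restrict_atlas S \<A> = (\<lambda>(U, \<phi>). (U \<inter> S, \<phi>)) ` \<A>"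

definition diffeomorphism ::
  "'x set \<Rightarrow> ('x, 'e::banach) chart set \<Rightarrow> 'y set \<Rightarrow> ('y, 'f::banach) chart set \<Rightarrow> ('x \<Rightarrow> 'y) \<Rightarrow> bool"
  where "diffeomorphism X \<A> Y \<B> f \<longleftrightarrow> bij_betw f X Y \<and>
    mfd_map frechet_smooth_on X \<A> Y \<B> f \<and>
    mfd_map frechet_smooth_on Y \<B> X \<A> (inv_into X f)"


section \<open>Banach-Lie groups\<close>

text \<open>A Lie group comes with an atlas and a distinguished chart at the unit element.  The latter
  serves to identify the Lie algebra $T_{\mathbf 1}(G)$ with the model space \<open>'a\<close>: the tangent vector
  of a curve through the unit element is the derivative of its image in this chart.\<close>

record ('g, 'a) lie_group = "'g monoid" +
  atlas :: "('g, 'a) chart set"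
  unit_chart :: "('g, 'a) chart"

definition banach_lie_group :: "('g, 'a::banach) lie_group \<Rightarrow> bool"
  where "banach_lie_group G \<longleftrightarrow> group G \<and>
    banach_manifold frechet_smooth_on (carrier G) (atlas G) \<and>
    mfd_map frechet_smooth_on (carrier G \<times> carrier G) (prod_atlas (atlas G) (atlas G))
      (carrier G) (atlas G) (\<lambda>(g, g'). g \<otimes>\<^bsub>G\<^esub> g') \<and>
    mfd_map frechet_smooth_on (carrier G) (atlas G) (carrier G) (atlas G) (m_inv G) \<and>
    unit_chart G \<in> atlas G \<and> \<one>\<^bsub>G\<^esub> \<in> fst (unit_chart G)"

definition one_param_subgroup :: "('g, 'a::banach) lie_group \<Rightarrow> (real \<Rightarrow> 'g) \<Rightarrow> bool"
  where "one_param_subgroup G \<gamma> \<longleftrightarrow> (\<forall>s t. \<gamma> (s + t) = \<gamma> s \<otimes>\<^bsub>G\<^esub> \<gamma> t) \<and>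
    mfd_map frechet_smooth_on UNIV vec_atlas (carrier G) (atlas G) \<gamma>"

definition lie_exp :: "('g, 'a::banach) lie_group \<Rightarrow> 'a \<Rightarrow> 'g"
  where "lie_exp G x = (THE \<gamma>. one_param_subgroup G \<gamma> \<and>
    ((snd (unit_chart G) \<circ> \<gamma>) has_vector_derivative x) (at 0)) 1"

definition lie_Ad :: "('g, 'a::banach) lie_group \<Rightarrow> 'g \<Rightarrow> 'a \<Rightarrow> 'a"
  where "lie_Ad G g y = vector_derivative
    (\<lambda>t. snd (unit_chart G) (g \<otimes>\<^bsub>G\<^esub> lie_exp G (t *\<^sub>R y) \<otimes>\<^bsub>G\<^esub> inv\<^bsub>G\<^esub> g)) (at 0)"

text \<open>The bracket is $[x,y] = \mathrm{ad}(x)y$ with $\mathrm{ad} = T_{\mathbf 1}(\mathrm{Ad})$.\<close>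

definition lie_bracket :: "('g, 'a::banach) lie_group \<Rightarrow> 'a \<Rightarrow> 'a \<Rightarrow> 'a"
  where "lie_bracket G x y = vector_derivative (\<lambda>t. lie_Ad G (lie_exp G (t *\<^sub>R x)) y) (at 0)"

subsection \<open>The complexified Lie algebra\<close>

text \<open>The pair \<open>(x, y)\<close> stands for $x + iy \in \mathfrak g_{\mathbb C}$.\<close>

definition cpx_scale :: "complex \<Rightarrow> 'a::banach \<times> 'a \<Rightarrow> 'a \<times> 'a"
  where "cpx_scale c = (\<lambda>(x, y). (Re c *\<^sub>R x - Im c *\<^sub>R y, Re c *\<^sub>R y + Im c *\<^sub>R x))"

definition cpx_bracket :: "('g, 'a::banach) lie_group \<Rightarrow> 'a \<times> 'a \<Rightarrow> 'a \<times> 'a \<Rightarrow> 'a \<times> 'a"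
  where "cpx_bracket G = (\<lambda>(x, y) (x', y').
    (lie_bracket G x x' - lie_bracket G y y', lie_bracket G x y' + lie_bracket G y x'))"

definition cpx_Ad :: "('g, 'a::banach) lie_group \<Rightarrow> 'g \<Rightarrow> 'a \<times> 'a \<Rightarrow> 'a \<times> 'a"
  where "cpx_Ad G g = (\<lambda>(x, y). (lie_Ad G g x, lie_Ad G g y))"

definition lie_deriv ::
  "('g, 'a::banach) lie_group \<Rightarrow> 'a \<Rightarrow> ('g \<Rightarrow> 'v::cbanach) \<Rightarrow> 'g \<Rightarrow> 'v"
  where "lie_deriv G x f g = vector_derivative (\<lambda>t. f (g \<otimes>\<^bsub>G\<^esub> lie_exp G (t *\<^sub>R x))) (at 0)"

definition cpx_lie_deriv ::
  "('g, 'a::banach) lie_group \<Rightarrow> 'a \<times> 'a \<Rightarrow> ('g \<Rightarrow> 'v::cbanach) \<Rightarrow> 'g \<Rightarrow> 'v"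
  where "cpx_lie_deriv G = (\<lambda>(x, y) f g. lie_deriv G x f g + \<i> *\<^sub>C lie_deriv G y f g)"


section \<open>Complex Banach homogeneous spaces\<close>

text \<open>A Lie subgroup is an embedded submanifold: near each of its points it is given, in a suitable
  chart of \<open>G\<close>, by the closed subspace \<open>range j\<close> of the model space, and \<open>j\<close> identifies this subspace
  with the model space of \<open>H\<close>.\<close>

definition lie_subgroup ::
  "('g, 'a::banach) lie_group \<Rightarrow> 'g set \<Rightarrow> ('g, 'b::banach) chart set \<Rightarrow> bool"
  where "lie_subgroup G H AH \<longleftrightarrow> subgroup H G \<and>
    banach_manifold frechet_smooth_on H AH \<and>
    (\<forall>h\<in>H. \<exists>U \<phi> \<psi> (j :: 'b \<Rightarrow> 'a). h \<in> U \<and>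
      admissible_chart frechet_smooth_on (carrier G) (atlas G) (U, \<phi>) \<and>
      admissible_chart frechet_smooth_on H AH (U \<inter> H, \<psi>) \<and>
      bounded_linear j \<and> inj j \<and> closed (range j) \<and>
      \<phi> ` (U \<inter> H) = \<phi> ` U \<inter> range j \<and> (\<forall>x\<in>U \<inter> H. \<phi> x = j (\<psi> x)))"

definition subgroup_lie_algebra :: "('g, 'a::banach) lie_group \<Rightarrow> 'g set \<Rightarrow> 'a set"
  where "subgroup_lie_algebra G H = {x. \<forall>t. lie_exp G (t *\<^sub>R x) \<in> H}"

definition split_lie_subgroup ::
  "('g, 'a::banach) lie_group \<Rightarrow> 'g set \<Rightarrow> ('g, 'b::banach) chart set \<Rightarrow> bool"
  where "split_lie_subgroup G H AH \<longleftrightarrow> lie_subgroup G H AH \<and>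
    (\<exists>K. subspace K \<and> closed K \<and> subgroup_lie_algebra G H \<inter> K = {0} \<and>
      (\<forall>x. \<exists>u\<in>subgroup_lie_algebra G H. \<exists>k\<in>K. x = u + k))"

definition principal_quotient_bundle ::
  "('g, 'a::banach) lie_group \<Rightarrow> 'g set \<Rightarrow> ('g, 'b::banach) chart set
    \<Rightarrow> ('g set, 'm::banach) chart set \<Rightarrow> bool"
  where "principal_quotient_bundle G H AH AM \<longleftrightarrow>
    mfd_map frechet_smooth_on (carrier G) (atlas G) (lcosets\<^bsub>G\<^esub> H) AM (\<lambda>g. g <#\<^bsub>G\<^esub> H) \<and>
    (\<forall>m\<in>lcosets\<^bsub>G\<^esub> H. \<exists>U \<Phi>. openin (mfd_top (lcosets\<^bsub>G\<^esub> H) AM) U \<and> m \<in> U \<and>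
      diffeomorphism (U \<times> H) (prod_atlas (restrict_atlas U AM) AH)
        {g \<in> carrier G. g <#\<^bsub>G\<^esub> H \<in> U}
        (restrict_atlas {g \<in> carrier G. g <#\<^bsub>G\<^esub> H \<in> U} (atlas G)) \<Phi> \<and>
      (\<forall>u\<in>U. \<forall>h\<in>H. \<Phi> (u, h) <#\<^bsub>G\<^esub> H = u \<and>
        (\<forall>h'\<in>H. \<Phi> (u, h \<otimes>\<^bsub>G\<^esub> h') = \<Phi> (u, h) \<otimes>\<^bsub>G\<^esub> h')))"

text \<open>Connectedness of $G/H$ is not part of this definition; results that rely on the identity theorem
  for holomorphic sections have to assume it separately.\<close>

definition complex_homogeneous_space ::
  "('g, 'a::banach) lie_group \<Rightarrow> 'g set \<Rightarrow> ('g, 'b::banach) chart set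
    \<Rightarrow> ('g set, 'm::cbanach) chart set \<Rightarrow> bool"
  where "complex_homogeneous_space G H AH AM \<longleftrightarrow>
    banach_lie_group G \<and> split_lie_subgroup G H AH \<and>
    banach_manifold cholomorphic_on (lcosets\<^bsub>G\<^esub> H) AM \<and>
    principal_quotient_bundle G H AH AM \<and>
    (\<forall>g\<in>carrier G. mfd_map cholomorphic_on (lcosets\<^bsub>G\<^esub> H) AM (lcosets\<^bsub>G\<^esub> H) AM
      (\<lambda>m. g <#\<^bsub>G\<^esub> m))"

text \<open>The differential of the quotient map at the unit element, read in a chart \<open>\<psi>\<close> of $G/H$ at the
  base point \<open>H\<close>.\<close>

definition quotient_tangent ::
  "('g, 'a::banach) lie_group \<Rightarrow> 'g set \<Rightarrow> ('g set \<Rightarrow> 'm::cbanach) \<Rightarrow> 'a \<Rightarrow> 'm"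
  where "quotient_tangent G H \<psi> x = vector_derivative (\<lambda>t. \<psi> (lie_exp G (t *\<^sub>R x) <#\<^bsub>G\<^esub> H)) (at 0)"

text \<open>The subalgebra $\mathfrak q$; the kernel does not depend on the chart \<open>\<psi>\<close>.\<close>

definition isotropy_q ::
  "('g, 'a::banach) lie_group \<Rightarrow> 'g set \<Rightarrow> ('g set, 'm::cbanach) chart set \<Rightarrow> ('a \<times> 'a) set"
  where "isotropy_q G H AM = {(x, y). \<forall>(U, \<psi>)\<in>AM. H \<in> U \<longrightarrow>
    quotient_tangent G H \<psi> x + \<i> *\<^sub>C quotient_tangent G H \<psi> y = 0}"


section \<open>Representations\<close>

definition unitary_hom ::
  "('g, 'a) lie_group \<Rightarrow> 'g set \<Rightarrow> ('g \<Rightarrow> 'v::chilbert \<Rightarrow>\<^sub>L 'v) \<Rightarrow> bool"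
  where "unitary_hom G K \<pi> \<longleftrightarrow> (\<forall>g\<in>K. unitary_op (\<pi> g)) \<and> \<pi> \<one>\<^bsub>G\<^esub> = id_blinfun \<and>
    (\<forall>g\<in>K. \<forall>g'\<in>K. \<pi> (g \<otimes>\<^bsub>G\<^esub> g') = \<pi> g o\<^sub>L \<pi> g')"

definition unitary_rep :: "('g, 'a::banach) lie_group \<Rightarrow> ('g \<Rightarrow> 'h::chilbert \<Rightarrow>\<^sub>L 'h) \<Rightarrow> bool"
  where "unitary_rep G \<pi> \<longleftrightarrow> unitary_hom G (carrier G) \<pi> \<and>
    (\<forall>v. continuous_map (mfd_top (carrier G) (atlas G)) euclidean (\<lambda>g. \<pi> g v))"

text \<open>\<open>\<rho>\<close> and \<open>\<beta>\<close> are total functions of which only the restrictions to \<open>H\<close> and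
  $\mathfrak q$ are relevant.\<close>

definition representation_of_pair ::
  "('g, 'a::banach) lie_group \<Rightarrow> 'g set \<Rightarrow> ('g, 'b::banach) chart set \<Rightarrow> ('a \<times> 'a) set
    \<Rightarrow> ('g \<Rightarrow> 'v::chilbert \<Rightarrow>\<^sub>L 'v) \<Rightarrow> ('a \<times> 'a \<Rightarrow> 'v \<Rightarrow>\<^sub>L 'v) \<Rightarrow> bool"
  where "representation_of_pair G H AH q \<rho> \<beta> \<longleftrightarrow>
    unitary_hom G H \<rho> \<and> continuous_map (mfd_top H AH) euclidean \<rho> \<and>
    \<beta> ` q \<subseteq> bounded_ops \<and> continuous_on q \<beta> \<and>
    (\<forall>x\<in>q. \<forall>y\<in>q. \<beta> (x + y) = \<beta> x + \<beta> y) \<and>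
    (\<forall>c. \<forall>x\<in>q. \<beta> (cpx_scale c x) = op_scaleC c (\<beta> x)) \<and>
    (\<forall>x\<in>q. \<forall>y\<in>q. \<beta> (cpx_bracket G x y) = (\<beta> x o\<^sub>L \<beta> y) - (\<beta> y o\<^sub>L \<beta> x)) \<and>
    (\<forall>x\<in>subgroup_lie_algebra G H.
      ((\<lambda>t. \<rho> (lie_exp G (t *\<^sub>R x))) has_vector_derivative \<beta> (x, 0)) (at 0)) \<and>
    (\<forall>h\<in>H. \<forall>x\<in>q. \<beta> (cpx_Ad G h x) = \<rho> h o\<^sub>L \<beta> x o\<^sub>L \<rho> (inv\<^bsub>G\<^esub> h))"


section \<open>The associated bundle and its holomorphic sections\<close>

text \<open>The class $[g,v] \in G \times_H V$, as an orbit of the action $h.(g,v) = (gh^{-1},\rho(h)v)$.\<close>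

definition bdl_class ::
  "('g, 'a) lie_group \<Rightarrow> 'g set \<Rightarrow> ('g \<Rightarrow> 'v::chilbert \<Rightarrow>\<^sub>L 'v) \<Rightarrow> 'g \<Rightarrow> 'v \<Rightarrow> ('g \<times> 'v) set"
  where "bdl_class G H \<rho> g v = {(g \<otimes>\<^bsub>G\<^esub> inv\<^bsub>G\<^esub> h, \<rho> h v) | h. h \<in> H}"

text \<open>The vector space structure and the norm of a fiber: $[g,v]+[g,w]=[g,v+w]$,
  $c[g,v]=[g,cv]$ and $\|[g,v]\|=\|v\|$.\<close>

definition fiber_add :: "('g \<times> 'v::chilbert) set \<Rightarrow> ('g \<times> 'v) set \<Rightarrow> ('g \<times> 'v) set"
  where "fiber_add C D = {(g, v + w) | g v w. (g, v) \<in> C \<and> (g, w) \<in> D}"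

definition fiber_scale :: "complex \<Rightarrow> ('g \<times> 'v::chilbert) set \<Rightarrow> ('g \<times> 'v) set"
  where "fiber_scale c C = {(g, c *\<^sub>C v) | g v. (g, v) \<in> C}"

definition fiber_norm :: "('g \<times> 'v::chilbert) set \<Rightarrow> real"
  where "fiber_norm C = (THE r. \<forall>(g, v)\<in>C. norm v = r)"

text \<open>\<open>hat_section G H \<rho> s\<close> is the function $\hat s$ with $s(gH) = [g,\hat s(g)]$.\<close>

definition hat_section ::
  "('g, 'a) lie_group \<Rightarrow> 'g set \<Rightarrow> ('g \<Rightarrow> 'v::chilbert \<Rightarrow>\<^sub>L 'v)
    \<Rightarrow> ('g set \<Rightarrow> ('g \<times> 'v) set) \<Rightarrow> 'g \<Rightarrow> 'v"
  where "hat_section G H \<rho> s g = (THE v. s (g <#\<^bsub>G\<^esub> H) = bdl_class G H \<rho> g v)"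

definition holomorphic_sections ::
  "('g, 'a::banach) lie_group \<Rightarrow> 'g set \<Rightarrow> ('a \<times> 'a) set
    \<Rightarrow> ('g \<Rightarrow> 'v::chilbert \<Rightarrow>\<^sub>L 'v) \<Rightarrow> ('a \<times> 'a \<Rightarrow> 'v \<Rightarrow>\<^sub>L 'v) \<Rightarrow> ('g set \<Rightarrow> ('g \<times> 'v) set) set"
  where "holomorphic_sections G H q \<rho> \<beta> = {s \<in> extensional (lcosets\<^bsub>G\<^esub> H).
    (\<forall>g\<in>carrier G. s (g <#\<^bsub>G\<^esub> H) = bdl_class G H \<rho> g (hat_section G H \<rho> s g)) \<and>
    mfd_map frechet_smooth_on (carrier G) (atlas G) UNIV vec_atlas (hat_section G H \<rho> s) \<and>
    (\<forall>g\<in>carrier G. \<forall>h\<in>H.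
      hat_section G H \<rho> s (g \<otimes>\<^bsub>G\<^esub> h) = \<rho> (inv\<^bsub>G\<^esub> h) (hat_section G H \<rho> s g)) \<and>
    (\<forall>x\<in>q. \<forall>g\<in>carrier G.
      cpx_lie_deriv G x (hat_section G H \<rho> s) g = - \<beta> x (hat_section G H \<rho> s g))}"

text \<open>$(g.s)(m) = g.s(g^{-1}m)$ with $g.[x,v] = [gx,v]$.\<close>

definition section_act ::
  "('g, 'a) lie_group \<Rightarrow> 'g set \<Rightarrow> 'g \<Rightarrow> ('g set \<Rightarrow> ('g \<times> 'v) set) \<Rightarrow> 'g set \<Rightarrow> ('g \<times> 'v) set"
  where "section_act G H g s =
    (\<lambda>m\<in>lcosets\<^bsub>G\<^esub> H. (\<lambda>(x, v). (g \<otimes>\<^bsub>G\<^esub> x, v)) ` s ((inv\<^bsub>G\<^esub> g) <#\<^bsub>G\<^esub> m))"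


section \<open>Holomorphically induced representations\<close>

definition ev_unit ::
  "('g, 'a) lie_group \<Rightarrow> 'g set \<Rightarrow> ('g \<Rightarrow> 'v::chilbert \<Rightarrow>\<^sub>L 'v)
    \<Rightarrow> ('h \<Rightarrow> 'g set \<Rightarrow> ('g \<times> 'v) set) \<Rightarrow> 'h \<Rightarrow> 'v"
  where "ev_unit G H \<rho> \<Psi> v = hat_section G H \<rho> (\<Psi> v) \<one>\<^bsub>G\<^esub>"

text \<open>\<open>\<Psi>\<close> realizes the representation \<open>\<pi>\<close> in the holomorphic sections.  The Hilbert space norm on
  \<open>range \<Psi>\<close> is the one transported from \<open>'h\<close>; the two clauses involving \<^const>\<open>fiber_norm\<close> state
  the continuity of the point evaluations and the local boundedness of their norms.  Since
  \<^const>\<open>unitary_rep\<close> is required, equivariance of \<open>\<Psi>\<close> makes \<open>range \<Psi>\<close> an invariant subspace on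
  which \<open>G\<close> acts unitarily.\<close>

definition holomorphically_induced_via ::
  "('g, 'a::banach) lie_group \<Rightarrow> 'g set \<Rightarrow> ('g set, 'm::cbanach) chart set
    \<Rightarrow> ('g \<Rightarrow> 'v::chilbert \<Rightarrow>\<^sub>L 'v) \<Rightarrow> ('a \<times> 'a \<Rightarrow> 'v \<Rightarrow>\<^sub>L 'v)
    \<Rightarrow> ('g \<Rightarrow> 'h::chilbert \<Rightarrow>\<^sub>L 'h) \<Rightarrow> ('h \<Rightarrow> 'g set \<Rightarrow> ('g \<times> 'v) set) \<Rightarrow> bool"
  where "holomorphically_induced_via G H AM \<rho> \<beta> \<pi> \<Psi> \<longleftrightarrow>
    unitary_rep G \<pi> \<and>
    inj \<Psi> \<and> range \<Psi> \<subseteq> holomorphic_sections G H (isotropy_q G H AM) \<rho> \<beta> \<and>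
    (\<forall>v w. \<forall>m\<in>lcosets\<^bsub>G\<^esub> H. \<Psi> (v + w) m = fiber_add (\<Psi> v m) (\<Psi> w m)) \<and>
    (\<forall>c v. \<forall>m\<in>lcosets\<^bsub>G\<^esub> H. \<Psi> (c *\<^sub>C v) m = fiber_scale c (\<Psi> v m)) \<and>
    (\<forall>g\<in>carrier G. \<forall>v. \<Psi> (\<pi> g v) = section_act G H g (\<Psi> v)) \<and>
    (\<forall>m\<in>lcosets\<^bsub>G\<^esub> H. \<exists>C. \<forall>v. fiber_norm (\<Psi> v m) \<le> C * norm v) \<and>
    (\<forall>m\<^sub>0\<in>lcosets\<^bsub>G\<^esub> H. \<exists>U C. openin (mfd_top (lcosets\<^bsub>G\<^esub> H) AM) U \<and> m\<^sub>0 \<in> U \<and>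
      (\<forall>m\<in>U. \<forall>v. fiber_norm (\<Psi> v m) \<le> C * norm v)) \<and>
    ev_unit G H \<rho> \<Psi> \<circ> cadj (ev_unit G H \<rho> \<Psi>) = id"

text \<open>The isometric embedding $\mathrm{ev}_{\mathbf 1}^*$ of \<open>V\<close> into the representation space, and
  the restriction \<open>A|\<^sub>V\<close> considered as an operator on \<open>V\<close>.\<close>

definition embed_V ::
  "('g, 'a) lie_group \<Rightarrow> 'g set \<Rightarrow> ('g \<Rightarrow> 'v::chilbert \<Rightarrow>\<^sub>L 'v)
    \<Rightarrow> ('h::chilbert \<Rightarrow> 'g set \<Rightarrow> ('g \<times> 'v) set) \<Rightarrow> 'v \<Rightarrow> 'h"
  where "embed_V G H \<rho> \<Psi> = cadj (ev_unit G H \<rho> \<Psi>)"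

definition restrict_op :: "('v::chilbert \<Rightarrow> 'h::chilbert) \<Rightarrow> ('h \<Rightarrow>\<^sub>L 'h) \<Rightarrow> ('v \<Rightarrow>\<^sub>L 'v)"
  where "restrict_op \<iota> A = Blinfun (\<lambda>v. inv_into UNIV \<iota> (A (\<iota> v)))"

definition involutive_commutant ::
  "'g set \<Rightarrow> 'x set \<Rightarrow> ('g \<Rightarrow> 'v::chilbert \<Rightarrow>\<^sub>L 'v) \<Rightarrow> ('x \<Rightarrow> 'v \<Rightarrow>\<^sub>L 'v) \<Rightarrow> ('v \<Rightarrow>\<^sub>L 'v) set"
  where "involutive_commutant H q \<rho> \<beta> = {A \<in> commutant (\<rho> ` H).
    \<forall>x\<in>q. A o\<^sub>L \<beta> x = \<beta> x o\<^sub>L A \<and> op_adj A o\<^sub>L \<beta> x = \<beta> x o\<^sub>L op_adj A}"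

end

theory Submission
  imports Defs "HOL-Complex_Analysis.Complex_Analysis"
begin

text \<open>Write $\mathrm{ev} = \mathrm{ev}_{\mathbf 1}$ and $\iota = \mathrm{ev}^*$.  Since the commutant of
  $\pi(G)$ is closed under adjoints and preserves $V$, each of its elements $A$ satisfies
  $\mathrm{ev} A = (A|_V)\, \mathrm{ev}$; hence $A|_V$ determines $A$, and differentiating
  $\mathrm{ev}\, \pi(g)^{-1} A \iota v = (A|_V)\, \mathrm{ev}\, \pi(g)^{-1} \iota v$ shows that $A|_V$
  commutes with $\beta(\mathfrak q)$.

  For surjectivity, let $B$ be in the involutive commutant and
  $\Phi(g) = \mathrm{ev}\, \pi(g) \iota B - B\, \mathrm{ev}\, \pi(g) \iota$.  Over a lift
  $\gamma(t + is) = \exp(tx)\sigma(s)$ of a holomorphic disc in $G/H$ the kernel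
  $\Phi(\gamma(z)^{-1}\gamma(w))$ becomes, in a trivialisation of the bundle that only depends on the
  imaginary part, a function of $z - \overline w$ holomorphic in that variable.  It vanishes on the
  diagonal, hence identically, so $\Phi(\exp x) = 0$ for all $x$.  The same discs propagate the
  vanishing of holomorphic sections along one-parameter groups, and as $G/H$ is connected, $\Phi = 0$.
  Then $\sum_i \pi(g_i)\iota v_i \mapsto \sum_i \pi(g_i)\iota B v_i$ is well defined and bounded, and
  its extension is an element of the commutant restricting to $B$.\<close>

section \<open>Hilbert spaces\<close>

text \<open>The group has no complexification at hand, so exp((t + is)x) makes sense only through
  its image in G/H. A disc replaces it by exp(tx)\<sigma>(s), where the velocities a and b in the
  directions t and s satisfy (a, b) \<in> \<qq>: this is the Cauchy-Riemann equation of the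
  projected curve. Along it the values u of a holomorphic section still obey u_t + i u_s = -
  \<beta>(a, b) u, and \<open>W\<close> solves the equation that cancels the right-hand side once u
  is paired with W w. All holomorphy is thereby reduced to scalar functions on a strip in the plane.

  The involution in the commutant supplies the second variable of the kernel: the adjoint of the
  commutator with B is minus the commutator with the adjoint of B, so holomorphy in z for the latter
  is antiholomorphy in w for the former.

  The obstacle in extending B is that the obvious bound on a sum of vectors \<pi>(g)\<iota>v depends
  on how the sum is written. Symmetry of the operator and repeated squaring remove this
  dependence.\<close>

lemma scaleC_zero_right [simp]: "c *\<^sub>C (0::'a::cbanach) = 0"
  using scaleC_add_right[of c 0 0] by simp

lemma scaleC_zero_left [simp]: "0 *\<^sub>C (x::'a::cbanach) = 0"
  using scaleC_of_real[of 0 x] by simp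

lemma scaleC_one [simp]: "1 *\<^sub>C (x::'a::cbanach) = x"
  using scaleC_of_real[of 1 x] by simp

lemma scaleC_minus_right [simp]: "c *\<^sub>C (- x::'a::cbanach) = - (c *\<^sub>C x)"
  using scaleC_add_right[of c x "-x"] by (simp add: eq_neg_iff_add_eq_0 add.commute)

lemma scaleC_minus_left [simp]: "(- c) *\<^sub>C (x::'a::cbanach) = - (c *\<^sub>C x)"
  using scaleC_add_left[of c "-c" x] by (simp add: eq_neg_iff_add_eq_0 add.commute)

lemma scaleC_diff_right: "c *\<^sub>C (x - y::'a::cbanach) = c *\<^sub>C x - c *\<^sub>C y"
  using scaleC_add_right[of c x "-y"] by simp

lemma scaleC_scaleR: "c *\<^sub>C (r *\<^sub>R x) = r *\<^sub>R (c *\<^sub>C (x::'a::cbanach))"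
  by (simp add: scaleC_scaleC mult.commute flip: scaleC_of_real)

lemma bounded_bilinear_scaleC: "bounded_bilinear (\<lambda>c (x::'a::cbanach). c *\<^sub>C x)"
proof
  show "\<exists>K. \<forall>a (b::'a). norm (a *\<^sub>C b) \<le> norm a * norm b * K"
    by (intro exI[of _ 1]) (simp add: norm_scaleC)
next
  fix r a and b :: 'a
  show "(r *\<^sub>R a) *\<^sub>C b = r *\<^sub>R a *\<^sub>C b"
    by (simp add: scaleR_conv_of_real scaleC_of_real flip: scaleC_scaleC)
qed (simp_all add: scaleC_add_left scaleC_add_right scaleC_scaleR)

lemma is_clinearD:
  assumes "is_clinear f"
  shows is_clinear_add: "f (x + y) = f x + f y"
    and is_clinear_scaleC: "f (c *\<^sub>C x) = c *\<^sub>C f x"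
    and is_clinear_scaleR: "f (r *\<^sub>R x) = r *\<^sub>R f x"
    and is_clinear_zero: "f 0 = 0"
    and is_clinear_diff: "f (x - y) = f x - f y"
    and is_clinear_minus: "f (- x) = - f x"
proof -
  show A: "f (x + y) = f x + f y" for x y using assms by (simp add: is_clinear_def)
  show S: "f (c *\<^sub>C x) = c *\<^sub>C f x" for c x using assms by (simp add: is_clinear_def)
  show R: "f (r *\<^sub>R x) = r *\<^sub>R f x" for r x using S[of "of_real r" x] by (simp add: scaleC_of_real)
  show "f 0 = 0" using R[of 0 0] by simp
  show M: "f (- x) = - f x" for x using R[of "-1" x] by simp
  show "f (x - y) = f x - f y" using A[of x "-y"] M[of y] by simp
qed

lemma is_clinear_linear: "is_clinear f \<Longrightarrow> linear f"
  by (intro linearI) (simp_all add: is_clinearD)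

lemma cinner_add_right: "cinner x (y + z) = cinner x y + cinner x (z::'a::chilbert)"
  using cinner_add_left[of y z x] by (metis cinner_commute complex_cnj_add)

lemma cinner_scaleC_right: "cinner x (c *\<^sub>C y) = cnj c * cinner x (y::'a::chilbert)"
  using cinner_scaleC_left[of c y x] by (metis cinner_commute complex_cnj_mult)

lemma cinner_scaleR_left: "cinner (r *\<^sub>R x) y = r *\<^sub>R cinner x (y::'a::chilbert)"
  using cinner_scaleC_left[of "of_real r" x y] by (simp add: scaleC_of_real scaleR_conv_of_real)

lemma cinner_scaleR_right: "cinner x (r *\<^sub>R y) = r *\<^sub>R cinner x (y::'a::chilbert)"
  using cinner_scaleC_right[of x "of_real r" y] by (simp add: scaleC_of_real scaleR_conv_of_real)

lemma cinner_zero_left [simp]: "cinner 0 (y::'a::chilbert) = 0"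
  using cinner_scaleR_left[of 0 0 y] by simp

lemma cinner_zero_right [simp]: "cinner (y::'a::chilbert) 0 = 0"
  using cinner_scaleR_right[of y 0 0] by simp

lemma cinner_minus_left [simp]: "cinner (- x) (y::'a::chilbert) = - cinner x y"
  using cinner_scaleR_left[of "-1" x y] by simp

lemma cinner_minus_right [simp]: "cinner x (- y::'a::chilbert) = - cinner x y"
  using cinner_scaleR_right[of x "-1" y] by simp

lemma cinner_diff_left: "cinner (x - z) (y::'a::chilbert) = cinner x y - cinner z y"
  using cinner_add_left[of x "-z" y] by simp

lemma cinner_diff_right: "cinner x (y - z::'a::chilbert) = cinner x y - cinner x z"
  using cinner_add_right[of x y "-z"] by simp

lemma cinner_self_eq_0: "cinner x x = 0 \<longleftrightarrow> (x::'a::chilbert) = 0"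
  by (simp add: cinner_self)

text \<open>With \<open>c\<close> the coefficient of the projection to the line through
  \<open>y\<close>, the squared norm of the residual is the difference of the two squared sides,
  divided by the squared norm of \<open>y\<close>.\<close>

lemma norm_cinner_le: "cmod (cinner x y) \<le> norm x * norm (y::'a::chilbert)"
proof (cases "y = 0")
  case False
  define c where "c = cinner x y / of_real ((norm y)\<^sup>2)"
  have c: "c * cinner y y = cinner x y"
    using False by (simp add: c_def cinner_self)
  have "cinner (x - c *\<^sub>C y) (x - c *\<^sub>C y) = cinner x x - c * cnj (cinner x y)"
    using c cinner_commute[of y x]
    by (simp add: cinner_diff_left cinner_diff_right cinner_scaleC_left cinner_scaleC_right
        algebra_simps)
  also have "\<dots> = of_real ((norm x)\<^sup>2 - (cmod (cinner x y))\<^sup>2 / (norm y)\<^sup>2)"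
    using complex_norm_square[of "cinner x y"] by (simp add: c_def cinner_self)
  finally have "(norm (x - c *\<^sub>C y))\<^sup>2 = (norm x)\<^sup>2 - (cmod (cinner x y))\<^sup>2 / (norm y)\<^sup>2"
    unfolding cinner_self of_real_eq_iff .
  then have "(cmod (cinner x y))\<^sup>2 / (norm y)\<^sup>2 \<le> (norm x)\<^sup>2"
    by (metis diff_ge_0_iff_ge zero_le_power2)
  then have "(cmod (cinner x y))\<^sup>2 \<le> (norm x * norm y)\<^sup>2"
    using False by (simp add: field_simps power_mult_distrib)
  then show ?thesis by (rule power2_le_imp_le) simp
qed simp

lemma bounded_bilinear_cinner: "bounded_bilinear (cinner :: 'a::chilbert \<Rightarrow> 'a \<Rightarrow> complex)"
  by standard (auto simp: cinner_add_left cinner_add_right cinner_scaleR_left cinner_scaleR_right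
      intro!: exI[of _ 1] norm_cinner_le)

lemma cinner_eqI: "(\<And>z. cinner z x = cinner z y) \<Longrightarrow> x = (y::'a::chilbert)"
  using cinner_self_eq_0[of "x - y"] by (simp add: cinner_diff_right)

lemma cinner_eqI_left: "(\<And>z. cinner x z = cinner y z) \<Longrightarrow> x = (y::'a::chilbert)"
  using cinner_self_eq_0[of "x - y"] by (simp add: cinner_diff_left)

section \<open>Orthogonal projection, Riesz representation and adjoints\<close>

lemma parallelogram:
  "(norm (x + y))\<^sup>2 + (norm (x - y))\<^sup>2 = 2 * (norm x)\<^sup>2 + 2 * (norm (y::'a::chilbert))\<^sup>2"
proof -
  have "complex_of_real ((norm (x + y))\<^sup>2 + (norm (x - y))\<^sup>2)
      = of_real (2 * (norm x)\<^sup>2 + 2 * (norm y)\<^sup>2)"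
    unfolding of_real_add of_real_mult cinner_self[symmetric]
    by (simp add: cinner_add_left cinner_add_right cinner_diff_left cinner_diff_right algebra_simps)
  then show ?thesis unfolding of_real_eq_iff .
qed

text \<open>A minimising sequence for the distance from \<open>x\<close> to \<open>S\<close> is
  Cauchy by the parallelogram law, since midpoints stay in \<open>S\<close>. Its limit
  \<open>p\<close> is closest to \<open>x\<close>, and subtracting from \<open>x - p\<close> its
  component along some \<open>y\<close> in \<open>S\<close> would come closer still unless that
  component vanishes.\<close>

lemma orthogonal_projection_exists:
  fixes S :: "'a::chilbert set"
  assumes S: "closed S" "0 \<in> S" "\<And>x y. x \<in> S \<Longrightarrow> y \<in> S \<Longrightarrow> x + y \<in> S"
    and C: "\<And>c x. x \<in> S \<Longrightarrow> c *\<^sub>C x \<in> S"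
  obtains p where "p \<in> S" "\<And>y. y \<in> S \<Longrightarrow> cinner (x - p) y = 0"
proof -
  define d where "d = infdist x S"
  have ne: "S \<noteq> {}" using S by auto
  have d: "d \<le> norm (x - s)" if "s \<in> S" for s
    using infdist_le[OF that, of x] by (simp add: d_def dist_norm)
  have "d \<ge> 0" by (simp add: d_def infdist_nonneg)
  have "\<exists>s\<in>S. norm (x - s) < d + 1 / real (Suc n)" for n
  proof (rule ccontr)
    assume "\<not> ?thesis"
    then have "d + 1 / real (Suc n) \<le> infdist x S"
      using ne by (auto simp: infdist_notempty dist_norm not_less intro!: cINF_greatest)
    then show False by (simp add: d_def)
  qed
  then obtain s where s: "\<And>n. s n \<in> S" "\<And>n. norm (x - s n) < d + 1 / real (Suc n)" by metis
  have half: "(1/2) *\<^sub>R u \<in> S" if "u \<in> S" for u using C[OF that, of "of_real (1/2)"]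
    unfolding scaleC_of_real .
  \<comment> \<open>Both distances are at most d + e and the midpoint is at distance at least d, so
    the parallelogram law leaves 4 (d + e)^2 - (2 d)^2 = 4 e (2 d + e); then e \<le> 1 gives the
    constant.\<close>
  have est: "(norm (s m - s n))\<^sup>2 \<le> 4 * (2 * d + 1) / real (Suc N)" if "m \<ge> N" "n \<ge> N" for m n N
  proof -
    define e where "e = 1 / real (Suc N)"
    have e: "0 < e" "e \<le> 1" by (auto simp: e_def)
    have le: "norm (x - s k) \<le> d + e" if "k \<ge> N" for k
    proof -
      have "1 / real (Suc k) \<le> e" unfolding e_def using that by (intro divide_left_mono) auto
      then show ?thesis using s(2)[of k] by linarith
    qed
    have "2 * d \<le> norm ((x - s m) + (x - s n))"
    proof -
      have "d \<le> norm (x - (1/2) *\<^sub>R (s m + s n))"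
        using s(1) S(3) half by (intro d) auto
      also have "x - (1/2) *\<^sub>R (s m + s n) = (1/2) *\<^sub>R ((x - s m) + (x - s n))"
        by (simp add: algebra_simps flip: scaleR_left_distrib)
      finally show ?thesis by simp
    qed
    then have "(2 * d)\<^sup>2 \<le> (norm ((x - s m) + (x - s n)))\<^sup>2"
      using \<open>d \<ge> 0\<close> by (intro power_mono) auto
    note two = this
    have "(norm (x - s k))\<^sup>2 \<le> (d + e)\<^sup>2" if "k \<ge> N" for k
      using le[OF that] by (intro power_mono) auto
    from this[OF that(1)] this[OF that(2)] parallelogram[of "x - s m" "x - s n"] two
    have "(norm ((x - s m) - (x - s n)))\<^sup>2 \<le> 4 * (d + e)\<^sup>2 - (2 * d)\<^sup>2"
      by linarith
    also have "\<dots> = 4 * e * (2 * d + e)" by (simp add: power2_eq_square algebra_simps)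
    also have "\<dots> \<le> 4 * e * (2 * d + 1)" using e \<open>d \<ge> 0\<close> by (intro mult_left_mono) auto
    finally show ?thesis by (simp add: e_def norm_minus_commute field_simps)
  qed
  have "Cauchy s"
  proof (rule metric_CauchyI)
    fix e :: real assume "e > 0"
    then obtain N where N: "4 * (2 * d + 1) / e\<^sup>2 < real N"
      using reals_Archimedean2 by blast
    have "dist (s m) (s n) < e" if "m \<ge> N" "n \<ge> N" for m n
    proof -
      have "4 * (2 * d + 1) / e\<^sup>2 < real (Suc N)" using N by simp
      then have "4 * (2 * d + 1) / real (Suc N) < e\<^sup>2"
        using \<open>e > 0\<close> by (simp add: field_simps)
      with est[OF that] have "(norm (s m - s n))\<^sup>2 < e\<^sup>2" by linarith
      then show ?thesis using \<open>e > 0\<close> by (simp add: dist_norm power_less_imp_less_base)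
    qed
    then show "\<exists>M. \<forall>m\<ge>M. \<forall>n\<ge>M. dist (s m) (s n) < e" by blast
  qed
  then obtain p where p: "s \<longlonglongrightarrow> p" using Cauchy_convergent_iff convergent_def by blast
  have "p \<in> S" using closed_sequentially[OF S(1) s(1) p] .
  have pd: "norm (x - p) \<le> d"
  proof (rule LIMSEQ_le)
    show "(\<lambda>n. norm (x - s n)) \<longlonglongrightarrow> norm (x - p)" by (intro tendsto_intros p)
    show "(\<lambda>n. d + 1 / real (Suc n)) \<longlonglongrightarrow> d"
      using tendsto_add[OF tendsto_const LIMSEQ_inverse_real_of_nat, of d]
      by (simp add: inverse_eq_divide)
    show "\<exists>N. \<forall>n\<ge>N. norm (x - s n) \<le> d + 1 / real (Suc n)" using s(2) by (auto intro: less_imp_le)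
  qed
  have "cinner (x - p) y = 0" if y: "y \<in> S" for y
  proof (cases "y = 0")
    case False
    define z where "z = x - p"
    define c where "c = cinner z y / of_real ((norm y)\<^sup>2)"
    have c: "c * cinner y y = cinner z y"
      using False by (simp add: c_def cinner_self)
    have "cinner (z - c *\<^sub>C y) (z - c *\<^sub>C y) = cinner z z - c * cnj (cinner z y)"
      using c cinner_commute[of y z]
      by (simp add: cinner_diff_left cinner_diff_right
          cinner_scaleC_left cinner_scaleC_right algebra_simps)
    also have "\<dots> = of_real ((norm z)\<^sup>2 - (cmod (cinner z y))\<^sup>2 / (norm y)\<^sup>2)"
      using complex_norm_square[of "cinner z y"] by (simp add: c_def cinner_self)
    finally have eq: "(norm (z - c *\<^sub>C y))\<^sup>2
        = (norm z)\<^sup>2 - (cmod (cinner z y))\<^sup>2 / (norm y)\<^sup>2"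
      unfolding cinner_self of_real_eq_iff .
    have "p + c *\<^sub>C y \<in> S" using S(3) C y \<open>p \<in> S\<close> by auto
    from d[OF this] have "norm z \<le> norm (z - c *\<^sub>C y)"
      using pd by (simp add: z_def algebra_simps)
    then have "(norm z)\<^sup>2 \<le> (norm (z - c *\<^sub>C y))\<^sup>2" by (intro power_mono) auto
    with eq have "(cmod (cinner z y))\<^sup>2 / (norm y)\<^sup>2 \<le> 0" by simp
    then show ?thesis using False by (simp add: divide_le_0_iff z_def)
  qed simp
  with \<open>p \<in> S\<close> show ?thesis by (rule that)
qed

text \<open>A point minus its projection to \<open>S\<close> is orthogonal to \<open>S\<close>.
  Applied below to the closure of a subspace, in order to obtain density.\<close>

lemma orthogonal_complement_trivial_imp_UNIV:
  fixes S :: "'a::chilbert set"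
  assumes "closed S" "0 \<in> S" "\<And>x y. x \<in> S \<Longrightarrow> y \<in> S \<Longrightarrow> x + y \<in> S"
    and "\<And>c x. x \<in> S \<Longrightarrow> c *\<^sub>C x \<in> S" and "\<And>x. (\<And>y. y \<in> S \<Longrightarrow> cinner x y = 0) \<Longrightarrow> x = 0"
  shows "S = UNIV"
proof -
  have "x \<in> S" for x
  proof -
    obtain p where "p \<in> S" "\<And>y. y \<in> S \<Longrightarrow> cinner (x - p) y = 0"
      using orthogonal_projection_exists[OF assms(1-4), where x = x] by metis
    with assms(5)[of "x - p"] show ?thesis by simp
  qed
  then show ?thesis by auto
qed

text \<open>The residual \<open>z\<close> of a point outside the kernel is orthogonal to the kernel,
  and every \<open>u\<close> differs from the multiple \<open>(F u / F z) *\<^sub>C z\<close> by an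
  element of the kernel. Pairing with \<open>z\<close> determines \<open>F u\<close>.\<close>

lemma riesz_representation:
  fixes F :: "'a::chilbert \<Rightarrow> complex"
  assumes bl: "bounded_linear F" and cl: "\<And>c x. F (c *\<^sub>C x) = c * F x"
  obtains y where "\<And>x. F x = cinner x y"
proof -
  interpret bounded_linear F by fact
  define S where "S = {x. F x = 0}"
  have 1: "closed S" unfolding S_def
    by (intro closed_Collect_eq continuous_intros linear_continuous_on bl)
  have 2: "0 \<in> S" "\<And>x y. x \<in> S \<Longrightarrow> y \<in> S \<Longrightarrow> x + y \<in> S" "\<And>c x. x \<in> S \<Longrightarrow> c *\<^sub>C x \<in> S"
    by (auto simp: S_def zero add cl)
  show ?thesis
  proof (cases "S = UNIV")
    case True
    then show ?thesis using that[of 0] by (auto simp: S_def)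
  next
    case False
    then obtain x where x: "x \<notin> S" by auto
    obtain p where p: "p \<in> S" "\<And>y. y \<in> S \<Longrightarrow> cinner (x - p) y = 0"
      using orthogonal_projection_exists[OF 1 2, where x = x] by metis
    define z where "z = x - p"
    have lz: "F z \<noteq> 0" using p x by (simp add: z_def diff S_def)
    then have "z \<noteq> 0" by (auto simp: zero)
    then have zz: "cinner z z \<noteq> 0" by (simp add: cinner_self_eq_0)
    have "F u = cinner u ((cnj (F z / cinner z z)) *\<^sub>C z)" for u
    proof -
      have "u - (F u / F z) *\<^sub>C z \<in> S" using lz by (simp add: S_def diff cl)
      then have "cinner z (u - (F u / F z) *\<^sub>C z) = 0" using p by (simp add: z_def)
      then have "cinner (u - (F u / F z) *\<^sub>C z) z = 0" using cinner_commute[of _ z] by simp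
      then have "cinner u z = (F u / F z) * cinner z z"
        by (simp add: cinner_diff_left cinner_scaleC_left)
      then show ?thesis using lz zz by (simp add: cinner_scaleC_right field_simps)
    qed
    then show ?thesis by (rule that)
  qed
qed

lemma cadj_unique:
  assumes "\<And>v w. cinner (f v) w = cinner v (g w)"
  shows "cadj f = g"
  unfolding cadj_def
proof (rule the_equality)
  show "\<forall>v w. cinner (f v) w = cinner v (g w)" using assms by blast
next
  fix h assume h: "\<forall>v w. cinner (f v) w = cinner v (h w)"
  show "h = g"
    by (rule ext, rule cinner_eqI) (metis h assms)
qed

text \<open>\<open>cadj\<close> is a definite description, so its defining equation has to be
  earned: for every \<open>w\<close>, Riesz' theorem represents the functional
  \<open>\<lambda>v. cinner (f v) w\<close>.\<close>

lemma cadj_works: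
  fixes f :: "'v::chilbert \<Rightarrow> 'w::chilbert"
  assumes bl: "bounded_linear f" and cl: "is_clinear f"
  shows "cinner (f v) w = cinner v (cadj f w)"
proof -
  have "\<exists>y. \<forall>v. cinner (f v) w = cinner v y" for w
  proof -
    have "bounded_linear (\<lambda>v. cinner (f v) w)"
      using bounded_linear_compose[OF bounded_bilinear.bounded_linear_left[OF bounded_bilinear_cinner] bl] .
    then obtain y where "\<And>v. cinner (f v) w = cinner v y"
      by (rule riesz_representation)
         (simp_all add: is_clinear_scaleC[OF cl] cinner_scaleC_left)
    then show ?thesis by auto
  qed
  then obtain g where g: "\<And>v w. cinner (f v) w = cinner v (g w)" by metis
  have "cadj f = g" by (rule cadj_unique) (rule g)
  then show ?thesis using g by metis
qed

lemma is_clinear_cadj: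
  assumes bl: "bounded_linear f" and cl: "is_clinear f"
  shows "is_clinear (cadj f)"
  unfolding is_clinear_def
  by (intro conjI allI; rule cinner_eqI)
     (simp_all add: cadj_works[OF assms, symmetric] cinner_add_right cinner_scaleC_right)

text \<open>The square of the left norm equals \<open>cinner (f (cadj f w)) w\<close>;
  Cauchy-Schwarz then allows one factor \<open>norm (cadj f w)\<close> to be cancelled.\<close>

lemma norm_cadj_le:
  assumes bl: "bounded_linear f" and cl: "is_clinear f" and K: "\<And>v. norm (f v) \<le> K * norm v" "K \<ge> 0"
  shows "norm (cadj f w) \<le> K * norm w"
proof -
  have "(norm (cadj f w))\<^sup>2 = cmod (cinner (cadj f w) (cadj f w))" by (simp add: cinner_self norm_power)
  also have "\<dots> = cmod (cinner (f (cadj f w)) w)" by (simp add: cadj_works[OF bl cl])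
  also have "\<dots> \<le> K * norm (cadj f w) * norm w"
    by (rule order.trans[OF norm_cinner_le]) (intro mult_right_mono K, simp)
  finally have "norm (cadj f w) * norm (cadj f w) \<le> (K * norm w) * norm (cadj f w)"
    by (simp add: power2_eq_square mult_ac)
  then show ?thesis
    using K(2) by (cases "cadj f w = 0") (auto simp: mult_le_cancel_right)
qed

lemma bounded_linear_cadj:
  assumes bl: "bounded_linear f" and cl: "is_clinear f"
  shows "bounded_linear (cadj f)"
proof -
  obtain K where K: "K \<ge> 0" "\<And>v. norm (f v) \<le> norm v * K"
    using bounded_linear.nonneg_bounded[OF bl] by blast
  then have "norm (cadj f w) \<le> norm w * K" for w
    using norm_cadj_le[OF assms, of K w] by (simp add: mult.commute)
  then show ?thesis
    by (intro bounded_linear_intro[of _ K])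
       (simp_all add: is_clinearD[OF is_clinear_cadj[OF assms]])
qed

subsection \<open>Operator algebras\<close>

lemma bounded_opsD: "A \<in> bounded_ops \<Longrightarrow> is_clinear (blinfun_apply A)"
  by (simp add: bounded_ops_def)

lemma op_adj_apply: "A \<in> bounded_ops \<Longrightarrow> blinfun_apply (op_adj A) = cadj (blinfun_apply A)"
  unfolding op_adj_def
  by (intro bounded_linear_Blinfun_apply bounded_linear_cadj blinfun.bounded_linear_right bounded_opsD)

lemma cinner_op_adj:
  fixes A :: "'a::chilbert \<Rightarrow>\<^sub>L 'a"
  assumes "A \<in> bounded_ops"
  shows "cinner (A v) w = cinner v (op_adj A w)"
  unfolding op_adj_apply[OF assms]
  by (rule cadj_works[OF blinfun.bounded_linear_right bounded_opsD[OF assms]])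

lemma cinner_op_adj':
  fixes A :: "'a::chilbert \<Rightarrow>\<^sub>L 'a"
  assumes "A \<in> bounded_ops"
  shows "cinner v (A w) = cinner (op_adj A v) w"
proof -
  have "cinner v (A w) = cnj (cinner (A w) v)" by (rule cinner_commute)
  also have "\<dots> = cnj (cinner w (op_adj A v))" by (simp only: cinner_op_adj[OF assms])
  also have "\<dots> = cinner (op_adj A v) w" by (rule cinner_commute[symmetric])
  finally show ?thesis .
qed

lemma op_adj_bounded_ops [simp]: "A \<in> bounded_ops \<Longrightarrow> op_adj A \<in> bounded_ops"
  using is_clinear_cadj[OF blinfun.bounded_linear_right, of A]
  by (simp add: bounded_ops_def op_adj_apply)

lemma op_adjI:
  fixes A B :: "'a::chilbert \<Rightarrow>\<^sub>L 'a"
  assumes "A \<in> bounded_ops" "\<And>v w. cinner (A v) w = cinner v (B w)"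
  shows "op_adj A = B"
  by (rule blinfun_eqI, rule cinner_eqI) (simp add: cinner_op_adj[OF assms(1), symmetric] assms(2))

lemma op_adj_op_adj [simp]: "A \<in> bounded_ops \<Longrightarrow> op_adj (op_adj A) = A"
  by (intro op_adjI) (simp_all add: cinner_op_adj')

lemma compose_bounded_ops [simp]: "A \<in> bounded_ops \<Longrightarrow> B \<in> bounded_ops \<Longrightarrow> A o\<^sub>L B \<in> bounded_ops"
  by (simp add: bounded_ops_def is_clinear_def)

lemma op_adj_compose: "A \<in> bounded_ops \<Longrightarrow> B \<in> bounded_ops \<Longrightarrow>
    op_adj (A o\<^sub>L B) = op_adj B o\<^sub>L op_adj A"
  by (intro op_adjI) (simp_all add: cinner_op_adj)

lemma norm_op_adj_le: "A \<in> bounded_ops \<Longrightarrow> norm (op_adj A v) \<le> norm A * norm v"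
  using norm_cadj_le[OF blinfun.bounded_linear_right bounded_opsD, of A "norm A" v] norm_blinfun[of A]
  by (simp add: op_adj_apply)

lemma op_scaleC_apply [simp]: "blinfun_apply (op_scaleC c A) v = c *\<^sub>C A v"
  unfolding op_scaleC_def
  by (subst bounded_linear_Blinfun_apply)
     (auto intro!: bounded_linear_compose[OF bounded_bilinear.bounded_linear_right[OF bounded_bilinear_scaleC]]
       blinfun.bounded_linear_right)

lemma commutantD:
  fixes S :: "('a::cbanach \<Rightarrow>\<^sub>L 'a) set"
  shows "A \<in> commutant S \<Longrightarrow> B \<in> S \<Longrightarrow> A (B v) = B (A v)"
  by (metis (mono_tags, lifting) blinfun_apply_blinfun_compose commutant_def mem_Collect_eq)

lemma commutantI:
  fixes S :: "('a::cbanach \<Rightarrow>\<^sub>L 'a) set"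
  assumes "A \<in> bounded_ops" "\<And>B v. B \<in> S \<Longrightarrow> A (B v) = B (A v)"
  shows "A \<in> commutant S"
  using assms by (auto simp: commutant_def intro!: blinfun_eqI)

lemma commutant_bounded_ops: "A \<in> commutant S \<Longrightarrow> A \<in> bounded_ops"
  by (simp add: commutant_def)

lemma commutant_op_adj:
  fixes S :: "('a::chilbert \<Rightarrow>\<^sub>L 'a) set"
  assumes "S \<subseteq> bounded_ops" "\<And>B. B \<in> S \<Longrightarrow> op_adj B \<in> S" "A \<in> commutant S"
  shows "op_adj A \<in> commutant S"
proof (rule commutantI)
  have A: "A \<in> bounded_ops" using assms(3) by (rule commutant_bounded_ops)
  then show "op_adj A \<in> bounded_ops" by simp
  fix B v assume "B \<in> S"
  then have B: "B \<in> bounded_ops" "op_adj B \<in> S" using assms by auto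
  show "op_adj A (B v) = B (op_adj A v)"
    by (rule cinner_eqI)
       (simp add: cinner_op_adj[OF A, symmetric] cinner_op_adj'[OF B(1)] commutantD[OF assms(3) B(2)])
qed

text \<open>Purely formal: every set of bounded operators lies in its bicommutant and commutants
  reverse inclusions, so the third commutant is the first.\<close>

lemma von_neumann_algebra_commutant:
  fixes S :: "('a::chilbert \<Rightarrow>\<^sub>L 'a) set"
  assumes S: "S \<subseteq> bounded_ops" "\<And>B. B \<in> S \<Longrightarrow> op_adj B \<in> S"
  shows "von_neumann_algebra (commutant S)"
  unfolding von_neumann_algebra_def
proof (intro conjI ballI)
  show "commutant S \<subseteq> bounded_ops" by (auto simp: commutant_def)
  show "op_adj A \<in> commutant S" if "A \<in> commutant S" for A using commutant_op_adj[OF S that] .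
  show "commutant (commutant (commutant S)) = commutant S"
  proof
    have sub: "T \<subseteq> commutant (commutant T)" if "T \<subseteq> bounded_ops" for T :: "('a \<Rightarrow>\<^sub>L 'a) set"
    proof
      fix A assume "A \<in> T"
      with that show "A \<in> commutant (commutant T)"
        by (intro commutantI) (auto intro: commutantD[symmetric])
    qed
    show "commutant (commutant (commutant S)) \<subseteq> commutant S"
      using sub[OF S(1)] by (auto simp: commutant_def)
    show "commutant S \<subseteq> commutant (commutant (commutant S))"
      by (intro sub) (auto simp: commutant_def)
  qed
qed

section \<open>Ordinary differential equations in Banach spaces\<close>

lemma vector_derivative_bound:
  fixes f :: "real \<Rightarrow> 'b::real_normed_vector"
  assumes S: "convex S" "a \<in> S" "b \<in> S"
    and d: "\<And>t. t \<in> S \<Longrightarrow> (f has_vector_derivative f' t) (at t within S)"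
    and B: "\<And>t. t \<in> S \<Longrightarrow> norm (f' t) \<le> B"
  shows "norm (f b - f a) \<le> B * \<bar>b - a\<bar>"
proof -
  have "onorm (\<lambda>h. h *\<^sub>R f' t) \<le> B" if "t \<in> S" for t
    by (rule onorm_le) (use B[OF that] in \<open>simp add: mult_left_mono mult.commute[of B]\<close>)
  from differentiable_bound[OF S(1) d[unfolded has_vector_derivative_def] this S(3,2)]
  show ?thesis by simp
qed

text \<open>The solution is a fixed point in the complete space of bounded continuous functions on
  the whole line with values in the ball. \<open>M * T \<le> R\<close> keeps the integral operator
  inside the ball, and \<open>L * T \<le> 1/2\<close> makes it a contraction.\<close>

lemma picard_lindelof:
  fixes X :: "'e::banach \<Rightarrow> 'e"
  assumes T: "T > 0" and L: "L \<ge> 0" and R: "R \<ge> 0"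
    and bd: "\<And>p. p \<in> cball x0 R \<Longrightarrow> norm (X p) \<le> M"
    and lip: "\<And>p q. p \<in> cball x0 R \<Longrightarrow> q \<in> cball x0 R \<Longrightarrow> norm (X p - X q) \<le> L * norm (p - q)"
    and MT: "M * T \<le> R" and LT: "L * T \<le> 1/2"
  obtains c where "c 0 = x0"
    and "\<And>t. \<bar>t\<bar> < T \<Longrightarrow> c t \<in> cball x0 R \<and> (c has_vector_derivative X (c t)) (at t)"
proof -
  \<comment> \<open>Clamping time to [-T, T] makes the integral operator constant outside that
    interval, so that its values are functions on the whole line.\<close>
  define cl where "cl t = max (-T) (min T t)" for t :: real
  have cl: "cl t \<in> {-T..T}" "\<bar>cl t\<bar> \<le> T" for t using T by (auto simp: cl_def)
  have cl_id: "cl t = t" if "\<bar>t\<bar> \<le> T" for t using that by (auto simp: cl_def)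
  define S where "S = PiC UNIV (\<lambda>_::real. cball x0 R)"
  have memS: "c \<in> S \<longleftrightarrow> (\<forall>t. apply_bcontfun c t \<in> cball x0 R)" for c
    by (auto simp: S_def mem_PiC_iff)
  \<comment> \<open>Integrating from -T, and subtracting the value at 0 in \<open>Q\<close>, covers
    negative times without oriented integrals.\<close>
  define J where "J c t = integral {-T..t} (\<lambda>s. X (apply_bcontfun c s))" for c and t :: real
  define Q where "Q c t = x0 + (J c (cl t) - J c (cl 0))" for c t
  have contX: "continuous_on (cball x0 R) X"
  proof (rule continuous_onI)
    fix p and e :: real assume p: "p \<in> cball x0 R" "e > 0"
    have "dist (X q) (X p) \<le> e" if "q \<in> cball x0 R" "dist q p < e / (L + 1)" for q
    proof -
      have "dist (X q) (X p) \<le> L * dist q p" using lip[of q p] p that by (simp add: dist_norm)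
      also have "\<dots> \<le> (L + 1) * (e / (L + 1))" using that(2) L by (intro mult_mono) auto
      finally show ?thesis using L by simp
    qed
    then show "\<exists>d>0. \<forall>x'\<in>cball x0 R. dist x' p < d \<longrightarrow> dist (X x') (X p) \<le> e"
      using p L by (intro exI[of _ "e / (L + 1)"]) auto
  qed
  have cont: "continuous_on A (\<lambda>s. X (apply_bcontfun c s))" if "c \<in> S" for c A
  proof (rule continuous_on_compose2[OF contX])
    show "continuous_on A (apply_bcontfun c)" by simp
    show "apply_bcontfun c ` A \<subseteq> cball x0 R" using that by (auto simp only: memS)
  qed
  have J: "(J c has_vector_derivative X (apply_bcontfun c t)) (at t within {-T..T})"
    if "c \<in> S" "t \<in> {-T..T}" for c t
    unfolding J_def using integral_has_vector_derivative[OF cont[OF that(1)] that(2)] .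
  have J_le: "norm (J c t - J c s) \<le> M * \<bar>t - s\<bar>" if "c \<in> S" "s \<in> {-T..T}" "t \<in> {-T..T}" for c s t
  proof (rule vector_derivative_bound[OF _ that(2,3) J[OF that(1)]])
    show "norm (X (apply_bcontfun c u)) \<le> M" for u
      using that(1) by (intro bd) (simp only: memS)
  qed auto
  have Q_in: "Q c t \<in> cball x0 R" if "c \<in> S" for c t
  proof -
    have "norm (J c (cl t) - J c (cl 0)) \<le> M * \<bar>cl t - cl 0\<bar>" using J_le[OF that cl(1) cl(1)] .
    also have "\<dots> \<le> M * T"
    proof (intro mult_left_mono)
      show "\<bar>cl t - cl 0\<bar> \<le> T" using T by (auto simp: cl_def)
      have "norm (X (apply_bcontfun c 0)) \<le> M" using that bd memS by blast
      then show "0 \<le> M" by (meson norm_ge_zero order_trans)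
    qed
    finally show ?thesis using MT by (simp add: Q_def dist_norm norm_minus_commute)
  qed
  have Q_bc: "Q c \<in> bcontfun" if "c \<in> S" for c
  proof -
    have "continuous_on {-T..T} (J c)"
      unfolding continuous_on_eq_continuous_within
      using J[OF that] has_vector_derivative_continuous by blast
    then have "continuous_on UNIV (\<lambda>t. J c (cl t))"
    proof (rule continuous_on_compose2)
      show "continuous_on UNIV cl" unfolding cl_def by (intro continuous_intros)
      show "cl ` UNIV \<subseteq> {-T..T}" using cl(1) by blast
    qed
    then have "continuous_on UNIV (Q c)" unfolding Q_def by (intro continuous_intros)
    moreover have "bounded (range (Q c))"
      by (rule bounded_subset[of "cball x0 R"]) (use Q_in[OF that] in blast)+
    ultimately show ?thesis by (simp add: bcontfun_def)
  qed
  define P where "P c = Bcontfun (Q c)" for c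
  have P: "apply_bcontfun (P c) = Q c" if "c \<in> S" for c
    using Q_bc[OF that] by (simp add: P_def Bcontfun_inverse)
  have "\<exists>!c. c \<in> S \<and> P c = c"
  proof (rule Banach_fix)
    show "complete S" unfolding S_def complete_eq_closed by (intro closed_PiC) auto
    show "S \<noteq> {}" using R memS[of "const_bcontfun x0"] by auto
    show "P ` S \<subseteq> S" using Q_in P by (auto simp: memS)
    show "dist (P c) (P d) \<le> 1/2 * dist c d" if cd: "c \<in> S" "d \<in> S" for c d
    proof (rule dist_bound)
      fix t
      have "norm ((J c (cl t) - J d (cl t)) - (J c (cl 0) - J d (cl 0))) \<le> (L * dist c d) * \<bar>cl t - cl 0\<bar>"
      proof (rule vector_derivative_bound[where S = "{-T..T}"])
        fix s assume s: "s \<in> {-T..T}"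
        show "((\<lambda>t. J c t - J d t) has_vector_derivative
            (X (apply_bcontfun c s) - X (apply_bcontfun d s))) (at s within {-T..T})"
          by (intro has_vector_derivative_diff J cd s)
        have "norm (X (apply_bcontfun c s) - X (apply_bcontfun d s))
            \<le> L * dist (apply_bcontfun c s) (apply_bcontfun d s)"
          using lip cd memS by (simp add: dist_norm)
        also have "\<dots> \<le> L * dist c d" using L by (intro mult_left_mono dist_bounded)
        finally show "norm (X (apply_bcontfun c s) - X (apply_bcontfun d s)) \<le> L * dist c d" .
      qed (use cl in auto)
      also have "\<dots> \<le> (L * dist c d) * T"
        using L T by (intro mult_left_mono) (auto simp: cl_def)
      also have "\<dots> \<le> 1/2 * dist c d"
        using mult_right_mono[OF LT, of "dist c d"] by (simp add: mult_ac)
      finally show "dist (apply_bcontfun (P c) t) (apply_bcontfun (P d) t) \<le> 1/2 * dist c d"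
        using cd by (simp add: P Q_def dist_norm algebra_simps)
    qed
  qed auto
  then obtain c where c: "c \<in> S" "P c = c" by blast
  then have ceq: "apply_bcontfun c t = Q c t" for t using P[OF c(1)] by simp
  show ?thesis
  proof
    show "apply_bcontfun c 0 = x0" using ceq[of 0] by (simp add: Q_def)
    fix t :: real assume t: "\<bar>t\<bar> < T"
    have "(J c has_vector_derivative X (apply_bcontfun c t)) (at t)"
      using J[OF c(1), of t] t at_within_interior[of t "{-T..T}"] by (auto simp: abs_less_iff)
    then have "((\<lambda>t. x0 + (J c t - J c (cl 0))) has_vector_derivative X (apply_bcontfun c t)) (at t)"
      using has_vector_derivative_diff[OF _ has_vector_derivative_const[of "J c (cl 0)"]]
        has_vector_derivative_add[OF has_vector_derivative_const[of x0]] by fastforce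
    then have "(apply_bcontfun c has_vector_derivative X (apply_bcontfun c t)) (at t)"
      by (rule has_vector_derivative_transform_within_open[of _ _ _ "{-T<..<T}"])
         (use t ceq cl_id in \<open>auto simp: Q_def\<close>)
    then show "apply_bcontfun c t \<in> cball x0 R \<and>
        (apply_bcontfun c has_vector_derivative X (apply_bcontfun c t)) (at t)"
      using c(1) memS by blast
  qed
qed

subsection \<open>Smooth families\<close>

text \<open>The family hidden behind the existential in \<open>frechet_smooth_on\<close>, given a
  name: its values on longer lists are needed as smooth maps in their own right, for instance as
  left invariant vector fields.\<close>

definition smooth_family :: "'a::banach set \<Rightarrow> ('a \<Rightarrow> 'a list \<Rightarrow> 'b::banach) \<Rightarrow> bool"
  where "smooth_family S D \<longleftrightarrow> open S \<and>
      (\<forall>n. \<forall>x\<in>S. bounded_multilinear n (D x) \<and>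
        (\<forall>\<epsilon>>0. \<exists>\<delta>>0. \<forall>y\<in>S. norm (y - x) < \<delta> \<longrightarrow>
          (\<forall>vs. length vs = n \<longrightarrow>
            norm (D y vs - D x vs - D x ((y - x) # vs))
              \<le> \<epsilon> * norm (y - x) * prod_list (map norm vs))))"

lemma smooth_familyE:
  assumes "smooth_family S D" "x \<in> S" "\<epsilon> > 0"
  obtains \<delta> where "\<delta> > 0" "\<And>y vs. y \<in> S \<Longrightarrow> norm (y - x) < \<delta> \<Longrightarrow> length vs = n \<Longrightarrow>
    norm (D y vs - D x vs - D x ((y - x) # vs)) \<le> \<epsilon> * norm (y - x) * prod_list (map norm vs)"
proof -
  have "\<exists>\<delta>>0. \<forall>y\<in>S. norm (y - x) < \<delta> \<longrightarrow> (\<forall>vs. length vs = n \<longrightarrow>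
      norm (D y vs - D x vs - D x ((y - x) # vs)) \<le> \<epsilon> * norm (y - x) * prod_list (map norm vs))"
    using assms unfolding smooth_family_def by blast
  then show ?thesis using that by blast
qed

lemma smooth_family_open: "smooth_family S D \<Longrightarrow> open S"
  by (simp add: smooth_family_def)

lemma smooth_family_multilinear: "smooth_family S D \<Longrightarrow> x \<in> S \<Longrightarrow> bounded_multilinear n (D x)"
  by (simp add: smooth_family_def)

lemma frechet_smooth_on_iff: "frechet_smooth_on S f \<longleftrightarrow> open S \<and> (\<exists>D. smooth_family S D \<and> (\<forall>x\<in>S. D x [] = f x))"
  unfolding frechet_smooth_on_def smooth_family_def by blast

lemma bounded_multilinear_bound:
  assumes "bounded_multilinear n T"
  obtains K where "K \<ge> 0" "\<And>vs. length vs = n \<Longrightarrow> norm (T vs) \<le> K * prod_list (map norm vs)"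
proof -
  obtain K where K: "\<And>vs. length vs = n \<Longrightarrow> norm (T vs) \<le> K * prod_list (map norm vs)"
    using assms unfolding bounded_multilinear_def by blast
  have "prod_list (map norm vs) \<ge> 0" for vs :: "'a list" by (induction vs) auto
  then have "norm (T vs) \<le> \<bar>K\<bar> * prod_list (map norm vs)" if "length vs = n" for vs
    using K[OF that] by (meson abs_ge_self mult_right_mono order_trans)
  then show ?thesis using that[of "\<bar>K\<bar>"] by simp
qed

lemma prod_list_norm_nonneg [simp]: "0 \<le> prod_list (map norm vs)"
  by (induction vs) auto

lemma bounded_multilinear_Cons:
  assumes "bounded_multilinear (Suc n) T"
  shows "bounded_multilinear n (\<lambda>ws. T (v # ws))"
proof -
  obtain K where K: "K \<ge> 0" "\<And>vs. length vs = Suc n \<Longrightarrow> norm (T vs) \<le> K * prod_list (map norm vs)"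
    using bounded_multilinear_bound[OF assms] by metis
  show ?thesis unfolding bounded_multilinear_def
  proof (intro conjI allI impI)
    fix vs :: "'a list" and i assume "length vs = n" "i < n"
    then have "linear (\<lambda>w. T ((v # vs)[Suc i := w]))"
      using assms[unfolded bounded_multilinear_def, THEN conjunct1, rule_format, of "v # vs" "Suc i"]
      by simp
    then show "linear (\<lambda>w. T (v # vs[i := w]))" by simp
  next
    show "\<exists>K. \<forall>vs. length vs = n \<longrightarrow> norm (T (v # vs)) \<le> K * prod_list (map norm vs)"
      using K(2)[of "v # _"] by (intro exI[of _ "K * norm v"]) (auto simp: mult_ac)
  qed
qed

lemma bounded_multilinear_Cons_linear:
  assumes "bounded_multilinear (Suc n) T" "length vs = n"
  shows "bounded_linear (\<lambda>v. T (v # vs))"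
proof -
  obtain K where K: "\<And>vs. length vs = Suc n \<Longrightarrow> norm (T vs) \<le> K * prod_list (map norm vs)"
    using bounded_multilinear_bound[OF assms(1)] by metis
  have "linear (\<lambda>v. T ((0 # vs)[0 := v]))"
    using assms(1)[unfolded bounded_multilinear_def, THEN conjunct1, rule_format, of "0 # vs" 0] assms(2)
    by simp
  then have l: "linear (\<lambda>v. T (v # vs))" by simp
  show ?thesis
    by (rule bounded_linear_intro[of _ "K * prod_list (map norm vs)"])
       (use K[of "_ # vs"] assms(2) in \<open>auto simp: linear_add[OF l] linear_cmul[OF l] mult_ac\<close>)
qed

lemma smooth_family_deriv:
  assumes "smooth_family S D" "x \<in> S"
  shows "((\<lambda>p. D p vs) has_derivative (\<lambda>h. D x (h # vs))) (at x)"
  unfolding has_derivative_at_alt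
proof (intro conjI allI impI)
  have "bounded_multilinear (Suc (length vs)) (D x)" using assms by (rule smooth_family_multilinear)
  then show "bounded_linear (\<lambda>h. D x (h # vs))" by (rule bounded_multilinear_Cons_linear) simp
  fix e :: real assume "e > 0"
  \<comment> \<open>The remainder estimate carries the factor
    \<open>prod_list (map norm vs)\<close>; adding 1 before dividing allows for the case that this
    product is 0.\<close>
  define e' where "e' = e / (1 + prod_list (map norm vs))"
  have P: "1 + prod_list (map norm vs) > 0" by (rule add_pos_nonneg) auto
  then have "e' > 0" using \<open>e > 0\<close> by (simp add: e'_def)
  then obtain d where d: "d > 0" "\<And>y ws. y \<in> S \<Longrightarrow> norm (y - x) < d \<Longrightarrow> length ws = length vs \<Longrightarrow>
      norm (D y ws - D x ws - D x ((y - x) # ws)) \<le> e' * norm (y - x) * prod_list (map norm ws)"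
    by (rule smooth_familyE[OF assms, where n = "length vs"]) blast
  obtain r where r: "r > 0" "ball x r \<subseteq> S"
    using smooth_family_open[OF assms(1)] assms(2) by (rule openE)
  have "e' * prod_list (map norm vs) \<le> e"
  proof -
    have "e' * prod_list (map norm vs) \<le> e' * (1 + prod_list (map norm vs))"
      using \<open>e' > 0\<close> by (intro mult_left_mono) auto
    also have "\<dots> = e" using P by (simp add: e'_def)
    finally show ?thesis .
  qed
  then have "norm (D y vs - D x vs - D x ((y - x) # vs)) \<le> e * norm (y - x)"
    if "norm (y - x) < min d r" for y
  proof -
    have "y \<in> S" using r that by (auto simp: dist_norm norm_minus_commute subset_iff)
    with d(2)[of y vs] that have "norm (D y vs - D x vs - D x ((y - x) # vs))
        \<le> (e' * prod_list (map norm vs)) * norm (y - x)" by (simp add: mult_ac)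
    also have "\<dots> \<le> e * norm (y - x)"
      using \<open>e' * prod_list (map norm vs) \<le> e\<close> by (intro mult_right_mono) auto
    finally show ?thesis .
  qed
  then show "\<exists>d>0. \<forall>y. norm (y - x) < d \<longrightarrow>
      norm (D y vs - D x vs - D x ((y - x) # vs)) \<le> e * norm (y - x)"
    using d r by (intro exI[of _ "min d r"]) auto
qed

lemma smooth_family_Nil_deriv:
  assumes "smooth_family S D" "x \<in> S" "\<forall>x\<in>S. D x [] = f x"
  shows "(f has_derivative (\<lambda>h. D x [h])) (at x)"
  by (rule has_derivative_transform_within_open[OF smooth_family_deriv[OF assms(1,2)]])
     (use assms in \<open>auto simp: smooth_family_def\<close>)

lemma frechet_smooth_on_differentiable:
  "frechet_smooth_on S f \<Longrightarrow> x \<in> S \<Longrightarrow> f differentiable (at x)"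
  unfolding frechet_smooth_on_iff using smooth_family_Nil_deriv by (blast intro: differentiableI)

text \<open>The derivative of order n + 1 is bounded on a small ball: \<open>K1\<close> and
  \<open>K2\<close> bound the derivatives of order n + 1 and n + 2 at \<open>x\<close>, and the
  remainder contributes 1. The mean value inequality turns this bound into a Lipschitz
  constant.\<close>

lemma smooth_family_lipschitz:
  assumes "smooth_family S D" "x \<in> S"
  obtains r K where "r > 0" "K \<ge> 0" "ball x r \<subseteq> S"
    "\<And>p q vs. p \<in> ball x r \<Longrightarrow> q \<in> ball x r \<Longrightarrow> length vs = n \<Longrightarrow>
      norm (D p vs - D q vs) \<le> K * norm (p - q) * prod_list (map norm vs)"
proof -
  have S: "open S" "\<And>n x. x \<in> S \<Longrightarrow> bounded_multilinear n (D x)"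
    using assms(1) by (auto intro: smooth_family_open smooth_family_multilinear)
  obtain d where d: "d > 0" "\<And>y vs. y \<in> S \<Longrightarrow> norm (y - x) < d \<Longrightarrow> length vs = Suc n \<Longrightarrow>
      norm (D y vs - D x vs - D x ((y - x) # vs)) \<le> 1 * norm (y - x) * prod_list (map norm vs)"
    by (rule smooth_familyE[OF assms zero_less_one, where n = "Suc n"]) blast
  obtain r where r: "r > 0" "ball x r \<subseteq> S"
    using S(1) assms(2) by (rule openE)
  obtain K1 where K1: "K1 \<ge> 0" "\<And>vs. length vs = Suc n \<Longrightarrow> norm (D x vs) \<le> K1 * prod_list (map norm vs)"
    using bounded_multilinear_bound[OF S(2)[OF assms(2)]] by metis
  obtain K2 where K2: "K2 \<ge> 0"
      "\<And>vs. length vs = Suc (Suc n) \<Longrightarrow> norm (D x vs) \<le> K2 * prod_list (map norm vs)"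
    using bounded_multilinear_bound[OF S(2)[OF assms(2)]] by metis
  define R where "R = min d r"
  define K where "K = K1 + (K2 + 1) * R"
  have R: "R > 0" "ball x R \<subseteq> S" using d r by (auto simp: R_def)
  have K0: "K \<ge> 0" using K1 K2 R by (simp add: K_def)
  have bd: "norm (D y vs) \<le> K * prod_list (map norm vs)"
    if y: "y \<in> ball x R" and len: "length vs = Suc n" for y vs
  proof -
    let ?P = "prod_list (map norm vs)"
    have n: "norm (y - x) \<le> R" "norm (y - x) < d" "y \<in> S" using y R
      by (auto simp: dist_norm norm_minus_commute R_def)
    have "norm (D y vs) \<le> norm (D y vs - D x vs - D x ((y - x) # vs)) + norm (D x vs) + norm (D x ((y - x) # vs))"
      using norm_triangle_ineq[of "D y vs - D x vs - D x ((y - x) # vs)" "D x vs + D x ((y - x) # vs)"]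
        norm_triangle_ineq[of "D x vs" "D x ((y - x) # vs)"] by simp
    also have "\<dots> \<le> norm (y - x) * ?P + K1 * ?P + K2 * (norm (y - x) * ?P)"
      using d(2)[OF n(3,2) len] K1(2)[OF len] K2(2)[of "(y - x) # vs"] len by (intro add_mono) auto
    also have "\<dots> = (K1 + (K2 + 1) * norm (y - x)) * ?P" by (simp add: algebra_simps)
    also have "\<dots> \<le> K * ?P" unfolding K_def
      using n K2 by (intro mult_right_mono add_left_mono mult_left_mono) auto
    finally show ?thesis .
  qed
  show ?thesis
  proof (rule that[OF R(1) K0 R(2)])
    fix p q and vs :: "'a list" assume pq: "p \<in> ball x R" "q \<in> ball x R" and len: "length vs = n"
    have "norm (D p vs - D q vs) \<le> (K * prod_list (map norm vs)) * norm (p - q)"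
    proof (rule differentiable_bound[where S = "ball x R" and f' = "\<lambda>z h. D z (h # vs)"])
      fix z assume z: "z \<in> ball x R"
      then show "((\<lambda>p. D p vs) has_derivative (\<lambda>h. D z (h # vs))) (at z within ball x R)"
        using smooth_family_deriv[OF assms(1)] R by (blast intro: has_derivative_at_withinI)
      show "onorm (\<lambda>h. D z (h # vs)) \<le> K * prod_list (map norm vs)"
        by (rule onorm_bound) (use bd[OF z, of "_ # vs"] len K0 in \<open>auto simp: mult_ac\<close>)
    qed (use pq in auto)
    then show "norm (D p vs - D q vs) \<le> K * norm (p - q) * prod_list (map norm vs)"
      by (simp add: mult_ac)
  qed
qed

subsection \<open>Differentiating multilinear maps along curves\<close>

text \<open>In this form a difference quotient can be placed into an argument of a multilinear map,
  where the limit statement below applies to it.\<close>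

lemma has_vector_derivative_iff_quotient:
  "(f has_vector_derivative f') (at t) \<longleftrightarrow> ((\<lambda>h. (f (t + h) - f t) /\<^sub>R h) \<longlongrightarrow> f') (at 0)"
proof -
  have "norm (f (t + h) - f t - h *\<^sub>R f') / norm h = norm ((f (t + h) - f t) /\<^sub>R h - f')"
    if "h \<noteq> 0" for h
  proof -
    have "(f (t + h) - f t) /\<^sub>R h - f' = (f (t + h) - f t - h *\<^sub>R f') /\<^sub>R h"
      using that by (simp add: scaleR_diff_right)
    then show ?thesis by (simp add: divide_inverse mult.commute)
  qed
  then have "((\<lambda>h. norm (f (t + h) - f t - h *\<^sub>R f') / norm h) \<longlongrightarrow> 0) (at 0) \<longleftrightarrow>
      ((\<lambda>h. norm ((f (t + h) - f t) /\<^sub>R h - f')) \<longlongrightarrow> 0) (at 0)"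
    by (intro filterlim_cong) (auto simp: eventually_at_filter)
  then show ?thesis
    unfolding has_vector_derivative_def has_derivative_at
    by (simp add: bounded_linear_scaleR_left tendsto_norm_zero_iff LIM_zero_iff)
qed

lemma prod_list_norm_tendsto:
  assumes "list_all2 (\<lambda>f v. (f \<longlongrightarrow> v) F) fs vs"
  shows "((\<lambda>h. prod_list (map norm (map (\<lambda>f. f h) fs))) \<longlongrightarrow> prod_list (map norm vs)) F"
  using assms by (induction rule: list_all2_induct) (auto intro!: tendsto_intros simp: o_def)

text \<open>Changing the head of the list costs at most \<open>K * norm (f h - v)\<close> times a
  convergent product of norms; the tail is the induction hypothesis for \<open>T\<close> with its
  first argument frozen at the limit \<open>v\<close>.\<close>

lemma bounded_multilinear_tendsto:
  assumes "list_all2 (\<lambda>f v. (f \<longlongrightarrow> v) F) fs vs" "bounded_multilinear (length vs) T"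
  shows "((\<lambda>h. T (map (\<lambda>f. f h) fs)) \<longlongrightarrow> T vs) F"
  using assms
proof (induction fs vs arbitrary: T rule: list_all2_induct)
  case (Cons f fs v vs)
  have 1: "((\<lambda>h. T (v # map (\<lambda>f. f h) fs)) \<longlongrightarrow> T (v # vs)) F"
    using Cons by (intro Cons.IH bounded_multilinear_Cons) simp
  obtain K where K: "K \<ge> 0" "\<And>ws. length ws = Suc (length vs) \<Longrightarrow> norm (T ws) \<le> K * prod_list (map norm ws)"
    using bounded_multilinear_bound[OF Cons.prems] by auto
  have len: "length fs = length vs" using Cons.hyps by (auto dest: list_all2_lengthD)
  note prod = prod_list_norm_tendsto[OF Cons.hyps(2)]
  have lin: "linear (\<lambda>u. T (u # map (\<lambda>f. f h) fs))" for h
    using bounded_multilinear_Cons_linear[of "length vs" T "map (\<lambda>f. f h) fs"] Cons.prems len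
    by (simp add: bounded_linear.linear)
  have 2: "((\<lambda>h. T (f h # map (\<lambda>f. f h) fs) - T (v # map (\<lambda>f. f h) fs)) \<longlongrightarrow> 0) F"
  proof (rule Lim_null_comparison)
    have "norm (T (f h # map (\<lambda>f. f h) fs) - T (v # map (\<lambda>f. f h) fs))
        \<le> K * (norm (f h - v) * prod_list (map norm (map (\<lambda>f. f h) fs)))" for h
      using K(2)[of "(f h - v) # map (\<lambda>f. f h) fs"] len by (simp add: linear_diff[OF lin])
    then show "\<forall>\<^sub>F h in F. norm (T (f h # map (\<lambda>f. f h) fs) - T (v # map (\<lambda>f. f h) fs))
        \<le> K * (norm (f h - v) * prod_list (map norm (map (\<lambda>f. f h) fs)))" by simp
    have "((\<lambda>h. K * (norm (f h - v) * prod_list (map norm (map (\<lambda>f. f h) fs))))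
        \<longlongrightarrow> K * (norm (v - v) * prod_list (map norm vs))) F"
      by (intro tendsto_intros prod Cons.hyps(1))
    then show "((\<lambda>h. K * (norm (f h - v) * prod_list (map norm (map (\<lambda>f. f h) fs)))) \<longlongrightarrow> 0) F"
      by simp
  qed
  from tendsto_add[OF 2 1] show ?case by simp
qed simp

text \<open>The product rule, one argument at a time: the difference quotient splits into
  \<open>T\<close> of the quotient of the head with the moving tail, and the quotient of the tail
  behind the fixed head \<open>d t\<close>.\<close>

lemma bounded_multilinear_curve_deriv:
  assumes "list_all2 (\<lambda>d d'. (d has_vector_derivative d') (at t)) ds ds'"
    and "bounded_multilinear (length ds') T"
  shows "((\<lambda>s. T (map (\<lambda>d. d s) ds)) has_vector_derivative
    (\<Sum>i<length ds'. T ((map (\<lambda>d. d t) ds)[i := ds' ! i]))) (at t)"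
  using assms
proof (induction ds ds' arbitrary: T rule: list_all2_induct)
  case (Cons d ds d' ds')
  let ?m = "\<lambda>s. map (\<lambda>d. d s) ds"
  have len: "length ds = length ds'" using Cons.hyps by (auto dest: list_all2_lengthD)
  have 1: "((\<lambda>s. T (d t # ?m s)) has_vector_derivative
      (\<Sum>i<length ds'. T (d t # (?m t)[i := ds' ! i]))) (at t)"
    using Cons by (intro Cons.IH bounded_multilinear_Cons) simp
  have lin: "linear (\<lambda>u. T (u # ?m h))" for h
    using bounded_multilinear_Cons_linear[of "length ds'" T "?m h"] Cons.prems len
    by (simp add: bounded_linear.linear)
  have cont: "(e \<longlongrightarrow> e t) (at t)" if "(e has_vector_derivative e') (at t)" for e :: "real \<Rightarrow> 'a" and e'
    using has_vector_derivative_continuous[OF that] by (simp add: continuous_within)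
  have "((\<lambda>h. T (map (\<lambda>f. f h) ((\<lambda>h. (d (t + h) - d t) /\<^sub>R h) # map (\<lambda>e h. e (t + h)) ds)))
      \<longlongrightarrow> T (d' # ?m t)) (at 0)"
  proof (rule bounded_multilinear_tendsto)
    have sh: "((\<lambda>h. e (t + h)) \<longlongrightarrow> e t) (at 0)"
      if "(e has_vector_derivative e') (at t)" for e :: "real \<Rightarrow> 'a" and e'
      using cont[OF that] by (simp add: LIM_offset_zero)
    have "list_all2 (\<lambda>f v. (f \<longlongrightarrow> v) (at 0)) (map (\<lambda>e h. e (t + h)) ds) (?m t)"
      using Cons.hyps(2) by (induction rule: list_all2_induct) (auto intro: sh)
    then show "list_all2 (\<lambda>f v. (f \<longlongrightarrow> v) (at 0))
        ((\<lambda>h. (d (t + h) - d t) /\<^sub>R h) # map (\<lambda>e h. e (t + h)) ds) (d' # ?m t)"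
      using Cons.hyps(1) by (simp add: has_vector_derivative_iff_quotient)
  qed (use Cons.prems len in simp)
  then have 2: "((\<lambda>h. T ((d (t + h) - d t) /\<^sub>R h # ?m (t + h))) \<longlongrightarrow> T (d' # ?m t)) (at 0)"
    by (simp add: o_def)
  have eq: "(T (d (t + h) # ?m (t + h)) - T (d t # ?m t)) /\<^sub>R h =
      T ((d (t + h) - d t) /\<^sub>R h # ?m (t + h)) + (T (d t # ?m (t + h)) - T (d t # ?m t)) /\<^sub>R h" for h
  proof -
    have "T (((d (t + h) - d t) /\<^sub>R h) # ?m (t + h)) = T ((d (t + h) - d t) # ?m (t + h)) /\<^sub>R h"
      by (rule linear_cmul[OF lin])
    moreover have "T ((d (t + h) - d t) # ?m (t + h)) = T (d (t + h) # ?m (t + h)) - T (d t # ?m (t + h))"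
      by (rule linear_diff[OF lin])
    ultimately show ?thesis by (simp add: scaleR_diff_right)
  qed
  show ?case
    using tendsto_add[OF 2 1[unfolded has_vector_derivative_iff_quotient]]
    unfolding has_vector_derivative_iff_quotient
    by (simp add: eq sum.lessThan_Suc_shift del: sum.lessThan_Suc)
qed (simp add: has_vector_derivative_const)

text \<open>The increment splits into the remainder \<open>E\<close> of the expansion in the base
  point, the derivative along \<open>c\<close>, and the product rule for the vectors at the fixed
  point \<open>c t\<close>. The remainder estimate is uniform in the vectors, so it may be used
  although they move with the parameter.\<close>

lemma smooth_family_curve_deriv:
  assumes D: "smooth_family S D" and c: "(c has_vector_derivative c') (at t)" "c t \<in> S"
    and ds: "list_all2 (\<lambda>d d'. (d has_vector_derivative d') (at t)) ds ds'"
  shows "((\<lambda>s. D (c s) (map (\<lambda>d. d s) ds)) has_vector_derivative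
    (D (c t) (c' # map (\<lambda>d. d t) ds) + (\<Sum>i<length ds'. D (c t) ((map (\<lambda>d. d t) ds)[i := ds' ! i])))) (at t)"
proof -
  let ?m = "\<lambda>s. map (\<lambda>d. d s) ds"
  let ?q = "\<lambda>h. (c (t + h) - c t) /\<^sub>R h"
  define E where "E h = D (c (t + h)) (?m (t + h)) - D (c t) (?m (t + h)) - D (c t) ((c (t + h) - c t) # ?m (t + h))" for h
  have len: "length ds = length ds'" using ds by (auto dest: list_all2_lengthD)
  have ml: "bounded_multilinear n (D (c t))" for n using D c(2) by (rule smooth_family_multilinear)
  have sh: "((\<lambda>h. e (t + h)) \<longlongrightarrow> e t) (at 0)"
    if "(e has_vector_derivative e') (at t)" for e :: "real \<Rightarrow> 'z::real_normed_vector" and e'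
    using has_vector_derivative_continuous[OF that] by (simp add: continuous_within LIM_offset_zero)
  have shs: "list_all2 (\<lambda>f v. (f \<longlongrightarrow> v) (at 0)) (map (\<lambda>e h. e (t + h)) ds) (?m t)"
    using ds by (induction rule: list_all2_induct) (auto intro: sh)
  have "((\<lambda>h. D (c t) (map (\<lambda>f. f h) (?q # map (\<lambda>e h. e (t + h)) ds))) \<longlongrightarrow> D (c t) (c' # ?m t)) (at 0)"
    using shs c(1) by (intro bounded_multilinear_tendsto ml) (simp add: has_vector_derivative_iff_quotient)
  then have 1: "((\<lambda>h. D (c t) (?q h # ?m (t + h))) \<longlongrightarrow> D (c t) (c' # ?m t)) (at 0)"
    by (simp add: o_def)
  have 2: "((\<lambda>h. (D (c t) (?m (t + h)) - D (c t) (?m t)) /\<^sub>R h) \<longlongrightarrow>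
      (\<Sum>i<length ds'. D (c t) ((?m t)[i := ds' ! i]))) (at 0)"
    using bounded_multilinear_curve_deriv[OF ds ml] by (simp add: has_vector_derivative_iff_quotient)
  have prod: "((\<lambda>h. prod_list (map norm (?m (t + h)))) \<longlongrightarrow> prod_list (map norm (?m t))) (at 0)"
    using prod_list_norm_tendsto[OF shs] by (simp add: o_def)
  have 3: "((\<lambda>h. E h /\<^sub>R h) \<longlongrightarrow> 0) (at 0)"
  proof (rule tendstoI)
    fix e :: real assume e: "e > 0"
    let ?B = "\<lambda>h. norm (?q h) * prod_list (map norm (?m (t + h)))"
    \<comment> \<open>The limit of the factor that multiplies the remainder constant; adding 1
      leaves room for values near the limit and allows division when it is 0.\<close>
    define B where "B = norm c' * prod_list (map norm (?m t))"
    have "B \<ge> 0" by (simp add: B_def del: map_map)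
    have "(?B \<longlongrightarrow> B) (at 0)" unfolding B_def
      using c(1) by (intro tendsto_intros prod) (simp add: has_vector_derivative_iff_quotient)
    then have ev1: "\<forall>\<^sub>F h in at 0. ?B h < B + 1"
      by (rule order_tendstoD) simp
    define \<epsilon> where "\<epsilon> = e / (B + 1)"
    have \<epsilon>: "\<epsilon> > 0" using e \<open>B \<ge> 0\<close> by (simp add: \<epsilon>_def)
    obtain \<delta> where \<delta>: "\<delta> > 0" "\<And>y vs. y \<in> S \<Longrightarrow> norm (y - c t) < \<delta> \<Longrightarrow> length vs = length ds \<Longrightarrow>
        norm (D y vs - D (c t) vs - D (c t) ((y - c t) # vs)) \<le> \<epsilon> * norm (y - c t) * prod_list (map norm vs)"
      by (rule smooth_familyE[OF D c(2) \<epsilon>, where n = "length ds"]) blast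
    have "open S" using D by (simp add: smooth_family_def)
    then have ev2: "\<forall>\<^sub>F h in at 0. c (t + h) \<in> S" using sh[OF c(1)] c(2) by (auto dest: topological_tendstoD)
    have ev3: "\<forall>\<^sub>F h in at 0. norm (c (t + h) - c t) < \<delta>"
      using tendstoD[OF sh[OF c(1)] \<delta>(1)] by (simp add: dist_norm)
    have ev4: "\<forall>\<^sub>F h in at (0::real). h \<noteq> 0" by (simp add: eventually_at_filter)
    show "\<forall>\<^sub>F h in at 0. dist (E h /\<^sub>R h) 0 < e"
      using ev1 ev2 ev3 ev4
    proof eventually_elim
      case (elim h)
      have "norm (E h) \<le> \<epsilon> * norm (c (t + h) - c t) * prod_list (map norm (?m (t + h)))"
        unfolding E_def using elim by (intro \<delta>(2)) auto
      then have "norm (E h) / \<bar>h\<bar> \<le> \<epsilon> * norm (c (t + h) - c t) * prod_list (map norm (?m (t + h))) / \<bar>h\<bar>"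
        by (intro divide_right_mono) auto
      also have "\<dots> = \<epsilon> * ?B h" by (simp add: divide_inverse mult_ac)
      also have "\<dots> < \<epsilon> * (B + 1)" using elim \<epsilon> by simp
      also have "\<dots> = e" using \<open>B \<ge> 0\<close> by (simp add: \<epsilon>_def)
      finally show ?case by (simp add: divide_inverse mult.commute)
    qed
  qed
  have lin: "linear (\<lambda>u. D (c t) (u # ?m h))" for h
    using bounded_multilinear_Cons_linear[OF ml, of "?m h"] by (simp add: bounded_linear.linear)
  have "(D (c (t + h)) (?m (t + h)) - D (c t) (?m t)) /\<^sub>R h =
      E h /\<^sub>R h + D (c t) (?q h # ?m (t + h)) + (D (c t) (?m (t + h)) - D (c t) (?m t)) /\<^sub>R h" for h
  proof -
    have "D (c t) (?q h # ?m (t + h)) = D (c t) ((c (t + h) - c t) # ?m (t + h)) /\<^sub>R h"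
      by (rule linear_cmul[OF lin])
    then show ?thesis by (simp add: E_def scaleR_diff_right)
  qed
  then show ?thesis unfolding has_vector_derivative_iff_quotient
    using tendsto_add[OF tendsto_add[OF 3 1] 2] by simp
qed

text \<open>An isometric \<open>j\<close> leaves all norm estimates intact. The trailing vectors
  \<open>us\<close> freeze the last arguments, so that a derivative in fixed directions becomes the
  zeroth entry of a family of its own.\<close>

lemma smooth_family_affine:
  fixes j :: "'a::banach \<Rightarrow> 'c::banach"
  assumes D: "smooth_family S D" and j: "linear j" "\<And>v. norm (j v) = norm v"
  shows "smooth_family {p. j p + b \<in> S} (\<lambda>p vs. D (j p + b) (map j vs @ us))"
proof -
  have jb: "bounded_linear j"
    by (rule bounded_linear_intro[of _ 1]) (simp_all add: linear_add[OF j(1)] linear_cmul[OF j(1)] j(2))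
  let ?U = "prod_list (map norm us)"
  have nj: "map norm (map j vs) = map norm vs" for vs by (simp add: j(2))
  show ?thesis unfolding smooth_family_def
  proof (intro conjI allI ballI impI)
    have "{p. j p + b \<in> S} = (\<lambda>p. j p + b) -` S" by auto
    moreover have "open \<dots>"
      by (intro open_vimage smooth_family_open[OF D] continuous_intros linear_continuous_on jb)
    ultimately show "open {p. j p + b \<in> S}" by simp
  next
    fix n x assume x: "x \<in> {p. j p + b \<in> S}"
    have ml: "bounded_multilinear (n + length us) (D (j x + b))"
      using smooth_family_multilinear[OF D] x by simp
    obtain K where K: "\<And>vs. length vs = n + length us \<Longrightarrow>
        norm (D (j x + b) vs) \<le> K * prod_list (map norm vs)"
      using bounded_multilinear_bound[OF ml] by metis
    show "bounded_multilinear n (\<lambda>vs. D (j x + b) (map j vs @ us))"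
      unfolding bounded_multilinear_def
    proof (intro conjI allI impI)
      fix vs :: "'a list" and i assume i: "length vs = n" "i < n"
      have "linear (\<lambda>v. D (j x + b) ((map j vs @ us)[i := v]))"
        using ml[unfolded bounded_multilinear_def, THEN conjunct1, rule_format, of "map j vs @ us" i] i
        by simp
      from linear_compose[OF j(1) this]
      show "linear (\<lambda>v. D (j x + b) (map j (vs[i := v]) @ us))"
        using i by (simp add: o_def map_update list_update_append)
    next
      have "norm (D (j x + b) (map j vs @ us)) \<le> (K * ?U) * prod_list (map norm vs)" if "length vs = n" for vs
      proof -
        have "norm (D (j x + b) (map j vs @ us)) \<le> K * prod_list (map norm (map j vs @ us))"
          using that by (intro K) simp
        then show ?thesis unfolding map_append nj by (simp add: mult_ac)
      qed
      then show "\<exists>K. \<forall>vs. length vs = n \<longrightarrow> norm (D (j x + b) (map j vs @ us)) \<le> K * prod_list (map norm vs)"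
        by blast
    qed
    fix \<epsilon> :: real assume e: "\<epsilon> > 0"
    have U: "0 < 1 + ?U" by (rule add_pos_nonneg) auto
    then have e': "\<epsilon> / (1 + ?U) > 0" using e by simp
    have le: "\<epsilon> / (1 + ?U) * ?U \<le> \<epsilon>"
    proof -
      have "\<epsilon> / (1 + ?U) * ?U \<le> \<epsilon> / (1 + ?U) * (1 + ?U)" using e' by (intro mult_left_mono) auto
      then show ?thesis using U by simp
    qed
    have x': "j x + b \<in> S" using x by simp
    obtain \<delta> where d: "\<delta> > 0" "\<And>y vs. y \<in> S \<Longrightarrow> norm (y - (j x + b)) < \<delta> \<Longrightarrow> length vs = n + length us \<Longrightarrow>
        norm (D y vs - D (j x + b) vs - D (j x + b) ((y - (j x + b)) # vs))
          \<le> \<epsilon> / (1 + ?U) * norm (y - (j x + b)) * prod_list (map norm vs)"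
      by (rule smooth_familyE[OF D x' e', where n = "n + length us"]) blast
    show "\<exists>\<delta>>0. \<forall>y\<in>{p. j p + b \<in> S}. norm (y - x) < \<delta> \<longrightarrow> (\<forall>vs. length vs = n \<longrightarrow>
        norm (D (j y + b) (map j vs @ us) - D (j x + b) (map j vs @ us)
            - D (j x + b) (map j ((y - x) # vs) @ us))
          \<le> \<epsilon> * norm (y - x) * prod_list (map norm vs))"
    proof (intro exI[of _ \<delta>] conjI d ballI impI allI)
      fix y and vs :: "'a list" assume y: "y \<in> {p. j p + b \<in> S}" "norm (y - x) < \<delta>" "length vs = n"
      have dj: "(j y + b) - (j x + b) = j (y - x)" by (simp add: linear_diff[OF j(1)])
      have "norm (D (j y + b) (map j vs @ us) - D (j x + b) (map j vs @ us)
            - D (j x + b) (j (y - x) # (map j vs @ us)))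
          \<le> \<epsilon> / (1 + ?U) * norm (y - x) * prod_list (map norm (map j vs @ us))"
        using d(2)[of "j y + b" "map j vs @ us"] y unfolding dj j(2) by simp
      also have "\<dots> = (\<epsilon> / (1 + ?U) * ?U) * (norm (y - x) * prod_list (map norm vs))"
        unfolding map_append nj by simp
      also have "\<dots> \<le> \<epsilon> * (norm (y - x) * prod_list (map norm vs))"
        using le by (intro mult_right_mono mult_nonneg_nonneg) auto
      finally show "norm (D (j y + b) (map j vs @ us) - D (j x + b) (map j vs @ us)
            - D (j x + b) (map j ((y - x) # vs) @ us))
          \<le> \<epsilon> * norm (y - x) * prod_list (map norm vs)" by (simp add: mult_ac)
    qed
  qed
qed

lemma smooth_family_slice_fst:
  fixes S :: "('a::banach \<times> 'b::banach) set"
  assumes "smooth_family S D"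
  shows "smooth_family {p. (p, b) \<in> S} (\<lambda>p vs. D (p, b) (map (\<lambda>v. (v, 0)) vs @ us))"
  using smooth_family_affine[OF assms, of "\<lambda>v. (v, 0)" "(0, b)" us]
  by (simp add: linear_iff norm_Pair)

lemma smooth_family_slice_snd:
  fixes S :: "('a::banach \<times> 'b::banach) set"
  assumes "smooth_family S D"
  shows "smooth_family {q. (a, q) \<in> S} (\<lambda>q vs. D (a, q) (map (\<lambda>v. (0, v)) vs @ us))"
  using smooth_family_affine[OF assms, of "\<lambda>v. (0, v)" "(a, 0)" us]
  by (simp add: linear_iff norm_Pair)

subsection \<open>Curves of class \<open>C\<^sup>n\<close> at a point\<close>

text \<open>Order 0 demands nothing, since differentiability at each step supplies continuity of
  what is below it; smoothness is \<open>ck n\<close> for all \<open>n\<close>. Asking for the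
  derivative on a neighbourhood keeps this a notion at a point that can still be iterated.\<close>

primrec ck :: "nat \<Rightarrow> (real \<Rightarrow> 'e::real_normed_vector) \<Rightarrow> real \<Rightarrow> bool" where
  "ck 0 = (\<lambda>f t. True)"
| "ck (Suc n) = (\<lambda>f t. \<exists>f'. (\<forall>\<^sub>F s in nhds t. (f has_vector_derivative f' s) (at s)) \<and> ck n f' t)"

lemma ck_SucI:
  "\<forall>\<^sub>F s in nhds t. (f has_vector_derivative f' s) (at s) \<Longrightarrow> ck n f' t \<Longrightarrow> ck (Suc n) f t"
  by auto

lemma ck_SucE:
  assumes "ck (Suc n) f t"
  obtains f' where "\<forall>\<^sub>F s in nhds t. (f has_vector_derivative f' s) (at s)" "ck n f' t"
  using assms by auto

declare ck.simps(2) [simp del]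

lemma ck_cong:
  assumes "\<forall>\<^sub>F s in nhds t. f s = g s" "ck n f t"
  shows "ck n g t"
proof (cases n)
  case (Suc m)
  then obtain f' where f': "\<forall>\<^sub>F s in nhds t. (f has_vector_derivative f' s) (at s)" "ck m f' t"
    using assms(2) by (blast elim: ck_SucE)
  have "\<forall>\<^sub>F s in nhds t. \<forall>\<^sub>F u in nhds s. f u = g u"
    using assms(1) by (simp add: eventually_eventually)
  with f'(1) have "\<forall>\<^sub>F s in nhds t. (g has_vector_derivative f' s) (at s)"
  proof eventually_elim
    case (elim s)
    then obtain U where U: "open U" "s \<in> U" "\<forall>u\<in>U. f u = g u" unfolding eventually_nhds by auto
    then show ?case
      using elim(1) by (intro has_vector_derivative_transform_within_open[of f "f' s" s U g]) auto
  qed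
  then show ?thesis unfolding Suc by (rule ck_SucI) (rule f'(2))
qed simp

lemma ck_SucD: "ck (Suc n) f t \<Longrightarrow> ck n f t"
proof (induction n arbitrary: f)
  case (Suc n)
  then obtain f' where f': "\<forall>\<^sub>F s in nhds t. (f has_vector_derivative f' s) (at s)" "ck (Suc n) f' t"
    by (blast elim: ck_SucE)
  show ?case by (rule ck_SucI[OF f'(1) Suc.IH[OF f'(2)]])
qed simp

lemma ck_const: "ck n (\<lambda>s. c) t"
proof (induction n arbitrary: c)
  case (Suc n)
  show ?case by (rule ck_SucI[OF _ Suc.IH[of 0]]) simp
qed simp

lemma ck_add: "ck n f t \<Longrightarrow> ck n g t \<Longrightarrow> ck n (\<lambda>s. f s + g s) t"
proof (induction n arbitrary: f g)
  case (Suc n)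
  obtain f' where f: "\<forall>\<^sub>F s in nhds t. (f has_vector_derivative f' s) (at s)" "ck n f' t"
    using Suc.prems(1) by (rule ck_SucE)
  obtain g' where g: "\<forall>\<^sub>F s in nhds t. (g has_vector_derivative g' s) (at s)" "ck n g' t"
    using Suc.prems(2) by (rule ck_SucE)
  have "\<forall>\<^sub>F s in nhds t. ((\<lambda>s. f s + g s) has_vector_derivative (f' s + g' s)) (at s)"
    using f(1) g(1) by eventually_elim (rule has_vector_derivative_add)
  then show ?case by (rule ck_SucI) (rule Suc.IH[OF f(2) g(2)])
qed simp

lemma ck_sum: "(\<And>i. i \<in> I \<Longrightarrow> ck n (f i) t) \<Longrightarrow> ck n (\<lambda>s. \<Sum>i\<in>I. f i s) t"
  by (induction I rule: infinite_finite_induct) (simp_all add: ck_const ck_add)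

lemma ck_affine: "ck n f (a * t + b) \<Longrightarrow> ck n (\<lambda>s. r *\<^sub>R f (a * s + b)) t"
proof (induction n arbitrary: f r)
  case (Suc n)
  obtain f' where f': "\<forall>\<^sub>F s in nhds (a * t + b). (f has_vector_derivative f' s) (at s)"
    "ck n f' (a * t + b)" using Suc.prems by (rule ck_SucE)
  have "filterlim (\<lambda>s. a * s + b) (nhds (a * t + b)) (nhds t)"
    by (intro tendsto_intros filterlim_ident)
  from eventually_compose_filterlim[OF f'(1) this]
  have "\<forall>\<^sub>F s in nhds t. (f has_vector_derivative f' (a * s + b)) (at (a * s + b))" .
  then have "\<forall>\<^sub>F s in nhds t. ((\<lambda>s. r *\<^sub>R f (a * s + b)) has_vector_derivative (r * a) *\<^sub>R f' (a * s + b)) (at s)"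
  proof eventually_elim
    case (elim s)
    have "((\<lambda>s. a * s + b) has_vector_derivative a) (at s)"
      unfolding has_real_derivative_iff_has_vector_derivative[symmetric]
      by (auto intro!: derivative_eq_intros)
    from vector_diff_chain_at[OF this elim]
    have "((\<lambda>s. f (a * s + b)) has_vector_derivative a *\<^sub>R f' (a * s + b)) (at s)" by (simp add: o_def)
    from bounded_linear.has_vector_derivative[OF bounded_linear_scaleR_right this]
    show ?case by simp
  qed
  then show ?case by (rule ck_SucI) (rule Suc.IH[OF f'(2)])
qed simp

text \<open>Stated for lists \<open>ds\<close> so that the induction closes: the derivative of the
  composite is a sum of terms of the same shape, in which one vector has been added or replaced by
  its derivative, and these only have to be regular of one order less.\<close>

lemma ck_smooth_family_compose:
  assumes D: "smooth_family S D" and c: "c t \<in> S"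
  shows "ck n c t \<Longrightarrow> (\<And>d. d \<in> set ds \<Longrightarrow> ck n d t) \<Longrightarrow> ck n (\<lambda>s. D (c s) (map (\<lambda>d. d s) ds)) t"
proof (induction n arbitrary: ds)
  case (Suc n)
  obtain c' where c': "\<forall>\<^sub>F s in nhds t. (c has_vector_derivative c' s) (at s)" "ck n c' t"
    using Suc.prems(1) by (rule ck_SucE)
  have "\<forall>d\<in>set ds. \<exists>d'. (\<forall>\<^sub>F s in nhds t. (d has_vector_derivative d' s) (at s)) \<and> ck n d' t"
    using Suc.prems(2) by (blast elim: ck_SucE)
  then obtain e where e: "\<And>d. d \<in> set ds \<Longrightarrow> \<forall>\<^sub>F s in nhds t. (d has_vector_derivative e d s) (at s)"
    "\<And>d. d \<in> set ds \<Longrightarrow> ck n (e d) t" by metis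
  have ck1: "ck n c t" "\<And>d. d \<in> set ds \<Longrightarrow> ck n d t" using Suc.prems ck_SucD by blast+
  have "(c has_vector_derivative c' t) (at t)" using c'(1) by (rule eventually_nhds_x_imp_x)
  from has_vector_derivative_continuous[OF this] have "(c \<longlongrightarrow> c t) (nhds t)"
    by (simp add: continuous_within tendsto_at_iff_tendsto_nhds)
  then have "\<forall>\<^sub>F s in nhds t. c s \<in> S"
    using smooth_family_open[OF D] c by (rule topological_tendstoD)
  moreover have "\<forall>\<^sub>F s in nhds t. \<forall>d\<in>set ds. (d has_vector_derivative e d s) (at s)"
    using e(1) by (intro eventually_ball_finite) auto
  ultimately have "\<forall>\<^sub>F s in nhds t. ((\<lambda>s. D (c s) (map (\<lambda>d. d s) ds)) has_vector_derivative
      (D (c s) (map (\<lambda>d. d s) (c' # ds)) + (\<Sum>i<length ds. D (c s) (map (\<lambda>d. d s) (ds[i := e (ds ! i)]))))) (at s)"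
    using c'(1)
  proof eventually_elim
    case (elim s)
    have "list_all2 (\<lambda>d d'. (d has_vector_derivative d') (at s)) ds (map (\<lambda>d. e d s) ds)"
      using elim by (auto simp: list_all2_conv_all_nth)
    from smooth_family_curve_deriv[OF D elim(3,1) this] show ?case
      by (simp add: map_update)
  qed
  moreover have "ck n (\<lambda>s. D (c s) (map (\<lambda>d. d s) (c' # ds))
      + (\<Sum>i<length ds. D (c s) (map (\<lambda>d. d s) (ds[i := e (ds ! i)])))) t"
  proof (rule ck_add)
    show "ck n (\<lambda>s. D (c s) (map (\<lambda>d. d s) (c' # ds))) t"
    proof (rule Suc.IH[OF ck1(1)])
      fix d assume "d \<in> set (c' # ds)"
      then consider "d = c'" | "d \<in> set ds" by auto
      then show "ck n d t" by cases (simp_all only: c'(2) ck1(2))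
    qed
    show "ck n (\<lambda>s. \<Sum>i<length ds. D (c s) (map (\<lambda>d. d s) (ds[i := e (ds ! i)]))) t"
    proof (rule ck_sum, rule Suc.IH[OF ck1(1)])
      fix i d assume i: "i \<in> {..<length ds}" "d \<in> set (ds[i := e (ds ! i)])"
      then have "d \<in> insert (e (ds ! i)) (set ds)" "ds ! i \<in> set ds"
        using set_update_subset_insert[of ds i "e (ds ! i)"] by auto
      then show "ck n d t" using e(2) ck1(2) by blast
    qed
  qed
  ultimately show ?case by (rule ck_SucI)
qed simp

lemma ck_vector_derivative:
  assumes "ck (Suc n) f t"
  shows "(f has_vector_derivative vector_derivative f (at t)) (at t)"
    and "ck n (\<lambda>s. vector_derivative f (at s)) t"
proof -
  obtain f' where f': "\<forall>\<^sub>F s in nhds t. (f has_vector_derivative f' s) (at s)" "ck n f' t"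
    using assms by (rule ck_SucE)
  have "(f has_vector_derivative f' t) (at t)" using f'(1) by (rule eventually_nhds_x_imp_x)
  then show "(f has_vector_derivative vector_derivative f (at t)) (at t)"
    using vector_derivative_at by metis
  have "\<forall>\<^sub>F s in nhds t. f' s = vector_derivative f (at s)"
    using f'(1) by eventually_elim (simp add: vector_derivative_at)
  then show "ck n (\<lambda>s. vector_derivative f (at s)) t" using f'(2) by (rule ck_cong)
qed

lemma prod_list_update: "i < length vs \<Longrightarrow> prod_list (vs[i := v]) = v * prod_list (vs[i := (1::real)])"
proof (induction vs arbitrary: i)
  case (Cons a vs)
  then show ?case by (cases i) (auto simp: mult_ac)
qed simp

lemma prod_list_norm: "prod_list (map norm vs) = \<bar>prod_list vs\<bar>" for vs :: "real list"
  by (induction vs) (auto simp: abs_mult)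

text \<open>On the line the derivative of order n multiplies the product of its n real arguments
  with one vector, the n-fold iterated \<open>vector_derivative\<close>; this writes the whole
  family down explicitly.\<close>

lemma frechet_smooth_on_ckI:
  fixes f :: "real \<Rightarrow> 'e::banach"
  assumes S: "open S" and ck: "\<And>t n. t \<in> S \<Longrightarrow> ck n f t"
  shows "frechet_smooth_on S f"
proof -
  define g where "g n = ((\<lambda>f s. vector_derivative f (at s)) ^^ n) f" for n
  have "ck m (g n) t" if "t \<in> S" for m n t
    by (induction n arbitrary: m) (auto simp: g_def ck[OF that] simp del: ck.simps intro!: ck_vector_derivative(2))
  from ck_vector_derivative(1)[OF this] have g: "(g n has_vector_derivative g (Suc n) t) (at t)" if "t \<in> S" for n t
    using that by (simp add: g_def)
  have "smooth_family S (\<lambda>t vs. prod_list vs *\<^sub>R g (length vs) t)"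
    unfolding smooth_family_def
  proof (intro conjI allI ballI impI)
    fix n x assume x: "x \<in> S"
    show "bounded_multilinear n (\<lambda>vs. prod_list vs *\<^sub>R g (length vs) x)"
      unfolding bounded_multilinear_def
    proof (intro conjI allI impI)
      fix vs :: "real list" and i assume i: "length vs = n" "i < n"
      have "linear (\<lambda>v. v *\<^sub>R (prod_list (vs[i := 1]) *\<^sub>R g n x))"
        by (rule bounded_linear.linear[OF bounded_linear_scaleR_left])
      then show "linear (\<lambda>v. prod_list (vs[i := v]) *\<^sub>R g (length (vs[i := v])) x)"
        using i by (subst prod_list_update) auto
    next
      show "\<exists>K. \<forall>vs. length vs = n \<longrightarrow> norm (prod_list vs *\<^sub>R g (length vs) x) \<le> K * prod_list (map norm vs)"
        by (intro exI[of _ "norm (g n x)"]) (auto simp: prod_list_norm simp del: real_norm_def)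
    qed
    fix e :: real assume "e > 0"
    then obtain d where d: "d > 0" "\<And>y. norm (y - x) < d \<Longrightarrow>
        norm (g n y - g n x - (y - x) *\<^sub>R g (Suc n) x) \<le> e * norm (y - x)"
      using g[OF x, of n] unfolding has_vector_derivative_def has_derivative_at_alt by blast
    show "\<exists>d>0. \<forall>y\<in>S. norm (y - x) < d \<longrightarrow> (\<forall>vs. length vs = n \<longrightarrow>
        norm (prod_list vs *\<^sub>R g (length vs) y - prod_list vs *\<^sub>R g (length vs) x -
          prod_list ((y - x) # vs) *\<^sub>R g (length ((y - x) # vs)) x)
        \<le> e * norm (y - x) * prod_list (map norm vs))"
    proof (intro exI[of _ d] conjI d ballI impI allI)
      fix y and vs :: "real list" assume y: "norm (y - x) < d" "length vs = n"
      have "prod_list vs *\<^sub>R g (length vs) y - prod_list vs *\<^sub>R g (length vs) x -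
          prod_list ((y - x) # vs) *\<^sub>R g (length ((y - x) # vs)) x
        = prod_list vs *\<^sub>R (g n y - g n x - (y - x) *\<^sub>R g (Suc n) x)"
        using y(2) by (simp add: scaleR_diff_right mult.commute)
      then have "norm (prod_list vs *\<^sub>R g (length vs) y - prod_list vs *\<^sub>R g (length vs) x -
          prod_list ((y - x) # vs) *\<^sub>R g (length ((y - x) # vs)) x)
        = \<bar>prod_list vs\<bar> * norm (g n y - g n x - (y - x) *\<^sub>R g (Suc n) x)" by simp
      also have "\<dots> \<le> \<bar>prod_list vs\<bar> * (e * norm (y - x))" using d(2)[OF y(1)] by (intro mult_left_mono) auto
      finally show "norm (prod_list vs *\<^sub>R g (length vs) y - prod_list vs *\<^sub>R g (length vs) x -
          prod_list ((y - x) # vs) *\<^sub>R g (length ((y - x) # vs)) x)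
        \<le> e * norm (y - x) * prod_list (map norm vs)" by (simp only: prod_list_norm mult_ac)
    qed
  qed fact
  then show ?thesis unfolding frechet_smooth_on_iff
    using S by (intro conjI exI[of _ "\<lambda>t vs. prod_list vs *\<^sub>R g (length vs) t"]) (auto simp: g_def)
qed

section \<open>Differentiable maps between manifolds\<close>

lemma differentiable_transform_eventually:
  assumes "f differentiable (at x)" "\<forall>\<^sub>F y in nhds x. f y = g y"
  shows "g differentiable (at x)"
proof -
  obtain f' where "(f has_derivative f') (at x)" using assms(1) by (auto simp: differentiable_def)
  moreover obtain U where "open U" "x \<in> U" "\<forall>y\<in>U. f y = g y"
    using assms(2) unfolding eventually_nhds by auto
  ultimately have "(g has_derivative f') (at x)"
    using has_derivative_transform_within_open[of f f' x UNIV U g] by auto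
  then show ?thesis by (rule differentiableI)
qed

lemma has_derivative_transform_eventually_nhds:
  assumes "(f has_derivative f') (at x)" "\<forall>\<^sub>F y in nhds x. f y = g y"
  shows "(g has_derivative f') (at x)"
proof -
  obtain U where "open U" "x \<in> U" "\<forall>y\<in>U. f y = g y"
    using assms(2) unfolding eventually_nhds by auto
  then show ?thesis
    using has_derivative_transform_within_open[of f f' x UNIV U g] assms(1) by auto
qed

lemma differentiable_tendsto_nhds:
  assumes "f differentiable (at x)" shows "(f \<longlongrightarrow> f x) (nhds x)"
  using differentiable_imp_continuous_within[OF assms]
  by (simp add: continuous_within tendsto_at_iff_tendsto_nhds)

text \<open>\<open>dmfd X A\<close> retains of a manifold only that its transition maps are differentiable, which
  smooth and holomorphic manifolds have in common.\<close>

definition dmfd :: "'x set \<Rightarrow> ('x, 'e::banach) chart set \<Rightarrow> bool"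
  where "dmfd X A \<longleftrightarrow> (\<forall>c\<in>A. chart_on X c) \<and> \<Union>(fst ` A) = X \<and>
    (\<forall>(U, \<phi>)\<in>A. \<forall>(V, \<psi>)\<in>A. open (\<phi> ` (U \<inter> V)) \<and>
      (\<forall>x\<in>U \<inter> V. (\<psi> \<circ> inv_into U \<phi>) differentiable (at (\<phi> x))))"

text \<open>The first conjunct keeps \<open>f\<close> inside the chart \<open>V\<close> near the
  point, so that the representative in the second one is meaningful there. All charts are quantified
  over, so that a composition may pass through any chart in the middle.\<close>

definition mdiff :: "('x, 'e::banach) chart set \<Rightarrow> ('y, 'f::banach) chart set \<Rightarrow> ('x \<Rightarrow> 'y) \<Rightarrow> 'x \<Rightarrow> bool"
  where "mdiff A B f x \<longleftrightarrow> (\<forall>(U, \<phi>)\<in>A. x \<in> U \<longrightarrow> (\<forall>(V, \<psi>)\<in>B. f x \<in> V \<longrightarrow>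
    (\<forall>\<^sub>F p in nhds (\<phi> x). p \<in> \<phi> ` U \<and> f (inv_into U \<phi> p) \<in> V) \<and>
    (\<lambda>p. \<psi> (f (inv_into U \<phi> p))) differentiable (at (\<phi> x))))"

lemma mdiffI:
  assumes "\<And>U \<phi> V \<psi>. (U, \<phi>) \<in> A \<Longrightarrow> x \<in> U \<Longrightarrow> (V, \<psi>) \<in> B \<Longrightarrow> f x \<in> V \<Longrightarrow>
    (\<forall>\<^sub>F p in nhds (\<phi> x). p \<in> \<phi> ` U \<and> f (inv_into U \<phi> p) \<in> V) \<and>
    (\<lambda>p. \<psi> (f (inv_into U \<phi> p))) differentiable (at (\<phi> x))"
  shows "mdiff A B f x"
  using assms unfolding mdiff_def by blast

lemma mdiffD:
  assumes "mdiff A B f x" "(U, \<phi>) \<in> A" "x \<in> U" "(V, \<psi>) \<in> B" "f x \<in> V"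
  shows "\<forall>\<^sub>F p in nhds (\<phi> x). p \<in> \<phi> ` U \<and> f (inv_into U \<phi> p) \<in> V"
    and "(\<lambda>p. \<psi> (f (inv_into U \<phi> p))) differentiable (at (\<phi> x))"
  using assms unfolding mdiff_def by blast+

lemma dmfd_chart:
  assumes "dmfd X A" "(U, \<phi>) \<in> A"
  shows "U \<subseteq> X" "inj_on \<phi> U" "open (\<phi> ` U)"
  using assms by (auto simp: dmfd_def chart_on_def)

lemma dmfd_cover:
  assumes "dmfd X A" "x \<in> X"
  obtains U \<phi> where "(U, \<phi>) \<in> A" "x \<in> U"
  using assms by (fastforce simp: dmfd_def)

lemma dmfd_transition:
  assumes "dmfd X A" "(U, \<phi>) \<in> A" "(V, \<psi>) \<in> A"
  shows "open (\<phi> ` (U \<inter> V))"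
    and "x \<in> U \<Longrightarrow> x \<in> V \<Longrightarrow> (\<lambda>p. \<psi> (inv_into U \<phi> p)) differentiable (at (\<phi> x))"
proof -
  have "\<forall>(V, \<psi>)\<in>A. open (\<phi> ` (U \<inter> V)) \<and>
      (\<forall>x\<in>U \<inter> V. (\<psi> \<circ> inv_into U \<phi>) differentiable (at (\<phi> x)))"
    using assms(1,2) unfolding dmfd_def by fast
  then show "open (\<phi> ` (U \<inter> V))"
    and "x \<in> U \<Longrightarrow> x \<in> V \<Longrightarrow> (\<lambda>p. \<psi> (inv_into U \<phi> p)) differentiable (at (\<phi> x))"
    using assms(3) by (auto simp: o_def)
qed

lemma dmfd_if_banach_manifold:
  assumes "banach_manifold R X A"
    and R: "\<And>S f z. R S f \<Longrightarrow> open S" "\<And>S f z. R S f \<Longrightarrow> z \<in> S \<Longrightarrow> f differentiable (at z)"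
  shows "dmfd X A"
proof -
  have "open (\<phi> ` (U \<inter> V)) \<and> (\<forall>x\<in>U \<inter> V. (\<psi> \<circ> inv_into U \<phi>) differentiable (at (\<phi> x)))"
    if c: "(U, \<phi>) \<in> A" "(V, \<psi>) \<in> A" for U \<phi> V \<psi>
  proof -
    have "R (\<phi> ` (U \<inter> V)) (\<psi> \<circ> inv_into U \<phi>)"
      using assms(1) c by (auto simp: banach_manifold_def compatible_charts_def)
    from R(1)[OF this] R(2)[OF this] show ?thesis by blast
  qed
  then show ?thesis using assms(1) unfolding dmfd_def banach_manifold_def by blast
qed

lemma dmfd_if_smooth: "banach_manifold frechet_smooth_on X A \<Longrightarrow> dmfd X A"
  by (rule dmfd_if_banach_manifold[where R = frechet_smooth_on])
     (auto simp: frechet_smooth_on_iff intro: frechet_smooth_on_differentiable[unfolded frechet_smooth_on_iff])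

lemma dmfd_if_holomorphic: "banach_manifold cholomorphic_on X A \<Longrightarrow> dmfd X A"
  by (rule dmfd_if_banach_manifold[where R = cholomorphic_on]) (auto simp: cholomorphic_on_def intro: differentiableI)

lemma inv_into_UNIV_id [simp]: "inv_into UNIV id = id" "inv_into UNIV (\<lambda>x. x) = id"
  by (auto simp: fun_eq_iff inv_into_f_f[of id UNIV, simplified] inv_into_f_f[of "\<lambda>x. x" UNIV, simplified])

lemma dmfd_vec: "dmfd UNIV (vec_atlas :: ('e, 'e::banach) chart set)"
  by (auto simp: dmfd_def vec_atlas_def chart_on_def id_def o_def)

lemma mfd_mapD:
  assumes "mfd_map R X A Y B f" "(U, \<phi>) \<in> A" "(V, \<psi>) \<in> B"
  shows "R (\<phi> ` {x \<in> U. f x \<in> V}) (\<psi> \<circ> f \<circ> inv_into U \<phi>)"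
  using assms unfolding mfd_map_def by fast

lemma mdiff_if_mfd_map:
  assumes A: "dmfd X A" and f: "mfd_map R X A Y B f"
    and R: "\<And>S f z. R S f \<Longrightarrow> open S" "\<And>S f z. R S f \<Longrightarrow> z \<in> S \<Longrightarrow> f differentiable (at z)"
  shows "mdiff A B f x"
proof (rule mdiffI)
  fix U \<phi> V \<psi> assume c: "(U, \<phi>) \<in> A" "x \<in> U" "(V, \<psi>) \<in> B" "f x \<in> V"
  let ?S = "\<phi> ` {x \<in> U. f x \<in> V}"
  have "R ?S (\<psi> \<circ> f \<circ> inv_into U \<phi>)" using f c unfolding mfd_map_def by fast
  note R = R(1)[OF this] R(2)[OF this]
  have x: "\<phi> x \<in> ?S" using c by auto
  have "\<forall>\<^sub>F p in nhds (\<phi> x). p \<in> ?S" using R(1) x by (rule eventually_nhds_in_open)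
  then have "\<forall>\<^sub>F p in nhds (\<phi> x). p \<in> \<phi> ` U \<and> f (inv_into U \<phi> p) \<in> V"
    by eventually_elim (auto simp: inv_into_f_f[OF dmfd_chart(2)[OF A c(1)]])
  with R(2)[OF x] show "(\<forall>\<^sub>F p in nhds (\<phi> x). p \<in> \<phi> ` U \<and> f (inv_into U \<phi> p) \<in> V) \<and>
    (\<lambda>p. \<psi> (f (inv_into U \<phi> p))) differentiable (at (\<phi> x))" by (simp add: o_def)
qed

lemma mdiff_if_smooth_map:
  "dmfd X A \<Longrightarrow> mfd_map frechet_smooth_on X A Y B f \<Longrightarrow> mdiff A B f x"
  by (rule mdiff_if_mfd_map[where R = frechet_smooth_on])
     (auto simp: frechet_smooth_on_iff intro: frechet_smooth_on_differentiable[unfolded frechet_smooth_on_iff])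

lemma mdiff_compose:
  assumes A: "dmfd X A" and B: "dmfd Y B" and fx: "f x \<in> Y" and f: "mdiff A B f x" and g: "mdiff B C g (f x)"
  shows "mdiff A C (\<lambda>x. g (f x)) x"
proof (rule mdiffI)
  fix U \<phi> W \<theta> assume c: "(U, \<phi>) \<in> A" "x \<in> U" "(W, \<theta>) \<in> C" "g (f x) \<in> W"
  obtain V \<psi> where V: "(V, \<psi>) \<in> B" "f x \<in> V" using B fx by (rule dmfd_cover)
  note F = mdiffD[OF f c(1,2) V]
  note G = mdiffD[OF g V c(3,4)]
  let ?F = "\<lambda>p. \<psi> (f (inv_into U \<phi> p))"
  have ix: "inv_into U \<phi> (\<phi> x) = x" using dmfd_chart(2)[OF A c(1)] c(2) by simp
  have lim: "filterlim ?F (nhds (\<psi> (f x))) (nhds (\<phi> x))"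
    using differentiable_tendsto_nhds[OF F(2)] ix by simp
  have ev: "\<forall>\<^sub>F p in nhds (\<phi> x). p \<in> \<phi> ` U \<and> f (inv_into U \<phi> p) \<in> V \<and> g (f (inv_into U \<phi> p)) \<in> W"
    using F(1) eventually_compose_filterlim[OF G(1) lim]
    by eventually_elim (auto simp: inv_into_f_f[OF dmfd_chart(2)[OF B V(1)]])
  have "(\<lambda>q. \<theta> (g (inv_into V \<psi> q))) differentiable (at (?F (\<phi> x)))" using G(2) ix by simp
  from differentiable_chain_at[OF F(2) this]
  have "(\<lambda>p. \<theta> (g (inv_into V \<psi> (?F p)))) differentiable (at (\<phi> x))" by (simp add: o_def)
  moreover have "\<forall>\<^sub>F p in nhds (\<phi> x). \<theta> (g (inv_into V \<psi> (?F p))) = \<theta> (g (f (inv_into U \<phi> p)))"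
    using ev by eventually_elim (auto simp: inv_into_f_f[OF dmfd_chart(2)[OF B V(1)]])
  ultimately have "(\<lambda>p. \<theta> (g (f (inv_into U \<phi> p)))) differentiable (at (\<phi> x))"
    by (rule differentiable_transform_eventually)
  moreover have "\<forall>\<^sub>F p in nhds (\<phi> x). p \<in> \<phi> ` U \<and> g (f (inv_into U \<phi> p)) \<in> W"
    using ev by eventually_elim auto
  ultimately show "(\<forall>\<^sub>F p in nhds (\<phi> x). p \<in> \<phi> ` U \<and> g (f (inv_into U \<phi> p)) \<in> W) \<and>
      (\<lambda>p. \<theta> (g (f (inv_into U \<phi> p)))) differentiable (at (\<phi> x))" by simp
qed

lemma mdiff_Pair:
  assumes f: "mdiff A B f x" and g: "mdiff A C g x"
  shows "mdiff A (prod_atlas B C) (\<lambda>x. (f x, g x)) x"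
proof (rule mdiffI)
  fix U \<phi> W \<theta> assume c: "(U, \<phi>) \<in> A" "x \<in> U" "(W, \<theta>) \<in> prod_atlas B C" "(f x, g x) \<in> W"
  then obtain V1 \<psi>1 V2 \<psi>2 where V: "(V1, \<psi>1) \<in> B" "(V2, \<psi>2) \<in> C" "W = V1 \<times> V2" "\<theta> = map_prod \<psi>1 \<psi>2"
    "f x \<in> V1" "g x \<in> V2" by (auto simp: prod_atlas_def)
  note F = mdiffD[OF f c(1,2) V(1,5)] and G = mdiffD[OF g c(1,2) V(2,6)]
  have "\<forall>\<^sub>F p in nhds (\<phi> x). p \<in> \<phi> ` U \<and> (f (inv_into U \<phi> p), g (inv_into U \<phi> p)) \<in> W"
    using F(1) G(1) by eventually_elim (auto simp: V)
  moreover have "(\<lambda>p. (\<psi>1 (f (inv_into U \<phi> p)), \<psi>2 (g (inv_into U \<phi> p)))) differentiable (at (\<phi> x))"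
    using F(2) G(2) unfolding differentiable_def
    by (elim exE) (rule exI, rule has_derivative_Pair)
  ultimately show "(\<forall>\<^sub>F p in nhds (\<phi> x). p \<in> \<phi> ` U \<and> (f (inv_into U \<phi> p), g (inv_into U \<phi> p)) \<in> W) \<and>
      (\<lambda>p. \<theta> (f (inv_into U \<phi> p), g (inv_into U \<phi> p))) differentiable (at (\<phi> x))"
    unfolding V(3,4) by simp
qed

lemma eventually_in_chart:
  assumes "dmfd X A" "(U, \<phi>) \<in> A" "x \<in> U"
  shows "\<forall>\<^sub>F p in nhds (\<phi> x). p \<in> \<phi> ` U"
  using dmfd_chart(3)[OF assms(1,2)] assms(3) by (intro eventually_nhds_in_open) auto

lemma mdiff_const:
  assumes "dmfd X A" shows "mdiff A B (\<lambda>x. c) x"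
  using eventually_in_chart[OF assms] by (intro mdiffI) simp

lemma mdiff_chart:
  assumes A: "dmfd X A" and c: "(U, \<phi>) \<in> A" "x \<in> U"
  shows "mdiff A vec_atlas \<phi> x"
proof (rule mdiffI)
  fix V \<psi> W \<theta> assume d: "(V, \<psi>) \<in> A" "x \<in> V" "(W, \<theta>) \<in> vec_atlas" "\<phi> x \<in> W"
  then show "(\<forall>\<^sub>F p in nhds (\<psi> x). p \<in> \<psi> ` V \<and> \<phi> (inv_into V \<psi> p) \<in> W) \<and>
      (\<lambda>p. \<theta> (\<phi> (inv_into V \<psi> p))) differentiable (at (\<psi> x))"
    using eventually_in_chart[OF A d(1,2)] dmfd_transition(2)[OF A d(1) c(1) d(2) c(2)]
    by (simp add: vec_atlas_def)
qed

lemma mdiff_inv_chart: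
  assumes A: "dmfd X A" and c: "(U, \<phi>) \<in> A" "p \<in> \<phi> ` U"
  shows "mdiff vec_atlas A (inv_into U \<phi>) p"
proof (rule mdiffI)
  fix W \<theta> V \<psi> assume d: "(W, \<theta>) \<in> vec_atlas" "p \<in> W" "(V, \<psi>) \<in> A" "inv_into U \<phi> p \<in> V"
  then have [simp]: "W = UNIV" "\<theta> = id" by (auto simp: vec_atlas_def)
  obtain x where x: "x \<in> U" "p = \<phi> x" using c by auto
  note inj = dmfd_chart(2)[OF A c(1)]
  then have xV: "x \<in> V" using d x by simp
  have "\<forall>\<^sub>F q in nhds p. q \<in> \<phi> ` (U \<inter> V)"
    using dmfd_transition(1)[OF A c(1) d(3)] x xV by (intro eventually_nhds_in_open) auto
  then have "\<forall>\<^sub>F q in nhds p. inv_into U \<phi> q \<in> V"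
    by eventually_elim (auto simp: inv_into_f_f[OF inj])
  then show "(\<forall>\<^sub>F q in nhds (\<theta> p). q \<in> \<theta> ` W \<and> inv_into U \<phi> (inv_into W \<theta> q) \<in> V) \<and>
      (\<lambda>q. \<psi> (inv_into U \<phi> (inv_into W \<theta> q))) differentiable (at (\<theta> p))"
    using dmfd_transition(2)[OF A c(1) d(3) x(1) xV] x by simp
qed

lemma mdiff_vec_source:
  "mdiff vec_atlas B f x \<longleftrightarrow> (\<forall>(V, \<psi>)\<in>B. f x \<in> V \<longrightarrow>
    (\<forall>\<^sub>F p in nhds x. f p \<in> V) \<and> (\<lambda>p. \<psi> (f p)) differentiable (at x))"
  by (auto simp: mdiff_def vec_atlas_def)

lemma mdiff_vec_vec [simp]: "mdiff vec_atlas vec_atlas f x \<longleftrightarrow> f differentiable (at x)"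
  by (auto simp: mdiff_vec_source) (auto simp: vec_atlas_def)

lemma mdiff_vec_cong:
  assumes "\<forall>\<^sub>F y in nhds x. f y = g y" "mdiff vec_atlas B f x"
  shows "mdiff vec_atlas B g x"
proof -
  have fg: "f x = g x" using assms(1) by (rule eventually_nhds_x_imp_x)
  have "(\<forall>\<^sub>F p in nhds x. g p \<in> V) \<and> (\<lambda>p. \<psi> (g p)) differentiable (at x)"
    if "(V, \<psi>) \<in> B" "g x \<in> V" for V \<psi>
  proof
    have f: "\<forall>\<^sub>F p in nhds x. f p \<in> V" "(\<lambda>p. \<psi> (f p)) differentiable (at x)"
      using assms(2) that fg unfolding mdiff_vec_source by fastforce+
    show "\<forall>\<^sub>F p in nhds x. g p \<in> V" using f(1) assms(1) by eventually_elim simp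
    have "\<forall>\<^sub>F p in nhds x. \<psi> (f p) = \<psi> (g p)" using assms(1) by eventually_elim simp
    with f(2) show "(\<lambda>p. \<psi> (g p)) differentiable (at x)" by (rule differentiable_transform_eventually)
  qed
  then show ?thesis unfolding mdiff_vec_source by blast
qed

text \<open>\<open>mfd_top\<close> is built by \<open>topology\<close>, which gives no access to the
  open sets until the predicate is known to be a topology. Intersections are the point of substance:
  images under charts commute with them by injectivity.\<close>

lemma openin_mfd_top:
  assumes "dmfd X A"
  shows "openin (mfd_top X A) S \<longleftrightarrow> S \<subseteq> X \<and> (\<forall>(U, \<phi>)\<in>A. open (\<phi> ` (S \<inter> U)))"
proof -
  have "istopology (\<lambda>S. S \<subseteq> X \<and> (\<forall>(U, \<phi>)\<in>A. open (\<phi> ` (S \<inter> U))))"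
    unfolding istopology_def
  proof (intro conjI allI impI)
    fix S T assume S: "S \<subseteq> X \<and> (\<forall>(U, \<phi>)\<in>A. open (\<phi> ` (S \<inter> U)))"
      and T: "T \<subseteq> X \<and> (\<forall>(U, \<phi>)\<in>A. open (\<phi> ` (T \<inter> U)))"
    show "S \<inter> T \<subseteq> X" using S by auto
    have "open (\<phi> ` (S \<inter> T \<inter> U))" if "(U, \<phi>) \<in> A" for U \<phi>
    proof -
      have "\<phi> ` (S \<inter> T \<inter> U) = \<phi> ` (S \<inter> U) \<inter> \<phi> ` (T \<inter> U)"
        using dmfd_chart(2)[OF assms that] by (auto simp: inj_on_def)
      then show ?thesis using S T that by auto
    qed
    then show "\<forall>(U, \<phi>)\<in>A. open (\<phi> ` (S \<inter> T \<inter> U))" by blast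
  next
    fix K assume K: "\<forall>S\<in>K. S \<subseteq> X \<and> (\<forall>(U, \<phi>)\<in>A. open (\<phi> ` (S \<inter> U)))"
    then show "\<Union>K \<subseteq> X" by auto
    have "open (\<phi> ` (\<Union>K \<inter> U))" if "(U, \<phi>) \<in> A" for U \<phi>
    proof -
      have "\<phi> ` (\<Union>K \<inter> U) = (\<Union>S\<in>K. \<phi> ` (S \<inter> U))" by auto
      moreover have "open (\<phi> ` (S \<inter> U))" if "S \<in> K" for S
        using K that \<open>(U, \<phi>) \<in> A\<close> by fast
      ultimately show ?thesis by (simp add: open_UN)
    qed
    then show "\<forall>(U, \<phi>)\<in>A. open (\<phi> ` (\<Union>K \<inter> U))" by blast
  qed
  then show ?thesis unfolding mfd_top_def by (simp add: topology_inverse')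
qed

lemma topspace_mfd_top:
  assumes "dmfd X A" shows "topspace (mfd_top X A) = X"
proof -
  have "X \<inter> U = U" if "(U, \<phi>) \<in> A" for U \<phi> using dmfd_chart(1)[OF assms that] by auto
  then have "openin (mfd_top X A) X"
    using dmfd_chart(3)[OF assms] by (auto simp: openin_mfd_top[OF assms])
  then have "X \<subseteq> topspace (mfd_top X A)" by (rule openin_subset)
  moreover have "topspace (mfd_top X A) \<subseteq> X"
    using openin_topspace[of "mfd_top X A"] unfolding openin_mfd_top[OF assms] by blast
  ultimately show ?thesis by blast
qed

lemma mfd_top_vec: "mfd_top UNIV (vec_atlas :: ('e, 'e::banach) chart set) = euclidean"
  unfolding topology_eq openin_mfd_top[OF dmfd_vec] by (simp add: vec_atlas_def)

lemma continuous_map_if_mdiff: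
  assumes A: "dmfd X A" and f: "\<And>t. f t \<in> X" "\<And>t. mdiff vec_atlas A f t"
  shows "continuous_map (mfd_top UNIV vec_atlas) (mfd_top X A) f"
  unfolding continuous_map_def
proof (intro conjI allI impI)
  show "f \<in> topspace (mfd_top UNIV vec_atlas) \<rightarrow> topspace (mfd_top X A)"
    using f by (simp add: topspace_mfd_top[OF A])
  fix S assume S: "openin (mfd_top X A) S"
  have "\<forall>\<^sub>F s in nhds t. f s \<in> S" if "f t \<in> S" for t
  proof -
    obtain U \<phi> where U: "(U, \<phi>) \<in> A" "f t \<in> U" using A f(1) by (rule dmfd_cover)
    have "\<forall>\<^sub>F s in nhds t. f s \<in> U" "(\<lambda>s. \<phi> (f s)) differentiable (at t)"
      using f(2)[of t, unfolded mdiff_vec_source, rule_format, OF U(1)] U(2) by simp_all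
    note F = this(1) differentiable_tendsto_nhds[OF this(2)]
    have "open (\<phi> ` (S \<inter> U))" using S U by (auto simp: openin_mfd_top[OF A])
    from topological_tendstoD[OF F(2) this] have "\<forall>\<^sub>F s in nhds t. \<phi> (f s) \<in> \<phi> ` (S \<inter> U)"
      using that U by auto
    with F(1) show ?thesis
      by eventually_elim (use dmfd_chart(2)[OF A U(1)] in \<open>auto simp: inj_on_def\<close>)
  qed
  then have "open {t. f t \<in> S}" by (subst open_subopen) (simp add: eventually_nhds subset_iff Ball_def)
  then show "openin (mfd_top UNIV vec_atlas) {t \<in> topspace (mfd_top UNIV vec_atlas). f t \<in> S}"
    by (simp add: mfd_top_vec)
qed

lemma has_derivative_along_curve:
  assumes "(f has_derivative f') (at (c t))" "(c has_vector_derivative v) (at t)"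
  shows "((\<lambda>s. f (c s)) has_vector_derivative f' v) (at t)"
proof -
  have "bounded_linear f'" using assms(1) by (rule has_derivative_bounded_linear)
  then have "f' (h *\<^sub>R v) = h *\<^sub>R f' v" for h by (simp add: bounded_linear.linear linear_cmul)
  then show ?thesis
    using diff_chain_at[OF assms(2)[unfolded has_vector_derivative_def] assms(1)]
    by (simp add: has_vector_derivative_def o_def)
qed

lemma has_vector_derivative_transform_eventually_nhds:
  "(f has_vector_derivative v) (at x) \<Longrightarrow> \<forall>\<^sub>F y in nhds x. f y = g y \<Longrightarrow> (g has_vector_derivative v) (at x)"
  unfolding has_vector_derivative_def by (rule has_derivative_transform_eventually_nhds)

lemma has_vector_derivative_affine:
  assumes "(f has_vector_derivative y) (at (a * t + b))"
  shows "((\<lambda>s. f (a * s + b)) has_vector_derivative a *\<^sub>R y) (at t)"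
proof -
  have "((\<lambda>s. a * s + b) has_vector_derivative a) (at t)"
    unfolding has_real_derivative_iff_has_vector_derivative[symmetric]
    by (auto intro!: derivative_eq_intros)
  from vector_diff_chain_at[OF this assms] show ?thesis by (simp add: o_def)
qed

lemma dmfd_prod:
  assumes "dmfd X A" "dmfd Y B"
  shows "dmfd (X \<times> Y) (prod_atlas A B)"
proof -
  have main: "case c of (U, \<phi>) \<Rightarrow> case d of (V, \<psi>) \<Rightarrow> open (\<phi> ` (U \<inter> V)) \<and>
        (\<forall>x\<in>U \<inter> V. (\<psi> \<circ> inv_into U \<phi>) differentiable (at (\<phi> x)))"
    if "c \<in> prod_atlas A B" "d \<in> prod_atlas A B" for c d
  proof -
    from that obtain U1 \<phi>1 U2 \<phi>2 V1 \<psi>1 V2 \<psi>2 where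
      c: "c = (U1 \<times> U2, map_prod \<phi>1 \<phi>2)" "(U1, \<phi>1) \<in> A" "(U2, \<phi>2) \<in> B" and
      d: "d = (V1 \<times> V2, map_prod \<psi>1 \<psi>2)" "(V1, \<psi>1) \<in> A" "(V2, \<psi>2) \<in> B"
      by (auto simp: prod_atlas_def)
    let ?c = "map_prod \<phi>1 \<phi>2" and ?d = "map_prod \<psi>1 \<psi>2"
    have inj: "inj_on ?c (U1 \<times> U2)"
      using dmfd_chart(2)[OF assms(1) c(2)] dmfd_chart(2)[OF assms(2) c(3)] by (rule map_prod_inj_on)
    have img: "?c ` (U1 \<times> U2 \<inter> V1 \<times> V2) = \<phi>1 ` (U1 \<inter> V1) \<times> \<phi>2 ` (U2 \<inter> V2)"
      by (auto simp: Times_Int_Times image_iff)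
    have "open (?c ` (U1 \<times> U2 \<inter> V1 \<times> V2))" unfolding img
      using dmfd_transition(1)[OF assms(1) c(2) d(2)] dmfd_transition(1)[OF assms(2) c(3) d(3)] by (rule open_Times)
    moreover have "(?d \<circ> inv_into (U1 \<times> U2) ?c) differentiable (at (?c z))"
      if z: "z \<in> U1 \<times> U2 \<inter> V1 \<times> V2" for z
    proof -
      obtain a b where ab: "z = (a, b)" "a \<in> U1" "b \<in> U2" "a \<in> V1" "b \<in> V2" using z by auto
      obtain D1 where D1: "((\<lambda>p. \<psi>1 (inv_into U1 \<phi>1 p)) has_derivative D1) (at (\<phi>1 a))"
        using dmfd_transition(2)[OF assms(1) c(2) d(2) ab(2,4)] by (auto simp: differentiable_def)
      obtain D2 where D2: "((\<lambda>p. \<psi>2 (inv_into U2 \<phi>2 p)) has_derivative D2) (at (\<phi>2 b))"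
        using dmfd_transition(2)[OF assms(2) c(3) d(3) ab(3,5)] by (auto simp: differentiable_def)
      have "((\<lambda>q. \<psi>1 (inv_into U1 \<phi>1 (fst q))) has_derivative (\<lambda>h. D1 (fst h))) (at (\<phi>1 a, \<phi>2 b))"
        using diff_chain_at[OF bounded_linear_imp_has_derivative[OF bounded_linear_fst],
            of "\<lambda>p. \<psi>1 (inv_into U1 \<phi>1 p)" D1 "(\<phi>1 a, \<phi>2 b)"] D1 by (simp add: o_def)
      moreover have "((\<lambda>q. \<psi>2 (inv_into U2 \<phi>2 (snd q))) has_derivative (\<lambda>h. D2 (snd h))) (at (\<phi>1 a, \<phi>2 b))"
        using diff_chain_at[OF bounded_linear_imp_has_derivative[OF bounded_linear_snd],
            of "\<lambda>p. \<psi>2 (inv_into U2 \<phi>2 p)" D2 "(\<phi>1 a, \<phi>2 b)"] D2 by (simp add: o_def)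
      ultimately have "((\<lambda>q. (\<psi>1 (inv_into U1 \<phi>1 (fst q)), \<psi>2 (inv_into U2 \<phi>2 (snd q))))
          has_derivative (\<lambda>h. (D1 (fst h), D2 (snd h)))) (at (\<phi>1 a, \<phi>2 b))"
        by (rule has_derivative_Pair)
      moreover have "\<forall>\<^sub>F q in nhds (\<phi>1 a, \<phi>2 b). q \<in> \<phi>1 ` U1 \<times> \<phi>2 ` U2"
        using dmfd_chart(3)[OF assms(1) c(2)] dmfd_chart(3)[OF assms(2) c(3)] ab
        by (intro eventually_nhds_in_open open_Times) auto
      then have "\<forall>\<^sub>F q in nhds (\<phi>1 a, \<phi>2 b). (\<psi>1 (inv_into U1 \<phi>1 (fst q)), \<psi>2 (inv_into U2 \<phi>2 (snd q)))
          = (?d \<circ> inv_into (U1 \<times> U2) ?c) q"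
      proof eventually_elim
        case (elim q)
        then obtain u v where uv: "q = ?c (u, v)" "u \<in> U1" "v \<in> U2" by auto
        then show ?case
          using inv_into_f_f[OF inj, of "(u, v)"] inv_into_f_f[OF dmfd_chart(2)[OF assms(1) c(2)] uv(2)]
            inv_into_f_f[OF dmfd_chart(2)[OF assms(2) c(3)] uv(3)] by simp
      qed
      ultimately have "((?d \<circ> inv_into (U1 \<times> U2) ?c) has_derivative (\<lambda>h. (D1 (fst h), D2 (snd h)))) (at (\<phi>1 a, \<phi>2 b))"
        by (rule has_derivative_transform_eventually_nhds)
      then show ?thesis by (auto simp: ab intro: differentiableI)
    qed
    ultimately show ?thesis unfolding c(1) d(1) by simp
  qed
  show ?thesis
    unfolding dmfd_def
  proof (intro conjI ballI)
    fix c assume "c \<in> prod_atlas A B"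
    then obtain U \<phi> V \<psi> where c: "c = (U \<times> V, map_prod \<phi> \<psi>)" "(U, \<phi>) \<in> A" "(V, \<psi>) \<in> B"
      by (auto simp: prod_atlas_def)
    have "map_prod \<phi> \<psi> ` (U \<times> V) = \<phi> ` U \<times> \<psi> ` V" by (rule map_prod_surj_on) auto
    then show "chart_on (X \<times> Y) c"
      using dmfd_chart[OF assms(1) c(2)] dmfd_chart[OF assms(2) c(3)]
      by (auto simp: c(1) chart_on_def intro!: map_prod_inj_on open_Times)
  next
    show "\<Union> (fst ` prod_atlas A B) = X \<times> Y"
    proof (intro equalityI subsetI)
      fix z assume "z \<in> \<Union> (fst ` prod_atlas A B)"
      then show "z \<in> X \<times> Y"
        using dmfd_chart(1)[OF assms(1)] dmfd_chart(1)[OF assms(2)] by (fastforce simp: prod_atlas_def)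
    next
      fix z assume z: "z \<in> X \<times> Y"
      obtain U \<phi> where U: "(U, \<phi>) \<in> A" "fst z \<in> U" using z by (auto elim: dmfd_cover[OF assms(1)])
      obtain V \<psi> where V: "(V, \<psi>) \<in> B" "snd z \<in> V" using z by (auto elim: dmfd_cover[OF assms(2)])
      have "(U \<times> V, map_prod \<phi> \<psi>) \<in> prod_atlas A B" using U V by (auto simp: prod_atlas_def)
      moreover have "z \<in> U \<times> V" using U V by (simp add: mem_Times_iff)
      ultimately show "z \<in> \<Union> (fst ` prod_atlas A B)" by force
    qed
  next
    fix c assume "c \<in> prod_atlas A B"
    with main[of c] show "case c of (U, \<phi>) \<Rightarrow> \<forall>(V, \<psi>)\<in>prod_atlas A B. open (\<phi> ` (U \<inter> V)) \<and>
        (\<forall>x\<in>U \<inter> V. (\<psi> \<circ> inv_into U \<phi>) differentiable (at (\<phi> x)))"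
      by (cases c) fastforce
  qed
qed

lemma mdiff_vec_sourceD:
  assumes "mdiff vec_atlas B f x" "(V, \<psi>) \<in> B" "f x \<in> V"
  shows "\<forall>\<^sub>F p in nhds x. f p \<in> V" "(\<lambda>p. \<psi> (f p)) differentiable (at x)"
  using assms unfolding mdiff_vec_source by blast+

section \<open>Curves in Banach-Lie groups\<close>

locale banach_lie = group G for G :: "('g, 'a::banach) lie_group" (structure) +
  assumes blg: "banach_lie_group G"
begin

abbreviation "At \<equiv> atlas G"
abbreviation "U0 \<equiv> fst (unit_chart G)"
abbreviation "ph \<equiv> snd (unit_chart G)"
abbreviation "ip \<equiv> inv_into U0 ph"
abbreviation "c0 \<equiv> ph \<one>"

lemma cancel_left [simp]:
  assumes "g \<in> carrier G" "x \<in> carrier G"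
  shows "inv g \<otimes> (g \<otimes> x) = x" "g \<otimes> (inv g \<otimes> x) = x"
  using assms by (simp_all add: m_assoc[symmetric])

lemma dG: "dmfd (carrier G) At"
  using blg by (auto simp: banach_lie_group_def intro: dmfd_if_smooth)

lemma unit_chart_in: "(U0, ph) \<in> At" and one_in_U0 [simp]: "\<one> \<in> U0"
  using blg by (auto simp: banach_lie_group_def)

lemma U0_carrier: "g \<in> U0 \<Longrightarrow> g \<in> carrier G"
  using dmfd_chart(1)[OF dG unit_chart_in] by auto

lemma open_ph: "open (ph ` U0)" by (rule dmfd_chart(3)[OF dG unit_chart_in])

lemma ip_ph [simp]: "g \<in> U0 \<Longrightarrow> ip (ph g) = g"
  by (rule inv_into_f_f[OF dmfd_chart(2)[OF dG unit_chart_in]])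

lemma ip_in: "p \<in> ph ` U0 \<Longrightarrow> ip p \<in> U0" by (rule inv_into_into)

lemma ip_carrier [simp]: "p \<in> ph ` U0 \<Longrightarrow> ip p \<in> carrier G" using ip_in U0_carrier by blast

lemma ph_ip [simp]: "p \<in> ph ` U0 \<Longrightarrow> ph (ip p) = p" by (rule f_inv_into_f)

lemma c0_in [simp]: "c0 \<in> ph ` U0" by simp

lemma ip_c0 [simp]: "ip c0 = \<one>" by simp

lemma eventually_c0: "\<forall>\<^sub>F p in nhds c0. p \<in> ph ` U0"
  by (rule eventually_nhds_in_open[OF open_ph c0_in])

lemma mdiff_mult:
  assumes "dmfd X A" "f x \<in> carrier G" "g x \<in> carrier G" "mdiff A At f x" "mdiff A At g x"
  shows "mdiff A At (\<lambda>x. f x \<otimes> g x) x"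
proof -
  have m: "mfd_map frechet_smooth_on (carrier G \<times> carrier G) (prod_atlas At At)
      (carrier G) At (\<lambda>(g, g'). g \<otimes> g')"
    using blg by (simp add: banach_lie_group_def)
  have d: "dmfd (carrier G \<times> carrier G) (prod_atlas At At)" by (rule dmfd_prod[OF dG dG])
  have "mdiff (prod_atlas At At) At (\<lambda>(g, g'). g \<otimes> g') (f x, g x)"
    by (rule mdiff_if_smooth_map[OF d m])
  from mdiff_compose[OF assms(1) d _ mdiff_Pair[OF assms(4,5)] this] show ?thesis
    using assms(2,3) by simp
qed

lemma mdiff_inv:
  assumes "dmfd X A" "f x \<in> carrier G" "mdiff A At f x"
  shows "mdiff A At (\<lambda>x. inv (f x)) x"
proof -
  have "mfd_map frechet_smooth_on (carrier G) At (carrier G) At (m_inv G)"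
    using blg by (simp add: banach_lie_group_def)
  from mdiff_compose[OF assms(1) dG assms(2,3) mdiff_if_smooth_map[OF dG this]] show ?thesis .
qed

lemma mdiff_ip:
  assumes "f differentiable (at x)" "f x \<in> ph ` U0"
  shows "mdiff vec_atlas At (\<lambda>x. ip (f x)) x"
  using mdiff_compose[OF dmfd_vec dmfd_vec, of f x At ip] mdiff_inv_chart[OF dG unit_chart_in assms(2)]
    assms(1) by simp

lemma mdiff_ph:
  assumes "mdiff vec_atlas At f x" "f x \<in> U0"
  shows "\<forall>\<^sub>F y in nhds x. f y \<in> U0" "(\<lambda>y. ph (f y)) differentiable (at x)"
  using mdiff_vec_sourceD[OF assms(1) unit_chart_in assms(2)] by simp_all

lemma mdiff_to_vec:
  assumes "mdiff vec_atlas At f x" "f x \<in> carrier G" "mdiff At vec_atlas F (f x)"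
  shows "(\<lambda>y. F (f y)) differentiable (at x)"
  using mdiff_compose[OF dmfd_vec dG assms(2,1,3)] by simp

lemma mdiff_eventually_carrier:
  assumes "mdiff vec_atlas At f x" "f x \<in> carrier G"
  shows "\<forall>\<^sub>F y in nhds x. f y \<in> carrier G"
proof -
  obtain U \<phi> where U: "(U, \<phi>) \<in> At" "f x \<in> U" using dG assms(2) by (rule dmfd_cover)
  have "\<forall>\<^sub>F y in nhds x. f y \<in> U"
    by (rule mdiff_vec_sourceD(1)[OF assms(1) U])
  then show ?thesis by eventually_elim (use dmfd_chart(1)[OF dG U(1)] in auto)
qed

text \<open>The logarithmic derivative \<open>y\<close> of a curve, i.e. its velocity translated to the unit element.\<close>

definition tangent :: "(real \<Rightarrow> 'g) \<Rightarrow> real \<Rightarrow> 'a \<Rightarrow> bool" where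
  "tangent \<gamma> t y \<longleftrightarrow> \<gamma> t \<in> carrier G \<and> mdiff vec_atlas At \<gamma> t \<and>
    ((\<lambda>s. ph (inv (\<gamma> t) \<otimes> \<gamma> s)) has_vector_derivative y) (at t)"

lemma tangentD:
  assumes "tangent \<gamma> t y"
  shows tangent_carrier: "\<gamma> t \<in> carrier G" and tangent_mdiff: "mdiff vec_atlas At \<gamma> t"
    and tangent_deriv: "((\<lambda>s. ph (inv (\<gamma> t) \<otimes> \<gamma> s)) has_vector_derivative y) (at t)"
  using assms by (auto simp: tangent_def)

text \<open>Near \<open>t\<close> the curve is read in the unit chart translated to
  \<open>\<gamma> t\<close>, which reduces chain rules on the group to chain rules at
  \<open>c0\<close> for the map sending \<open>p\<close> to
  \<open>F (\<gamma> t \<otimes> ip p)\<close>.\<close>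

lemma tangent_eventually:
  assumes "tangent \<gamma> t y"
  shows "\<forall>\<^sub>F s in nhds t. \<gamma> s \<in> carrier G \<and> inv (\<gamma> t) \<otimes> \<gamma> s \<in> U0 \<and>
    \<gamma> s = \<gamma> t \<otimes> ip (ph (inv (\<gamma> t) \<otimes> \<gamma> s))"
proof -
  note g = tangentD[OF assms]
  have "mdiff vec_atlas At (\<lambda>s. inv (\<gamma> t) \<otimes> \<gamma> s) t"
    using g by (intro mdiff_mult[OF dmfd_vec] mdiff_const[OF dmfd_vec]) auto
  from mdiff_ph(1)[OF this] have "\<forall>\<^sub>F s in nhds t. inv (\<gamma> t) \<otimes> \<gamma> s \<in> U0" using g by simp
  with mdiff_eventually_carrier[OF g(2,1)] show ?thesis
    by eventually_elim (use g in \<open>simp add: inv_solve_left m_assoc[symmetric]\<close>)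
qed

lemma tangent_left:
  assumes "tangent \<gamma> t y" "g \<in> carrier G"
  shows "tangent (\<lambda>s. g \<otimes> \<gamma> s) t y"
proof -
  note t = tangentD[OF assms(1)]
  have "\<forall>\<^sub>F s in nhds t. ph (inv (\<gamma> t) \<otimes> \<gamma> s) = ph (inv (g \<otimes> \<gamma> t) \<otimes> (g \<otimes> \<gamma> s))"
    using mdiff_eventually_carrier[OF t(2,1)]
    by eventually_elim (use t assms(2) in \<open>simp add: inv_mult_group m_assoc\<close>)
  from has_vector_derivative_transform_eventually_nhds[OF t(3) this]
  show ?thesis unfolding tangent_def
    using t assms(2) by (simp add: mdiff_mult[OF dmfd_vec] mdiff_const[OF dmfd_vec])
qed

lemma tangent_affine:
  assumes "tangent \<gamma> (a * t + b) y"
  shows "tangent (\<lambda>s. \<gamma> (a * s + b)) t (a *\<^sub>R y)"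
proof -
  note g = tangentD[OF assms]
  have "(\<lambda>s. a * s + b) differentiable (at t)" by (intro derivative_intros)
  then have "mdiff vec_atlas At (\<lambda>s. \<gamma> (a * s + b)) t"
    using mdiff_compose[OF dmfd_vec dmfd_vec, of "\<lambda>s. a * s + b" t At \<gamma>] g(2) by simp
  then show ?thesis using g(1) has_vector_derivative_affine[OF g(3)] by (simp add: tangent_def)
qed

text \<open>The differential of \<open>F\<close> at \<open>g\<close>, transported to the Lie algebra
  by left translation.\<close>

definition gd :: "('g \<Rightarrow> 'e::banach) \<Rightarrow> 'g \<Rightarrow> 'a \<Rightarrow> 'e" where
  "gd F g = frechet_derivative (\<lambda>p. F (g \<otimes> ip p)) (at c0)"

lemma gd_has_derivative:
  assumes "mdiff At vec_atlas F g" "g \<in> carrier G"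
  shows "((\<lambda>p. F (g \<otimes> ip p)) has_derivative gd F g) (at c0)"
proof -
  have "mdiff vec_atlas At (\<lambda>p. g \<otimes> ip p) c0"
    using assms(2) by (intro mdiff_mult[OF dmfd_vec] mdiff_const[OF dmfd_vec] mdiff_ip) auto
  from mdiff_to_vec[OF this, of F] have "(\<lambda>p. F (g \<otimes> ip p)) differentiable (at c0)"
    using assms by simp
  then show ?thesis unfolding gd_def by (simp add: frechet_derivative_works)
qed

lemma tangent_chain:
  assumes "tangent \<gamma> t y" "mdiff At vec_atlas F (\<gamma> t)"
  shows "((\<lambda>s. F (\<gamma> s)) has_vector_derivative gd F (\<gamma> t) y) (at t)"
proof -
  note t = tangentD[OF assms(1)]
  have "ph (inv (\<gamma> t) \<otimes> \<gamma> t) = c0" using t by simp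
  then have "((\<lambda>s. F (\<gamma> t \<otimes> ip (ph (inv (\<gamma> t) \<otimes> \<gamma> s)))) has_vector_derivative gd F (\<gamma> t) y) (at t)"
    using has_derivative_along_curve[OF _ t(3)] gd_has_derivative[OF assms(2) t(1)] by simp
  moreover have "\<forall>\<^sub>F s in nhds t. F (\<gamma> t \<otimes> ip (ph (inv (\<gamma> t) \<otimes> \<gamma> s))) = F (\<gamma> s)"
    using tangent_eventually[OF assms(1)] by eventually_elim metis
  ultimately show ?thesis by (rule has_vector_derivative_transform_eventually_nhds)
qed

text \<open>Near \<open>s\<close> the quotient is \<open>f\<close> evaluated at the coordinates of
  the two curves, each taken in the unit chart translated to its position at \<open>s\<close>. On
  the diagonal the two factors cancel and \<open>f\<close> is constant, so its derivative kills
  \<open>(x, x)\<close>, the velocity of the pair.\<close>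

lemma tangent_quotient_zero:
  assumes "tangent \<alpha> s x" "tangent \<beta> s x" "(V, \<psi>) \<in> At" "\<alpha> s \<otimes> inv (\<beta> s) \<in> V"
  shows "((\<lambda>r. \<psi> (\<alpha> r \<otimes> inv (\<beta> r))) has_vector_derivative 0) (at s)"
proof -
  note a = tangentD[OF assms(1)] and b = tangentD[OF assms(2)]
  define f where "f z = \<alpha> s \<otimes> ip (fst z) \<otimes> (inv (ip (snd z)) \<otimes> inv (\<beta> s))" for z :: "'a \<times> 'a"
  have d: "fst differentiable (at (c0, c0))" "snd differentiable (at (c0, c0))"
    by (rule bounded_linear_imp_differentiable, rule bounded_linear_fst bounded_linear_snd)+
  have md: "mdiff vec_atlas At f (c0, c0)" unfolding f_def
    by (intro mdiff_mult[OF dmfd_vec] mdiff_const[OF dmfd_vec] mdiff_ip mdiff_inv[OF dmfd_vec])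
       (use a b d in auto)
  have "f (c0, c0) = \<alpha> s \<otimes> inv (\<beta> s)" using a b by (simp add: f_def)
  then have "(\<lambda>z. \<psi> (f z)) differentiable (at (c0, c0))"
    using mdiff_vec_sourceD(2)[OF md assms(3)] assms(4) by simp
  then obtain D where D: "((\<lambda>z. \<psi> (f z)) has_derivative D) (at (c0, c0))"
    by (auto simp: differentiable_def)
  have "((\<lambda>p. (p, p)) has_derivative (\<lambda>p. (p, p))) (at c0)"
    by (intro has_derivative_Pair has_derivative_ident)
  from diff_chain_at[OF this, of "\<lambda>z. \<psi> (f z)" D] D
  have "((\<lambda>p. \<psi> (f (p, p))) has_derivative (\<lambda>p. D (p, p))) (at c0)" by (simp add: o_def)
  moreover have "\<forall>\<^sub>F p in nhds c0. \<psi> (f (p, p)) = \<psi> (\<alpha> s \<otimes> inv (\<beta> s))"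
    using eventually_c0 by eventually_elim
      (use a b in \<open>simp add: f_def m_assoc\<close>)
  ultimately have "((\<lambda>p. \<psi> (\<alpha> s \<otimes> inv (\<beta> s))) has_derivative (\<lambda>p. D (p, p))) (at c0)"
    by (rule has_derivative_transform_eventually_nhds)
  then have "(\<lambda>p. D (p, p)) = (\<lambda>p. 0)" using has_derivative_const by (rule has_derivative_unique)
  then have D0: "D (x, x) = 0" by (rule fun_cong)
  let ?c = "\<lambda>r. (ph (inv (\<alpha> s) \<otimes> \<alpha> r), ph (inv (\<beta> s) \<otimes> \<beta> r))"
  have c: "(?c has_vector_derivative (x, x)) (at s)"
    using a(3) b(3) by (rule has_vector_derivative_Pair)
  have "?c s = (c0, c0)" using a b by simp
  then have "((\<lambda>r. \<psi> (f (?c r))) has_vector_derivative D (x, x)) (at s)"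
    using has_derivative_along_curve[OF _ c] D by simp
  moreover have "\<forall>\<^sub>F r in nhds s. \<psi> (f (?c r)) = \<psi> (\<alpha> r \<otimes> inv (\<beta> r))"
    using tangent_eventually[OF assms(1)] tangent_eventually[OF assms(2)]
  proof eventually_elim
    case (elim r)
    then have 1: "ip (ph (inv (\<alpha> s) \<otimes> \<alpha> r)) = inv (\<alpha> s) \<otimes> \<alpha> r" "ip (ph (inv (\<beta> s) \<otimes> \<beta> r)) = inv (\<beta> s) \<otimes> \<beta> r"
      by simp_all
    have "\<alpha> s \<otimes> (inv (\<alpha> s) \<otimes> \<alpha> r) = \<alpha> r" using elim a by (simp add: m_assoc[symmetric])
    moreover have "inv (inv (\<beta> s) \<otimes> \<beta> r) \<otimes> inv (\<beta> s) = inv (\<beta> r)"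
      using elim b by (simp add: inv_mult_group m_assoc)
    ultimately show ?case by (simp add: f_def 1)
  qed
  ultimately show ?thesis unfolding D0 by (rule has_vector_derivative_transform_eventually_nhds)
qed

text \<open>The quotient of the curves is locally constant by the preceding lemma, and
  \<open>I\<close> is connected. This serves as the uniqueness theorem for left invariant
  differential equations on the whole group, where the curves need not stay in one chart.\<close>

lemma tangent_unique:
  assumes I: "connected I" "open I" "t0 \<in> I" "t \<in> I"
    and \<alpha>: "\<And>t. t \<in> I \<Longrightarrow> tangent \<alpha> t (x t)" and \<beta>: "\<And>t. t \<in> I \<Longrightarrow> tangent \<beta> t (x t)"
    and eq: "\<alpha> t0 = \<beta> t0"
  shows "\<alpha> t = \<beta> t"
proof -
  define \<delta> where "\<delta> t = \<alpha> t \<otimes> inv (\<beta> t)" for t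
  have car: "\<alpha> t \<in> carrier G" "\<beta> t \<in> carrier G" if "t \<in> I" for t
    using tangent_carrier[OF \<alpha>[OF that]] tangent_carrier[OF \<beta>[OF that]] by auto
  have "\<forall>\<^sub>F s in at t within I. \<delta> t = \<delta> s" if t: "t \<in> I" for t
  proof -
    have md: "mdiff vec_atlas At \<delta> t" unfolding \<delta>_def
      using tangentD[OF \<alpha>[OF t]] tangentD[OF \<beta>[OF t]]
      by (intro mdiff_mult[OF dmfd_vec] mdiff_inv[OF dmfd_vec]) auto
    obtain V \<psi> where V: "(V, \<psi>) \<in> At" "\<delta> t \<in> V"
      using dmfd_cover[OF dG, of "\<delta> t"] car[OF t] by (auto simp: \<delta>_def)
    have "\<forall>\<^sub>F s in nhds t. \<delta> s \<in> V" by (rule mdiff_vec_sourceD(1)[OF md V])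
    moreover have "\<forall>\<^sub>F s in nhds t. s \<in> I" using I(2) t by (rule eventually_nhds_in_open)
    ultimately have "\<forall>\<^sub>F s in nhds t. \<delta> s \<in> V \<and> s \<in> I" by eventually_elim simp
    then obtain e where e: "e > 0" "\<And>s. dist s t < e \<Longrightarrow> \<delta> s \<in> V \<and> s \<in> I"
      unfolding eventually_nhds_metric by blast
    have "((\<lambda>s. \<psi> (\<delta> s)) has_vector_derivative 0) (at s within ball t e)" if "s \<in> ball t e" for s
    proof (rule has_vector_derivative_at_within)
      have s: "\<delta> s \<in> V" "s \<in> I" using e(2)[of s] that by (auto simp: dist_commute)
      show "((\<lambda>s. \<psi> (\<delta> s)) has_vector_derivative 0) (at s)"
        using tangent_quotient_zero[OF \<alpha>[OF s(2)] \<beta>[OF s(2)] V(1)] s(1) by (simp add: \<delta>_def)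
    qed
    then obtain c where c: "\<And>s. s \<in> ball t e \<Longrightarrow> \<psi> (\<delta> s) = c"
      using has_vector_derivative_zero_constant[of "ball t e" "\<lambda>s. \<psi> (\<delta> s)"] by auto
    have "\<delta> t = \<delta> s" if "s \<in> ball t e" for s
    proof -
      have "\<psi> (\<delta> t) = \<psi> (\<delta> s)" using c[OF that] c[of t] e(1) by simp
      moreover have "\<delta> s \<in> V" using e(2)[of s] that by (auto simp: dist_commute)
      ultimately show ?thesis using dmfd_chart(2)[OF dG V(1)] V(2) by (simp add: inj_on_def)
    qed
    then have "\<forall>\<^sub>F s in nhds t. \<delta> t = \<delta> s"
      using e(1) unfolding eventually_nhds_metric by (auto simp: dist_commute)
    then show ?thesis by (auto simp: eventually_at_filter elim: eventually_mono)
  qed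
  then have "\<delta> t = \<delta> t0" using connected_local_const[OF I(1,4,3)] by blast
  then have "\<alpha> t \<otimes> inv (\<beta> t) = \<one>" using eq car[OF I(3)] by (simp add: \<delta>_def)
  then show ?thesis using car[OF I(4)] by (metis inv_closed inv_equality inv_inv)
qed

end

section \<open>The exponential map\<close>

context banach_lie begin

lemma mult_smooth_family:
  assumes c: "(U1, \<phi>1) \<in> At" "(U2, \<phi>2) \<in> At" "(V, \<psi>) \<in> At"
  obtains D where
    "smooth_family {z. fst z \<in> \<phi>1 ` U1 \<and> snd z \<in> \<phi>2 ` U2 \<and>
      inv_into U1 \<phi>1 (fst z) \<otimes> inv_into U2 \<phi>2 (snd z) \<in> V} D"
    "\<And>p q. p \<in> \<phi>1 ` U1 \<Longrightarrow> q \<in> \<phi>2 ` U2 \<Longrightarrow> inv_into U1 \<phi>1 p \<otimes> inv_into U2 \<phi>2 q \<in> V \<Longrightarrow>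
      D (p, q) [] = \<psi> (inv_into U1 \<phi>1 p \<otimes> inv_into U2 \<phi>2 q)"
proof -
  let ?S = "{z. fst z \<in> \<phi>1 ` U1 \<and> snd z \<in> \<phi>2 ` U2 \<and>
      inv_into U1 \<phi>1 (fst z) \<otimes> inv_into U2 \<phi>2 (snd z) \<in> V}"
  note inj = dmfd_chart(2)[OF dG c(1)] dmfd_chart(2)[OF dG c(2)]
  have inj2: "inj_on (map_prod \<phi>1 \<phi>2) (U1 \<times> U2)" using inj by (rule map_prod_inj_on)
  have "(U1 \<times> U2, map_prod \<phi>1 \<phi>2) \<in> prod_atlas At At" using c by (auto simp: prod_atlas_def)
  moreover have "mfd_map frechet_smooth_on (carrier G \<times> carrier G) (prod_atlas At At)
      (carrier G) At (\<lambda>(g, g'). g \<otimes> g')"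
    using blg by (simp add: banach_lie_group_def)
  ultimately have "frechet_smooth_on (map_prod \<phi>1 \<phi>2 ` {x \<in> U1 \<times> U2. (\<lambda>(g, g'). g \<otimes> g') x \<in> V})
      (\<psi> \<circ> (\<lambda>(g, g'). g \<otimes> g') \<circ> inv_into (U1 \<times> U2) (map_prod \<phi>1 \<phi>2))"
    using c(3) unfolding mfd_map_def by fast
  moreover have S: "map_prod \<phi>1 \<phi>2 ` {x \<in> U1 \<times> U2. (\<lambda>(g, g'). g \<otimes> g') x \<in> V} = ?S"
  proof (intro equalityI subsetI)
    fix z assume "z \<in> map_prod \<phi>1 \<phi>2 ` {x \<in> U1 \<times> U2. (\<lambda>(g, g'). g \<otimes> g') x \<in> V}"
    then show "z \<in> ?S" by (auto simp: inv_into_f_f[OF inj(1)] inv_into_f_f[OF inj(2)])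
  next
    fix z assume z: "z \<in> ?S"
    then have "z = map_prod \<phi>1 \<phi>2 (inv_into U1 \<phi>1 (fst z), inv_into U2 \<phi>2 (snd z))"
      by (simp add: f_inv_into_f)
    moreover have "(inv_into U1 \<phi>1 (fst z), inv_into U2 \<phi>2 (snd z)) \<in> {x \<in> U1 \<times> U2. (\<lambda>(g, g'). g \<otimes> g') x \<in> V}"
      using z by (simp add: inv_into_into)
    ultimately show "z \<in> map_prod \<phi>1 \<phi>2 ` {x \<in> U1 \<times> U2. (\<lambda>(g, g'). g \<otimes> g') x \<in> V}" by (rule image_eqI)
  qed
  ultimately obtain D where D: "smooth_family ?S D"
    "\<And>z. z \<in> ?S \<Longrightarrow> D z [] = (\<psi> \<circ> (\<lambda>(g, g'). g \<otimes> g') \<circ> inv_into (U1 \<times> U2) (map_prod \<phi>1 \<phi>2)) z"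
    unfolding frechet_smooth_on_iff by auto
  have "D (p, q) [] = \<psi> (inv_into U1 \<phi>1 p \<otimes> inv_into U2 \<phi>2 q)"
    if pq: "p \<in> \<phi>1 ` U1" "q \<in> \<phi>2 ` U2" "inv_into U1 \<phi>1 p \<otimes> inv_into U2 \<phi>2 q \<in> V" for p q
  proof -
    obtain u v where uv: "u \<in> U1" "p = \<phi>1 u" "v \<in> U2" "q = \<phi>2 v" using pq by auto
    have "inv_into (U1 \<times> U2) (map_prod \<phi>1 \<phi>2) (p, q) = (u, v)"
      using inv_into_f_f[OF inj2, of "(u, v)"] uv by simp
    then show ?thesis using D(2)[of "(p, q)"] pq uv
      by (simp add: inv_into_f_f[OF inj(1)] inv_into_f_f[OF inj(2)])
  qed
  with D(1) show ?thesis by (rule that)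
qed

definition Smu :: "('a \<times> 'a) set" where
  "Smu = {z. fst z \<in> ph ` U0 \<and> snd z \<in> ph ` U0 \<and> ip (fst z) \<otimes> ip (snd z) \<in> U0}"

text \<open>All derivatives of the multiplication in the unit chart, chosen once, so that the vector
  fields below are values of a single smooth family.\<close>

definition muD :: "'a \<times> 'a \<Rightarrow> ('a \<times> 'a) list \<Rightarrow> 'a" where
  "muD = (SOME D. smooth_family Smu D \<and> (\<forall>z\<in>Smu. D z [] = ph (ip (fst z) \<otimes> ip (snd z))))"

lemma muD: "smooth_family Smu muD" "z \<in> Smu \<Longrightarrow> muD z [] = ph (ip (fst z) \<otimes> ip (snd z))"
proof -
  obtain D where "smooth_family Smu D"
    "\<And>p q. p \<in> ph ` U0 \<Longrightarrow> q \<in> ph ` U0 \<Longrightarrow> ip p \<otimes> ip q \<in> U0 \<Longrightarrow> D (p, q) [] = ph (ip p \<otimes> ip q)"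
    unfolding Smu_def by (rule mult_smooth_family[OF unit_chart_in unit_chart_in unit_chart_in]) blast
  then have "\<exists>D. smooth_family Smu D \<and> (\<forall>z\<in>Smu. D z [] = ph (ip (fst z) \<otimes> ip (snd z)))"
    by (auto simp: Smu_def)
  then have "smooth_family Smu muD \<and> (\<forall>z\<in>Smu. muD z [] = ph (ip (fst z) \<otimes> ip (snd z)))"
    unfolding muD_def by (rule someI_ex)
  then show "smooth_family Smu muD" "z \<in> Smu \<Longrightarrow> muD z [] = ph (ip (fst z) \<otimes> ip (snd z))" by auto
qed

text \<open>\<open>Xi p\<close> and \<open>Xr p\<close> are, in the unit chart, the differentials at the unit element of left and
  right translation by the group element with coordinate \<open>p\<close>.\<close>

definition Xi :: "'a \<Rightarrow> 'a \<Rightarrow> 'a" where "Xi p v = muD (p, c0) [(0, v)]"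
definition Xr :: "'a \<Rightarrow> 'a \<Rightarrow> 'a" where "Xr p v = muD (c0, p) [(v, 0)]"

lemma in_Smu: "p \<in> ph ` U0 \<Longrightarrow> (p, c0) \<in> Smu" "p \<in> ph ` U0 \<Longrightarrow> (c0, p) \<in> Smu"
  by (simp_all add: Smu_def ip_in)

lemma Xi_deriv:
  assumes "p \<in> ph ` U0"
  shows "((\<lambda>q. ph (ip p \<otimes> ip q)) has_derivative Xi p) (at c0)"
proof -
  have 1: "((\<lambda>z. ph (ip (fst z) \<otimes> ip (snd z))) has_derivative (\<lambda>h. muD (p, c0) [h])) (at (p, c0))"
    using muD in_Smu[OF assms] by (intro smooth_family_Nil_deriv) auto
  have "((\<lambda>q. (p, q)) has_derivative (\<lambda>q. (0, q))) (at c0)"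
    by (intro has_derivative_Pair has_derivative_const has_derivative_ident)
  from diff_chain_at[OF this 1] show ?thesis by (simp add: o_def Xi_def[abs_def])
qed

lemma Xr_deriv:
  assumes "p \<in> ph ` U0"
  shows "((\<lambda>q. ph (ip q \<otimes> ip p)) has_derivative Xr p) (at c0)"
proof -
  have 1: "((\<lambda>z. ph (ip (fst z) \<otimes> ip (snd z))) has_derivative (\<lambda>h. muD (c0, p) [h])) (at (c0, p))"
    using muD in_Smu[OF assms] by (intro smooth_family_Nil_deriv) auto
  have "((\<lambda>q. (q, p)) has_derivative (\<lambda>q. (q, 0))) (at c0)"
    by (intro has_derivative_Pair has_derivative_const has_derivative_ident)
  from diff_chain_at[OF this 1] show ?thesis by (simp add: o_def Xr_def[abs_def])
qed

lemma Xi_linear: "p \<in> ph ` U0 \<Longrightarrow> bounded_linear (Xi p)"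
  using Xi_deriv by (rule has_derivative_bounded_linear)

lemma Xi_c0 [simp]: "Xi c0 v = v"
proof -
  have "\<forall>\<^sub>F q in nhds c0. ph (ip c0 \<otimes> ip q) = q"
    using eventually_c0 by eventually_elim simp
  from has_derivative_transform_eventually_nhds[OF Xi_deriv[OF c0_in] this]
  have "Xi c0 = (\<lambda>v. v)" using has_derivative_ident by (rule has_derivative_unique)
  then show ?thesis by simp
qed

lemma Xi_family:
  "smooth_family {p. (p, c0) \<in> Smu} (\<lambda>p vs. muD (p, c0) (map (\<lambda>v. (v, 0)) vs @ [(0, x)]))"
  by (rule smooth_family_slice_fst[OF muD(1)])

text \<open>\<open>Xi p\<close> and \<open>Xr p\<close> are partial first derivatives of the
  multiplication at \<open>(p, c0)\<close> and \<open>(c0, p)\<close>. Both points lie in one ball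
  about \<open>(c0, c0)\<close>, on which the first derivatives are Lipschitz.\<close>

lemma Xi_lipschitz:
  obtains r K where "r > 0" "K \<ge> 0" "ball c0 r \<subseteq> ph ` U0"
    "\<And>p q v. p \<in> ball c0 r \<Longrightarrow> q \<in> ball c0 r \<Longrightarrow> norm (Xi p v - Xi q v) \<le> K * norm (p - q) * norm v"
    "\<And>p q v. p \<in> ball c0 r \<Longrightarrow> q \<in> ball c0 r \<Longrightarrow> norm (Xr p v - Xr q v) \<le> K * norm (p - q) * norm v"
proof -
  obtain r K where r: "r > 0" "K \<ge> 0" "ball (c0, c0) r \<subseteq> Smu"
    "\<And>p q vs. p \<in> ball (c0, c0) r \<Longrightarrow> q \<in> ball (c0, c0) r \<Longrightarrow> length vs = 1 \<Longrightarrow>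
      norm (muD p vs - muD q vs) \<le> K * norm (p - q) * prod_list (map norm vs)"
    by (rule smooth_family_lipschitz[OF muD(1) in_Smu(1)[OF c0_in], where n = 1]) blast
  have b: "(p, c0) \<in> ball (c0, c0) r" "(c0, p) \<in> ball (c0, c0) r" if "p \<in> ball c0 r" for p
    using that by (simp_all add: dist_Pair_Pair)
  show ?thesis
  proof (rule that[OF r(1,2)])
    have "p \<in> ph ` U0" if "p \<in> ball c0 r" for p
    proof -
      have "(p, c0) \<in> Smu" using b(1)[OF that] r(3) by blast
      then show ?thesis by (simp add: Smu_def)
    qed
    then show "ball c0 r \<subseteq> ph ` U0" by blast
    fix p q v assume pq: "p \<in> ball c0 r" "q \<in> ball c0 r"
    show "norm (Xi p v - Xi q v) \<le> K * norm (p - q) * norm v"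
      using r(4)[OF b(1)[OF pq(1)] b(1)[OF pq(2)], of "[(0, v)]"] by (simp add: Xi_def norm_Pair)
    show "norm (Xr p v - Xr q v) \<le> K * norm (p - q) * norm v"
      using r(4)[OF b(2)[OF pq(1)] b(2)[OF pq(2)], of "[(v, 0)]"] by (simp add: Xr_def norm_Pair)
  qed
qed

text \<open>\<open>N\<close>, the differential at \<open>c t\<close> of the translation back to the
  unit element, is a left inverse of \<open>Xi (c t)\<close>; hence the chart velocity
  \<open>Xi (c t) y\<close> corresponds to the logarithmic derivative \<open>y\<close>.\<close>

lemma tangent_chart_curve:
  assumes c: "(c has_vector_derivative Xi (c t) y) (at t)" "c t \<in> ph ` U0"
  shows "tangent (\<lambda>s. ip (c s)) t y"
proof -
  have dc: "c differentiable (at t)" using c(1) by (auto simp: has_vector_derivative_def intro: differentiableI)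
  have "mdiff vec_atlas At (\<lambda>q. inv (ip (c t)) \<otimes> ip q) (c t)"
    using c(2) by (intro mdiff_mult[OF dmfd_vec] mdiff_const[OF dmfd_vec] mdiff_ip) auto
  from mdiff_ph(2)[OF this] obtain N where
    N: "((\<lambda>q. ph (inv (ip (c t)) \<otimes> ip q)) has_derivative N) (at (c t))"
    using c(2) by (auto simp: differentiable_def)
  have "ph (ip (c t) \<otimes> ip c0) = c t" using c(2) by simp
  then have "((\<lambda>q. ph (inv (ip (c t)) \<otimes> ip (ph (ip (c t) \<otimes> ip q)))) has_derivative (\<lambda>v. N (Xi (c t) v))) (at c0)"
    using diff_chain_at[OF Xi_deriv[OF c(2)], of _ N] N by (simp add: o_def)
  moreover have "\<forall>\<^sub>F q in nhds c0. ip (c t) \<otimes> ip q \<in> U0"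
  proof (rule mdiff_ph(1))
    show "mdiff vec_atlas At (\<lambda>q. ip (c t) \<otimes> ip q) c0"
      using c(2) by (intro mdiff_mult[OF dmfd_vec] mdiff_const[OF dmfd_vec] mdiff_ip) auto
  qed (use c(2) in \<open>simp add: ip_in\<close>)
  then have "\<forall>\<^sub>F q in nhds c0. ph (inv (ip (c t)) \<otimes> ip (ph (ip (c t) \<otimes> ip q))) = q"
    using eventually_c0 by eventually_elim (use c(2) in simp)
  ultimately have "((\<lambda>q. q) has_derivative (\<lambda>v. N (Xi (c t) v))) (at c0)"
    by (rule has_derivative_transform_eventually_nhds)
  then have "(\<lambda>v. N (Xi (c t) v)) = (\<lambda>v. v)" using has_derivative_ident by (rule has_derivative_unique)
  then have "N (Xi (c t) y) = y" by (rule fun_cong)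
  moreover have "((\<lambda>s. ph (inv (ip (c t)) \<otimes> ip (c s))) has_vector_derivative N (Xi (c t) y)) (at t)"
    by (rule has_derivative_along_curve[OF N c(1)])
  ultimately show ?thesis using mdiff_ip[OF dc c(2)] c(2) by (simp add: tangent_def)
qed

text \<open>One ball and one time interval serve all small \<open>x\<close>, so that curves with
  different initial velocities can be compared at time 1. By the last clause
  \<open>c x 1 - x\<close> is a contraction in \<open>x\<close>, from which surjectivity of exp near
  the unit is drawn.\<close>

lemma exp_local:
  obtains r0 c where "r0 > 0"
    "\<And>x. norm x \<le> r0 \<Longrightarrow> c x 0 = c0"
    "\<And>x t. norm x \<le> r0 \<Longrightarrow> \<bar>t\<bar> < 2 \<Longrightarrow> c x t \<in> ph ` U0 \<and> (c x has_vector_derivative Xi (c x t) x) (at t)"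
    "\<And>x y. norm x \<le> r0 \<Longrightarrow> norm y \<le> r0 \<Longrightarrow> norm (c x 1 - c y 1 - (x - y)) \<le> 2/3 * norm (x - y)"
proof -
  obtain r K where r: "r > 0" "K \<ge> 0" "ball c0 r \<subseteq> ph ` U0"
    and lip: "\<And>p q v. p \<in> ball c0 r \<Longrightarrow> q \<in> ball c0 r \<Longrightarrow> norm (Xi p v - Xi q v) \<le> K * norm (p - q) * norm v"
    by (rule Xi_lipschitz) blast
  \<comment> \<open>The radii make \<open>K * R\<close> and \<open>K * r0\<close> at most 1/4. On
    the ball \<open>Xi p\<close> is then within 1/4 of the identity and speeds are at most
    \<open>2 * r0\<close>, so that in time 2 a path moves by at most \<open>4 * r0 \<le> R\<close>;
    the Lipschitz constant \<open>K * r0\<close> times 2 is at most 1/2.\<close>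
  define R where "R = min (r/2) (1 / (4 * (K + 1)))"
  define r0 where "r0 = min (R/4) (1 / (4 * (K + 1)))"
  have R: "R > 0" "R < r" using r by (auto simp: R_def)
  have K4: "K * (1 / (4 * (K + 1))) \<le> 1/4" using r(2) by (simp add: field_simps)
  have KR: "K * R \<le> 1/4"
    by (rule order_trans[OF mult_left_mono K4]) (use r in \<open>auto simp: R_def\<close>)
  have r0: "r0 > 0" "4 * r0 \<le> R" using R r by (auto simp: r0_def)
  have Kr0: "K * r0 \<le> 1/4"
    by (rule order_trans[OF mult_left_mono K4]) (use r in \<open>auto simp: r0_def\<close>)
  have cb: "cball c0 R \<subseteq> ball c0 r" using R by auto
  have near: "norm (Xi p v - v) \<le> 1/4 * norm v" if "p \<in> cball c0 R" for p v
  proof -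
    have "norm (Xi p v - Xi c0 v) \<le> K * norm (p - c0) * norm v"
      using that cb r by (intro lip) auto
    also have "\<dots> \<le> K * R * norm v"
      using that r by (intro mult_right_mono mult_left_mono) (auto simp: dist_norm norm_minus_commute)
    also have "\<dots> \<le> 1/4 * norm v" using KR by (intro mult_right_mono) auto
    finally show ?thesis by simp
  qed
  have "\<exists>c. c 0 = c0 \<and> (\<forall>t. \<bar>t\<bar> < 2 \<longrightarrow> c t \<in> cball c0 R \<and> (c has_vector_derivative Xi (c t) x) (at t))"
    if x: "norm x \<le> r0" for x
  proof -
    have 1: "norm (Xi p x) \<le> 2 * r0" if "p \<in> cball c0 R" for p
      using near[OF that, of x] norm_triangle_ineq[of "Xi p x - x" x] x r0(1) by simp
    have 2: "norm (Xi p x - Xi q x) \<le> (K * r0) * norm (p - q)" if "p \<in> cball c0 R" "q \<in> cball c0 R" for p q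
    proof -
      have "norm (Xi p x - Xi q x) \<le> K * norm (p - q) * norm x" using that cb by (intro lip) auto
      also have "\<dots> \<le> K * norm (p - q) * r0" using x r by (intro mult_left_mono) auto
      finally show ?thesis by (simp add: mult_ac)
    qed
    obtain c where "c 0 = c0"
      "\<And>t. \<bar>t\<bar> < 2 \<Longrightarrow> c t \<in> cball c0 R \<and> (c has_vector_derivative Xi (c t) x) (at t)"
    proof (rule picard_lindelof[of 2 "K * r0" R c0 "\<lambda>p. Xi p x" "2 * r0"])
      show "0 \<le> K * r0" using r r0 by simp
      show "2 * r0 * 2 \<le> R" "0 \<le> R" using r0 R by auto
      show "K * r0 * 2 \<le> 1/2" using Kr0 by simp
    qed (use 1 2 in auto)
    then show ?thesis by blast
  qed
  then have "\<forall>x. \<exists>c. norm x \<le> r0 \<longrightarrow> c 0 = c0 \<and>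
      (\<forall>t. \<bar>t\<bar> < 2 \<longrightarrow> c t \<in> cball c0 R \<and> (c has_vector_derivative Xi (c t) x) (at t))" by blast
  then obtain c where cc: "\<forall>x. norm x \<le> r0 \<longrightarrow> c x 0 = c0 \<and>
      (\<forall>t. \<bar>t\<bar> < 2 \<longrightarrow> c x t \<in> cball c0 R \<and> (c x has_vector_derivative Xi (c x t) x) (at t))"
    by (rule choice[THEN exE])
  then have c: "\<And>x. norm x \<le> r0 \<Longrightarrow> c x 0 = c0"
    "\<And>x t. norm x \<le> r0 \<Longrightarrow> \<bar>t\<bar> < 2 \<Longrightarrow> c x t \<in> cball c0 R \<and> (c x has_vector_derivative Xi (c x t) x) (at t)"
    by blast+
  have "norm (c x 1 - c y 1 - (x - y)) \<le> 2/3 * norm (x - y)" if x: "norm x \<le> r0" and y: "norm y \<le> r0" for x y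
  proof -
    have cont: "continuous_on {0..1} (c z)" if "norm z \<le> r0" for z
    proof (rule continuous_at_imp_continuous_on, rule ballI)
      fix t :: real assume "t \<in> {0..1}"
      then have "\<bar>t\<bar> < 2" by simp
      from c(2)[OF that this] show "isCont (c z) t" by (blast intro: has_vector_derivative_continuous)
    qed
    have "\<exists>s\<in>{0..1}. \<forall>t\<in>{0..1}. norm (c x t - c y t) \<le> norm (c x s - c y s)"
      using cont[OF x] cont[OF y] by (intro continuous_attains_sup continuous_intros) auto
    then obtain s where s: "s \<in> {0..1}" "\<And>t. t \<in> {0..1} \<Longrightarrow> norm (c x t - c y t) \<le> norm (c x s - c y s)"
      by blast
    \<comment> \<open>The largest distance of the two curves on [0, 1]. Their deviation
      \<open>d\<close> from \<open>t *\<^sub>R (x - y)\<close> is at most (norm (x - y) + m)/4, so m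
      \<le> 5/3 norm (x - y), and feeding this back gives (1 + 5/3)/4 = 2/3.\<close>
    define m where "m = norm (c x s - c y s)"
    define d where "d t = c x t - c y t - t *\<^sub>R (x - y)" for t
    have d: "norm (d t) \<le> 1/4 * norm (x - y) + 1/4 * m" if t: "t \<in> {0..1}" for t
    proof -
      have "norm (d t - d 0) \<le> (1/4 * norm (x - y) + 1/4 * m) * \<bar>t - 0\<bar>"
      proof (rule vector_derivative_bound[where S = "{0..1}"])
        fix u :: real assume u: "u \<in> {0..1}"
        have cx: "c x u \<in> cball c0 R" "(c x has_vector_derivative Xi (c x u) x) (at u)"
          and cy: "c y u \<in> cball c0 R" "(c y has_vector_derivative Xi (c y u) y) (at u)"
          using c(2)[OF x, of u] c(2)[OF y, of u] u by auto
        have "((\<lambda>t. t *\<^sub>R (x - y)) has_vector_derivative (x - y)) (at u)"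
          using has_vector_derivative_scaleR[OF DERIV_ident has_vector_derivative_const[of "x - y"]] by simp
        with cx(2) cy(2) have "(d has_vector_derivative (Xi (c x u) x - Xi (c y u) y - (x - y))) (at u)"
          unfolding d_def by (intro has_vector_derivative_diff)
        then show "(d has_vector_derivative (Xi (c x u) x - Xi (c y u) y - (x - y))) (at u within {0..1})"
          by (rule has_vector_derivative_at_within)
        have "c x u \<in> ph ` U0" using cx(1) cb r(3) by blast
        then have lin: "Xi (c x u) (x - y) = Xi (c x u) x - Xi (c x u) y"
          using Xi_linear by (simp add: bounded_linear.linear linear_diff)
        have eq: "Xi (c x u) x - Xi (c y u) y - (x - y)
            = (Xi (c x u) (x - y) - (x - y)) + (Xi (c x u) y - Xi (c y u) y)" by (simp add: lin)
        have "norm (Xi (c x u) y - Xi (c y u) y) \<le> K * norm (c x u - c y u) * norm y"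
          using cx(1) cy(1) cb by (intro lip) auto
        also have "\<dots> \<le> K * m * r0"
          using s(2)[OF u] y r by (intro mult_mono) (auto simp: m_def)
        also have "\<dots> = (K * r0) * m" by simp
        also have "\<dots> \<le> 1/4 * m" using Kr0 by (intro mult_right_mono) (auto simp: m_def)
        finally show "norm (Xi (c x u) x - Xi (c y u) y - (x - y)) \<le> 1/4 * norm (x - y) + 1/4 * m"
          unfolding eq using near[OF cx(1), of "x - y"] by (intro norm_triangle_le) auto
      qed (use t in auto)
      also have "\<dots> \<le> (1/4 * norm (x - y) + 1/4 * m) * 1"
        using t by (intro mult_left_mono) (auto simp: m_def)
      finally show ?thesis using c(1) x y by (simp add: d_def)
    qed
    have ds: "c x s - c y s = d s + s *\<^sub>R (x - y)" by (simp add: d_def)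
    have "m \<le> norm (d s) + norm (s *\<^sub>R (x - y))" unfolding m_def ds by (rule norm_triangle_ineq)
    moreover have "norm (s *\<^sub>R (x - y)) \<le> norm (x - y)"
      using s(1) by (simp add: mult_left_le_one_le)
    ultimately have "m \<le> 5/3 * norm (x - y)" using d[OF s(1)] by linarith
    moreover have "norm (d 1) \<le> 1/4 * norm (x - y) + 1/4 * m" by (rule d) simp
    ultimately show ?thesis by (simp add: d_def)
  qed
  note est = this
  have sub: "cball c0 R \<subseteq> ph ` U0" using cb r(3) by blast
  show ?thesis
  proof (rule that[OF r0(1) c(1) _ est])
    fix x :: 'a and t :: real assume "norm x \<le> r0" "\<bar>t\<bar> < 2"
    from c(2)[OF this] sub
    show "c x t \<in> ph ` U0 \<and> (c x has_vector_derivative Xi (c x t) x) (at t)" by blast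
  qed
qed

section \<open>One-parameter groups and surjectivity of exp near the unit\<close>

lemma pow_mult_commute:
  assumes "x \<in> carrier G" "y \<in> carrier G" "x \<otimes> y = y \<otimes> x"
  shows "(x \<otimes> y) [^] (n::nat) = x [^] n \<otimes> y [^] n"
proof (induction n)
  case (Suc n)
  have yx: "y [^] n \<otimes> x = x \<otimes> y [^] n"
  proof (induction n)
    case (Suc n)
    have "y [^] Suc n \<otimes> x = y [^] n \<otimes> (x \<otimes> y)" using assms by (simp add: m_assoc)
    also have "\<dots> = (y [^] n \<otimes> x) \<otimes> y" using assms(1,2) by (simp add: m_assoc)
    also have "\<dots> = x \<otimes> y [^] Suc n" using assms(1,2) Suc by (simp add: m_assoc)
    finally show ?case .
  qed (use assms in simp)
  have "(x \<otimes> y) [^] Suc n = x [^] n \<otimes> (y [^] n \<otimes> x) \<otimes> y" using assms Suc by (simp add: m_assoc)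
  also have "\<dots> = x [^] Suc n \<otimes> y [^] Suc n" using assms yx by (simp add: m_assoc)
  finally show ?case .
qed simp

text \<open>Uniqueness of curves with constant logarithmic derivative makes \<open>\<gamma>\<close>
  a local homomorphism. It extends to the 2^m-th power of \<gamma>(t/2^m), which does not depend on
  m once t/2^m is in range. Near any time the extension is a fixed element times the local curve,
  from which it inherits smoothness.\<close>

lemma one_param_extension:
  assumes e: "e > 0" and c0: "c 0 = c0"
    and c: "\<And>t. \<bar>t\<bar> < e \<Longrightarrow> c t \<in> ph ` U0 \<and> (c has_vector_derivative Xi (c t) x) (at t)"
  obtains E where "one_param_subgroup G E" "((ph \<circ> E) has_vector_derivative x) (at 0)"
    "\<And>t. \<bar>t\<bar> < e \<Longrightarrow> E t = ip (c t)"
proof -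
  define \<gamma> where "\<gamma> t = ip (c t)" for t
  have tan: "tangent \<gamma> t x" if "\<bar>t\<bar> < e" for t
    unfolding \<gamma>_def using c[OF that] by (intro tangent_chart_curve) auto
  have car: "\<gamma> t \<in> carrier G" if "\<bar>t\<bar> < e" for t using tan[OF that] by (rule tangent_carrier)
  have \<gamma>0: "\<gamma> 0 = \<one>" by (simp add: \<gamma>_def c0)
  have hom: "\<gamma> (s + t) = \<gamma> s \<otimes> \<gamma> t" if st: "\<bar>s\<bar> < e" "\<bar>t\<bar> < e" "\<bar>s + t\<bar> < e" for s t
  proof -
    \<comment> \<open>For times u in this intersection both u and s + u stay in the domain of
      \<open>\<gamma>\<close>.\<close>
    let ?I = "{-e<..<e} \<inter> {-e-s<..<e-s}"
    show ?thesis
    proof (rule tangent_unique[of ?I 0 t "\<lambda>t. \<gamma> (s + t)" "\<lambda>_. x" "\<lambda>t. \<gamma> s \<otimes> \<gamma> t"])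
      show "connected ?I" by (intro convex_connected convex_Int) auto
      show "open ?I" by auto
      show "tangent (\<lambda>t. \<gamma> (s + t)) u x" if "u \<in> ?I" for u
      proof -
        have "\<bar>u + s\<bar> < e" using that by (auto simp: abs_less_iff)
        then show ?thesis using tangent_affine[of \<gamma> 1 u s x] tan[of "u + s"] by (simp add: add.commute[of s])
      qed
      show "tangent (\<lambda>t. \<gamma> s \<otimes> \<gamma> t) u x" if "u \<in> ?I" for u
        using that st by (intro tangent_left tan car) auto
    qed (use st car \<gamma>0 e in auto)
  qed
  let ?P = "\<lambda>t m. \<gamma> (t / 2 ^ m) [^] (2 ^ m :: nat)"
  have small: "\<bar>t / 2 ^ (m + k)\<bar> \<le> \<bar>t / 2 ^ m\<bar>" for t :: real and m k
    using mult_left_mono[of 1 "2 ^ k" "\<bar>t\<bar>"] by (simp add: power_add divide_simps mult.commute)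
  have step: "?P t (m + k) = ?P t m" if "\<bar>t / 2 ^ m\<bar> < e" for t m k
  proof (induction k)
    case (Suc k)
    let ?u = "t / 2 ^ (m + Suc k)"
    have u2: "?u + ?u = t / 2 ^ (m + k)" by simp
    have u: "\<bar>?u\<bar> < e" "\<bar>?u + ?u\<bar> < e" using small[of t m "Suc k"] small[of t m k] that u2 by linarith+
    have "\<gamma> (?u + ?u) = \<gamma> ?u [^] (2::nat)"
      using hom[OF u(1) u(1) u(2)] car[OF u(1)] by (simp add: numeral_2_eq_2)
    then have "\<gamma> ?u [^] (2 ^ (m + Suc k) :: nat) = ?P t (m + k)"
      using nat_pow_pow[OF car[OF u(1)], of 2 "2 ^ (m + k)"] u2 by (simp add: mult.commute)
    then show ?case using Suc by simp
  qed simp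
  have ex: "\<exists>m. \<bar>t / 2 ^ m\<bar> < e / 2" for t
  proof -
    have "(\<lambda>m. \<bar>t\<bar> / 2 ^ m) \<longlonglongrightarrow> 0" using LIMSEQ_divide_realpow_zero[of 2] by simp
    from order_tendstoD(2)[OF this, of "e / 2"] e
    obtain m where "\<bar>t\<bar> / 2 ^ m < e / 2" unfolding eventually_sequentially by auto
    then show ?thesis by (intro exI[of _ m]) simp
  qed
  \<comment> \<open>Half of \<open>e\<close>, so that in \<open>E_hom\<close> the sum of two scaled
    arguments is still in range.\<close>
  define N where "N t = (SOME m. \<bar>t / 2 ^ m\<bar> < e / 2)" for t :: real
  have N: "\<bar>t / 2 ^ N t\<bar> < e / 2" for t unfolding N_def by (rule someI_ex[OF ex])
  define E where "E t = ?P t (N t)" for t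
  have E_eq: "E t = ?P t m" if "\<bar>t / 2 ^ m\<bar> < e" for t m
  proof -
    have "\<bar>t / 2 ^ N t\<bar> < e" using N[of t] e by linarith
    from step[OF this, of m] step[OF that, of "N t"] show ?thesis by (simp add: E_def add.commute)
  qed
  have E_loc: "E t = \<gamma> t" if "\<bar>t\<bar> < e" for t using E_eq[of t 0] that car by simp
  have E_car: "E t \<in> carrier G" for t
    unfolding E_def using N[of t] e by (intro nat_pow_closed car) linarith
  have E_hom: "E (s + t) = E s \<otimes> E t" for s t
  proof -
    define m where "m = N s + N t"
    let ?s = "s / 2 ^ m" and ?t = "t / 2 ^ m"
    have st: "\<bar>?s\<bar> < e / 2" "\<bar>?t\<bar> < e / 2"
    proof -
      have "\<bar>?s\<bar> \<le> \<bar>s / 2 ^ N s\<bar>" unfolding m_def by (rule small)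
      then show "\<bar>?s\<bar> < e / 2" using N[of s] by (rule le_less_trans)
      have "\<bar>?t\<bar> \<le> \<bar>t / 2 ^ N t\<bar>" unfolding m_def add.commute[of "N s"] by (rule small)
      then show "\<bar>?t\<bar> < e / 2" using N[of t] by (rule le_less_trans)
    qed
    have sum: "(s + t) / 2 ^ m = ?s + ?t" by (simp add: add_divide_distrib)
    have lt: "\<bar>?s\<bar> < e" "\<bar>?t\<bar> < e" "\<bar>?s + ?t\<bar> < e" "\<bar>?t + ?s\<bar> < e" using st by linarith+
    have "\<gamma> ?s \<otimes> \<gamma> ?t = \<gamma> ?t \<otimes> \<gamma> ?s"
      using hom[OF lt(1,2,3)] hom[OF lt(2,1,4)] by (simp add: add.commute)
    from pow_mult_commute[OF car[OF lt(1)] car[OF lt(2)] this]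
    show ?thesis using E_eq[of s m] E_eq[of t m] E_eq[of "s + t" m] lt hom[OF lt(1,2,3)] by (simp add: sum)
  qed
  have E_near: "\<forall>\<^sub>F s in nhds t. E s = E t \<otimes> ip (c (s - t))" for t
  proof -
    have "\<forall>\<^sub>F s in nhds t. dist s t < e" using e by (auto simp: eventually_nhds_metric)
    then show ?thesis
    proof eventually_elim
      case (elim s)
      then have "E (s - t) = ip (c (s - t))" using E_loc by (simp add: dist_real_def \<gamma>_def)
      then show ?case using E_hom[of t "s - t"] by simp
    qed
  qed
  have c_at0: "c differentiable (at 0)"
    using c[of 0] e by (auto simp: has_vector_derivative_def intro: differentiableI)
  have E_mdiff: "mdiff vec_atlas At E t" for t
  proof (rule mdiff_vec_cong)
    show "\<forall>\<^sub>F s in nhds t. E t \<otimes> ip (c (s - t)) = E s" using E_near by eventually_elim simp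
    have "(\<lambda>s. s - t) differentiable (at t)" by (intro derivative_intros)
    then have "(\<lambda>s. c (s - t)) differentiable (at t)"
      using differentiable_chain_at[of "\<lambda>s. s - t" t c] c_at0 by (simp add: o_def)
    then show "mdiff vec_atlas At (\<lambda>s. E t \<otimes> ip (c (s - t))) t"
      using E_car by (intro mdiff_mult[OF dmfd_vec] mdiff_const[OF dmfd_vec] mdiff_ip) (auto simp: c0)
  qed
  \<comment> \<open>Bootstrapping: the velocity of \<open>c\<close> is a smooth function of
    \<open>c\<close>, so each order of regularity yields the next.\<close>
  have ckc: "ck n c t" if "\<bar>t\<bar> < e" for n t
    using that
  proof (induction n arbitrary: t)
    case (Suc n)
    have "open {t. \<bar>t\<bar> < e}" by (intro open_Collect_less continuous_intros)
    then have "\<forall>\<^sub>F s in nhds t. \<bar>s\<bar> < e" using Suc.prems eventually_nhds_in_open[of "{t. \<bar>t\<bar> < e}"] by simp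
    then have "\<forall>\<^sub>F s in nhds t. (c has_vector_derivative Xi (c s) x) (at s)"
      by eventually_elim (use c in blast)
    moreover have "(c t, c0) \<in> Smu" using c[OF Suc.prems] in_Smu by blast
    then have "ck n (\<lambda>s. Xi (c s) x) t"
      using ck_smooth_family_compose[OF Xi_family[of x], of c t n "[]"] Suc by (simp add: Xi_def)
    ultimately show ?case by (rule ck_SucI)
  qed simp
  have "one_param_subgroup G E" unfolding one_param_subgroup_def mfd_map_def
  proof (intro conjI allI ballI)
    show "E (s + t) = E s \<otimes> E t" for s t by (rule E_hom)
    show "continuous_map (mfd_top UNIV vec_atlas) (mfd_top (carrier G) At) E"
      by (rule continuous_map_if_mdiff[OF dG E_car E_mdiff])
    have main: "frechet_smooth_on {t. E t \<in> V} (\<lambda>t. \<psi> (E t))" if V: "(V, \<psi>) \<in> At" for V \<psi>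
    proof (rule frechet_smooth_on_ckI)
      have "\<forall>\<^sub>F s in nhds t. E s \<in> V" if "E t \<in> V" for t
        using mdiff_vec_sourceD(1)[OF E_mdiff V that] .
      then show "open {t. E t \<in> V}" by (subst open_subopen) (simp add: eventually_nhds subset_iff Ball_def)
      fix t n assume t: "t \<in> {t. E t \<in> V}"
      \<comment> \<open>The factor \<open>E t\<close> may be far from the unit and is read in a
        chart of its own; freezing its coordinate leaves a smooth function of
        \<open>c (s - t)\<close>.\<close>
      obtain W \<theta> where W: "(W, \<theta>) \<in> At" "E t \<in> W" using dG E_car by (rule dmfd_cover)
      have iW: "inv_into W \<theta> (\<theta> (E t)) = E t" by (rule inv_into_f_f[OF dmfd_chart(2)[OF dG W(1)] W(2)])
      obtain D where D: "smooth_family {z. fst z \<in> \<theta> ` W \<and> snd z \<in> ph ` U0 \<and>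
          inv_into W \<theta> (fst z) \<otimes> ip (snd z) \<in> V} D" (is "smooth_family ?S D")
        "\<And>p q. p \<in> \<theta> ` W \<Longrightarrow> q \<in> ph ` U0 \<Longrightarrow> inv_into W \<theta> p \<otimes> ip q \<in> V \<Longrightarrow>
          D (p, q) [] = \<psi> (inv_into W \<theta> p \<otimes> ip q)"
        by (rule mult_smooth_family[OF W(1) unit_chart_in V]) blast
      have ck: "ck n (\<lambda>s. c (s - t)) t"
        using ck_affine[of n c 1 t "-t" 1] ckc[of 0 n] e by simp
      have "(\<theta> (E t), c (t - t)) \<in> ?S" using W t iW E_car by (simp add: c0)
      then have "ck n (\<lambda>s. D (\<theta> (E t), c (s - t)) []) t"
        using ck_smooth_family_compose[OF smooth_family_slice_snd[OF D(1), of "\<theta> (E t)" "[]"], of "\<lambda>s. c (s - t)" t n "[]"] ck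
        by simp
      moreover have "\<forall>\<^sub>F s in nhds t. D (\<theta> (E t), c (s - t)) [] = \<psi> (E s)"
      proof -
        have "\<forall>\<^sub>F s in nhds t. dist s t < e" using e by (auto simp: eventually_nhds_metric)
        moreover have "\<forall>\<^sub>F s in nhds t. E s \<in> V" using mdiff_vec_sourceD(1)[OF E_mdiff V] t by simp
        ultimately show ?thesis using E_near
        proof eventually_elim
          case (elim s)
          have "c (s - t) \<in> ph ` U0" using c[of "s - t"] elim by (simp add: dist_real_def)
          then show ?case using D(2)[of "\<theta> (E t)" "c (s - t)"] elim W(2) iW by simp
        qed
      qed
      ultimately show "ck n (\<lambda>t. \<psi> (E t)) t" by (rule ck_cong[rotated])
    qed
    show "case c of (U, \<phi>) \<Rightarrow> \<forall>(V, \<psi>)\<in>At. frechet_smooth_on (\<phi> ` {x \<in> U. E x \<in> V}) (\<psi> \<circ> E \<circ> inv_into U \<phi>)"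
      if "c \<in> vec_atlas" for c :: "(real, real) chart"
      using that main by (auto simp: vec_atlas_def o_def)
  qed
  moreover have "((ph \<circ> E) has_vector_derivative x) (at 0)"
  proof -
    have "\<forall>\<^sub>F s in nhds 0. dist s 0 < e" using e by (auto simp: eventually_nhds_metric)
    then have "\<forall>\<^sub>F s in nhds 0. c s = (ph \<circ> E) s"
      by eventually_elim (use c E_loc in \<open>simp add: \<gamma>_def\<close>)
    moreover have "(c has_vector_derivative x) (at 0)" using c[of 0] e by (simp add: c0)
    ultimately show ?thesis by (rule has_vector_derivative_transform_eventually_nhds[rotated])
  qed
  ultimately show ?thesis using that E_loc by (simp add: \<gamma>_def)
qed

text \<open>The whole curve of which \<open>lie_exp\<close> takes the value at 1. That the
  description denotes such a curve is known from \<open>expc_props\<close> on.\<close>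

definition expc :: "'a \<Rightarrow> real \<Rightarrow> 'g" where
  "expc x = (THE \<gamma>. one_param_subgroup G \<gamma> \<and> ((ph \<circ> \<gamma>) has_vector_derivative x) (at 0))"

lemma lie_exp_expc: "lie_exp G x = expc x 1"
  by (simp add: lie_exp_def expc_def)

lemma one_param_tangent:
  assumes \<gamma>: "one_param_subgroup G \<gamma>" and d: "((ph \<circ> \<gamma>) has_vector_derivative x) (at 0)"
  shows "tangent \<gamma> t x" "\<gamma> 0 = \<one>"
proof -
  have hom: "\<gamma> (s + t) = \<gamma> s \<otimes> \<gamma> t" for s t using \<gamma> by (simp add: one_param_subgroup_def)
  have m: "mfd_map frechet_smooth_on UNIV vec_atlas (carrier G) At \<gamma>"
    using \<gamma> by (simp add: one_param_subgroup_def)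
  then have "continuous_map (mfd_top UNIV vec_atlas) (mfd_top (carrier G) At) \<gamma>"
    by (simp add: mfd_map_def)
  from continuous_map_funspace[OF this] have car: "\<gamma> t \<in> carrier G" for t
    by (auto simp: topspace_mfd_top[OF dG] mfd_top_vec)
  show g0: "\<gamma> 0 = \<one>" using hom[of 0 0] car[of 0] by (simp add: l_cancel_one)
  have "\<gamma> s = \<gamma> t \<otimes> \<gamma> (s - t)" for s using hom[of t "s - t"] by simp
  then have eq: "inv (\<gamma> t) \<otimes> \<gamma> s = \<gamma> (s - t)" for s using car by (metis cancel_left(1))
  have "((\<lambda>s. (ph \<circ> \<gamma>) (1 * s + - t)) has_vector_derivative 1 *\<^sub>R x) (at t)"
    by (rule has_vector_derivative_affine) (use d in \<open>simp add: o_def\<close>)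
  then have "((\<lambda>s. ph (inv (\<gamma> t) \<otimes> \<gamma> s)) has_vector_derivative x) (at t)"
    by (simp add: eq)
  then show "tangent \<gamma> t x" using car mdiff_if_smooth_map[OF dmfd_vec m] by (simp add: tangent_def)
qed

lemma one_param_unique:
  assumes "\<And>t. tangent \<alpha> t x" "\<And>t. tangent \<beta> t x" "\<alpha> 0 = \<one>" "\<beta> 0 = \<one>"
  shows "\<alpha> = \<beta>"
proof
  fix t show "\<alpha> t = \<beta> t"
    by (rule tangent_unique[of UNIV 0 t \<alpha> "\<lambda>_. x" \<beta>]) (use assms in auto)
qed

lemma expc_props: "one_param_subgroup G (expc x)" "((ph \<circ> expc x) has_vector_derivative x) (at 0)"
proof -
  obtain r0 and c :: "'a \<Rightarrow> real \<Rightarrow> 'a" where r0: "r0 > 0" and c: "\<And>x. norm x \<le> r0 \<Longrightarrow> c x 0 = c0"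
    "\<And>x t. norm x \<le> r0 \<Longrightarrow> \<bar>t\<bar> < 2 \<Longrightarrow> c x t \<in> ph ` U0 \<and> (c x has_vector_derivative Xi (c x t) x) (at t)"
    by (rule exp_local) blast
  \<comment> \<open>Dividing \<open>x\<close> by \<open>k\<close> brings it into the ball of
    \<open>exp_local\<close>; running that curve \<open>k\<close> times as fast solves the equation
    for \<open>x\<close> up to time 2/k.\<close>
  define k where "k = norm x / r0 + 1"
  have k: "k > 0" using r0 by (simp add: k_def add_nonneg_pos)
  define y where "y = x /\<^sub>R k"
  have "norm x \<le> k * r0" using r0 by (simp add: k_def field_simps)
  then have y: "norm y \<le> r0" using k by (simp add: y_def field_simps)
  have x: "x = k *\<^sub>R y" using k by (simp add: y_def)
  obtain E where E: "one_param_subgroup G E" "((ph \<circ> E) has_vector_derivative x) (at 0)"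
  proof (rule one_param_extension[of "2 / k" "\<lambda>t. c y (k * t + 0)" x])
    show "2 / k > 0" using k by simp
    show "c y (k * 0 + 0) = c0" using c(1)[OF y] by simp
    fix t assume "\<bar>t\<bar> < 2 / k"
    then have "\<bar>k * t + 0\<bar> < 2" using k by (simp add: abs_mult field_simps)
    note cy = c(2)[OF y this]
    have "Xi (c y (k * t + 0)) x = k *\<^sub>R Xi (c y (k * t + 0)) y"
      using Xi_linear[of "c y (k * t + 0)"] cy by (simp add: x bounded_linear.linear linear_cmul)
    then show "c y (k * t + 0) \<in> ph ` U0 \<and>
        ((\<lambda>t. c y (k * t + 0)) has_vector_derivative Xi (c y (k * t + 0)) x) (at t)"
      using has_vector_derivative_affine[of "c y" _ k t 0] cy by metis
  qed blast
  have "expc x = E" unfolding expc_def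
  proof (rule the_equality)
    fix \<gamma> assume "one_param_subgroup G \<gamma> \<and> ((ph \<circ> \<gamma>) has_vector_derivative x) (at 0)"
    then show "\<gamma> = E" using one_param_unique one_param_tangent E by blast
  qed (use E in blast)
  then show "one_param_subgroup G (expc x)" "((ph \<circ> expc x) has_vector_derivative x) (at 0)"
    using E by simp_all
qed

lemma expc_tangent: "tangent (expc x) t x" and expc_0 [simp]: "expc x 0 = \<one>"
  using one_param_tangent[OF expc_props] by auto

lemma expc_carrier [simp]: "expc x t \<in> carrier G"
  using tangent_carrier[OF expc_tangent] .

lemma expc_add: "expc x (s + t) = expc x s \<otimes> expc x t"
  using expc_props(1)[of x] by (simp add: one_param_subgroup_def)

lemma expc_minus: "inv (expc x t) = expc x (- t)"
  using expc_add[of x "- t" t] by (intro inv_equality) auto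

lemma expc_scale: "expc (a *\<^sub>R x) t = expc x (a * t)"
proof -
  have "expc (a *\<^sub>R x) = (\<lambda>t. expc x (a * t))"
  proof (rule one_param_unique)
    show "tangent (\<lambda>t. expc x (a * t)) t (a *\<^sub>R x)" for t
      using tangent_affine[of "expc x" a t 0 x] expc_tangent by simp
  qed (auto intro: expc_tangent)
  then show ?thesis by (rule fun_cong)
qed

lemma lie_exp_scale: "lie_exp G (t *\<^sub>R x) = expc x t"
  by (simp add: lie_exp_expc expc_scale)

text \<open>The local exponential curves satisfy a contraction estimate in their initial velocity, so that
  Banach's fixed point theorem replaces the inverse function theorem.\<close>

lemma exp_onto_neighbourhood:
  obtains \<rho> where "\<rho> > 0" "\<And>p. p \<in> ball c0 \<rho> \<Longrightarrow> p \<in> ph ` U0 \<and> (\<exists>x. ip p = expc x 1)"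
proof -
  obtain r0 and c :: "'a \<Rightarrow> real \<Rightarrow> 'a" where r0: "r0 > 0" and c: "\<And>x. norm x \<le> r0 \<Longrightarrow> c x 0 = c0"
    "\<And>x t. norm x \<le> r0 \<Longrightarrow> \<bar>t\<bar> < 2 \<Longrightarrow> c x t \<in> ph ` U0 \<and> (c x has_vector_derivative Xi (c x t) x) (at t)"
    "\<And>x y. norm x \<le> r0 \<Longrightarrow> norm y \<le> r0 \<Longrightarrow> norm (c x 1 - c y 1 - (x - y)) \<le> 2/3 * norm (x - y)"
    by (rule exp_local) blast
  have ex: "expc x 1 = ip (c x 1)" if "norm x \<le> r0" for x
  proof (rule tangent_unique[of "{-2<..<2}" 0 1 "expc x" "\<lambda>_. x" "\<lambda>t. ip (c x t)"])
    show "tangent (\<lambda>t. ip (c x t)) t x" if "t \<in> {-2<..<2}" for t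
    proof (rule tangent_chart_curve)
      have "\<bar>t\<bar> < 2" using that by auto
      from c(2)[OF \<open>norm x \<le> r0\<close> this]
      show "(c x has_vector_derivative Xi (c x t) x) (at t)" "c x t \<in> ph ` U0" by auto
    qed
  qed (use c(1)[OF that] in \<open>auto intro: expc_tangent\<close>)
  have c01: "c 0 1 = c0"
  proof -
    have "ip (c 0 1) = \<one>" using ex[of 0] r0 expc_scale[of 0 0 1] by simp
    moreover have "c 0 1 \<in> ph ` U0" using c(2)[of 0 1] r0 by simp
    ultimately show ?thesis using ph_ip by metis
  qed
  have "p \<in> ph ` U0 \<and> (\<exists>x. ip p = expc x 1)" if p: "p \<in> ball c0 (r0 / 3)" for p
  proof -
    \<comment> \<open>Its fixed points are the solutions of \<open>c x 1 = p\<close>.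
      \<open>F\<close> contracts by 2/3 and \<open>norm (F 0) \<le> r0 / 3\<close>, which together
      preserve the ball of radius \<open>r0\<close>.\<close>
    define F where "F x = p - (c x 1 - x)" for x
    have F: "norm (F x - F y) \<le> 2/3 * norm (x - y)" if "norm x \<le> r0" "norm y \<le> r0" for x y
      using c(3)[OF that] by (simp add: F_def algebra_simps norm_minus_commute)
    have F0: "norm (F 0) \<le> r0 / 3" using p by (simp add: F_def c01 dist_norm norm_minus_commute)
    have "\<exists>!x. x \<in> cball 0 r0 \<and> F x = x"
    proof (rule Banach_fix[where c = "2/3"])
      show "F ` cball 0 r0 \<subseteq> cball 0 r0"
      proof (intro image_subsetI)
        fix x :: 'a assume x: "x \<in> cball 0 r0"
        have "norm (F x) \<le> norm (F x - F 0) + norm (F 0)" using norm_triangle_ineq[of "F x - F 0" "F 0"] by simp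
        also have "\<dots> \<le> 2/3 * norm (x - 0) + r0 / 3" using F[of x 0] F0 x r0 by (intro add_mono) auto
        also have "\<dots> \<le> r0" using x by simp
        finally show "F x \<in> cball 0 r0" by simp
      qed
      show "dist (F x) (F y) \<le> 2/3 * dist x y" if "x \<in> cball 0 r0" "y \<in> cball 0 r0" for x y
        using F[of x y] that by (simp add: dist_norm)
    qed (use r0 in \<open>auto simp: complete_eq_closed\<close>)
    then obtain x where x: "norm x \<le> r0" "F x = x" by auto
    then have "c x 1 = p" by (simp add: F_def)
    then show ?thesis using ex[OF x(1)] c(2)[OF x(1), of 1] by auto
  qed
  then show ?thesis using that[of "r0 / 3"] r0 by simp
qed

text \<open>Turns the derivative along one-parameter groups into a Frechet differential, which is
  linear in \<open>x\<close> and obeys the chain rule along arbitrary curves.\<close>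

lemma lie_deriv_eq_gd:
  assumes "mdiff At vec_atlas f g" "g \<in> carrier G"
  shows "lie_deriv G x f g = gd f g x"
proof -
  have t: "tangent (\<lambda>t. g \<otimes> expc x t) 0 x" using expc_tangent assms(2) by (rule tangent_left)
  have "((\<lambda>t. f (g \<otimes> expc x t)) has_vector_derivative gd f g x) (at 0)"
    using tangent_chain[OF t, of f] assms by simp
  then show ?thesis unfolding lie_deriv_def lie_exp_scale by (rule vector_derivative_at)
qed

end

section \<open>Homogeneous spaces\<close>

locale homogeneous = banach_lie G for G :: "('g, 'a::banach) lie_group" (structure) +
  fixes H :: "'g set" and AH :: "('g, 'b::banach) chart set" and AM :: "('g set, 'm::cbanach) chart set"
  assumes chs: "complex_homogeneous_space G H AH AM"
begin

abbreviation "M \<equiv> lcosets H"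
abbreviation "\<qq> \<equiv> isotropy_q G H AM"

section \<open>Cosets and local sections of the quotient map\<close>

lemma subgroup_H: "subgroup H G"
  using chs by (simp add: complex_homogeneous_space_def split_lie_subgroup_def lie_subgroup_def)

lemma H_carrier [simp]: "h \<in> H \<Longrightarrow> h \<in> carrier G"
  using subgroup.mem_carrier[OF subgroup_H] .

lemma H_one [simp]: "\<one> \<in> H" using subgroup.one_closed[OF subgroup_H] .
lemma H_mult [simp]: "h \<in> H \<Longrightarrow> k \<in> H \<Longrightarrow> h \<otimes> k \<in> H" using subgroup.m_closed[OF subgroup_H] .
lemma H_inv [simp]: "h \<in> H \<Longrightarrow> inv h \<in> H" using subgroup.m_inv_closed[OF subgroup_H] .

lemma dM: "dmfd M AM"
  using chs by (auto simp: complex_homogeneous_space_def intro: dmfd_if_holomorphic)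

lemma dH: "dmfd H AH"
  using chs by (auto simp: complex_homogeneous_space_def split_lie_subgroup_def lie_subgroup_def
      intro: dmfd_if_smooth)

lemma coset_in_M [simp]: "g \<in> carrier G \<Longrightarrow> g <# H \<in> M"
  by (auto simp: LCOSETS_def)

lemma coset_one [simp]: "\<one> <# H = H"
  by (auto simp: l_coset_def)

lemma coset_mult_H [simp]:
  assumes "g \<in> carrier G" "h \<in> H" shows "(g \<otimes> h) <# H = g <# H"
proof -
  have "g \<otimes> k \<in> (g \<otimes> h) <# H" if "k \<in> H" for k
    using assms that by (auto simp: l_coset_def m_assoc intro!: bexI[of _ "inv h \<otimes> k"])
  moreover have "g \<otimes> h \<otimes> k \<in> g <# H" if "k \<in> H" for k
    using assms that by (auto simp: l_coset_def m_assoc intro!: bexI[of _ "h \<otimes> k"])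
  ultimately show ?thesis by (auto simp: l_coset_def)
qed

lemma coset_eqE:
  assumes "g <# H = g' <# H" "g \<in> carrier G" "g' \<in> carrier G"
  obtains h where "h \<in> H" "g' = g \<otimes> h"
proof -
  have "g' \<in> g' <# H" using assms(3) by (auto simp: l_coset_def intro!: bexI[of _ \<one>])
  then have "g' \<in> g <# H" using assms(1) by simp
  then show ?thesis using that by (auto simp: l_coset_def)
qed

lemma H_in_M: "H \<in> M" using coset_in_M[of \<one>] by simp

lemma mdiff_quotient: "mdiff At AM (\<lambda>g. g <# H) g"
  by (rule mdiff_if_smooth_map[OF dG, where Y = M])
     (use chs in \<open>simp add: complex_homogeneous_space_def principal_quotient_bundle_def\<close>)

text \<open>The second coordinate of a local trivialisation is frozen at the value \<open>h0\<close>
  that it takes at \<open>g\<close>; the resulting section passes through \<open>g\<close> itself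
  and not merely through its coset.\<close>

lemma local_section:
  assumes g: "g \<in> carrier G"
  obtains s U where "openin (mfd_top M AM) U" "g <# H \<in> U" "s (g <# H) = g"
    "\<And>u. u \<in> U \<Longrightarrow> s u \<in> carrier G \<and> s u <# H = u" "mdiff AM At s (g <# H)"
proof -
  let ?m = "g <# H"
  have "principal_quotient_bundle G H AH AM" using chs by (simp add: complex_homogeneous_space_def)
  from this[unfolded principal_quotient_bundle_def, THEN conjunct2, THEN bspec, OF coset_in_M[OF g]]
  obtain U \<Phi> where U: "openin (mfd_top M AM) U" "?m \<in> U" and
    dif: "diffeomorphism (U \<times> H) (prod_atlas (restrict_atlas U AM) AH)
        {g \<in> carrier G. g <# H \<in> U}
        (restrict_atlas {g \<in> carrier G. g <# H \<in> U} (atlas G)) \<Phi>" and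
    sec: "\<And>u h. u \<in> U \<Longrightarrow> h \<in> H \<Longrightarrow> \<Phi> (u, h) <# H = u" by (elim exE conjE) blast
  have bij: "bij_betw \<Phi> (U \<times> H) {g \<in> carrier G. g <# H \<in> U}"
    using dif by (simp add: diffeomorphism_def)
  have "g \<in> \<Phi> ` (U \<times> H)" using bij_betw_imp_surj_on[OF bij] g U(2) by auto
  then obtain u0 h0 where uh: "u0 \<in> U" "h0 \<in> H" "\<Phi> (u0, h0) = g" by auto
  then have "u0 = ?m" using sec[of u0 h0] by simp
  with uh have h0: "h0 \<in> H" "\<Phi> (?m, h0) = g" by auto
  define s where "s u = \<Phi> (u, h0)" for u
  have s: "s u \<in> carrier G \<and> s u <# H = u" if "u \<in> U" for u
    using bij_betwE[OF bij] that h0(1) sec by (auto simp: s_def)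
  obtain V \<theta> where V: "(V, \<theta>) \<in> AH" "h0 \<in> V" using dH h0(1) by (rule dmfd_cover)
  have "mdiff AM At s ?m"
  proof (rule mdiffI)
    fix U1 \<psi> W \<phi> assume c: "(U1, \<psi>) \<in> AM" "?m \<in> U1" "(W, \<phi>) \<in> At" "s ?m \<in> W"
    let ?C = "(U1 \<inter> U) \<times> V" and ?c = "map_prod \<psi> \<theta>"
    let ?G = "{g \<in> carrier G. g <# H \<in> U}"
    have "(U1 \<inter> U, \<psi>) \<in> restrict_atlas U AM"
      unfolding restrict_atlas_def by (rule image_eqI[OF _ c(1)]) simp
    then have r1: "(?C, ?c) \<in> prod_atlas (restrict_atlas U AM) AH"
      unfolding prod_atlas_def using V(1) by blast
    have r2: "(W \<inter> ?G, \<phi>) \<in> restrict_atlas ?G At"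
      unfolding restrict_atlas_def by (rule image_eqI[OF _ c(3)]) simp
    have "mfd_map frechet_smooth_on (U \<times> H) (prod_atlas (restrict_atlas U AM) AH)
        ?G (restrict_atlas ?G At) \<Phi>" using dif by (simp add: diffeomorphism_def)
    from mfd_mapD[OF this r1 r2]
    have fs: "frechet_smooth_on (?c ` {x \<in> ?C. \<Phi> x \<in> W \<inter> ?G}) (\<phi> \<circ> \<Phi> \<circ> inv_into ?C ?c)" .
    note inj1 = dmfd_chart(2)[OF dM c(1)] and inj2 = dmfd_chart(2)[OF dH V(1)]
    have inj: "inj_on ?c ?C" by (rule map_prod_inj_on[OF inj_on_subset[OF inj1] inj2]) auto
    let ?S = "?c ` {x \<in> ?C. \<Phi> x \<in> W \<inter> ?G}"
    have in_S: "(\<psi> ?m, \<theta> h0) \<in> ?S"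
    proof (rule image_eqI)
      show "(\<psi> ?m, \<theta> h0) = ?c (?m, h0)" by simp
      show "(?m, h0) \<in> {x \<in> ?C. \<Phi> x \<in> W \<inter> ?G}"
        using c(2,4) V(2) U(2) s[OF U(2)] by (simp add: s_def)
    qed
    have "open ?S" using fs by (simp add: frechet_smooth_on_iff)
    have "filterlim (\<lambda>p. (p, \<theta> h0)) (nhds (\<psi> ?m, \<theta> h0)) (nhds (\<psi> ?m))"
      by (intro tendsto_Pair tendsto_const filterlim_ident)
    from eventually_compose_filterlim[OF eventually_nhds_in_open[OF \<open>open ?S\<close> in_S] this]
    have ev: "\<forall>\<^sub>F p in nhds (\<psi> ?m). (p, \<theta> h0) \<in> ?S" .
    have ev2: "p \<in> \<psi> ` U1 \<and> s (inv_into U1 \<psi> p) \<in> W \<and>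
        (\<phi> \<circ> \<Phi> \<circ> inv_into ?C ?c) (p, \<theta> h0) = \<phi> (s (inv_into U1 \<psi> p))" if "(p, \<theta> h0) \<in> ?S" for p
    proof -
      from that obtain z where z3: "(p, \<theta> h0) = ?c z" and z: "z \<in> {x \<in> ?C. \<Phi> x \<in> W \<inter> ?G}"
        by (rule imageE)
      obtain u h where zuh: "z = (u, h)" by (rule prod.exhaust)
      have uh: "u \<in> U1 \<inter> U" "h \<in> V" "p = \<psi> u" "\<theta> h0 = \<theta> h" "\<Phi> (u, h) \<in> W"
        using z z3 unfolding zuh by simp_all
      have h: "h = h0" by (rule inj_onD[OF inj2 uh(4)[symmetric] uh(2) V(2)])
      have 1: "inv_into ?C ?c (p, \<theta> h0) = (u, h)"
        unfolding z3 zuh by (rule inv_into_f_f[OF inj]) (use uh in simp)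
      have 2: "inv_into U1 \<psi> p = u" unfolding uh(3) by (rule inv_into_f_f[OF inj1]) (use uh in simp)
      show ?thesis unfolding o_apply 1 2 s_def using uh h by simp
    qed
    have "\<forall>\<^sub>F p in nhds (\<psi> ?m). p \<in> \<psi> ` U1 \<and> s (inv_into U1 \<psi> p) \<in> W"
      using ev by (rule eventually_mono) (drule ev2, simp)
    moreover have "(\<lambda>p. \<phi> (s (inv_into U1 \<psi> p))) differentiable (at (\<psi> ?m))"
    proof (rule differentiable_transform_eventually)
      show "\<forall>\<^sub>F p in nhds (\<psi> ?m). (\<phi> \<circ> \<Phi> \<circ> inv_into ?C ?c) (p, \<theta> h0) = \<phi> (s (inv_into U1 \<psi> p))"
        using ev by (rule eventually_mono) (drule ev2, simp)
      have "(\<lambda>p. (p, \<theta> h0)) differentiable (at (\<psi> ?m))"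
        by (rule differentiableI[OF has_derivative_Pair[OF has_derivative_ident has_derivative_const]])
      from differentiable_chain_at[OF this frechet_smooth_on_differentiable[OF fs in_S]]
      show "(\<lambda>p. (\<phi> \<circ> \<Phi> \<circ> inv_into ?C ?c) (p, \<theta> h0)) differentiable (at (\<psi> ?m))" by (simp add: o_def)
    qed
    ultimately show "(\<forall>\<^sub>F p in nhds (\<psi> ?m). p \<in> \<psi> ` U1 \<and> s (inv_into U1 \<psi> p) \<in> W) \<and>
      (\<lambda>p. \<phi> (s (inv_into U1 \<psi> p))) differentiable (at (\<psi> ?m))" by simp
  qed
  moreover have "s ?m = g" using h0(2) by (simp add: s_def)
  ultimately show ?thesis using that[OF U _ s] by blast
qed

subsection \<open>The subalgebra \<open>\<qq>\<close>\<close>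

text \<open>Agrees with \<open>quotient_tangent\<close> in charts at the base point, but is a
  Frechet derivative and therefore linear.\<close>

definition qT :: "('g set \<Rightarrow> 'm) \<Rightarrow> 'a \<Rightarrow> 'm" where
  "qT \<psi> = gd (\<lambda>g. \<psi> (g <# H)) \<one>"

lemma mdiff_chart_quotient:
  assumes "(U, \<psi>) \<in> AM" "g <# H \<in> U" "g \<in> carrier G"
  shows "mdiff At vec_atlas (\<lambda>g. \<psi> (g <# H)) g"
  using mdiff_compose[OF dG dM _ mdiff_quotient mdiff_chart[OF dM assms(1,2)]] assms(3) by simp

lemma qT_deriv:
  assumes "(U, \<psi>) \<in> AM" "H \<in> U"
  shows "((\<lambda>p. \<psi> (ip p <# H)) has_derivative qT \<psi>) (at c0)"
proof -
  have "((\<lambda>p. \<psi> ((\<one> \<otimes> ip p) <# H)) has_derivative qT \<psi>) (at c0)"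
    unfolding qT_def using assms by (intro gd_has_derivative mdiff_chart_quotient) auto
  moreover have "\<forall>\<^sub>F p in nhds c0. \<psi> ((\<one> \<otimes> ip p) <# H) = \<psi> (ip p <# H)"
    using eventually_c0 by eventually_elim simp
  ultimately show ?thesis by (rule has_derivative_transform_eventually_nhds)
qed

lemma qT_linear: "(U, \<psi>) \<in> AM \<Longrightarrow> H \<in> U \<Longrightarrow> bounded_linear (qT \<psi>)"
  using qT_deriv by (rule has_derivative_bounded_linear)

lemma quotient_tangent_eq:
  assumes "(U, \<psi>) \<in> AM" "H \<in> U"
  shows "quotient_tangent G H \<psi> x = qT \<psi> x"
proof -
  have "mdiff At vec_atlas (\<lambda>g. \<psi> (g <# H)) (expc x 0)"
    using mdiff_chart_quotient[OF assms(1), of \<one>] assms(2) by simp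
  from tangent_chain[OF expc_tangent this]
  show ?thesis unfolding quotient_tangent_def lie_exp_scale qT_def by (simp add: vector_derivative_at)
qed

lemma q_iff: "(x, y) \<in> \<qq> \<longleftrightarrow> (\<forall>(U, \<psi>)\<in>AM. H \<in> U \<longrightarrow> qT \<psi> x + \<i> *\<^sub>C qT \<psi> y = 0)"
  unfolding isotropy_q_def using quotient_tangent_eq by (auto split: prod.splits)

lemma q_subspace:
  shows "0 \<in> \<qq>" "z \<in> \<qq> \<Longrightarrow> w \<in> \<qq> \<Longrightarrow> z + w \<in> \<qq>" "z \<in> \<qq> \<Longrightarrow> r *\<^sub>R z \<in> \<qq>"
proof -
  have lin: "linear (qT \<psi>)" if "(U, \<psi>) \<in> AM" "H \<in> U" for U \<psi>
    using qT_linear[OF that] by (rule bounded_linear.linear)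
  have "qT \<psi> 0 = 0" if "(U, \<psi>) \<in> AM" "H \<in> U" for U \<psi> using linear_0[OF lin[OF that]] .
  then show "0 \<in> \<qq>" by (auto simp: q_iff zero_prod_def)
  show "z + w \<in> \<qq>" if zw: "z \<in> \<qq>" "w \<in> \<qq>"
  proof -
    obtain x y x' y' where e: "z = (x, y)" "w = (x', y')" by (cases z, cases w)
    have "qT \<psi> (x + x') + \<i> *\<^sub>C qT \<psi> (y + y') = 0" if "(U, \<psi>) \<in> AM" "H \<in> U" for U \<psi>
    proof -
      have "qT \<psi> x + \<i> *\<^sub>C qT \<psi> y = 0" "qT \<psi> x' + \<i> *\<^sub>C qT \<psi> y' = 0"
        using zw that unfolding e q_iff by blast+
      then have "(qT \<psi> x + \<i> *\<^sub>C qT \<psi> y) + (qT \<psi> x' + \<i> *\<^sub>C qT \<psi> y') = 0" by simp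
      then show ?thesis by (simp add: linear_add[OF lin[OF that]] scaleC_add_right algebra_simps)
    qed
    then show ?thesis unfolding e by (auto simp: q_iff)
  qed
  show "r *\<^sub>R z \<in> \<qq>" if z: "z \<in> \<qq>"
  proof -
    obtain x y where e: "z = (x, y)" by (cases z)
    have "qT \<psi> (r *\<^sub>R x) + \<i> *\<^sub>C qT \<psi> (r *\<^sub>R y) = 0" if "(U, \<psi>) \<in> AM" "H \<in> U" for U \<psi>
    proof -
      have "qT \<psi> x + \<i> *\<^sub>C qT \<psi> y = 0" using z that unfolding e q_iff by blast
      then have "r *\<^sub>R (qT \<psi> x + \<i> *\<^sub>C qT \<psi> y) = 0" by simp
      then show ?thesis by (simp add: linear_cmul[OF lin[OF that]] scaleC_scaleR scaleR_add_right)
    qed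
    then show ?thesis unfolding e by (auto simp: q_iff)
  qed
qed

text \<open>Complex multiplication on the tangent space of \<open>G/H\<close> lifts to a real linear map \<open>L\<close>; this is
  the concrete form of the identity that \<open>\<qq>\<close> and its conjugate span the complexified Lie algebra.\<close>

lemma antiholomorphic_lift:
  obtains L where "bounded_linear L" "\<And>x. (x, L x) \<in> \<qq>"
proof -
  obtain U \<psi> where U: "(U, \<psi>) \<in> AM" "H \<in> U" using dM H_in_M by (rule dmfd_cover)
  have iH: "inv_into U \<psi> (\<psi> H) = H" by (rule inv_into_f_f[OF dmfd_chart(2)[OF dM U(1)] U(2)])
  obtain s W where W: "openin (mfd_top M AM) W" "H \<in> W" and s: "s H = \<one>"
    "\<And>u. u \<in> W \<Longrightarrow> s u \<in> carrier G \<and> s u <# H = u" and ms: "mdiff AM At s H"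
    by (rule local_section[OF one_closed, unfolded coset_one]) blast
  let ?f = "\<lambda>p. ph (s (inv_into U \<psi> p))"
  have "s H \<in> U0" using s(1) by simp
  note F = mdiffD[OF ms U unit_chart_in this]
  obtain S where S: "(?f has_derivative S) (at (\<psi> H))" using F(2) by (auto simp: differentiable_def)
  have "?f (\<psi> H) = c0" by (simp add: iH s(1))
  then have "((\<lambda>p. \<psi> (ip (?f p) <# H)) has_derivative (\<lambda>v. qT \<psi> (S v))) (at (\<psi> H))"
    using diff_chain_at[OF S, of "\<lambda>p. \<psi> (ip p <# H)" "qT \<psi>"] qT_deriv[OF U] by (simp add: o_def)
  moreover have "\<forall>\<^sub>F p in nhds (\<psi> H). \<psi> (ip (?f p) <# H) = p"
  proof -
    have "open (\<psi> ` (W \<inter> U))" using W(1) U(1) by (auto simp: openin_mfd_top[OF dM])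
    then have "\<forall>\<^sub>F p in nhds (\<psi> H). p \<in> \<psi> ` (W \<inter> U)" by (rule eventually_nhds_in_open) (use W U in auto)
    with F(1) show ?thesis
    proof eventually_elim
      case (elim p)
      then obtain u where u: "u \<in> W" "u \<in> U" "p = \<psi> u" by auto
      then have "inv_into U \<psi> p = u" using dmfd_chart(2)[OF dM U(1)] by simp
      then show ?case using elim u s(2)[OF u(1)] by simp
    qed
  qed
  ultimately have "((\<lambda>p. p) has_derivative (\<lambda>v. qT \<psi> (S v))) (at (\<psi> H))"
    by (rule has_derivative_transform_eventually_nhds)
  then have "(\<lambda>v. qT \<psi> (S v)) = (\<lambda>v. v)" using has_derivative_ident by (rule has_derivative_unique)
  then have TS: "qT \<psi> (S v) = v" for v by (rule fun_cong)
  \<comment> \<open>\<open>S\<close> is the differential of a local section, hence a right inverse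
    of \<open>qT \<psi>\<close>. So \<open>qT \<psi>\<close> takes \<open>L x\<close> to i times the
    image of \<open>x\<close>, and x + i L x goes to zero.\<close>
  define L where "L x = S (\<i> *\<^sub>C qT \<psi> x)" for x
  have "bounded_linear L" unfolding L_def
    by (intro bounded_linear_compose[OF has_derivative_bounded_linear[OF S]]
        bounded_linear_compose[OF bounded_bilinear.bounded_linear_right[OF bounded_bilinear_scaleC]]
        qT_linear[OF U])
  moreover have "(x, L x) \<in> \<qq>" for x
  proof -
    \<comment> \<open>Membership in \<open>\<qq>\<close> refers to all charts at the base point;
      passing to a second chart only applies the complex linear derivative \<open>C\<close> of the
      transition map.\<close>
    have "qT \<psi>' x + \<i> *\<^sub>C qT \<psi>' (L x) = 0" if U': "(U', \<psi>') \<in> AM" "H \<in> U'" for U' \<psi>'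
    proof -
      have "cholomorphic_on (\<psi> ` (U \<inter> U')) (\<psi>' \<circ> inv_into U \<psi>)"
        using chs U U' unfolding complex_homogeneous_space_def banach_manifold_def compatible_charts_def by fast
      then obtain C where C: "((\<psi>' \<circ> inv_into U \<psi>) has_derivative C) (at (\<psi> H))" "is_clinear C"
        unfolding cholomorphic_on_def using U(2) U'(2) by blast
      have "((\<lambda>p. (\<psi>' \<circ> inv_into U \<psi>) (\<psi> (ip p <# H))) has_derivative (\<lambda>v. C (qT \<psi> v))) (at c0)"
        using diff_chain_at[OF qT_deriv[OF U], of "\<psi>' \<circ> inv_into U \<psi>" C] C(1) by (simp add: o_def)
      moreover have "\<forall>\<^sub>F p in nhds c0. ip p <# H \<in> U"
        using mdiffD(1)[OF mdiff_quotient unit_chart_in one_in_U0 U(1)] U(2) by (auto elim: eventually_mono)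
      then have "\<forall>\<^sub>F p in nhds c0. (\<psi>' \<circ> inv_into U \<psi>) (\<psi> (ip p <# H)) = \<psi>' (ip p <# H)"
        by eventually_elim (use dmfd_chart(2)[OF dM U(1)] in simp)
      ultimately have "((\<lambda>p. \<psi>' (ip p <# H)) has_derivative (\<lambda>v. C (qT \<psi> v))) (at c0)"
        by (rule has_derivative_transform_eventually_nhds)
      then have eq: "qT \<psi>' v = C (qT \<psi> v)" for v
        using qT_deriv[OF U'] has_derivative_unique by metis
      have "qT \<psi>' x + \<i> *\<^sub>C qT \<psi>' (L x) = C (qT \<psi> x + \<i> *\<^sub>C (\<i> *\<^sub>C qT \<psi> x))"
        unfolding eq L_def TS by (simp only: is_clinear_add[OF C(2)] is_clinear_scaleC[OF C(2)])
      also have "\<dots> = 0" by (simp add: scaleC_scaleC is_clinear_zero[OF C(2)])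
      finally show ?thesis .
    qed
    then show ?thesis by (auto simp: q_iff)
  qed
  ultimately show ?thesis by (rule that)
qed

text \<open>The second hypothesis is openness of \<open>P\<close>, expressed at each point through
  the unit chart. A local section through \<open>g\<close> sends cosets near that of
  \<open>g\<close> to elements near \<open>g\<close>, which lie in \<open>P\<close>; so these cosets
  belong to the image.\<close>

lemma openin_quotient_image:
  assumes P: "P \<subseteq> carrier G" "\<And>g. g \<in> P \<Longrightarrow> \<forall>\<^sub>F p in nhds c0. g \<otimes> ip p \<in> P"
  shows "openin (mfd_top M AM) ((\<lambda>g. g <# H) ` P)"
  unfolding openin_mfd_top[OF dM]
proof (intro conjI)
  show "(\<lambda>g. g <# H) ` P \<subseteq> M" using P(1) by auto
  have "open (\<psi> ` ((\<lambda>g. g <# H) ` P \<inter> U))" if U: "(U, \<psi>) \<in> AM" for U \<psi>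
  proof (subst open_subopen, intro ballI)
    fix x assume "x \<in> \<psi> ` ((\<lambda>g. g <# H) ` P \<inter> U)"
    then obtain g where g: "g \<in> P" "g <# H \<in> U" "x = \<psi> (g <# H)" by auto
    then have gc: "g \<in> carrier G" using P(1) by auto
    obtain s W where W: "openin (mfd_top M AM) W" "g <# H \<in> W" and s: "s (g <# H) = g"
      "\<And>u. u \<in> W \<Longrightarrow> s u \<in> carrier G \<and> s u <# H = u" and ms: "mdiff AM At s (g <# H)"
      by (rule local_section[OF gc]) blast
    have iU: "inv_into U \<psi> x = g <# H" using dmfd_chart(2)[OF dM U] g by simp
    have "x \<in> \<psi> ` U" using g by auto
    from mdiff_compose[OF dmfd_vec dM _ mdiff_inv_chart[OF dM U this], of At s]
    have "mdiff vec_atlas At (\<lambda>p. s (inv_into U \<psi> p)) x"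
      using ms gc by (simp add: iU)
    then have md: "mdiff vec_atlas At (\<lambda>p. inv g \<otimes> s (inv_into U \<psi> p)) x"
      using gc s(1) by (intro mdiff_mult[OF dmfd_vec] mdiff_const[OF dmfd_vec]) (simp_all add: iU)
    have v: "inv g \<otimes> s (inv_into U \<psi> x) = \<one>" using gc s(1) by (simp add: iU)
    then have "inv g \<otimes> s (inv_into U \<psi> x) \<in> U0" by simp
    note d = mdiff_ph[OF md this]
    have "filterlim (\<lambda>p. ph (inv g \<otimes> s (inv_into U \<psi> p))) (nhds c0) (nhds x)"
      using differentiable_tendsto_nhds[OF d(2)] unfolding v .
    from eventually_compose_filterlim[OF P(2)[OF g(1)] this]
    have e1: "\<forall>\<^sub>F p in nhds x. g \<otimes> ip (ph (inv g \<otimes> s (inv_into U \<psi> p))) \<in> P" .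
    have "open (\<psi> ` (W \<inter> U))" using W(1) U by (auto simp: openin_mfd_top[OF dM])
    then have e2: "\<forall>\<^sub>F p in nhds x. p \<in> \<psi> ` (W \<inter> U)" by (rule eventually_nhds_in_open) (use W g in auto)
    have "\<forall>\<^sub>F p in nhds x. p \<in> \<psi> ` ((\<lambda>g. g <# H) ` P \<inter> U)"
      using d(1) e1 e2
    proof eventually_elim
      case (elim p)
      then obtain u where u: "u \<in> W" "u \<in> U" "p = \<psi> u" by auto
      then have iu: "inv_into U \<psi> p = u" using dmfd_chart(2)[OF dM U] by simp
      have "s u \<in> P" using elim(1,2) s(2)[OF u(1)] gc by (simp add: iu)
      then have "u \<in> (\<lambda>g. g <# H) ` P" using s(2)[OF u(1)] by (intro rev_image_eqI[of "s u"]) simp_all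
      then show ?case unfolding u(3) using u(2) by (intro imageI IntI)
    qed
    then show "\<exists>T. open T \<and> x \<in> T \<and> T \<subseteq> \<psi> ` ((\<lambda>g. g <# H) ` P \<inter> U)"
      unfolding eventually_nhds by blast
  qed
  then show "\<forall>(U, \<psi>)\<in>AM. open (\<psi> ` ((\<lambda>g. g <# H) ` P \<inter> U))" by blast
qed

text \<open>Connectedness concerns \<open>G/H\<close>, while \<open>G\<close> may have several
  components. Stability under \<open>H\<close> makes the images of \<open>P\<close> and of its
  complement disjoint; both are open and they cover \<open>G/H\<close>.\<close>

lemma connected_saturation:
  assumes con: "connected_space (mfd_top M AM)" and P: "P \<subseteq> carrier G" "\<one> \<in> P"
    and PH: "\<And>g h. g \<in> P \<Longrightarrow> h \<in> H \<Longrightarrow> g \<otimes> h \<in> P"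
    and op: "\<And>g. g \<in> P \<Longrightarrow> \<forall>\<^sub>F p in nhds c0. g \<otimes> ip p \<in> P"
    and cl: "\<And>g. g \<in> carrier G \<Longrightarrow> g \<notin> P \<Longrightarrow> \<forall>\<^sub>F p in nhds c0. g \<otimes> ip p \<notin> P"
  shows "P = carrier G"
proof (rule ccontr)
  assume "P \<noteq> carrier G"
  then obtain g0 where g0: "g0 \<in> carrier G - P" using P(1) by auto
  let ?q = "\<lambda>g. g <# H"
  have 1: "openin (mfd_top M AM) (?q ` P)" using P(1) op by (rule openin_quotient_image)
  have 2: "openin (mfd_top M AM) (?q ` (carrier G - P))"
  proof (rule openin_quotient_image)
    fix g assume "g \<in> carrier G - P"
    then have g: "g \<in> carrier G" "g \<notin> P" by auto
    show "\<forall>\<^sub>F p in nhds c0. g \<otimes> ip p \<in> carrier G - P"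
      using cl[OF g] eventually_c0 by eventually_elim (use g in auto)
  qed auto
  have "?q ` P \<inter> ?q ` (carrier G - P) = {}"
  proof (rule ccontr)
    assume "?q ` P \<inter> ?q ` (carrier G - P) \<noteq> {}"
    then obtain g g' where g: "g \<in> P" "g' \<in> carrier G - P" "g <# H = g' <# H" by blast
    obtain h where "h \<in> H" "g' = g \<otimes> h" by (rule coset_eqE[OF g(3)]) (use g P(1) in blast)+
    then show False using PH[of g h] g by simp
  qed
  note disj = this
  have "m \<in> ?q ` P \<union> ?q ` (carrier G - P)" if "m \<in> M" for m
  proof -
    from that obtain g where g: "g \<in> carrier G" "m = g <# H" by (auto simp: LCOSETS_def)
    show ?thesis
    proof (cases "g \<in> P")
      case True
      then show ?thesis using g(2) by (intro UnI1 rev_image_eqI)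
    next
      case False
      then have "g \<in> carrier G - P" using g(1) by simp
      then show ?thesis using g(2) by (intro UnI2 rev_image_eqI)
    qed
  qed
  then have cover: "topspace (mfd_top M AM) \<subseteq> ?q ` P \<union> ?q ` (carrier G - P)"
    unfolding topspace_mfd_top[OF dM] by (rule subsetI)
  have "?q ` P \<noteq> {}" "?q ` (carrier G - P) \<noteq> {}" using P(2) g0 by blast+
  with 1 2 cover disj have "\<not> connected_space (mfd_top M AM)"
    unfolding connected_space_def not_not by (intro exI[of _ "?q ` P"] exI[of _ "?q ` (carrier G - P)"] conjI)
  then show False using con by (rule notE)
qed

end

section \<open>Holomorphic discs\<close>

text \<open>Bounds are carried along with Lipschitz constants because the estimate for a product of
  two Lipschitz maps involves the size of both factors.\<close>

definition lipb :: "'a::real_normed_vector set \<Rightarrow> ('a \<Rightarrow> 'b::real_normed_vector) \<Rightarrow> bool" where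
  "lipb S f \<longleftrightarrow> (\<exists>K B. 0 \<le> K \<and> 0 \<le> B \<and> (\<forall>p\<in>S. norm (f p) \<le> B) \<and>
    (\<forall>p\<in>S. \<forall>q\<in>S. norm (f p - f q) \<le> K * norm (p - q)))"

lemma lipbI:
  assumes "0 \<le> K" "0 \<le> B" "\<And>p. p \<in> S \<Longrightarrow> norm (f p) \<le> B"
    "\<And>p q. p \<in> S \<Longrightarrow> q \<in> S \<Longrightarrow> norm (f p - f q) \<le> K * norm (p - q)"
  shows "lipb S f"
  using assms unfolding lipb_def by blast

lemma lipbE:
  assumes "lipb S f"
  obtains K B where "0 \<le> K" "0 \<le> B" "\<And>p. p \<in> S \<Longrightarrow> norm (f p) \<le> B"
    "\<And>p q. p \<in> S \<Longrightarrow> q \<in> S \<Longrightarrow> norm (f p - f q) \<le> K * norm (p - q)"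
  using assms unfolding lipb_def by blast

lemma lipb_bilinear:
  assumes "bounded_bilinear prd" "lipb S f" "lipb S g"
  shows "lipb S (\<lambda>p. prd (f p) (g p))"
proof -
  interpret bounded_bilinear prd by fact
  obtain C where C: "C > 0" "\<And>a b. norm (prd a b) \<le> norm a * norm b * C" using pos_bounded by blast
  obtain K B where f: "0 \<le> K" "0 \<le> B" "\<And>p. p \<in> S \<Longrightarrow> norm (f p) \<le> B"
    "\<And>p q. p \<in> S \<Longrightarrow> q \<in> S \<Longrightarrow> norm (f p - f q) \<le> K * norm (p - q)" using assms(2) by (rule lipbE) blast
  obtain K' B' where g: "0 \<le> K'" "0 \<le> B'" "\<And>p. p \<in> S \<Longrightarrow> norm (g p) \<le> B'"
    "\<And>p q. p \<in> S \<Longrightarrow> q \<in> S \<Longrightarrow> norm (g p - g q) \<le> K' * norm (p - q)" using assms(3) by (rule lipbE) blast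
  show ?thesis
  proof (rule lipbI[of "(K * B' + B * K') * C" "B * B' * C"])
    fix p assume p: "p \<in> S"
    show "norm (prd (f p) (g p)) \<le> B * B' * C"
      by (rule order_trans[OF C(2)]) (use f(2) g(2) f(3)[OF p] g(3)[OF p] C(1) in \<open>intro mult_right_mono mult_mono\<close>, auto)
    fix q assume q: "q \<in> S"
    have "prd (f p) (g p) - prd (f q) (g q) = prd (f p - f q) (g p) + prd (f q) (g p - g q)"
      by (simp add: diff_left diff_right)
    then have "norm (prd (f p) (g p) - prd (f q) (g q))
        \<le> norm (f p - f q) * norm (g p) * C + norm (f q) * norm (g p - g q) * C"
      using C(2)[of "f p - f q" "g p"] C(2)[of "f q" "g p - g q"] norm_triangle_ineq order_trans
      by (smt (verit))
    also have "\<dots> \<le> (K * norm (p - q)) * B' * C + B * (K' * norm (p - q)) * C"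
      using f(4)[OF p q] g(4)[OF p q] f(3)[OF q] g(3)[OF p] f(1,2) g(1,2) C(1)
      by (intro add_mono mult_right_mono mult_mono) auto
    finally show "norm (prd (f p) (g p) - prd (f q) (g q)) \<le> (K * B' + B * K') * C * norm (p - q)"
      by (simp add: algebra_simps)
  qed (use f g C in auto)
qed

lemma lipb_linear:
  assumes "bounded_linear T" "lipb S f" shows "lipb S (\<lambda>p. T (f p))"
proof -
  interpret bounded_linear T by fact
  obtain C where C: "C \<ge> 0" "\<And>a. norm (T a) \<le> norm a * C" using nonneg_bounded by blast
  obtain K B where f: "0 \<le> K" "0 \<le> B" "\<And>p. p \<in> S \<Longrightarrow> norm (f p) \<le> B"
    "\<And>p q. p \<in> S \<Longrightarrow> q \<in> S \<Longrightarrow> norm (f p - f q) \<le> K * norm (p - q)" using assms(2) by (rule lipbE) blast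
  show ?thesis
  proof (rule lipbI[of "K * C" "B * C"])
    fix p assume p: "p \<in> S"
    show "norm (T (f p)) \<le> B * C"
      by (rule order_trans[OF C(2) mult_right_mono[OF f(3)[OF p] C(1)]])
    fix q assume q: "q \<in> S"
    have "norm (T (f p) - T (f q)) \<le> norm (f p - f q) * C" using C(2)[of "f p - f q"] by (simp add: diff)
    also have "\<dots> \<le> (K * norm (p - q)) * C" by (rule mult_right_mono[OF f(4)[OF p q] C(1)])
    finally show "norm (T (f p) - T (f q)) \<le> K * C * norm (p - q)" by (simp add: mult_ac)
  qed (use f C in auto)
qed

lemma lipb_Pair:
  assumes "lipb S f" "lipb S g" shows "lipb S (\<lambda>p. (f p, g p))"
proof -
  obtain K B where f: "0 \<le> K" "0 \<le> B" "\<And>p. p \<in> S \<Longrightarrow> norm (f p) \<le> B"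
    "\<And>p q. p \<in> S \<Longrightarrow> q \<in> S \<Longrightarrow> norm (f p - f q) \<le> K * norm (p - q)" using assms(1) by (rule lipbE) blast
  obtain K' B' where g: "0 \<le> K'" "0 \<le> B'" "\<And>p. p \<in> S \<Longrightarrow> norm (g p) \<le> B'"
    "\<And>p q. p \<in> S \<Longrightarrow> q \<in> S \<Longrightarrow> norm (g p - g q) \<le> K' * norm (p - q)" using assms(2) by (rule lipbE) blast
  show ?thesis
  proof (rule lipbI[of "K + K'" "B + B'"])
    fix p assume p: "p \<in> S"
    show "norm (f p, g p) \<le> B + B'"
      by (rule order_trans[OF norm_Pair_le add_mono[OF f(3)[OF p] g(3)[OF p]]])
    fix q assume q: "q \<in> S"
    have "norm ((f p, g p) - (f q, g q)) \<le> norm (f p - f q) + norm (g p - g q)"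
      by (simp add: norm_Pair_le)
    also have "\<dots> \<le> K * norm (p - q) + K' * norm (p - q)" by (rule add_mono[OF f(4)[OF p q] g(4)[OF p q]])
    finally show "norm ((f p, g p) - (f q, g q)) \<le> (K + K') * norm (p - q)" by (simp add: algebra_simps)
  qed (use f g in auto)
qed

lemma norm_fst_le': "norm (fst z) \<le> norm z" and norm_snd_le': "norm (snd z) \<le> norm z"
  for z :: "'b::real_normed_vector \<times> 'c::real_normed_vector"
  by (cases z, simp add: norm_fst_le norm_snd_le)+

lemma lipb_fst:
  assumes "lipb A f" "fst ` S \<subseteq> A" shows "lipb S (\<lambda>z. f (fst z))"
proof -
  obtain K B where f: "0 \<le> K" "0 \<le> B" "\<And>p. p \<in> A \<Longrightarrow> norm (f p) \<le> B"
    "\<And>p q. p \<in> A \<Longrightarrow> q \<in> A \<Longrightarrow> norm (f p - f q) \<le> K * norm (p - q)" using assms(1) by (rule lipbE) blast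
  show ?thesis
  proof (rule lipbI[OF f(1,2)])
    fix z assume z: "z \<in> S"
    then have zA: "fst z \<in> A" using assms(2) by blast
    then show "norm (f (fst z)) \<le> B" by (rule f(3))
    fix w assume "w \<in> S"
    then have "fst w \<in> A" using assms(2) by blast
    from f(4)[OF zA this] have "norm (f (fst z) - f (fst w)) \<le> K * norm (fst (z - w))" by simp
    also have "\<dots> \<le> K * norm (z - w)" using norm_fst_le'[of "z - w"] f(1)
      by (intro mult_left_mono)
    finally show "norm (f (fst z) - f (fst w)) \<le> K * norm (z - w)" .
  qed
qed

lemma lipb_snd_cball:
  fixes z0 :: "'b::real_normed_vector \<times> 'c::real_normed_vector"
  shows "lipb (cball z0 R) snd"
proof (rule lipbI[of 1 "norm (snd z0) + \<bar>R\<bar>"])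
  have le: "norm (snd z - snd w) \<le> norm (z - w)" for z w :: "'b \<times> 'c"
    using norm_snd_le'[of "z - w"] by simp
  show "norm (snd z - snd w) \<le> 1 * norm (z - w)" for z w :: "'b \<times> 'c" using le by simp
  fix z assume "z \<in> cball z0 R"
  then have "norm (snd z - snd z0) \<le> \<bar>R\<bar>" using le[of z z0] by (simp add: dist_norm norm_minus_commute)
  then show "norm (snd z) \<le> norm (snd z0) + \<bar>R\<bar>"
    using norm_triangle_ineq[of "snd z0" "snd z - snd z0"] by simp
qed auto

lemma picard_lipb:
  fixes X :: "'e::banach \<Rightarrow> 'e"
  assumes "lipb (cball x0 R) X" "R > 0"
  obtains \<epsilon> c where "\<epsilon> > 0" "c 0 = x0"
    "\<And>t. \<bar>t\<bar> < \<epsilon> \<Longrightarrow> c t \<in> cball x0 R \<and> (c has_vector_derivative X (c t)) (at t)"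
proof -
  obtain K B where X: "0 \<le> K" "0 \<le> B" "\<And>p. p \<in> cball x0 R \<Longrightarrow> norm (X p) \<le> B"
    "\<And>p q. p \<in> cball x0 R \<Longrightarrow> q \<in> cball x0 R \<Longrightarrow> norm (X p - X q) \<le> K * norm (p - q)"
    using assms(1) by (rule lipbE) blast
  \<comment> \<open>The two bounds give \<open>B * T \<le> R\<close> and
    \<open>K * T \<le> 1/2\<close>; the added 1 keeps the denominators positive.\<close>
  define T where "T = min (R / (B + 1)) (1 / (2 * (K + 1)))"
  have T: "T > 0" using assms(2) X by (simp add: T_def)
  have "B * T \<le> (B + 1) * (R / (B + 1))" using X T by (intro mult_mono) (auto simp: T_def)
  then have BT: "B * T \<le> R" using X by simp
  have "K * T \<le> (K + 1) * (1 / (2 * (K + 1)))" using X T by (intro mult_mono) (auto simp: T_def)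
  also have "\<dots> = 1/2" using X by (simp add: divide_simps)
  finally have KT: "K * T \<le> 1/2" .
  show ?thesis
    by (rule picard_lindelof[OF T X(1) less_imp_le[OF assms(2)] X(3,4) BT KT]) (use T that in blast)+
qed

context homogeneous begin

section \<open>The adjoint action in the unit chart\<close>

lemma Xr_c0 [simp]: "Xr c0 v = v"
proof -
  have "\<forall>\<^sub>F q in nhds c0. ph (ip q \<otimes> ip c0) = q"
    using eventually_c0 by eventually_elim simp
  from has_derivative_transform_eventually_nhds[OF Xr_deriv[OF c0_in] this]
  have "Xr c0 = (\<lambda>v. v)" using has_derivative_ident by (rule has_derivative_unique)
  then show ?thesis by simp
qed

text \<open>\<open>adi x g\<close> is \<open>Ad(g)\<^sup>-\<^sup>1 x\<close>.\<close>

definition adi :: "'a \<Rightarrow> 'g \<Rightarrow> 'a" where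
  "adi x g = vector_derivative (\<lambda>t. ph (inv g \<otimes> (expc x t \<otimes> g))) (at 0)"

lemma adi_deriv:
  assumes g: "g \<in> carrier G"
  shows "((\<lambda>t. ph (inv g \<otimes> (expc x t \<otimes> g))) has_vector_derivative adi x g) (at 0)"
proof -
  have "mdiff vec_atlas At (\<lambda>t. inv g \<otimes> (expc x t \<otimes> g)) 0"
    using g tangent_mdiff[OF expc_tangent]
    by (intro mdiff_mult[OF dmfd_vec] mdiff_const[OF dmfd_vec]) auto
  from mdiff_ph(2)[OF this] have "(\<lambda>t. ph (inv g \<otimes> (expc x t \<otimes> g))) differentiable (at 0)"
    using g by simp
  then show ?thesis unfolding adi_def by (simp add: vector_derivative_works)
qed

text \<open>The inverse of exp(tx) g times exp(sx) g is a conjugate of exp((s - t)x), so the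
  logarithmic derivative does not change along the curve. For a disc this makes the velocity in the
  direction t a function of s alone.\<close>

lemma tangent_expc_right:
  assumes g: "g \<in> carrier G"
  shows "tangent (\<lambda>t. expc x t \<otimes> g) t (adi x g)"
proof -
  have "mdiff vec_atlas At (\<lambda>t. expc x t \<otimes> g) t"
    using g tangent_mdiff[OF expc_tangent]
    by (intro mdiff_mult[OF dmfd_vec] mdiff_const[OF dmfd_vec]) auto
  moreover have "inv (expc x t \<otimes> g) \<otimes> (expc x s \<otimes> g) = inv g \<otimes> (expc x (1 * s + - t) \<otimes> g)" for s
    using g expc_add[of x "- t" s] by (simp add: inv_mult_group expc_minus m_assoc)
  moreover have "((\<lambda>s. ph (inv g \<otimes> (expc x (1 * s + - t) \<otimes> g))) has_vector_derivative 1 *\<^sub>R adi x g) (at t)"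
    by (rule has_vector_derivative_affine) (use adi_deriv[OF g] in simp)
  ultimately show ?thesis using g by (simp add: tangent_def)
qed

text \<open>Both sides are the chart velocity at 0 of exp(tx) times the element with coordinate
  \<open>p\<close>: once by right translation, once by left translation of the conjugated curve. The
  adjoint action is thus tied to two fields with known Lipschitz estimates.\<close>

lemma Xi_adi:
  assumes p: "p \<in> ph ` U0"
  shows "Xi p (adi x (ip p)) = Xr p x"
proof -
  have d: "((\<lambda>t. ph (expc x t)) has_vector_derivative x) (at 0)" using expc_props(2)[of x] by (simp add: o_def)
  have "((\<lambda>t. ph (ip (ph (expc x t)) \<otimes> ip p)) has_vector_derivative Xr p x) (at 0)"
    by (rule has_derivative_along_curve[where c = "\<lambda>t. ph (expc x t)", OF _ d]) (use Xr_deriv[OF p] in simp)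
  moreover have "\<forall>\<^sub>F t in nhds 0. expc x t \<in> U0"
    by (rule mdiff_ph(1)[OF tangent_mdiff[OF expc_tangent]]) simp
  then have "\<forall>\<^sub>F t in nhds 0. ph (ip (ph (expc x t)) \<otimes> ip p) = ph (expc x t \<otimes> ip p)"
    by eventually_elim simp
  ultimately have 1: "((\<lambda>t. ph (expc x t \<otimes> ip p)) has_vector_derivative Xr p x) (at 0)"
    by (rule has_vector_derivative_transform_eventually_nhds)
  have ipc: "ip p \<in> carrier G" using p by simp
  let ?c = "\<lambda>t. inv (ip p) \<otimes> (expc x t \<otimes> ip p)"
  have "((\<lambda>t. ph (ip p \<otimes> ip (ph (?c t)))) has_vector_derivative Xi p (adi x (ip p))) (at 0)"
    by (rule has_derivative_along_curve[where c = "\<lambda>t. ph (?c t)", OF _ adi_deriv[OF ipc]])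
       (use Xi_deriv[OF p] ipc in simp)
  moreover have "mdiff vec_atlas At ?c 0"
    using ipc tangent_mdiff[OF expc_tangent]
    by (intro mdiff_mult[OF dmfd_vec] mdiff_const[OF dmfd_vec]) auto
  then have "\<forall>\<^sub>F t in nhds 0. ?c t \<in> U0" by (rule mdiff_ph(1)) (use ipc in simp)
  then have "\<forall>\<^sub>F t in nhds 0. ph (ip p \<otimes> ip (ph (?c t))) = ph (expc x t \<otimes> ip p)"
    by eventually_elim (use ipc in simp)
  ultimately have "((\<lambda>t. ph (expc x t \<otimes> ip p)) has_vector_derivative Xi p (adi x (ip p))) (at 0)"
    by (rule has_vector_derivative_transform_eventually_nhds)
  then show ?thesis using 1 by (rule vector_derivative_unique_at)
qed

text \<open>On a small ball \<open>Xi p\<close> is within 1/2 of the identity, so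
  \<open>norm v \<le> 2 * norm (Xi p v)\<close>; this lower bound turns estimates for
  \<open>Xi p (adi x (ip p)) = Xr p x\<close> into estimates for \<open>adi\<close> without
  inverting \<open>Xi p\<close>.\<close>

lemma Xi_adi_lipb:
  obtains r where "r > 0" "ball c0 r \<subseteq> ph ` U0"
    "lipb (ball c0 r) (\<lambda>p. Blinfun (Xi p))" "\<And>x. lipb (ball c0 r) (\<lambda>p. adi x (ip p))"
proof -
  obtain r K where r: "r > 0" "K \<ge> 0" "ball c0 r \<subseteq> ph ` U0"
    and Xi: "\<And>p q v. p \<in> ball c0 r \<Longrightarrow> q \<in> ball c0 r \<Longrightarrow> norm (Xi p v - Xi q v) \<le> K * norm (p - q) * norm v"
    and Xr: "\<And>p q v. p \<in> ball c0 r \<Longrightarrow> q \<in> ball c0 r \<Longrightarrow> norm (Xr p v - Xr q v) \<le> K * norm (p - q) * norm v"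
    by (rule Xi_lipschitz) blast
  define R where "R = min r (1 / (2 * (K + 1)))"
  have R: "R > 0" "R \<le> r" using r by (auto simp: R_def)
  have "K * R \<le> (K + 1) * (1 / (2 * (K + 1)))" using r R by (intro mult_mono) (auto simp: R_def)
  also have "\<dots> = 1/2" using r by (simp add: divide_simps)
  finally have KR: "K * R \<le> 1/2" .
  have sub: "ball c0 R \<subseteq> ball c0 r" using R by auto
  have U: "p \<in> ph ` U0" if "p \<in> ball c0 R" for p using that sub r(3) by blast
  have small: "K * norm (p - c0) * norm v \<le> 1/2 * norm v" if "p \<in> ball c0 R" for p v
  proof -
    have "K * norm (p - c0) \<le> K * R"
      using that r(2) by (intro mult_left_mono) (auto simp: dist_norm norm_minus_commute)
    then show ?thesis using KR by (intro mult_right_mono) auto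
  qed
  have Xi_near: "norm (Xi p v - v) \<le> 1/2 * norm v" if "p \<in> ball c0 R" for p v
    using Xi[of p c0 v] small[OF that, of v] that sub r(1) by force
  have Xr_near: "norm (Xr p v - v) \<le> 1/2 * norm v" if "p \<in> ball c0 R" for p v
    using Xr[of p c0 v] small[OF that, of v] that sub r(1) by force
  have Xi_lower: "norm v \<le> 2 * norm (Xi p v)" if "p \<in> ball c0 R" for p v
    using Xi_near[OF that, of v] norm_triangle_ineq4[of "Xi p v" "Xi p v - v"] by simp
  have Xi_upper: "norm (Xi p v) \<le> 2 * norm v" if "p \<in> ball c0 R" for p v
    using Xi_near[OF that, of v] norm_triangle_sub[of "Xi p v" v] norm_ge_zero[of v] by linarith
  have Xr_upper: "norm (Xr p v) \<le> 2 * norm v" if "p \<in> ball c0 R" for p v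
    using Xr_near[OF that, of v] norm_triangle_sub[of "Xr p v" v] norm_ge_zero[of v] by linarith
  have app: "blinfun_apply (Blinfun (Xi p)) = Xi p" if "p \<in> ball c0 R" for p
    by (rule bounded_linear_Blinfun_apply[OF Xi_linear[OF U[OF that]]])
  have 1: "lipb (ball c0 R) (\<lambda>p. Blinfun (Xi p))"
  proof (rule lipbI[of K 2])
    fix p assume p: "p \<in> ball c0 R"
    show "norm (Blinfun (Xi p)) \<le> 2" using Xi_upper[OF p] by (intro norm_blinfun_bound) (simp_all add: app[OF p])
    fix q assume q: "q \<in> ball c0 R"
    show "norm (Blinfun (Xi p) - Blinfun (Xi q)) \<le> K * norm (p - q)"
    proof (rule norm_blinfun_bound)
      have "p \<in> ball c0 r" "q \<in> ball c0 r" using p q sub by blast+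
      from Xi[OF this] show "norm (blinfun_apply (Blinfun (Xi p) - Blinfun (Xi q)) v) \<le> K * norm (p - q) * norm v" for v
        by (simp add: app[OF p] app[OF q] blinfun.diff_left)
    qed (use r in simp)
  qed (use r in auto)
  have 2: "lipb (ball c0 R) (\<lambda>p. adi x (ip p))" for x
  proof -
    let ?a = "\<lambda>p. adi x (ip p)"
    have bd: "norm (?a p) \<le> 4 * norm x" if "p \<in> ball c0 R" for p
      using Xi_lower[OF that, of "?a p"] Xr_upper[OF that, of x] by (simp add: Xi_adi[OF U[OF that]])
    show ?thesis
    proof (rule lipbI[of "10 * K * norm x" "4 * norm x"])
      fix p assume p: "p \<in> ball c0 R"
      show "norm (?a p) \<le> 4 * norm x" by (rule bd[OF p])
      fix q assume q: "q \<in> ball c0 R"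
      \<comment> \<open>The difference of the equations at \<open>p\<close> and \<open>q\<close>,
        arranged so that \<open>Xi p\<close> acts on the difference sought. With
        \<open>norm (?a q) \<le> 4 * norm x\<close> the right side contributes 1 + 4, and the lower
        bound doubles this to 10.\<close>
      have "Xi p (?a p - ?a q) = (Xr p x - Xr q x) - (Xi p (?a q) - Xi q (?a q))"
        using Xi_adi[OF U[OF p]] Xi_adi[OF U[OF q]] linear_diff[OF bounded_linear.linear[OF Xi_linear[OF U[OF p]]]]
        by simp
      then have "norm (Xi p (?a p - ?a q)) \<le> norm (Xr p x - Xr q x) + norm (Xi p (?a q) - Xi q (?a q))"
        using norm_triangle_ineq4 by metis
      also have "\<dots> \<le> K * norm (p - q) * norm x + K * norm (p - q) * norm (?a q)"
        using p q sub by (intro add_mono Xi Xr) auto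
      also have "\<dots> \<le> K * norm (p - q) * norm x + K * norm (p - q) * (4 * norm x)"
        using bd[OF q] r(2) by (intro add_left_mono mult_left_mono) auto
      finally have "norm (Xi p (?a p - ?a q)) \<le> 5 * K * norm x * norm (p - q)" by (simp add: algebra_simps)
      with Xi_lower[OF p, of "?a p - ?a q"] show "norm (?a p - ?a q) \<le> 10 * K * norm x * norm (p - q)" by linarith
    qed (use r in auto)
  qed
  from R(1) U 1 2 show ?thesis using that[of R] by blast
qed

end

section \<open>Linear algebra of \<open>\<beta>\<close> and the construction of discs\<close>

lemma bounded_ops_diff [simp]: "A \<in> bounded_ops \<Longrightarrow> B \<in> bounded_ops \<Longrightarrow> A - B \<in> bounded_ops"
  by (simp add: bounded_ops_def is_clinear_def blinfun.diff_left scaleC_diff_right)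

lemma op_adj_diff:
  fixes A B :: "'v::chilbert \<Rightarrow>\<^sub>L 'v"
  assumes "A \<in> bounded_ops" "B \<in> bounded_ops"
  shows "op_adj (A - B) = op_adj A - op_adj B"
  by (rule op_adjI) (simp_all add: assms blinfun.diff_left cinner_diff_left cinner_diff_right cinner_op_adj)

lemma norm_op_scaleC_i_adj:
  fixes A :: "'v::chilbert \<Rightarrow>\<^sub>L 'v"
  assumes "A \<in> bounded_ops"
  shows "norm (op_scaleC \<i> (op_adj A)) \<le> norm A"
  by (rule norm_blinfun_bound) (simp_all add: norm_scaleC norm_op_adj_le[OF assms])

lemma has_field_derivative_if_cauchy_riemann:
  fixes k :: "complex \<Rightarrow> complex"
  assumes "(k has_derivative D) (at z)" "D \<i> = \<i> * D 1"
  shows "(k has_field_derivative D 1) (at z)"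
proof -
  have "linear D" using assms(1) has_derivative_linear by blast
  have "D h = D 1 * h" for h
  proof -
    have "D h = D (Re h *\<^sub>R 1 + Im h *\<^sub>R \<i>)" by (simp add: complex_eq scaleR_conv_of_real mult.commute flip: complex_eq)
    also have "\<dots> = Re h *\<^sub>R D 1 + Im h *\<^sub>R D \<i>" using \<open>linear D\<close> by (simp add: linear_add linear_cmul)
    also have "\<dots> = D 1 * h" unfolding assms(2)
      by (subst (2) complex_eq[of h]) (simp add: scaleR_conv_of_real algebra_simps)
    finally show ?thesis .
  qed
  then have "D = (*) (D 1)" by (rule ext)
  with assms(1) show ?thesis by (simp add: has_field_derivative_def)
qed

locale pair_rep = homogeneous G H AH AM
  for G :: "('g, 'a::banach) lie_group" (structure) and H :: "'g set"
    and AH :: "('g, 'b::banach) chart set" and AM :: "('g set, 'm::cbanach) chart set" +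
  fixes \<rho> :: "'g \<Rightarrow> 'v::chilbert \<Rightarrow>\<^sub>L 'v" and \<beta> :: "'a \<times> 'a \<Rightarrow> 'v \<Rightarrow>\<^sub>L 'v"
  assumes rep: "representation_of_pair G H AH \<qq> \<rho> \<beta>"
begin

lemma beta_ops: "\<theta> \<in> \<qq> \<Longrightarrow> \<beta> \<theta> \<in> bounded_ops"
  using rep unfolding representation_of_pair_def by blast

lemma beta_add: "z \<in> \<qq> \<Longrightarrow> w \<in> \<qq> \<Longrightarrow> \<beta> (z + w) = \<beta> z + \<beta> w"
  using rep unfolding representation_of_pair_def by blast

lemma beta_scaleR: "z \<in> \<qq> \<Longrightarrow> \<beta> (r *\<^sub>R z) = r *\<^sub>R \<beta> z"
proof -
  assume z: "z \<in> \<qq>"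
  have "cpx_scale (of_real r) z = r *\<^sub>R z" by (cases z) (simp add: cpx_scale_def)
  moreover have "\<beta> (cpx_scale (of_real r) z) = op_scaleC (of_real r) (\<beta> z)"
    using rep z unfolding representation_of_pair_def by blast
  moreover have "op_scaleC (of_real r) (\<beta> z) = r *\<^sub>R \<beta> z"
    by (rule blinfun_eqI) (simp add: scaleC_of_real blinfun.scaleR_left)
  ultimately show ?thesis by simp
qed

lemma beta_diff:
  assumes "z \<in> \<qq>" "w \<in> \<qq>"
  shows "z - w \<in> \<qq>" "\<beta> (z - w) = \<beta> z - \<beta> w"
proof -
  have w: "(-1) *\<^sub>R w \<in> \<qq>" using q_subspace(3)[OF assms(2)] .
  show "z - w \<in> \<qq>" using q_subspace(2)[OF assms(1) w] by simp
  show "\<beta> (z - w) = \<beta> z - \<beta> w"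
    using beta_add[OF assms(1) w] unfolding beta_scaleR[OF assms(2)] by simp
qed

text \<open>Continuity at 0 bounds \<open>\<beta>\<close> on a small ball of \<open>\<qq>\<close>,
  and rescaling does the rest. The values of \<open>\<beta>\<close> are controlled on the subspace
  \<open>\<qq>\<close> only, so it is not treated as a bounded linear map on the whole type.\<close>

lemma beta_bounded:
  obtains C where "C \<ge> 0" "\<And>\<theta>. \<theta> \<in> \<qq> \<Longrightarrow> norm (\<beta> \<theta>) \<le> C * norm \<theta>"
proof -
  have \<beta>0: "\<beta> 0 = 0" using beta_scaleR[OF q_subspace(1), of 0] by simp
  have "continuous_on \<qq> \<beta>" using rep unfolding representation_of_pair_def by blast
  then obtain d where d: "d > 0" "\<And>\<theta>. \<theta> \<in> \<qq> \<Longrightarrow> dist \<theta> 0 < d \<Longrightarrow> dist (\<beta> \<theta>) (\<beta> 0) < 1"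
    unfolding continuous_on_iff using q_subspace(1) zero_less_one by (metis (no_types, lifting))
  have "norm (\<beta> \<theta>) \<le> (2 / d) * norm \<theta>" if t: "\<theta> \<in> \<qq>" for \<theta>
  proof (cases "\<theta> = 0")
    case False
    define r where "r = d / (2 * norm \<theta>)"
    have r: "r > 0" using False d(1) by (simp add: r_def)
    have "norm (r *\<^sub>R \<theta>) < d" using False d(1) by (simp add: r_def)
    then have "norm (\<beta> (r *\<^sub>R \<theta>)) < 1" using d(2)[OF q_subspace(3)[OF t, of r]] by (simp add: \<beta>0)
    then have "r * norm (\<beta> \<theta>) < 1" using r by (simp add: beta_scaleR[OF t])
    then have "norm (\<beta> \<theta>) < 1 / r" using r by (simp add: field_simps)
    also have "1 / r = (2 / d) * norm \<theta>" by (simp add: r_def)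
    finally show ?thesis by simp
  qed (simp add: \<beta>0)
  then show ?thesis using that[of "2 / d"] d(1) by simp
qed

text \<open>A lift to \<open>G\<close> of the holomorphic curve \<open>t + i s \<mapsto> exp ((t + i s) x)\<close> in \<open>G/H\<close>.  Since the
  lift is \<open>exp (t x) \<sigma>(s)\<close>, its Maurer-Cartan form only depends on \<open>s\<close>, and therefore the bundle
  trivialisation \<open>W\<close> over it is obtained from a linear ordinary differential equation.\<close>

definition disc :: "'a \<Rightarrow> real \<Rightarrow> (real \<Rightarrow> 'g) \<Rightarrow> (real \<Rightarrow> 'v \<Rightarrow>\<^sub>L 'v) \<Rightarrow> bool" where
  "disc x \<epsilon> \<sigma> W \<longleftrightarrow> \<epsilon> > 0 \<and> \<sigma> 0 = \<one> \<and> W 0 = id_blinfun \<and>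
    (\<forall>s. \<bar>s\<bar> < \<epsilon> \<longrightarrow> (\<exists>b. (adi x (\<sigma> s), b) \<in> \<qq> \<and> tangent \<sigma> s b \<and>
      (W has_vector_derivative (op_scaleC \<i> (op_adj (\<beta> (adi x (\<sigma> s), b))) o\<^sub>L W s)) (at s)))"

text \<open>Taking b = L a, with \<open>L\<close> from \<open>antiholomorphic_lift\<close>, solves
  the constraint \<open>(a, b) \<in> \<qq>\<close> by a Lipschitz function of the position. The
  coordinate of \<open>\<sigma>\<close> in the unit chart and the operator \<open>W\<close> then
  form one autonomous system whose right-hand side \<open>X\<close> is \<open>lipb\<close> near the
  initial value.\<close>

lemma disc_exists: obtains \<epsilon> \<sigma> W where "disc x \<epsilon> \<sigma> W"
proof -
  obtain r where r: "r > 0" "ball c0 r \<subseteq> ph ` U0"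
    and lXi: "lipb (ball c0 r) (\<lambda>p. Blinfun (Xi p))" and la: "\<And>x. lipb (ball c0 r) (\<lambda>p. adi x (ip p))"
    by (rule Xi_adi_lipb) blast
  obtain L where L: "bounded_linear L" "\<And>x. (x, L x) \<in> \<qq>" by (rule antiholomorphic_lift) blast
  obtain C where C: "C \<ge> 0" "\<And>\<theta>. \<theta> \<in> \<qq> \<Longrightarrow> norm (\<beta> \<theta>) \<le> C * norm \<theta>" by (rule beta_bounded) blast
  define \<theta> where "\<theta> p = (adi x (ip p), L (adi x (ip p)))" for p
  define N where "N p = op_scaleC \<i> (op_adj (\<beta> (\<theta> p)))" for p
  have \<theta>q: "\<theta> p \<in> \<qq>" for p unfolding \<theta>_def by (rule L(2))
  have l\<theta>: "lipb (ball c0 r) \<theta>" unfolding \<theta>_def by (intro lipb_Pair la lipb_linear[OF L(1)])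
  have lN: "lipb (ball c0 r) N"
  proof -
    obtain K B where f: "0 \<le> K" "0 \<le> B" "\<And>p. p \<in> ball c0 r \<Longrightarrow> norm (\<theta> p) \<le> B"
      "\<And>p q. p \<in> ball c0 r \<Longrightarrow> q \<in> ball c0 r \<Longrightarrow> norm (\<theta> p - \<theta> q) \<le> K * norm (p - q)"
      using l\<theta> by (rule lipbE) blast
    show ?thesis
    proof (rule lipbI[of "C * K" "C * B"])
      fix p assume p: "p \<in> ball c0 r"
      have "norm (N p) \<le> norm (\<beta> (\<theta> p))" unfolding N_def by (rule norm_op_scaleC_i_adj[OF beta_ops[OF \<theta>q]])
      also have "\<dots> \<le> C * norm (\<theta> p)" by (rule C(2)[OF \<theta>q])
      also have "\<dots> \<le> C * B" by (rule mult_left_mono[OF f(3)[OF p] C(1)])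
      finally show "norm (N p) \<le> C * B" .
      fix q assume q: "q \<in> ball c0 r"
      have d: "\<theta> p - \<theta> q \<in> \<qq>" "\<beta> (\<theta> p - \<theta> q) = \<beta> (\<theta> p) - \<beta> (\<theta> q)" using beta_diff[OF \<theta>q \<theta>q] .
      have "N p - N q = op_scaleC \<i> (op_adj (\<beta> (\<theta> p - \<theta> q)))"
        unfolding N_def d(2) op_adj_diff[OF beta_ops[OF \<theta>q] beta_ops[OF \<theta>q]]
        by (rule blinfun_eqI) (simp add: blinfun.diff_left scaleC_diff_right)
      then have "norm (N p - N q) \<le> norm (\<beta> (\<theta> p - \<theta> q))"
        using norm_op_scaleC_i_adj[OF beta_ops[OF d(1)]] by simp
      also have "\<dots> \<le> C * norm (\<theta> p - \<theta> q)" by (rule C(2)[OF d(1)])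
      also have "\<dots> \<le> C * (K * norm (p - q))" by (rule mult_left_mono[OF f(4)[OF p q] C(1)])
      finally show "norm (N p - N q) \<le> C * K * norm (p - q)" by (simp add: mult_ac)
    qed (use C f in auto)
  qed
  define z0 :: "'a \<times> ('v \<Rightarrow>\<^sub>L 'v)" where "z0 = (c0, id_blinfun)"
  define X where "X z = (blinfun_apply (Blinfun (Xi (fst z))) (L (adi x (ip (fst z)))), N (fst z) o\<^sub>L snd z)"
    for z :: "'a \<times> ('v \<Rightarrow>\<^sub>L 'v)"
  have sub: "fst ` cball z0 (r/2) \<subseteq> ball c0 r"
  proof
    fix p assume "p \<in> fst ` cball z0 (r/2)"
    then obtain z where z: "p = fst z" "dist z0 z \<le> r/2" by auto
    have "dist c0 p \<le> dist z0 z" using dist_fst_le[of z0 z] by (simp add: z0_def z(1))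
    then show "p \<in> ball c0 r" using z(2) r(1) by simp
  qed
  have lX: "lipb (cball z0 (r/2)) X" unfolding X_def
    by (intro lipb_Pair lipb_bilinear[OF bounded_bilinear_blinfun_apply] lipb_linear[OF L(1)]
        lipb_bilinear[OF bounded_bilinear_blinfun_compose] lipb_fst[OF lXi sub] lipb_fst[OF la sub]
        lipb_fst[OF lN sub] lipb_snd_cball)
  obtain \<epsilon> c where c: "\<epsilon> > 0" "c 0 = z0"
    "\<And>t. \<bar>t\<bar> < \<epsilon> \<Longrightarrow> c t \<in> cball z0 (r/2) \<and> (c has_vector_derivative X (c t)) (at t)"
    by (rule picard_lipb[OF lX half_gt_zero[OF r(1)]]) blast
  have "disc x \<epsilon> (\<lambda>s. ip (fst (c s))) (\<lambda>s. snd (c s))"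
    unfolding disc_def
  proof (intro conjI allI impI)
    show "\<epsilon> > 0" by (rule c)
    show "ip (fst (c 0)) = \<one>" "snd (c 0) = id_blinfun" by (simp_all add: c(2) z0_def)
    fix s assume s: "\<bar>s\<bar> < \<epsilon>"
    have "fst (c s) \<in> ball c0 r" using c(3)[OF s] sub by blast
    then have p: "fst (c s) \<in> ph ` U0" using r(2) by blast
    have d: "((\<lambda>s. fst (c s)) has_vector_derivative fst (X (c s))) (at s)"
      "((\<lambda>s. snd (c s)) has_vector_derivative snd (X (c s))) (at s)"
      using c(3)[OF s] bounded_linear.has_vector_derivative[OF bounded_linear_fst]
        bounded_linear.has_vector_derivative[OF bounded_linear_snd] by blast+
    have "fst (X (c s)) = Xi (fst (c s)) (L (adi x (ip (fst (c s)))))"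
      by (simp add: X_def bounded_linear_Blinfun_apply[OF Xi_linear[OF p]])
    then have "tangent (\<lambda>s. ip (fst (c s))) s (L (adi x (ip (fst (c s)))))"
      using d(1) p by (intro tangent_chart_curve) simp_all
    moreover have "((\<lambda>s. snd (c s)) has_vector_derivative
        (op_scaleC \<i> (op_adj (\<beta> (adi x (ip (fst (c s))), L (adi x (ip (fst (c s))))))) o\<^sub>L snd (c s))) (at s)"
      using d(2) by (simp add: X_def N_def \<theta>_def)
    ultimately show "\<exists>b. (adi x (ip (fst (c s))), b) \<in> \<qq> \<and> tangent (\<lambda>s. ip (fst (c s))) s b \<and>
      ((\<lambda>s. snd (c s)) has_vector_derivative
        (op_scaleC \<i> (op_adj (\<beta> (adi x (ip (fst (c s))), b))) o\<^sub>L snd (c s))) (at s)"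
      using L(2) by blast
  qed
  then show ?thesis by (rule that)
qed

text \<open>The infinitesimal half of the condition on holomorphic sections, separated from
  equivariance under \<open>H\<close>. It passes to differences and to images under operators
  commuting with \<open>\<beta>\<close>, such as \<open>B\<close>.\<close>

definition sol :: "('g \<Rightarrow> 'v) \<Rightarrow> bool" where
  "sol f \<longleftrightarrow> (\<forall>g\<in>carrier G. mdiff At vec_atlas f g) \<and>
    (\<forall>\<theta>\<in>\<qq>. \<forall>g\<in>carrier G. cpx_lie_deriv G \<theta> f g = - \<beta> \<theta> (f g))"

text \<open>Let u be the values of \<open>f\<close> on the disc, \<omega> = W w and B the value of
  \<open>\<beta>\<close> at the current velocities. Then u_t + i u_s = - B u, while the s-derivative
  of \<omega> is i times the adjoint of B applied to \<omega>. As \<open>cinner\<close> is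
  antilinear on the right, this contributes exactly the term that cancels - B u in the
  Cauchy-Riemann equation of the pairing.\<close>

lemma disc_holomorphic:
  assumes disc: "disc x \<epsilon> \<sigma> W" and f: "sol f" and g0: "g0 \<in> carrier G"
  shows "(\<lambda>z. cinner (f (g0 \<otimes> (expc x (Re z) \<otimes> \<sigma> (Im z)))) (W (Im z) w)) holomorphic_on {z. \<bar>Im z\<bar> < \<epsilon>}"
    (is "?k holomorphic_on _")
proof -
  define u where "u z = f (g0 \<otimes> (expc x (Re z) \<otimes> \<sigma> (Im z)))" for z
  have "\<exists>d. (?k has_field_derivative d) (at z)" if z: "\<bar>Im z\<bar> < \<epsilon>" for z
  proof -
    define t s where "t = Re z" and "s = Im z"
    define a where "a = adi x (\<sigma> s)"
    from disc z obtain b where b: "(a, b) \<in> \<qq>" "tangent \<sigma> s b"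
      "(W has_vector_derivative (op_scaleC \<i> (op_adj (\<beta> (a, b))) o\<^sub>L W s)) (at s)"
      unfolding disc_def a_def s_def by blast
    define B where "B = \<beta> (a, b)"
    have B: "B \<in> bounded_ops" unfolding B_def by (rule beta_ops[OF b(1)])
    define \<omega> where "\<omega> s = W s w" for s
    have \<omega>: "(\<omega> has_vector_derivative (\<i> *\<^sub>C op_adj B (\<omega> s))) (at s)"
      using bounded_linear.has_vector_derivative[OF blinfun.bounded_linear_left[of w] b(3)]
      by (simp add: \<omega>_def[abs_def] B_def)
    have \<sigma>c: "\<sigma> s \<in> carrier G" using b(2) by (rule tangent_carrier)
    define g1 where "g1 = g0 \<otimes> (expc x t \<otimes> \<sigma> s)"
    have g1: "g1 \<in> carrier G" using g0 \<sigma>c by (simp add: g1_def)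
    have mf: "mdiff At vec_atlas f g1" using f g1 by (simp add: sol_def)
    have dRe: "Re differentiable (at z)" "Im differentiable (at z)"
      by (rule bounded_linear_imp_differentiable, rule bounded_linear_Re bounded_linear_Im)+
    have m1: "mdiff vec_atlas At (\<lambda>z. expc x (Re z)) z"
      using mdiff_compose[OF dmfd_vec dmfd_vec, of Re z At "expc x"] dRe tangent_mdiff[OF expc_tangent] by simp
    have m2: "mdiff vec_atlas At (\<lambda>z. \<sigma> (Im z)) z"
      using mdiff_compose[OF dmfd_vec dmfd_vec, of Im z At \<sigma>] dRe tangent_mdiff[OF b(2)] by (simp add: s_def)
    have "mdiff vec_atlas At (\<lambda>z. g0 \<otimes> (expc x (Re z) \<otimes> \<sigma> (Im z))) z"
      using g0 \<sigma>c by (intro mdiff_mult[OF dmfd_vec] mdiff_const[OF dmfd_vec] m1 m2) (auto simp: s_def)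
    from mdiff_to_vec[OF this, of f] have "u differentiable (at z)"
      using g1 mf by (simp add: u_def[abs_def] g1_def t_def s_def)
    then obtain Du where Du: "(u has_derivative Du) (at z)" by (auto simp: differentiable_def)
    have uz: "u z = f g1" by (simp add: u_def g1_def t_def s_def)
    \<comment> \<open>The differential in the directions 1 and i gives the two left invariant
      derivatives that occur in the equation over \<open>\<qq>\<close>: \<open>a\<close> from moving
      exp, and below \<open>b\<close> from moving \<open>\<sigma>\<close>.\<close>
    have Du1: "Du 1 = lie_deriv G a f g1"
    proof -
      have "((\<lambda>r. Complex r s) has_vector_derivative 1) (at t)"
        unfolding has_vector_derivative_def Complex_eq
        by (auto intro!: derivative_eq_intros simp: scaleR_conv_of_real mult.commute)
      from has_derivative_along_curve[of u Du, OF _ this] Du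
      have 1: "((\<lambda>r. u (Complex r s)) has_vector_derivative Du 1) (at t)" by (simp add: t_def s_def)
      have "tangent (\<lambda>r. g0 \<otimes> (expc x r \<otimes> \<sigma> s)) t a"
        unfolding a_def by (intro tangent_left tangent_expc_right \<sigma>c g0)
      from tangent_chain[OF this, of f] mf
      have "((\<lambda>r. u (Complex r s)) has_vector_derivative gd f g1 a) (at t)"
        by (simp add: u_def g1_def)
      with 1 show ?thesis unfolding lie_deriv_eq_gd[OF mf g1] by (rule vector_derivative_unique_at)
    qed
    have Dui: "Du \<i> = lie_deriv G b f g1"
    proof -
      have "((\<lambda>r. Complex t r) has_vector_derivative \<i>) (at s)"
        unfolding has_vector_derivative_def Complex_eq
        by (auto intro!: derivative_eq_intros simp: scaleR_conv_of_real mult.commute)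
      from has_derivative_along_curve[of u Du, OF _ this] Du
      have 1: "((\<lambda>r. u (Complex t r)) has_vector_derivative Du \<i>) (at s)" by (simp add: t_def s_def)
      have "tangent (\<lambda>r. g0 \<otimes> (expc x t \<otimes> \<sigma> r)) s b"
        by (intro tangent_left b(2) expc_carrier g0)
      from tangent_chain[OF this, of f] mf
      have "((\<lambda>r. u (Complex t r)) has_vector_derivative gd f g1 b) (at s)"
        by (simp add: u_def g1_def)
      with 1 show ?thesis unfolding lie_deriv_eq_gd[OF mf g1] by (rule vector_derivative_unique_at)
    qed
    have cr: "Du 1 + \<i> *\<^sub>C Du \<i> = - B (u z)"
      using f b(1) g1 unfolding sol_def Du1 Dui uz B_def by (fastforce simp: cpx_lie_deriv_def)
    have d\<omega>: "((\<lambda>z. \<omega> (Im z)) has_derivative (\<lambda>h. Im h *\<^sub>R (\<i> *\<^sub>C op_adj B (\<omega> s)))) (at z)"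
      using diff_chain_at[OF bounded_linear_imp_has_derivative[OF bounded_linear_Im], of \<omega> _ z] \<omega>
      by (simp add: has_vector_derivative_def o_def s_def)
    define D where "D h = cinner (u z) (Im h *\<^sub>R (\<i> *\<^sub>C op_adj B (\<omega> s))) + cinner (Du h) (\<omega> s)" for h
    have D: "(?k has_derivative D) (at z)"
      using bounded_bilinear.FDERIV[OF bounded_bilinear_cinner Du d\<omega>]
      by (simp add: u_def[abs_def] \<omega>_def D_def[abs_def] s_def)
    have "D \<i> = \<i> * D 1"
    proof -
      have "Du 1 = - B (u z) - \<i> *\<^sub>C Du \<i>" using cr by (simp add: eq_diff_eq)
      then have X: "cinner (Du 1) (\<omega> s) = - cinner (B (u z)) (\<omega> s) - \<i> * cinner (Du \<i>) (\<omega> s)"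
        by (simp add: cinner_diff_left cinner_scaleC_left)
      have "D \<i> = - \<i> * cinner (B (u z)) (\<omega> s) + cinner (Du \<i>) (\<omega> s)"
        by (simp add: D_def cinner_scaleC_right cinner_op_adj[OF B])
      also have "\<dots> = \<i> * (- cinner (B (u z)) (\<omega> s) - \<i> * cinner (Du \<i>) (\<omega> s))"
        by (simp add: right_diff_distrib flip: mult.assoc)
      also have "\<dots> = \<i> * D 1" unfolding X[symmetric] by (simp add: D_def)
      finally show ?thesis .
    qed
    from has_field_derivative_if_cauchy_riemann[OF D this] show ?thesis by blast
  qed
  moreover have "open {z. \<bar>Im z\<bar> < \<epsilon>}" by (intro open_Collect_less continuous_intros)
  ultimately show ?thesis by (auto simp: holomorphic_on_open)
qed

end

section \<open>Holomorphically induced representations\<close>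

lemma blinfun_left_inverse_eq:
  assumes "A o\<^sub>L B = id_blinfun" "B o\<^sub>L C = id_blinfun"
  shows "A = C"
proof (rule blinfun_eqI)
  fix v
  have "A (B (C v)) = C v" using fun_cong[OF arg_cong[OF assms(1), of blinfun_apply], of "C v"] by simp
  moreover have "B (C v) = v" using fun_cong[OF arg_cong[OF assms(2), of blinfun_apply], of v] by simp
  ultimately show "A v = C v" by simp
qed

lemma unitary_op_norm:
  fixes U :: "'v::chilbert \<Rightarrow>\<^sub>L 'v"
  assumes "unitary_op U" shows "norm (U v) = norm v"
proof -
  have U: "U \<in> bounded_ops" "op_adj U o\<^sub>L U = id_blinfun" using assms by (auto simp: unitary_op_def)
  have "op_adj U (U v) = v" using U(2) by (metis blinfun_apply_blinfun_compose blinfun_apply_id_blinfun id_apply)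
  then have "cinner (U v) (U v) = cinner v v" by (simp add: cinner_op_adj[OF U(1)])
  then have "complex_of_real ((norm (U v))\<^sup>2) = complex_of_real ((norm v)\<^sup>2)" unfolding cinner_self .
  then show ?thesis unfolding of_real_eq_iff by simp
qed

context pair_rep begin

lemma cpx_lie_deriv_gd:
  assumes "mdiff At vec_atlas f g" "g \<in> carrier G"
  shows "cpx_lie_deriv G (x, y) f g = gd f g x + \<i> *\<^sub>C gd f g y"
  by (simp add: cpx_lie_deriv_def lie_deriv_eq_gd[OF assms])

lemma sol_mdiff: "sol f \<Longrightarrow> g \<in> carrier G \<Longrightarrow> mdiff At vec_atlas f g"
  by (simp add: sol_def)

lemma sol_gd: "sol f \<Longrightarrow> g \<in> carrier G \<Longrightarrow> (x, y) \<in> \<qq> \<Longrightarrow>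
    gd f g x + \<i> *\<^sub>C gd f g y = - \<beta> (x, y) (f g)"
  using cpx_lie_deriv_gd[OF sol_mdiff] unfolding sol_def by (metis (no_types, lifting))

lemma mdiff_linear_comp:
  assumes "mdiff At vec_atlas f g" "g \<in> carrier G" "bounded_linear T"
  shows "mdiff At vec_atlas (\<lambda>g. T (f g)) g"
  using mdiff_compose[OF dG dmfd_vec, of f g vec_atlas T] assms bounded_linear_imp_differentiable
  by auto

lemma gd_linear_comp:
  assumes "mdiff At vec_atlas f g" "g \<in> carrier G" "bounded_linear T"
  shows "gd (\<lambda>g. T (f g)) g x = T (gd f g x)"
proof -
  have "((\<lambda>p. T (f (g \<otimes> ip p))) has_derivative (\<lambda>x. T (gd f g x))) (at c0)"
    by (rule bounded_linear.has_derivative[OF assms(3) gd_has_derivative[OF assms(1,2)]])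
  from has_derivative_unique[OF gd_has_derivative[OF mdiff_linear_comp[OF assms] assms(2)] this]
  show ?thesis by (rule fun_cong)
qed

lemma mdiff_vec_diff:
  assumes "mdiff At vec_atlas f g" "mdiff At vec_atlas f' g"
  shows "mdiff At vec_atlas (\<lambda>g. f g - f' g) g"
proof (rule mdiffI)
  fix U \<phi> V \<psi> assume c: "(U, \<phi>) \<in> At" "g \<in> U" "(V, \<psi>) \<in> vec_atlas" "f g - f' g \<in> V"
  have V: "V = UNIV" "\<psi> = id" using c(3) by (auto simp: vec_atlas_def)
  have i: "(UNIV, id) \<in> (vec_atlas :: ('z, 'z::banach) chart set)" by (simp add: vec_atlas_def)
  have "(\<lambda>p. f (inv_into U \<phi> p)) differentiable (at (\<phi> g))" "(\<lambda>p. f' (inv_into U \<phi> p)) differentiable (at (\<phi> g))"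
    using mdiffD(2)[OF assms(1) c(1,2) i] mdiffD(2)[OF assms(2) c(1,2) i] by simp_all
  then show "(\<forall>\<^sub>F p in nhds (\<phi> g). p \<in> \<phi> ` U \<and> f (inv_into U \<phi> p) - f' (inv_into U \<phi> p) \<in> V) \<and>
      (\<lambda>p. \<psi> (f (inv_into U \<phi> p) - f' (inv_into U \<phi> p))) differentiable (at (\<phi> g))"
    unfolding V using eventually_in_chart[OF dG c(1,2)] by (simp add: differentiable_diff)
qed

lemma gd_diff:
  assumes "mdiff At vec_atlas f g" "mdiff At vec_atlas f' g" "g \<in> carrier G"
  shows "gd (\<lambda>g. f g - f' g) g x = gd f g x - gd f' g x"
proof -
  have "((\<lambda>p. f (g \<otimes> ip p) - f' (g \<otimes> ip p)) has_derivative (\<lambda>x. gd f g x - gd f' g x)) (at c0)"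
    by (rule has_derivative_diff[OF gd_has_derivative[OF assms(1,3)] gd_has_derivative[OF assms(2,3)]])
  from has_derivative_unique[OF gd_has_derivative[OF mdiff_vec_diff[OF assms(1,2)] assms(3)] this]
  show ?thesis by (rule fun_cong)
qed

lemma solI:
  assumes "\<And>g. g \<in> carrier G \<Longrightarrow> mdiff At vec_atlas f g"
    and "\<And>x y g. (x, y) \<in> \<qq> \<Longrightarrow> g \<in> carrier G \<Longrightarrow> gd f g x + \<i> *\<^sub>C gd f g y = - \<beta> (x, y) (f g)"
  shows "sol f"
  unfolding sol_def
proof (intro conjI ballI)
  fix \<theta> g assume "\<theta> \<in> \<qq>" "g \<in> carrier G"
  then show "cpx_lie_deriv G \<theta> f g = - \<beta> \<theta> (f g)"
    using assms by (cases \<theta>) (simp add: cpx_lie_deriv_gd)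
qed (use assms in auto)

lemma sol_diff:
  assumes "sol f" "sol f'" shows "sol (\<lambda>g. f g - f' g)"
proof (rule solI)
  fix g assume g: "g \<in> carrier G"
  note m = sol_mdiff[OF assms(1) g] sol_mdiff[OF assms(2) g]
  show "mdiff At vec_atlas (\<lambda>g. f g - f' g) g" using m by (rule mdiff_vec_diff)
  fix x y assume q: "(x, y) \<in> \<qq>"
  have "gd (\<lambda>g. f g - f' g) g x + \<i> *\<^sub>C gd (\<lambda>g. f g - f' g) g y
      = (gd f g x + \<i> *\<^sub>C gd f g y) - (gd f' g x + \<i> *\<^sub>C gd f' g y)"
    by (simp add: gd_diff[OF m g] scaleC_diff_right)
  also have "\<dots> = - \<beta> (x, y) (f g - f' g)"
    by (simp add: sol_gd[OF assms(1) g q] sol_gd[OF assms(2) g q] blinfun.diff_right)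
  finally show "gd (\<lambda>g. f g - f' g) g x + \<i> *\<^sub>C gd (\<lambda>g. f g - f' g) g y = - \<beta> (x, y) (f g - f' g)" .
qed

lemma sol_op:
  assumes f: "sol f" and A: "A \<in> bounded_ops" "\<And>\<theta> v. \<theta> \<in> \<qq> \<Longrightarrow> A (\<beta> \<theta> v) = \<beta> \<theta> (A v)"
  shows "sol (\<lambda>g. A (f g))"
proof (rule solI)
  fix g assume g: "g \<in> carrier G"
  note m = sol_mdiff[OF f g]
  have T: "bounded_linear (blinfun_apply A)" by (rule blinfun.bounded_linear_right)
  show "mdiff At vec_atlas (\<lambda>g. A (f g)) g" by (rule mdiff_linear_comp[OF m g T])
  fix x y assume q: "(x, y) \<in> \<qq>"
  have "gd (\<lambda>g. A (f g)) g x + \<i> *\<^sub>C gd (\<lambda>g. A (f g)) g y = A (gd f g x + \<i> *\<^sub>C gd f g y)"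
    by (simp add: gd_linear_comp[OF m g T] is_clinear_add[OF bounded_opsD[OF A(1)]]
        is_clinear_scaleC[OF bounded_opsD[OF A(1)]])
  also have "\<dots> = - \<beta> (x, y) (A (f g))" by (simp add: sol_gd[OF f g q] blinfun.minus_right A(2)[OF q])
  finally show "gd (\<lambda>g. A (f g)) g x + \<i> *\<^sub>C gd (\<lambda>g. A (f g)) g y = - \<beta> (x, y) (A (f g))" .
qed

section \<open>Fibres of the associated bundle\<close>

lemma rho_one: "\<rho> \<one> = id_blinfun" and rho_unitary: "h \<in> H \<Longrightarrow> unitary_op (\<rho> h)"
  and rho_mult: "h \<in> H \<Longrightarrow> k \<in> H \<Longrightarrow> \<rho> (h \<otimes> k) = \<rho> h o\<^sub>L \<rho> k"
  using rep unfolding representation_of_pair_def unitary_hom_def by auto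

lemma in_bdl_class:
  assumes "g \<in> carrier G" shows "(g, v) \<in> bdl_class G H \<rho> g v"
proof -
  have "(g, v) = (g \<otimes> inv \<one>, \<rho> \<one> v)" using assms by (simp add: rho_one)
  then show ?thesis unfolding bdl_class_def using H_one by blast
qed

text \<open>Equal first components force h to be the unit, so over each group element a class
  contains exactly one vector; this is what determines \<open>hat_section\<close>.\<close>

lemma bdl_class_unique:
  assumes "(g, v) \<in> bdl_class G H \<rho> g w" "g \<in> carrier G" shows "v = w"
proof -
  obtain h where h: "h \<in> H" "g = g \<otimes> inv h" "v = \<rho> h w" using assms(1) by (auto simp: bdl_class_def)
  have "inv h = inv g \<otimes> (g \<otimes> inv h)" using h(1) assms(2) by simp
  also have "\<dots> = \<one>" using assms(2) by (simp only: h(2)[symmetric] l_inv)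
  finally have "inv h = \<one>" .
  then have "h = \<one>" using h(1) by (metis H_carrier inv_inv inv_one)
  then show ?thesis using h(3) by (simp add: rho_one)
qed

lemma fiber_norm_bdl_class:
  assumes "g \<in> carrier G" shows "fiber_norm (bdl_class G H \<rho> g v) = norm v"
  unfolding fiber_norm_def
proof (rule the_equality)
  show "\<forall>(g', v')\<in>bdl_class G H \<rho> g v. norm v' = norm v"
    using unitary_op_norm[OF rho_unitary] by (auto simp: bdl_class_def)
  fix r assume "\<forall>(g', v')\<in>bdl_class G H \<rho> g v. norm v' = r"
  then show "r = norm v" using in_bdl_class[OF assms, of v] by blast
qed

end

locale induced = pair_rep G H AH AM \<rho> \<beta>
  for G :: "('g, 'a::banach) lie_group" (structure) and H :: "'g set"
    and AH :: "('g, 'b::banach) chart set" and AM :: "('g set, 'm::cbanach) chart set"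
    and \<rho> :: "'g \<Rightarrow> 'v::chilbert \<Rightarrow>\<^sub>L 'v" and \<beta> :: "'a \<times> 'a \<Rightarrow> 'v \<Rightarrow>\<^sub>L 'v" +
  fixes \<pi> :: "'g \<Rightarrow> 'h::chilbert \<Rightarrow>\<^sub>L 'h" and \<Psi> :: "'h \<Rightarrow> 'g set \<Rightarrow> ('g \<times> 'v) set"
  assumes ind: "holomorphically_induced_via G H AM \<rho> \<beta> \<pi> \<Psi>"
begin

abbreviation hat :: "'h \<Rightarrow> 'g \<Rightarrow> 'v" where "hat \<xi> \<equiv> hat_section G H \<rho> (\<Psi> \<xi>)"
abbreviation ev :: "'h \<Rightarrow> 'v" where "ev \<equiv> ev_unit G H \<rho> \<Psi>"
abbreviation emb :: "'v \<Rightarrow> 'h" where "emb \<equiv> embed_V G H \<rho> \<Psi>"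

lemma Psi_section: "\<Psi> \<xi> \<in> holomorphic_sections G H \<qq> \<rho> \<beta>"
  using ind unfolding holomorphically_induced_via_def by blast

lemma Psi_eq: "g \<in> carrier G \<Longrightarrow> \<Psi> \<xi> (g <# H) = bdl_class G H \<rho> g (hat \<xi> g)"
  using Psi_section[of \<xi>] unfolding holomorphic_sections_def by blast

lemma hat_H: "g \<in> carrier G \<Longrightarrow> h \<in> H \<Longrightarrow> hat \<xi> (g \<otimes> h) = \<rho> (inv h) (hat \<xi> g)"
  using Psi_section[of \<xi>] unfolding holomorphic_sections_def by blast

lemma hat_sol: "sol (hat \<xi>)"
proof -
  have s: "mfd_map frechet_smooth_on (carrier G) At UNIV vec_atlas (hat \<xi>)"
    "\<forall>x\<in>\<qq>. \<forall>g\<in>carrier G. cpx_lie_deriv G x (hat \<xi>) g = - \<beta> x (hat \<xi> g)"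
    using Psi_section[of \<xi>] unfolding holomorphic_sections_def by blast+
  then show ?thesis unfolding sol_def using mdiff_if_smooth_map[OF dG s(1)] by blast
qed

lemma hat_eqI:
  assumes "g \<in> carrier G" "(g, v) \<in> \<Psi> \<xi> (g <# H)" shows "hat \<xi> g = v"
  using bdl_class_unique[of g v "hat \<xi> g"] assms Psi_eq by metis

lemma hat_mem: "g \<in> carrier G \<Longrightarrow> (g, hat \<xi> g) \<in> \<Psi> \<xi> (g <# H)"
  by (simp add: Psi_eq in_bdl_class)

lemma hat_add: "g \<in> carrier G \<Longrightarrow> hat (\<xi> + \<eta>) g = hat \<xi> g + hat \<eta> g"
proof (rule hat_eqI)
  assume g: "g \<in> carrier G"
  have "\<Psi> (\<xi> + \<eta>) (g <# H) = fiber_add (\<Psi> \<xi> (g <# H)) (\<Psi> \<eta> (g <# H))"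
    using ind coset_in_M[OF g] unfolding holomorphically_induced_via_def by blast
  then show "(g, hat \<xi> g + hat \<eta> g) \<in> \<Psi> (\<xi> + \<eta>) (g <# H)"
    unfolding fiber_add_def using hat_mem[OF g] by blast
qed

lemma hat_scale: "g \<in> carrier G \<Longrightarrow> hat (c *\<^sub>C \<xi>) g = c *\<^sub>C hat \<xi> g"
proof (rule hat_eqI)
  assume g: "g \<in> carrier G"
  have "\<Psi> (c *\<^sub>C \<xi>) (g <# H) = fiber_scale c (\<Psi> \<xi> (g <# H))"
    using ind coset_in_M[OF g] unfolding holomorphically_induced_via_def by blast
  then show "(g, c *\<^sub>C hat \<xi> g) \<in> \<Psi> (c *\<^sub>C \<xi>) (g <# H)"
    unfolding fiber_scale_def using hat_mem[OF g] by blast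
qed

lemma hat_pi:
  assumes g: "g \<in> carrier G" and k: "k \<in> carrier G"
  shows "hat (\<pi> k \<xi>) g = hat \<xi> (inv k \<otimes> g)"
proof (rule hat_eqI[OF g])
  have kg: "inv k \<otimes> g \<in> carrier G" using g k by simp
  have "\<Psi> (\<pi> k \<xi>) = section_act G H k (\<Psi> \<xi>)"
    using ind k unfolding holomorphically_induced_via_def by blast
  then have "\<Psi> (\<pi> k \<xi>) (g <# H) = (\<lambda>(x, v). (k \<otimes> x, v)) ` \<Psi> \<xi> (inv k <# (g <# H))"
    using coset_in_M[OF g] by (simp add: section_act_def)
  also have "inv k <# (g <# H) = (inv k \<otimes> g) <# H"
    by (rule lcos_m_assoc) (use g k in auto)
  finally have "\<Psi> (\<pi> k \<xi>) (g <# H) = (\<lambda>(x, v). (k \<otimes> x, v)) ` \<Psi> \<xi> ((inv k \<otimes> g) <# H)" .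
  moreover have "(g, hat \<xi> (inv k \<otimes> g)) = (\<lambda>(x, v). (k \<otimes> x, v)) (inv k \<otimes> g, hat \<xi> (inv k \<otimes> g))"
    using g k by simp
  ultimately show "(g, hat \<xi> (inv k \<otimes> g)) \<in> \<Psi> (\<pi> k \<xi>) (g <# H)"
    using hat_mem[OF kg, of \<xi>] by (metis imageI)
qed

lemma hat_one: "hat \<xi> \<one> = ev \<xi>" by (simp add: ev_unit_def)

text \<open>Translates values of sections into \<open>ev\<close> and \<open>\<pi>\<close>, where
  adjoints can be taken.\<close>

lemma hat_ev: "g \<in> carrier G \<Longrightarrow> hat \<xi> g = ev (\<pi> (inv g) \<xi>)"
  using hat_pi[of \<one> "inv g" \<xi>] by (simp add: hat_one)

lemma pi_unitary: "g \<in> carrier G \<Longrightarrow> unitary_op (\<pi> g)" and pi_one: "\<pi> \<one> = id_blinfun"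
  and pi_mult: "g \<in> carrier G \<Longrightarrow> h \<in> carrier G \<Longrightarrow> \<pi> (g \<otimes> h) = \<pi> g o\<^sub>L \<pi> h"
  using ind unfolding holomorphically_induced_via_def unitary_rep_def unitary_hom_def by auto

lemma pi_ops: "g \<in> carrier G \<Longrightarrow> \<pi> g \<in> bounded_ops"
  using pi_unitary by (simp add: unitary_op_def)

lemma pi_adj: assumes g: "g \<in> carrier G" shows "op_adj (\<pi> g) = \<pi> (inv g)"
proof -
  have "op_adj (\<pi> g) o\<^sub>L \<pi> g = id_blinfun" using pi_unitary[OF g] by (simp add: unitary_op_def)
  moreover have "\<pi> g o\<^sub>L \<pi> (inv g) = id_blinfun" using pi_mult[of g "inv g"] g by (simp add: pi_one)
  ultimately show ?thesis by (rule blinfun_left_inverse_eq)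
qed

lemma cinner_pi: "g \<in> carrier G \<Longrightarrow> cinner (\<pi> g \<xi>) \<eta> = cinner \<xi> (\<pi> (inv g) \<eta>)"
  using cinner_op_adj[OF pi_ops] pi_adj by metis

lemma rho_ops: "h \<in> H \<Longrightarrow> \<rho> h \<in> bounded_ops"
  using rho_unitary by (simp add: unitary_op_def)

lemma rho_adj: assumes h: "h \<in> H" shows "op_adj (\<rho> h) = \<rho> (inv h)"
proof -
  have "op_adj (\<rho> h) o\<^sub>L \<rho> h = id_blinfun" using rho_unitary[OF h] by (simp add: unitary_op_def)
  moreover have "\<rho> h o\<^sub>L \<rho> (inv h) = id_blinfun" using rho_mult[of h "inv h"] h by (simp add: rho_one)
  ultimately show ?thesis by (rule blinfun_left_inverse_eq)
qed

lemma ev_clinear: "is_clinear ev"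
  unfolding is_clinear_def using hat_add[of \<one>] hat_scale[of \<one>] by (simp add: hat_one)

lemma ev_bounded: "bounded_linear ev"
proof -
  have "\<exists>C. \<forall>v. fiber_norm (\<Psi> v H) \<le> C * norm v"
    using ind H_in_M unfolding holomorphically_induced_via_def by blast
  then obtain C where C: "\<And>v. fiber_norm (\<Psi> v H) \<le> C * norm v" by blast
  have "norm (ev v) \<le> norm v * C" for v
    using C[of v] Psi_eq[of \<one> v] fiber_norm_bdl_class[of \<one>] by (simp add: hat_one mult.commute)
  then show ?thesis
    by (intro bounded_linear_intro[of _ C]) (simp_all add: is_clinearD[OF ev_clinear])
qed

lemma emb_def: "emb = cadj ev" by (simp add: embed_V_def fun_eq_iff)

lemma cinner_ev: "cinner (ev \<xi>) v = cinner \<xi> (emb v)"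
  unfolding emb_def by (rule cadj_works[OF ev_bounded ev_clinear])

lemma cinner_emb: "cinner (emb v) \<xi> = cinner v (ev \<xi>)"
  using cinner_ev[of \<xi> v] by (metis cinner_commute)

lemma emb_clinear: "is_clinear emb"
  unfolding emb_def by (rule is_clinear_cadj[OF ev_bounded ev_clinear])

lemma emb_bounded: "bounded_linear emb"
  unfolding emb_def by (rule bounded_linear_cadj[OF ev_bounded ev_clinear])

lemma ev_emb [simp]: "ev (emb v) = v"
  using ind unfolding holomorphically_induced_via_def emb_def by (metis comp_apply id_apply)

lemma cinner_emb_emb: "cinner (emb v) (emb w) = cinner v w"
  by (simp add: cinner_emb)

lemma norm_emb: "norm (emb v) = norm v"
proof -
  have "complex_of_real ((norm (emb v))\<^sup>2) = of_real ((norm v)\<^sup>2)"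
    unfolding cinner_self[symmetric] by (rule cinner_emb_emb)
  then show ?thesis unfolding of_real_eq_iff by simp
qed

text \<open>Dual to the equivariance of \<open>hat\<close> under \<open>H\<close> at the unit; it
  exhibits \<open>\<rho>\<close> as the action of \<open>H\<close> on the embedded copy of
  \<open>V\<close>.\<close>

lemma pi_emb: assumes h: "h \<in> H" shows "\<pi> h (emb v) = emb (\<rho> h v)"
proof (rule cinner_eqI)
  fix z
  have "cinner z (\<pi> h (emb v)) = cinner (\<pi> (inv h) z) (emb v)"
    using cinner_op_adj'[OF pi_ops, of h z "emb v"] h by (simp add: pi_adj)
  also have "\<dots> = cinner (hat z h) v" using h by (simp add: cinner_ev[symmetric] hat_ev)
  also have "hat z h = \<rho> (inv h) (ev z)" using hat_H[of \<one> h z] h by (simp add: hat_one)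
  also have "cinner (\<rho> (inv h) (ev z)) v = cinner (ev z) (\<rho> h v)"
    using cinner_op_adj'[OF rho_ops[OF h], of "ev z" v] h by (simp add: rho_adj)
  also have "\<dots> = cinner z (emb (\<rho> h v))" by (rule cinner_ev)
  finally show "cinner z (\<pi> h (emb v)) = cinner z (emb (\<rho> h v))" .
qed

text \<open>Injectivity of \<open>\<Psi>\<close> speaks of functions on all sets of group elements;
  as sections are extensional, agreement on cosets is enough.\<close>

lemma hat_inject:
  assumes "\<And>g. g \<in> carrier G \<Longrightarrow> hat \<xi> g = hat \<eta> g" shows "\<xi> = \<eta>"
proof -
  have ext: "\<Psi> \<xi> \<in> extensional M" "\<Psi> \<eta> \<in> extensional M"
    using Psi_section unfolding holomorphic_sections_def by blast+
  have "\<Psi> \<xi> = \<Psi> \<eta>"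
  proof (rule extensionalityI[OF ext])
    fix m assume "m \<in> M"
    then obtain g where "g \<in> carrier G" "m = g <# H" by (auto simp: LCOSETS_def)
    then show "\<Psi> \<xi> m = \<Psi> \<eta> m" using assms by (simp add: Psi_eq)
  qed
  moreover have "inj \<Psi>" using ind unfolding holomorphically_induced_via_def by blast
  ultimately show ?thesis by (simp add: inj_def)
qed

end

section \<open>Vanishing of the commutator kernel\<close>

text \<open>The zeros on a short segment from 0 in the direction \<open>c\<close> accumulate at 0, a
  point of the connected open strip. Both the real and the imaginary direction occur below.\<close>

lemma strip_identity:
  fixes f :: "complex \<Rightarrow> complex"
  assumes hol: "f holomorphic_on {z. \<bar>Im z\<bar> < \<delta>}" and d: "\<delta> > 0" and \<rho>: "\<rho> > 0" and c: "norm c = 1"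
    and zero: "\<And>r. 0 < r \<Longrightarrow> r < \<rho> \<Longrightarrow> f (of_real r * c) = 0" and w: "\<bar>Im w\<bar> < \<delta>"
  shows "f w = 0"
proof (rule analytic_continuation[OF hol])
  let ?S = "{z. \<bar>Im z\<bar> < \<delta>}" and ?U = "(\<lambda>r. of_real r * c) ` {0<..<min \<rho> \<delta>}"
  show "open ?S" by (intro open_Collect_less continuous_intros)
  have "?S = {z. Im z < \<delta>} \<inter> {z. Im z > - \<delta>}" by auto
  then show "connected ?S"
    by (simp add: convex_connected convex_Int convex_halfspace_Im_lt convex_halfspace_Im_gt)
  show "?U \<subseteq> ?S"
  proof
    fix z assume "z \<in> ?U"
    then obtain r where z: "z = of_real r * c" and "r \<in> {0<..<min \<rho> \<delta>}" by (rule imageE)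
    then have r: "0 < r" "r < \<delta>" by simp_all
    have "\<bar>Im z\<bar> \<le> norm z" by (rule abs_Im_le_cmod)
    also have "norm z = r" using r c by (simp add: z norm_mult)
    finally show "z \<in> ?S" using r by simp
  qed
  show "0 \<in> ?S" using d by simp
  show "0 islimpt ?U" unfolding islimpt_approachable
  proof (intro allI impI)
    fix e :: real assume e: "e > 0"
    define r where "r = min (min \<rho> \<delta>) e / 2"
    have r: "0 < r" "r < min \<rho> \<delta>" "r < e" using d \<rho> e by (auto simp: r_def)
    have "dist (of_real r * c) 0 = r" "of_real r * c \<noteq> 0" using r(1) c by (auto simp: norm_mult)
    then show "\<exists>z\<in>?U. z \<noteq> 0 \<and> dist z 0 < e" using r by (intro bexI[of _ "of_real r * c"]) auto
  qed
  show "f z = 0" if "z \<in> ?U" for z using that zero by auto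
  show "w \<in> ?S" using w by simp
qed

context induced begin

text \<open>\<open>ev (\<pi> g (emb v))\<close> is the compression of \<open>\<pi> g\<close> to
  \<open>V\<close>, and this is its commutator with \<open>B\<close>.\<close>

definition Phi :: "('v \<Rightarrow>\<^sub>L 'v) \<Rightarrow> 'g \<Rightarrow> 'v \<Rightarrow> 'v" where
  "Phi B g v = ev (\<pi> g (emb (B v))) - B (ev (\<pi> g (emb v)))"

definition icomm :: "('v \<Rightarrow>\<^sub>L 'v) set" where
  "icomm = involutive_commutant H \<qq> \<rho> \<beta>"

lemma icommD:
  assumes "B \<in> icomm"
  shows "B \<in> bounded_ops" "op_adj B \<in> icomm" "\<theta> \<in> \<qq> \<Longrightarrow> B (\<beta> \<theta> v) = \<beta> \<theta> (B v)"
    "h \<in> H \<Longrightarrow> B (\<rho> h v) = \<rho> h (B v)"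
proof -
  have B: "B \<in> commutant (\<rho> ` H)" "\<And>x. x \<in> \<qq> \<Longrightarrow> B o\<^sub>L \<beta> x = \<beta> x o\<^sub>L B"
    "\<And>x. x \<in> \<qq> \<Longrightarrow> op_adj B o\<^sub>L \<beta> x = \<beta> x o\<^sub>L op_adj B"
    using assms unfolding icomm_def involutive_commutant_def by auto
  show Bo: "B \<in> bounded_ops" using B(1) by (rule commutant_bounded_ops)
  have "op_adj B \<in> commutant (\<rho> ` H)"
  proof (rule commutant_op_adj[OF _ _ B(1)])
    show "\<rho> ` H \<subseteq> bounded_ops" using rho_ops by auto
    show "op_adj C \<in> \<rho> ` H" if C: "C \<in> \<rho> ` H" for C using C rho_adj by auto
  qed
  then show "op_adj B \<in> icomm" unfolding icomm_def involutive_commutant_def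
    using B Bo by simp
  show "\<theta> \<in> \<qq> \<Longrightarrow> B (\<beta> \<theta> v) = \<beta> \<theta> (B v)" using B(2) by (metis blinfun_apply_blinfun_compose)
  show "h \<in> H \<Longrightarrow> B (\<rho> h v) = \<rho> h (B v)" using commutantD[OF B(1)] by blast
qed

lemma Phi_one: "Phi B \<one> v = 0" by (simp add: Phi_def pi_one)

text \<open>For fixed \<open>k\<close> the commutator is built from values of sections at
  \<open>g\<close>, so that the disc lemma applies to it.\<close>

lemma Phi_hat:
  assumes "g \<in> carrier G" "k \<in> carrier G"
  shows "Phi B (inv g \<otimes> k) v = hat (\<pi> k (emb (B v))) g - B (hat (\<pi> k (emb v)) g)"
  using assms by (simp add: Phi_def hat_ev pi_mult)

lemma Phi_sol:
  assumes "B \<in> icomm" "k \<in> carrier G"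
  shows "sol (\<lambda>g. hat (\<pi> k (emb (B v))) g - B (hat (\<pi> k (emb v)) g))"
  by (intro sol_diff hat_sol sol_op icommD[OF assms(1)])

text \<open>The adjoint of the compression of \<open>\<pi> g\<close> is that of
  \<open>\<pi> (inv g)\<close>. Taking adjoints thus exchanges the two points of the kernel and
  replaces \<open>B\<close> by \<open>op_adj B\<close>, which lies in \<open>icomm\<close>
  again.\<close>

lemma Phi_adj:
  assumes B: "B \<in> icomm" and g: "g \<in> carrier G"
  shows "cinner (Phi B g v) u = - cnj (cinner (Phi (op_adj B) (inv g) u) v)"
proof -
  note Bo = icommD(1)[OF B]
  have "cinner (ev (\<pi> g (emb (B v)))) u = cinner v (op_adj B (ev (\<pi> (inv g) (emb u))))"
    using g by (simp add: cinner_ev cinner_pi cinner_emb cinner_op_adj[OF Bo])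
  moreover have "cinner (B (ev (\<pi> g (emb v)))) u = cinner v (ev (\<pi> (inv g) (emb (op_adj B u))))"
    using g by (simp add: cinner_ev cinner_pi cinner_emb cinner_op_adj[OF Bo])
  ultimately have "cinner (Phi B g v) u = - cinner v (Phi (op_adj B) (inv g) u)"
    by (simp add: Phi_def cinner_diff_left cinner_diff_right)
  also have "cinner v (Phi (op_adj B) (inv g) u) = cnj (cinner (Phi (op_adj B) (inv g) u) v)"
    by (rule cinner_commute)
  finally show ?thesis .
qed

lemma Phi_holomorphic:
  assumes B: "B \<in> icomm" and disc: "disc x \<epsilon> \<sigma> W" and k: "k \<in> carrier G"
  shows "(\<lambda>z. cinner (Phi B (inv (expc x (Re z) \<otimes> \<sigma> (Im z)) \<otimes> k) v) (W (Im z) w))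
    holomorphic_on {z. \<bar>Im z\<bar> < \<epsilon>}"
proof -
  have \<sigma>: "\<sigma> s \<in> carrier G" if "\<bar>s\<bar> < \<epsilon>" for s using disc that tangent_carrier unfolding disc_def by blast
  have "(\<lambda>z. cinner (hat (\<pi> k (emb (B v))) (\<one> \<otimes> (expc x (Re z) \<otimes> \<sigma> (Im z)))
      - B (hat (\<pi> k (emb v)) (\<one> \<otimes> (expc x (Re z) \<otimes> \<sigma> (Im z))))) (W (Im z) w))
      holomorphic_on {z. \<bar>Im z\<bar> < \<epsilon>}"
    by (rule disc_holomorphic[OF disc Phi_sol[OF B k] one_closed])
  then show ?thesis
  proof (rule holomorphic_transform)
    fix z assume "z \<in> {z. \<bar>Im z\<bar> < \<epsilon>}"
    then have s: "\<sigma> (Im z) \<in> carrier G" using \<sigma> by simp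
    then have "expc x (Re z) \<otimes> \<sigma> (Im z) \<in> carrier G" by simp
    from Phi_hat[OF this k, of B v] s
    show "cinner (hat (\<pi> k (emb (B v))) (\<one> \<otimes> (expc x (Re z) \<otimes> \<sigma> (Im z)))
      - B (hat (\<pi> k (emb v)) (\<one> \<otimes> (expc x (Re z) \<otimes> \<sigma> (Im z))))) (W (Im z) w)
      = cinner (Phi B (inv (expc x (Re z) \<otimes> \<sigma> (Im z)) \<otimes> k) v) (W (Im z) w)" by simp
  qed
qed

text \<open>The kernel \<open>k z w\<close> is holomorphic in \<open>z\<close>, antiholomorphic in \<open>w\<close> and invariant under common
  real translations, so it is a function of \<open>z - cnj w\<close>; it vanishes for \<open>z = w\<close>.\<close>

lemma Phi_expc:
  assumes B: "B \<in> icomm"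
  shows "Phi B (expc x t) v = 0"
proof -
  obtain \<epsilon> \<sigma> W where disc: "disc x \<epsilon> \<sigma> W" by (rule disc_exists)
  have e: "\<epsilon> > 0" and \<sigma>0: "\<sigma> 0 = \<one>" and W0: "W 0 = id_blinfun" using disc by (auto simp: disc_def)
  have \<sigma>: "\<sigma> s \<in> carrier G" if "\<bar>s\<bar> < \<epsilon>" for s using disc that tangent_carrier unfolding disc_def by blast
  define \<gamma> where "\<gamma> z = expc x (Re z) \<otimes> \<sigma> (Im z)" for z
  have \<gamma>: "\<gamma> z \<in> carrier G" if "\<bar>Im z\<bar> < \<epsilon>" for z using \<sigma>[OF that] by (simp add: \<gamma>_def)
  define k where "k B z w a b = cinner (Phi B (inv (\<gamma> z) \<otimes> \<gamma> w) (W (Im w) a)) (W (Im z) b)" for B z w a b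
  have k_hol: "(\<lambda>z. k C z w a b) holomorphic_on {z. \<bar>Im z\<bar> < \<epsilon>}" if "C \<in> icomm" "\<bar>Im w\<bar> < \<epsilon>" for C w a b
    unfolding k_def \<gamma>_def[of "_ :: complex"]
    using Phi_holomorphic[OF that(1) disc \<gamma>[OF that(2)]] by (simp add: \<gamma>_def)
  have k_adj: "k B z w a b = - cnj (k (op_adj B) w z b a)" if "\<bar>Im z\<bar> < \<epsilon>" "\<bar>Im w\<bar> < \<epsilon>" for z w a b
  proof -
    have "inv (inv (\<gamma> z) \<otimes> \<gamma> w) = inv (\<gamma> w) \<otimes> \<gamma> z" using \<gamma>[OF that(1)] \<gamma>[OF that(2)] by (simp add: inv_mult_group)
    then show ?thesis unfolding k_def using \<gamma>[OF that(1)] \<gamma>[OF that(2)] by (subst Phi_adj[OF B]) simp_all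
  qed
  \<comment> \<open>The kernel with its second point at the unit: the candidate for the function of
    z - cnj w.\<close>
  define A where "A a b z = k B z 0 a b" for a b z
  have A_hol: "A a b holomorphic_on {z. \<bar>Im z\<bar> < \<epsilon>}" for a b
    unfolding A_def using k_hol[OF B, of 0] e by simp
  have kA: "k B z (cnj w) a b = A a b (z - w)" if zw: "\<bar>Im z\<bar> + \<bar>Im w\<bar> < \<epsilon>" for z w a b
  proof -
    \<comment> \<open>For \<open>w\<close> in the strip of this half-width both \<open>cnj w\<close>
      and \<open>z - w\<close> stay in the strip of half-width \<epsilon>.\<close>
    define \<delta> where "\<delta> = \<epsilon> - \<bar>Im z\<bar>"
    have d: "\<delta> > 0" "\<bar>Im w\<bar> < \<delta>" "\<bar>Im z\<bar> < \<epsilon>" using zw by (auto simp: \<delta>_def)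
    have "(\<lambda>w. k (op_adj B) w z b a) holomorphic_on cnj ` {w. \<bar>Im w\<bar> < \<delta>}"
      by (rule holomorphic_on_subset[OF k_hol[OF icommD(2)[OF B] d(3)]]) (auto simp: \<delta>_def)
    moreover have "open {w. \<bar>Im w\<bar> < \<delta>}" by (intro open_Collect_less continuous_intros)
    ultimately have "(cnj \<circ> (\<lambda>w. k (op_adj B) w z b a) \<circ> cnj) holomorphic_on {w. \<bar>Im w\<bar> < \<delta>}"
      by (rule holomorphic_on_compose_cnj_cnj)
    then have h1: "(\<lambda>w. - cnj (k (op_adj B) (cnj w) z b a)) holomorphic_on {w. \<bar>Im w\<bar> < \<delta>}"
      by (intro holomorphic_on_minus) (simp add: o_def)
    have "(A a b \<circ> (\<lambda>w. z - w)) holomorphic_on {w. \<bar>Im w\<bar> < \<delta>}"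
      by (intro holomorphic_on_compose holomorphic_intros holomorphic_on_subset[OF A_hol]) (auto simp: \<delta>_def)
    then have h2: "(\<lambda>w. A a b (z - w)) holomorphic_on {w. \<bar>Im w\<bar> < \<delta>}" by (simp add: o_def)
    \<comment> \<open>Comparison for real \<open>w\<close> suffices by the identity theorem. There
      the second point is exp(rx), and a common left translation by exp(-rx) turns the pair (z, r)
      into (z - r, 0).\<close>
    have "- cnj (k (op_adj B) (cnj w) z b a) - A a b (z - w) = 0"
    proof (rule strip_identity[OF holomorphic_on_diff[OF h1 h2] d(1) zero_less_one norm_one _ d(2)])
      fix r :: real
      let ?r = "complex_of_real r * 1"
      have \<sigma>z: "\<sigma> (Im z) \<in> carrier G" by (rule \<sigma>[OF d(3)])
      have "inv (expc x (Re z) \<otimes> \<sigma> (Im z)) \<otimes> expc x r = inv (expc x (Re z - r) \<otimes> \<sigma> (Im z))"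
        using \<sigma>z expc_add[of x "- Re z" r] by (simp add: inv_mult_group expc_minus m_assoc add.commute)
      then have "k B z (cnj ?r) a b = A a b (z - ?r)"
        using \<sigma>z by (simp add: A_def k_def \<gamma>_def \<sigma>0 W0)
      moreover have "k B z (cnj ?r) a b = - cnj (k (op_adj B) (cnj ?r) z b a)"
        using d(3) e by (intro k_adj) auto
      ultimately show "- cnj (k (op_adj B) (cnj ?r) z b a) - A a b (z - ?r) = 0" by simp
    qed
    moreover have "k B z (cnj w) a b = - cnj (k (op_adj B) (cnj w) z b a)"
      using d zw by (intro k_adj) auto
    ultimately show ?thesis by simp
  qed
  have A0: "A a b z = 0" if z: "\<bar>Im z\<bar> < \<epsilon>" for a b z
  proof (rule strip_identity[OF A_hol e e _ _ z, of \<i>])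
    fix r :: real assume r: "0 < r" "r < \<epsilon>"
    \<comment> \<open>For this point the diagonal value of the kernel is the value of
      \<open>A\<close> at z - cnj z = ir, and on the diagonal \<open>Phi\<close> is evaluated at the
      unit.\<close>
    let ?z = "Complex 0 (r / 2)"
    have "k B ?z (cnj (cnj ?z)) a b = A a b (?z - cnj ?z)" by (rule kA) (use r in auto)
    moreover have "k B ?z ?z a b = 0"
      using \<gamma>[of ?z] r by (simp add: k_def Phi_one)
    moreover have "?z - cnj ?z = of_real r * \<i>" by (simp add: complex_eq_iff)
    ultimately show "A a b (of_real r * \<i>) = 0" by simp
  qed simp
  \<comment> \<open>The kernel contains an inverse, so exp(tx) is read off at the real point -t,
    where the trivialisation is the identity.\<close>
  have "cinner (Phi B (expc x t) v) b = 0" for b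
    using A0[of "of_real (- t)" v b] e by (simp add: A_def k_def \<gamma>_def \<sigma>0 W0 expc_minus)
  then show ?thesis using cinner_self_eq_0 by blast
qed

text \<open>For \<open>p\<close> near \<open>c0\<close>, the products
  \<open>ip p \<otimes> ip q\<close> with \<open>q\<close> near \<open>c0\<close> stay near
  \<open>ip p\<close>. A property that holds near \<open>g\<close> therefore holds near each
  sufficiently close point.\<close>

lemma eventually_left_translate:
  assumes ev: "\<forall>\<^sub>F p in nhds c0. Q (g \<otimes> ip p)" and g: "g \<in> carrier G"
  shows "\<forall>\<^sub>F p in nhds c0. \<forall>\<^sub>F q in nhds c0. Q (g \<otimes> ip p \<otimes> ip q)"
proof -
  have "\<forall>\<^sub>F p in nhds c0. \<forall>\<^sub>F p' in nhds p. Q (g \<otimes> ip p')" using ev by (simp add: eventually_eventually)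
  then show ?thesis using eventually_c0
  proof eventually_elim
    case (elim p)
    have ipp: "ip p \<in> carrier G" "ip p \<in> U0" using elim(2) by (auto simp: ip_in)
    have "mdiff vec_atlas At (\<lambda>q. ip p \<otimes> ip q) c0"
      using ipp by (intro mdiff_mult[OF dmfd_vec] mdiff_const[OF dmfd_vec] mdiff_ip) auto
    moreover have "ip p \<otimes> ip c0 \<in> U0" using ipp by simp
    ultimately have m: "\<forall>\<^sub>F q in nhds c0. ip p \<otimes> ip q \<in> U0" "(\<lambda>q. ph (ip p \<otimes> ip q)) differentiable (at c0)"
      by (rule mdiff_ph)+
    have "ph (ip p \<otimes> ip c0) = p" using ipp elim(2) by simp
    then have "filterlim (\<lambda>q. ph (ip p \<otimes> ip q)) (nhds p) (nhds c0)"
      using differentiable_tendsto_nhds[OF m(2)] by simp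
    from eventually_compose_filterlim[OF elim(1) this] m(1) eventually_c0
    show ?case by eventually_elim (use ipp g in \<open>simp add: m_assoc\<close>)
  qed
qed

text \<open>Conjugation by \<open>k\<close> fixes the unit and is continuous there; this moves a
  neighbourhood past a factor on the right.\<close>

lemma eventually_conj:
  assumes ev: "\<forall>\<^sub>F p in nhds c0. Q (ip p)" and k: "k \<in> carrier G"
  shows "\<forall>\<^sub>F p in nhds c0. Q (k \<otimes> ip p \<otimes> inv k)"
proof -
  have "mdiff vec_atlas At (\<lambda>p. k \<otimes> ip p \<otimes> inv k) c0"
    using k by (intro mdiff_mult[OF dmfd_vec] mdiff_const[OF dmfd_vec] mdiff_ip) auto
  moreover have "k \<otimes> ip c0 \<otimes> inv k \<in> U0" using k by simp
  ultimately have m: "\<forall>\<^sub>F p in nhds c0. k \<otimes> ip p \<otimes> inv k \<in> U0"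
    "(\<lambda>p. ph (k \<otimes> ip p \<otimes> inv k)) differentiable (at c0)" by (rule mdiff_ph)+
  have "filterlim (\<lambda>p. ph (k \<otimes> ip p \<otimes> inv k)) (nhds c0) (nhds c0)"
    using differentiable_tendsto_nhds[OF m(2)] k by simp
  from eventually_compose_filterlim[OF ev this] m(1) show ?thesis by eventually_elim simp
qed

text \<open>Zeros at the points exp x alone would not pass to products. The argument therefore runs
  over the set \<open>P\<close> of points with a whole neighbourhood of zeros common to all
  \<open>f v\<close>: an open set, stable under right translation by one-parameter groups and by
  \<open>H\<close>.\<close>

theorem Phi_vanishes:
  assumes con: "connected_space (mfd_top M AM)" and B: "B \<in> icomm" and g: "g \<in> carrier G"
  shows "Phi B g v = 0"
proof -
  define f where "f v g = hat (emb (B v)) g - B (hat (emb v) g)" for v g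
  have f_Phi: "f v g = Phi B (inv g) v" if "g \<in> carrier G" for g v
    using Phi_hat[OF that one_closed, of B v] that by (simp add: f_def pi_one)
  have f_sol: "sol (f v)" for v
    unfolding f_def using Phi_sol[OF B one_closed, of v] by (simp add: pi_one)
  define P where "P = {g \<in> carrier G. \<forall>\<^sub>F p in nhds c0. \<forall>v. f v (g \<otimes> ip p) = 0}"
  have PI: "g \<in> P" if "g \<in> carrier G" "\<forall>\<^sub>F p in nhds c0. \<forall>v. f v (g \<otimes> ip p) = 0" for g
    using that by (simp add: P_def)
  have PD: "g \<in> carrier G" "\<forall>\<^sub>F p in nhds c0. \<forall>v. f v (g \<otimes> ip p) = 0" if "g \<in> P" for g
    using that by (simp_all add: P_def)
  \<comment> \<open>The neighbourhood of zeros at \<open>g\<close> contains a piece of the curve g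
    exp(ty), and the identity theorem on the disc spreads its zeros along the whole real
    line.\<close>
  have line: "f v (g \<otimes> expc y t) = 0" if g: "g \<in> P" for g y t v
  proof -
    obtain \<epsilon> \<sigma> W where disc: "disc y \<epsilon> \<sigma> W" by (rule disc_exists)
    have e: "\<epsilon> > 0" and \<sigma>0: "\<sigma> 0 = \<one>" and W0: "W 0 = id_blinfun" using disc by (auto simp: disc_def)
    have m: "\<forall>\<^sub>F t in nhds 0. expc y t \<in> U0" "(\<lambda>t. ph (expc y t)) differentiable (at 0)"
      using mdiff_ph[OF tangent_mdiff[OF expc_tangent], of y 0] by simp_all
    have "filterlim (\<lambda>t. ph (expc y t)) (nhds c0) (nhds 0)"
      using differentiable_tendsto_nhds[OF m(2)] by simp
    from eventually_compose_filterlim[OF PD(2)[OF g] this] m(1)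
    have "\<forall>\<^sub>F t in nhds 0. \<forall>v. f v (g \<otimes> expc y t) = 0" by eventually_elim simp
    then obtain d where d: "d > 0" "\<And>t v. dist t 0 < d \<Longrightarrow> f v (g \<otimes> expc y t) = 0"
      unfolding eventually_nhds_metric by blast
    have "cinner (f v (g \<otimes> (expc y (Re z) \<otimes> \<sigma> (Im z)))) (W (Im z) w) = 0" if "\<bar>Im z\<bar> < \<epsilon>" for z w
    proof (rule strip_identity[OF disc_holomorphic[OF disc f_sol PD(1)[OF g]] e d(1) norm_one _ that])
      fix r :: real assume "0 < r" "r < d"
      then have "f v (g \<otimes> expc y r) = 0" by (intro d(2)) simp
      then show "cinner (f v (g \<otimes> (expc y (Re (complex_of_real r * 1)) \<otimes> \<sigma> (Im (complex_of_real r * 1)))))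
          (W (Im (complex_of_real r * 1)) w) = 0" by (simp add: \<sigma>0)
    qed
    from this[of "of_real t"] e have "cinner (f v (g \<otimes> expc y t)) w = 0" for w by (simp add: \<sigma>0 W0)
    then show ?thesis using cinner_self_eq_0 by blast
  qed
  have openP: "\<forall>\<^sub>F p in nhds c0. g \<otimes> ip p \<in> P" if g: "g \<in> P" for g
  proof -
    have "\<forall>\<^sub>F p in nhds c0. \<forall>\<^sub>F q in nhds c0. \<forall>v. f v (g \<otimes> ip p \<otimes> ip q) = 0"
      by (rule eventually_left_translate[OF PD(2)[OF g] PD(1)[OF g]])
    then show ?thesis using eventually_c0 by eventually_elim (rule PI, use PD(1)[OF g] in auto)
  qed
  \<comment> \<open>A neighbourhood has to be carried along, not only the point. With k the
    conjugate of ip p by exp(ty), the element g exp(ty) ip p equals (g k) exp(ty); for p near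
    \<open>c0\<close> the factor g k lies in \<open>P\<close>, and \<open>line\<close> applies to
    it.\<close>
  have P_exp: "g \<otimes> expc y t \<in> P" if g: "g \<in> P" for g y t
  proof (rule PI)
    note gc = PD(1)[OF g]
    show "g \<otimes> expc y t \<in> carrier G" using gc by simp
    from eventually_conj[OF openP[OF g], of "expc y t"]
    have "\<forall>\<^sub>F p in nhds c0. g \<otimes> (expc y t \<otimes> ip p \<otimes> inv (expc y t)) \<in> P" by simp
    then show "\<forall>\<^sub>F p in nhds c0. \<forall>v. f v (g \<otimes> expc y t \<otimes> ip p) = 0" using eventually_c0
    proof eventually_elim
      case (elim p)
      have "g \<otimes> (expc y t \<otimes> ip p \<otimes> inv (expc y t)) \<otimes> expc y t = g \<otimes> expc y t \<otimes> ip p"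
        using gc elim(2) by (simp add: m_assoc)
      then show ?case using line[OF elim(1), of _ y t] by simp
    qed
  qed
  obtain \<rho>0 where r: "\<rho>0 > 0" "\<And>p. p \<in> ball c0 \<rho>0 \<Longrightarrow> p \<in> ph ` U0 \<and> (\<exists>x. ip p = expc x 1)"
    by (rule exp_onto_neighbourhood) blast
  have "\<forall>\<^sub>F p in nhds c0. p \<in> ball c0 \<rho>0" using r(1) by (intro eventually_nhds_in_open) auto
  then have near: "\<forall>\<^sub>F p in nhds c0. \<exists>x. ip p = expc x 1" by eventually_elim (use r(2) in blast)
  have "P = carrier G"
  proof (rule connected_saturation[OF con])
    show "P \<subseteq> carrier G" using PD(1) by blast
    have "\<forall>\<^sub>F p in nhds c0. \<forall>v. f v (\<one> \<otimes> ip p) = 0" using near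
    proof eventually_elim
      case (elim p)
      then obtain x where x: "ip p = expc x 1" by blast
      have "f v (expc x 1) = 0" for v
        using f_Phi[OF expc_carrier, of v x 1] Phi_expc[OF B] by (simp add: expc_minus)
      then show ?case by (simp add: x)
    qed
    then show "\<one> \<in> P" by (rule PI[OF one_closed])
    show "\<forall>\<^sub>F p in nhds c0. g \<otimes> ip p \<in> P" if "g \<in> P" for g using openP[OF that] .
    \<comment> \<open>If g exp x were in \<open>P\<close>, translating back by exp(-x) would put
      \<open>g\<close> into \<open>P\<close>; and every point near \<open>g\<close> is of this
      form.\<close>
    show "\<forall>\<^sub>F p in nhds c0. g \<otimes> ip p \<notin> P" if g: "g \<in> carrier G" "g \<notin> P" for g
      using near
    proof eventually_elim
      case (elim p)
      then obtain x where x: "ip p = expc x 1" by blast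
      have "g \<otimes> expc x 1 \<otimes> expc x (- 1) = g" using g(1) by (simp add: m_assoc flip: expc_add)
      then show ?case using P_exp[of "g \<otimes> expc x 1" x "- 1"] g(2) by (auto simp: x)
    qed
    \<comment> \<open>Equivariance of sections and commutation of \<open>B\<close> with
      \<open>\<rho>\<close> change \<open>f v\<close> only by the operator
      \<open>\<rho> (inv h)\<close>, which preserves zeros.\<close>
    show "g \<otimes> h \<in> P" if g: "g \<in> P" and h: "h \<in> H" for g h
    proof (rule PI)
      note gc = PD(1)[OF g]
      show "g \<otimes> h \<in> carrier G" using gc h by simp
      from eventually_conj[OF PD(2)[OF g], of h] h
      have "\<forall>\<^sub>F p in nhds c0. \<forall>v. f v (g \<otimes> (h \<otimes> ip p \<otimes> inv h)) = 0" by simp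
      then show "\<forall>\<^sub>F p in nhds c0. \<forall>v. f v (g \<otimes> h \<otimes> ip p) = 0" using eventually_c0
      proof eventually_elim
        case (elim p)
        let ?g = "g \<otimes> (h \<otimes> ip p \<otimes> inv h)"
        have g': "?g \<in> carrier G" using gc h elim(2) by simp
        have eq: "g \<otimes> h \<otimes> ip p = ?g \<otimes> h" using gc h elim(2) by (simp add: m_assoc)
        have "f v (?g \<otimes> h) = \<rho> (inv h) (f v ?g)" for v
          unfolding f_def hat_H[OF g' h] using icommD(4)[OF B H_inv[OF h]] by (simp add: blinfun.diff_right)
        then show ?case unfolding eq using elim(1) by simp
      qed
    qed
  qed
  \<comment> \<open>\<open>f\<close> is \<open>Phi\<close> at the inverse, and vanishing at the
    point itself is the case t = 0 of \<open>line\<close>.\<close>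
  then have "inv g \<in> P" using g by simp
  from line[OF this, of v 0 0] have "f v (inv g) = 0" using g by simp
  then show ?thesis using f_Phi[of "inv g" v] g by simp
qed

end

section \<open>Extension of operators from \<open>V\<close>\<close>

text \<open>For positive a, iterating the square inequality gives (b 0 / a)^(2^k) \<le> b k / a,
  which is at most M/a times \<tau>^(2^k). If b 0 exceeded \<tau> a, the powers of r = b 0 / (\<tau>
  a) > 1 would thus stay below M/a. The crude constant \<open>M\<close> disappears from the
  bound.\<close>

lemma le_if_square_le_mult:
  fixes b :: "nat \<Rightarrow> real"
  assumes a: "0 \<le> a" and \<tau>: "0 \<le> \<tau>" and b: "\<And>k. 0 \<le> b k"
    and sq: "\<And>k. (b k)\<^sup>2 \<le> a * b (Suc k)" and bd: "\<And>k. b k \<le> M * \<tau> ^ (2 ^ k)"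
  shows "b 0 \<le> \<tau> * a"
proof (rule ccontr)
  assume "\<not> b 0 \<le> \<tau> * a"
  then have gt: "\<tau> * a < b 0" by simp
  then have b0: "b 0 > 0" using a \<tau> by (meson le_less_trans mult_nonneg_nonneg)
  have a0: "a > 0"
  proof (rule ccontr)
    assume "\<not> a > 0"
    then have "a = 0" using a by simp
    then show False using sq[of 0] b0 by simp
  qed
  have \<tau>0: "\<tau> > 0"
  proof (rule ccontr)
    assume "\<not> \<tau> > 0"
    then have "\<tau> = 0" using \<tau> by simp
    then show False using bd[of 0] b0 by simp
  qed
  have step: "a * b 0 ^ (2 ^ k) \<le> a ^ (2 ^ k) * b k" for k
  proof (induction k)
    case (Suc k)
    have "a * (a * b 0 ^ (2 ^ Suc k)) = (a * b 0 ^ (2 ^ k))\<^sup>2"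
      by (simp add: power2_eq_square power_add mult_2 mult_ac)
    also have "\<dots> \<le> (a ^ (2 ^ k) * b k)\<^sup>2" using Suc a0 b0 by (intro power_mono) auto
    also have "\<dots> = a ^ (2 ^ Suc k) * (b k)\<^sup>2" by (simp add: power2_eq_square power_add mult_2 mult_ac)
    also have "\<dots> \<le> a ^ (2 ^ Suc k) * (a * b (Suc k))" using sq a0 by (intro mult_left_mono) auto
    also have "\<dots> = a * (a ^ (2 ^ Suc k) * b (Suc k))" by (simp only: mult_ac)
    finally show ?case using a0 by (simp only: mult_le_cancel_left_pos)
  qed simp
  define r where "r = b 0 / (\<tau> * a)"
  have r: "r > 1" using gt \<tau>0 a0 by (simp add: r_def)
  have "r ^ k \<le> M / a" for k
  proof -
    have "r ^ k \<le> r ^ (2 ^ k)" using r by (intro power_increasing) (auto intro: less_imp_le)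
    also have "\<dots> \<le> M / a"
    proof -
      have "a * b 0 ^ (2 ^ k) \<le> a ^ (2 ^ k) * (M * \<tau> ^ (2 ^ k))"
        using a0 by (intro order_trans[OF step mult_left_mono[OF bd]]) simp
      also have "\<dots> = M * (\<tau> * a) ^ (2 ^ k)" by (simp add: power_mult_distrib mult_ac)
      finally show ?thesis using a0 \<tau>0 unfolding r_def power_divide by (simp add: field_simps)
    qed
    finally show ?thesis .
  qed
  moreover obtain n where "M / a < r ^ n" using real_arch_pow[OF r] by blast
  ultimately show False by (meson not_le)
qed

context induced begin

text \<open>Lists of pairs stand for formal sums of vectors \<open>\<pi> g (emb v)\<close>. The
  operator to be constructed acts on them by \<open>mapc\<close>, before anything is known about its
  compatibility with equality of sums.\<close>

definition J :: "('g \<times> 'v) list \<Rightarrow> 'h" where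
  "J xs = sum_list (map (\<lambda>x. \<pi> (fst x) (emb (snd x))) xs)"

definition mapc :: "('v \<Rightarrow> 'v) \<Rightarrow> ('g \<times> 'v) list \<Rightarrow> ('g \<times> 'v) list" where
  "mapc C xs = map (\<lambda>x. (fst x, C (snd x))) xs"

definition good :: "('g \<times> 'v) list \<Rightarrow> bool" where "good xs \<longleftrightarrow> fst ` set xs \<subseteq> carrier G"

lemma J_simps [simp]: "J [] = 0" "J (x # xs) = \<pi> (fst x) (emb (snd x)) + J xs" "J (xs @ ys) = J xs + J ys"
  by (simp_all add: J_def)

lemma mapc_simps [simp]: "mapc C [] = []" "mapc C (x # xs) = (fst x, C (snd x)) # mapc C xs"
  "mapc C (xs @ ys) = mapc C xs @ mapc C ys"
  by (simp_all add: mapc_def)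

lemma good_simps [simp]: "good []" "good (x # xs) \<longleftrightarrow> fst x \<in> carrier G \<and> good xs"
  "good (xs @ ys) \<longleftrightarrow> good xs \<and> good ys" "good (mapc C xs) \<longleftrightarrow> good xs"
  by (auto simp: good_def mapc_def image_image)

lemma J_mapc_scale: "good xs \<Longrightarrow> J (mapc (\<lambda>v. c *\<^sub>C v) xs) = c *\<^sub>C J xs"
proof (induction xs)
  case (Cons x xs)
  then have "\<pi> (fst x) (c *\<^sub>C w) = c *\<^sub>C \<pi> (fst x) w" for w
    using is_clinear_scaleC[OF bounded_opsD[OF pi_ops]] by simp
  with Cons show ?case by (simp add: is_clinear_scaleC[OF emb_clinear] scaleC_add_right)
qed simp

text \<open>Vanishing of \<open>Phi\<close> in the form used for the extension. It is closed under
  composition, which makes \<open>op_adj B o\<^sub>L B\<close> available.\<close>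

definition Comm :: "('v \<Rightarrow>\<^sub>L 'v) set" where
  "Comm = {C \<in> bounded_ops. \<forall>g\<in>carrier G. \<forall>v. ev (\<pi> g (emb (C v))) = C (ev (\<pi> g (emb v)))}"

lemma CommD: "C \<in> Comm \<Longrightarrow> C \<in> bounded_ops"
  "C \<in> Comm \<Longrightarrow> g \<in> carrier G \<Longrightarrow> ev (\<pi> g (emb (C v))) = C (ev (\<pi> g (emb v)))"
  by (auto simp: Comm_def)

lemma Comm_compose: "C \<in> Comm \<Longrightarrow> D \<in> Comm \<Longrightarrow> C o\<^sub>L D \<in> Comm"
  by (simp add: Comm_def)

lemma cinner_pi_pi:
  assumes "g \<in> carrier G" "h \<in> carrier G"
  shows "cinner (\<pi> g (emb v)) (\<pi> h (emb w)) = cinner (ev (\<pi> (inv h \<otimes> g) (emb v))) w"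
proof -
  have "cinner (\<pi> g (emb v)) (\<pi> h (emb w)) = cinner (\<pi> (inv h) (\<pi> g (emb v))) (emb w)"
    using cinner_op_adj'[OF pi_ops[OF assms(2)]] pi_adj[OF assms(2)] by simp
  then show ?thesis using assms by (simp add: cinner_ev pi_mult)
qed

text \<open>The inner product of \<open>\<pi> g (emb v)\<close> and \<open>\<pi> h (emb w)\<close>
  is a coefficient of a compression, with which \<open>C\<close> commutes; so \<open>C\<close> moves
  across pair by pair.\<close>

lemma cinner_J_mapc:
  assumes C: "C \<in> Comm" and xs: "good xs" and ys: "good ys"
  shows "cinner (J (mapc C xs)) (J ys) = cinner (J xs) (J (mapc (op_adj C) ys))"
  using xs
proof (induction xs)
  case (Cons x xs)
  have "cinner (\<pi> (fst x) (emb (C (snd x)))) (J ys) = cinner (\<pi> (fst x) (emb (snd x))) (J (mapc (op_adj C) ys))"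
    using ys
  proof (induction ys)
    case (Cons y ys)
    have "cinner (\<pi> (fst x) (emb (C (snd x)))) (\<pi> (fst y) (emb (snd y)))
        = cinner (\<pi> (fst x) (emb (snd x))) (\<pi> (fst y) (emb (op_adj C (snd y))))"
      using Cons.prems \<open>good (x # xs)\<close>
      by (simp add: cinner_pi_pi CommD(2)[OF C] cinner_op_adj[OF CommD(1)[OF C]])
    with Cons show ?case by (simp add: cinner_add_right)
  qed simp
  with Cons show ?case by (simp add: cinner_add_left)
qed simp

lemma norm_J_le: "good xs \<Longrightarrow> norm (J xs) \<le> sum_list (map (\<lambda>x. norm (snd x)) xs)"
proof (induction xs)
  case (Cons x xs)
  have "norm (J (x # xs)) \<le> norm (\<pi> (fst x) (emb (snd x))) + norm (J xs)"
    by (simp add: norm_triangle_ineq)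
  also have "norm (\<pi> (fst x) (emb (snd x))) = norm (snd x)"
    using Cons.prems unitary_op_norm[OF pi_unitary] by (simp add: norm_emb)
  finally show ?case using Cons by simp
qed simp

text \<open>With \<xi> the given sum, symmetry bounds the squared norm of T^m \<xi> by the product
  of the norms of \<xi> and T^(2m) \<xi>. The triangle inequality bounds the norm of T^n \<xi> by
  norm(T)^n times a constant that depends on the list; \<open>le_if_square_le_mult\<close>, along n
  = 2^k, removes that constant.\<close>

lemma norm_J_mapc_selfadjoint:
  assumes T: "T \<in> Comm" "op_adj T = T" and xs: "good xs"
  shows "norm (J (mapc T xs)) \<le> norm T * norm (J xs)"
proof -
  let ?p = "\<lambda>n. (mapc T ^^ n) xs"
  have gd: "good ((mapc T ^^ n) ys) = good ys" for n ys by (induction n) simp_all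
  have shift: "cinner (J ((mapc T ^^ m) ys)) (J zs) = cinner (J ys) (J ((mapc T ^^ m) zs))"
    if "good ys" "good zs" for m ys zs
    using that(2)
  proof (induction m arbitrary: zs)
    case (Suc m)
    have "cinner (J ((mapc T ^^ Suc m) ys)) (J zs) = cinner (J ((mapc T ^^ m) ys)) (J (mapc T zs))"
      using cinner_J_mapc[OF T(1), of "(mapc T ^^ m) ys" zs] Suc.prems that(1) gd T(2) by simp
    also have "\<dots> = cinner (J ys) (J ((mapc T ^^ m) (mapc T zs)))" by (rule Suc.IH) (use Suc.prems in simp)
    finally show ?case by (simp only: funpow_Suc_right o_apply)
  qed simp
  have sq: "(norm (J (?p m)))\<^sup>2 \<le> norm (J xs) * norm (J (?p (m + m)))" for m
  proof -
    have "complex_of_real ((norm (J (?p m)))\<^sup>2) = cinner (J xs) (J (?p (m + m)))"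
      unfolding cinner_self[symmetric] using shift[OF xs, of "?p m" m] gd xs by (simp add: funpow_add)
    then have "(norm (J (?p m)))\<^sup>2 = cmod (cinner (J xs) (J (?p (m + m))))"
      by (metis norm_of_real abs_of_nonneg zero_le_power2)
    then show ?thesis using norm_cinner_le[of "J xs" "J (?p (m + m))"] by simp
  qed
  define S where "S ys = sum_list (map (\<lambda>x. norm (snd x)) ys)" for ys :: "('g \<times> 'v) list"
  have S: "S (mapc T ys) \<le> norm T * S ys" for ys
  proof (induction ys)
    case (Cons y ys)
    then show ?case using norm_blinfun[of T "snd y"] by (simp add: S_def distrib_left)
  qed (simp add: S_def)
  have Sn: "S (?p n) \<le> S xs * norm T ^ n" for n
  proof (induction n)
    case (Suc n)
    have "S (?p (Suc n)) \<le> norm T * S (?p n)" using S by simp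
    also have "\<dots> \<le> norm T * (S xs * norm T ^ n)" using Suc by (intro mult_left_mono) auto
    finally show ?case by (simp add: mult_ac)
  qed simp
  have "norm (J (?p (2 ^ 0))) \<le> norm T * norm (J xs)"
  proof (rule le_if_square_le_mult[where b = "\<lambda>k. norm (J (?p (2 ^ k)))" and M = "S xs"])
    show "(norm (J (?p (2 ^ k))))\<^sup>2 \<le> norm (J xs) * norm (J (?p (2 ^ Suc k)))" for k
      using sq[of "2 ^ k"] by (simp add: mult_2)
    show "norm (J (?p (2 ^ k))) \<le> S xs * norm T ^ 2 ^ k" for k
      using norm_J_le[of "?p (2 ^ k)"] Sn[of "2 ^ k"] gd xs unfolding S_def by fastforce
  qed auto
  then show ?thesis by simp
qed

text \<open>The squared norm of \<open>J (mapc B xs)\<close> is the pairing of \<open>J xs\<close>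
  with \<open>J (mapc T xs)\<close> for a selfadjoint \<open>T\<close>, to which the preceding lemma
  applies; hence the constant \<open>sqrt (norm T)\<close>.\<close>

lemma norm_J_mapc:
  assumes B: "B \<in> Comm" "op_adj B \<in> Comm"
  obtains K where "K \<ge> 0" "\<And>xs. good xs \<Longrightarrow> norm (J (mapc B xs)) \<le> K * norm (J xs)"
proof -
  define T where "T = op_adj B o\<^sub>L B"
  have Bo: "B \<in> bounded_ops" by (rule CommD(1)[OF B(1)])
  have T: "T \<in> Comm" "op_adj T = T"
    unfolding T_def by (rule Comm_compose[OF B(2,1)]) (simp add: op_adj_compose Bo)
  have "norm (J (mapc B xs)) \<le> sqrt (norm T) * norm (J xs)" if xs: "good xs" for xs
  proof (rule power2_le_imp_le)
    have "mapc (op_adj B) (mapc B xs) = mapc T xs" by (simp add: mapc_def T_def)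
    then have "complex_of_real ((norm (J (mapc B xs)))\<^sup>2) = cinner (J xs) (J (mapc T xs))"
      unfolding cinner_self[symmetric] using cinner_J_mapc[OF B(1) xs, of "mapc B xs"] xs by simp
    then have "(norm (J (mapc B xs)))\<^sup>2 = cmod (cinner (J xs) (J (mapc T xs)))"
      by (metis norm_of_real abs_of_nonneg zero_le_power2)
    also have "\<dots> \<le> norm (J xs) * norm (J (mapc T xs))" by (rule norm_cinner_le)
    also have "\<dots> \<le> norm (J xs) * (norm T * norm (J xs))"
      by (intro mult_left_mono norm_J_mapc_selfadjoint T xs) simp
    finally show "(norm (J (mapc B xs)))\<^sup>2 \<le> (sqrt (norm T) * norm (J xs))\<^sup>2"
      by (simp add: power_mult_distrib power2_eq_square[of "norm (J xs)"] mult_ac)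
  qed simp
  then show ?thesis using that[of "sqrt (norm T)"] by simp
qed

text \<open>A vector orthogonal to all \<open>\<pi> g (emb v)\<close> has \<open>hat\<close> zero at
  every group element, and so is zero by injectivity of \<open>\<Psi>\<close>.\<close>

lemma J_dense: obtains xs where "\<And>n. good (xs n)" "(\<lambda>n. J (xs n)) \<longlonglongrightarrow> \<xi>"
proof -
  define D where "D = J ` {xs. good xs}"
  have add: "x + y \<in> D" if "x \<in> D" "y \<in> D" for x y
  proof -
    from that obtain xs ys where "x = J xs" "good xs" "y = J ys" "good ys" by (auto simp: D_def)
    then show ?thesis unfolding D_def by (intro image_eqI[of _ _ "xs @ ys"]) simp_all
  qed
  have scale: "c *\<^sub>C x \<in> D" if "x \<in> D" for x c
  proof -
    from that obtain xs where "x = J xs" "good xs" by (auto simp: D_def)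
    then show ?thesis unfolding D_def
      by (intro image_eqI[of _ _ "mapc (\<lambda>v. c *\<^sub>C v) xs"]) (simp_all add: J_mapc_scale)
  qed
  have "closure D = UNIV"
  proof (rule orthogonal_complement_trivial_imp_UNIV)
    show "closed (closure D)" by simp
    have "J [] \<in> D" unfolding D_def by (rule imageI) simp
    then show "0 \<in> closure D" using closure_subset[of D] by auto
    show "x + y \<in> closure D" if xy: "x \<in> closure D" "y \<in> closure D" for x y
    proof -
      from xy obtain X Y where "\<And>n. X n \<in> D" "X \<longlonglongrightarrow> x" "\<And>n. Y n \<in> D" "Y \<longlonglongrightarrow> y"
        unfolding closure_sequential by auto
      then show ?thesis unfolding closure_sequential
        by (intro exI[of _ "\<lambda>n. X n + Y n"]) (auto intro: add tendsto_add)
    qed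
    show "c *\<^sub>C x \<in> closure D" if x: "x \<in> closure D" for x c
    proof -
      from x obtain X where "\<And>n. X n \<in> D" "X \<longlonglongrightarrow> x" unfolding closure_sequential by auto
      then show ?thesis unfolding closure_sequential
        by (intro exI[of _ "\<lambda>n. c *\<^sub>C X n"])
          (auto intro: scale bounded_linear.tendsto[OF bounded_bilinear.bounded_linear_right[OF bounded_bilinear_scaleC]])
    qed
    fix x assume x: "\<And>y. y \<in> closure D \<Longrightarrow> cinner x y = 0"
    have "hat x g = hat 0 g" if g: "g \<in> carrier G" for g
    proof -
      have "cinner (hat x g) v = 0" for v
      proof -
        have "J [(g, v)] \<in> D" unfolding D_def using g by (intro imageI) simp
        then have "cinner x (\<pi> g (emb v)) = 0" using x[of "\<pi> g (emb v)"] closure_subset[of D] by auto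
        then show ?thesis
          using g cinner_op_adj'[OF pi_ops[OF g], of x "emb v"] by (simp add: hat_ev cinner_ev pi_adj)
      qed
      then have "hat x g = 0" using cinner_self_eq_0 by blast
      moreover have "hat 0 g = 0" using hat_scale[OF g, of 0 0] by simp
      ultimately show ?thesis by simp
    qed
    then show "x = 0" by (rule hat_inject)
  qed
  then have "\<xi> \<in> closure D" by simp
  then obtain X where X: "\<And>n. X n \<in> D" "X \<longlonglongrightarrow> \<xi>" unfolding closure_sequential by auto
  have "\<forall>n. \<exists>xs. good xs \<and> X n = J xs" using X(1) by (auto simp: D_def)
  then obtain xs where "\<forall>n. good (xs n) \<and> X n = J (xs n)" by (rule choice[THEN exE])
  then have xs: "good (xs n)" "X n = J (xs n)" for n by auto
  show ?thesis by (rule that[of xs]) (use xs X(2) in \<open>simp_all flip: xs(2)\<close>)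
qed

text \<open>The bound for formal sums, applied to differences, shows that equal sums have equal
  images and that the map on the dense subspace of sums is Lipschitz. \<open>A\<close> is its
  continuous extension, taken as a limit along approximating lists.\<close>

lemma extension_exists:
  assumes B: "B \<in> Comm" "op_adj B \<in> Comm"
  obtains A where "A \<in> commutant (\<pi> ` carrier G)" "\<And>v. A (emb v) = emb (B v)"
proof -
  have Bo: "B \<in> bounded_ops" by (rule CommD(1)[OF B(1)])
  obtain K where K: "K \<ge> 0" "\<And>xs. good xs \<Longrightarrow> norm (J (mapc B xs)) \<le> K * norm (J xs)"
    by (rule norm_J_mapc[OF B]) blast
  have neg: "mapc B (mapc (\<lambda>v. (-1) *\<^sub>C v) ys) = mapc (\<lambda>v. (-1) *\<^sub>C v) (mapc B ys)" for ys
    by (simp add: mapc_def blinfun.minus_right)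
  have diff: "norm (J (mapc B xs) - J (mapc B ys)) \<le> K * norm (J xs - J ys)" if "good xs" "good ys" for xs ys
    using K(2)[of "xs @ mapc (\<lambda>v. (-1) *\<^sub>C v) ys"] that
    by (simp add: neg J_mapc_scale del: scaleC_minus_left) simp
  have "\<forall>\<xi>. \<exists>xs. (\<forall>n. good (xs n)) \<and> (\<lambda>n. J (xs n)) \<longlonglongrightarrow> \<xi>" using J_dense by metis
  then obtain X where X: "\<forall>\<xi>. (\<forall>n. good (X \<xi> n)) \<and> (\<lambda>n. J (X \<xi> n)) \<longlonglongrightarrow> \<xi>"
    by (rule choice[THEN exE])
  then have Xg: "good (X \<xi> n)" and Xl: "(\<lambda>n. J (X \<xi> n)) \<longlonglongrightarrow> \<xi>" for \<xi> n by auto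
  have conv: "convergent (\<lambda>n. J (mapc B (X \<xi> n)))" for \<xi>
  proof (rule Cauchy_convergent, rule metric_CauchyI)
    fix e :: real assume e: "e > 0"
    have "Cauchy (\<lambda>n. J (X \<xi> n))" using Xl[of \<xi>] by (rule LIMSEQ_imp_Cauchy)
    then obtain N where N: "\<And>m n. m \<ge> N \<Longrightarrow> n \<ge> N \<Longrightarrow> norm (J (X \<xi> m) - J (X \<xi> n)) < e / (K + 1)"
      using metric_CauchyD[of "\<lambda>n. J (X \<xi> n)" "e / (K + 1)"] e K(1) by (auto simp: dist_norm)
    have "dist (J (mapc B (X \<xi> m))) (J (mapc B (X \<xi> n))) < e" if "m \<ge> N" "n \<ge> N" for m n
    proof -
      have "dist (J (mapc B (X \<xi> m))) (J (mapc B (X \<xi> n))) \<le> K * norm (J (X \<xi> m) - J (X \<xi> n))"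
        unfolding dist_norm by (rule diff[OF Xg Xg])
      also have "\<dots> \<le> K * (e / (K + 1))" using N[OF that] K(1) by (intro mult_left_mono) auto
      also have "\<dots> < e" using e K(1) by (simp add: field_simps)
      finally show ?thesis .
    qed
    then show "\<exists>M. \<forall>m\<ge>M. \<forall>n\<ge>M. dist (J (mapc B (X \<xi> m))) (J (mapc B (X \<xi> n))) < e" by blast
  qed
  define A where "A \<xi> = lim (\<lambda>n. J (mapc B (X \<xi> n)))" for \<xi>
  have XA: "(\<lambda>n. J (mapc B (X \<xi> n))) \<longlonglongrightarrow> A \<xi>" for \<xi>
    unfolding A_def using conv convergent_LIMSEQ_iff by blast
  \<comment> \<open>The limit does not depend on the approximating lists. Every property of
    \<open>A\<close> follows by exhibiting convenient ones, such as concatenated, scaled or left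
    translated lists, and identifying the two limits.\<close>
  have any: "A \<xi> = \<eta>" if g: "\<And>n. good (Y n)" and l: "(\<lambda>n. J (Y n)) \<longlonglongrightarrow> \<xi>"
    and l': "(\<lambda>n. J (mapc B (Y n))) \<longlonglongrightarrow> \<eta>" for Y \<xi> \<eta>
  proof -
    have "(\<lambda>n. J (mapc B (X \<xi> n)) - J (mapc B (Y n))) \<longlonglongrightarrow> 0"
    proof (rule Lim_null_comparison)
      show "\<forall>\<^sub>F n in sequentially. norm (J (mapc B (X \<xi> n)) - J (mapc B (Y n))) \<le> K * norm (J (X \<xi> n) - J (Y n))"
        by (intro always_eventually allI diff Xg g)
      have "(\<lambda>n. K * norm (J (X \<xi> n) - J (Y n))) \<longlonglongrightarrow> K * norm (\<xi> - \<xi>)"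
        by (intro tendsto_mult tendsto_const tendsto_norm tendsto_diff Xl l)
      then show "(\<lambda>n. K * norm (J (X \<xi> n) - J (Y n))) \<longlonglongrightarrow> 0" by simp
    qed
    moreover have "(\<lambda>n. J (mapc B (X \<xi> n)) - J (mapc B (Y n))) \<longlonglongrightarrow> A \<xi> - \<eta>"
      by (intro tendsto_diff XA l')
    ultimately have "A \<xi> - \<eta> = 0" using LIMSEQ_unique by blast
    then show ?thesis by simp
  qed
  have A_add: "A (\<xi> + \<eta>) = A \<xi> + A \<eta>" for \<xi> \<eta>
    by (rule any[of "\<lambda>n. X \<xi> n @ X \<eta> n"]) (simp_all add: Xg tendsto_add Xl XA)
  have A_scale: "A (c *\<^sub>C \<xi>) = c *\<^sub>C A \<xi>" for c \<xi>
  proof (rule any[of "\<lambda>n. mapc (\<lambda>v. c *\<^sub>C v) (X \<xi> n)"])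
    note sc = bounded_linear.tendsto[OF bounded_bilinear.bounded_linear_right[OF bounded_bilinear_scaleC]]
    show "(\<lambda>n. J (mapc (\<lambda>v. c *\<^sub>C v) (X \<xi> n))) \<longlonglongrightarrow> c *\<^sub>C \<xi>" using sc[OF Xl] by (simp add: J_mapc_scale Xg)
    have "mapc B (mapc (\<lambda>v. c *\<^sub>C v) ys) = mapc (\<lambda>v. c *\<^sub>C v) (mapc B ys)" for ys
      by (simp add: mapc_def is_clinear_scaleC[OF bounded_opsD[OF Bo]])
    then show "(\<lambda>n. J (mapc B (mapc (\<lambda>v. c *\<^sub>C v) (X \<xi> n)))) \<longlonglongrightarrow> c *\<^sub>C A \<xi>"
      using sc[OF XA] by (simp add: J_mapc_scale Xg)
  qed (simp add: Xg)
  have A_cl: "is_clinear A" unfolding is_clinear_def by (simp add: A_add A_scale)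
  have A_norm: "norm (A \<xi>) \<le> norm \<xi> * K" for \<xi>
  proof (rule LIMSEQ_le)
    show "(\<lambda>n. norm (J (mapc B (X \<xi> n)))) \<longlonglongrightarrow> norm (A \<xi>)" by (intro tendsto_norm XA)
    show "(\<lambda>n. norm (J (X \<xi> n)) * K) \<longlonglongrightarrow> norm \<xi> * K" by (intro tendsto_mult tendsto_norm Xl tendsto_const)
    show "\<exists>N. \<forall>n\<ge>N. norm (J (mapc B (X \<xi> n))) \<le> norm (J (X \<xi> n)) * K" using K(2)[OF Xg] by (auto simp: mult.commute)
  qed
  have A_bl: "bounded_linear A"
    by (rule bounded_linear_intro[OF _ _ A_norm]) (simp_all add: is_clinearD[OF A_cl])
  have A_pi: "A (\<pi> g \<xi>) = \<pi> g (A \<xi>)" if g: "g \<in> carrier G" for g \<xi>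
  proof (rule any[of "\<lambda>n. map (\<lambda>x. (g \<otimes> fst x, snd x)) (X \<xi> n)"])
    have Jg: "J (map (\<lambda>x. (g \<otimes> fst x, snd x)) ys) = \<pi> g (J ys)" if "good ys" for ys
      using that by (induction ys) (simp_all add: pi_mult g blinfun.add_right)
    have m: "mapc B (map (\<lambda>x. (g \<otimes> fst x, snd x)) ys) = map (\<lambda>x. (g \<otimes> fst x, snd x)) (mapc B ys)" for ys
      by (simp add: mapc_def)
    show "good (map (\<lambda>x. (g \<otimes> fst x, snd x)) (X \<xi> n))" for n
      using Xg[of \<xi> n] g by (auto simp: good_def)
    show "(\<lambda>n. J (map (\<lambda>x. (g \<otimes> fst x, snd x)) (X \<xi> n))) \<longlonglongrightarrow> \<pi> g \<xi>"
      using bounded_linear.tendsto[OF blinfun.bounded_linear_right Xl] by (simp add: Jg Xg)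
    show "(\<lambda>n. J (mapc B (map (\<lambda>x. (g \<otimes> fst x, snd x)) (X \<xi> n)))) \<longlonglongrightarrow> \<pi> g (A \<xi>)"
      using bounded_linear.tendsto[OF blinfun.bounded_linear_right XA] by (simp add: m Jg Xg)
  qed
  have A_emb: "A (emb v) = emb (B v)" for v
    by (rule any[of "\<lambda>n. [(\<one>, v)]"]) (simp_all add: pi_one)
  have app: "blinfun_apply (Blinfun A) = A" by (rule bounded_linear_Blinfun_apply[OF A_bl])
  show ?thesis
  proof (rule that[of "Blinfun A"])
    show "Blinfun A \<in> commutant (\<pi> ` carrier G)"
      by (rule commutantI) (auto simp: bounded_ops_def app A_cl A_pi)
    show "blinfun_apply (Blinfun A) (emb v) = emb (B v)" for v by (simp add: app A_emb)
  qed
qed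

end

section \<open>The restriction isomorphism\<close>

context induced begin

abbreviation "GC \<equiv> commutant (\<pi> ` carrier G)"

lemma pi_set: "\<pi> ` carrier G \<subseteq> bounded_ops" "B \<in> \<pi> ` carrier G \<Longrightarrow> op_adj B \<in> \<pi> ` carrier G"
  using pi_ops pi_adj by auto

lemma GC_adj: "A \<in> GC \<Longrightarrow> op_adj A \<in> GC"
  by (rule commutant_op_adj[OF pi_set])

text \<open>That the adjoint of \<open>A\<close> commutes with \<open>\<beta> \<theta>\<close> means
  that \<open>A\<close> commutes with the adjoint of \<open>\<beta> \<theta>\<close>. The involutive
  commutant is thus the commutant of a set closed under adjoints, and the formal bicommutant
  argument applies.\<close>

lemma icomm_eq: "icomm = commutant (\<rho> ` H \<union> \<beta> ` \<qq> \<union> op_adj ` \<beta> ` \<qq>)"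
proof (intro equalityI subsetI)
  fix A assume A: "A \<in> icomm"
  show "A \<in> commutant (\<rho> ` H \<union> \<beta> ` \<qq> \<union> op_adj ` \<beta> ` \<qq>)"
  proof (rule commutantI[OF icommD(1)[OF A]])
    fix C v assume "C \<in> \<rho> ` H \<union> \<beta> ` \<qq> \<union> op_adj ` \<beta> ` \<qq>"
    then consider h where "h \<in> H" "C = \<rho> h" | \<theta> where "\<theta> \<in> \<qq>" "C = \<beta> \<theta>"
      | \<theta> where "\<theta> \<in> \<qq>" "C = op_adj (\<beta> \<theta>)" by (elim UnE imageE) simp_all
    then show "A (C v) = C (A v)"
    proof cases
      case 1
      then show ?thesis using icommD(4)[OF A] by simp
    next
      case 2
      then show ?thesis using icommD(3)[OF A] by simp
    next
      case 3
      note Ao = icommD(1)[OF A] and b = beta_ops[OF 3(1)]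
      have "cinner z (A (op_adj (\<beta> \<theta>) v)) = cinner z (op_adj (\<beta> \<theta>) (A v))" for z
      proof -
        have "cinner z (A (op_adj (\<beta> \<theta>) v)) = cinner (\<beta> \<theta> (op_adj A z)) v"
          by (simp only: cinner_op_adj'[OF Ao] cinner_op_adj[OF b])
        also have "\<dots> = cinner (op_adj A (\<beta> \<theta> z)) v" by (simp only: icommD(3)[OF icommD(2)[OF A] 3(1)])
        also have "\<dots> = cinner z (op_adj (\<beta> \<theta>) (A v))"
          by (simp only: cinner_op_adj'[OF Ao, symmetric] cinner_op_adj[OF b])
        finally show ?thesis .
      qed
      then show ?thesis unfolding 3(2) by (rule cinner_eqI)
    qed
  qed
next
  fix A assume A: "A \<in> commutant (\<rho> ` H \<union> \<beta> ` \<qq> \<union> op_adj ` \<beta> ` \<qq>)"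
  have Ao: "A \<in> bounded_ops" using A by (rule commutant_bounded_ops)
  have 1: "A (\<rho> h v) = \<rho> h (A v)" if "h \<in> H" for h v using commutantD[OF A] that by blast
  have 2: "A (\<beta> \<theta> v) = \<beta> \<theta> (A v)" if "\<theta> \<in> \<qq>" for \<theta> v using commutantD[OF A] that by blast
  have 3: "A (op_adj (\<beta> \<theta>) v) = op_adj (\<beta> \<theta>) (A v)" if "\<theta> \<in> \<qq>" for \<theta> v
    using commutantD[OF A] that by blast
  have 4: "op_adj A (\<beta> \<theta> v) = \<beta> \<theta> (op_adj A v)" if t: "\<theta> \<in> \<qq>" for \<theta> v
  proof (rule cinner_eqI)
    fix z
    have "cinner z (op_adj A (\<beta> \<theta> v)) = cinner (op_adj (\<beta> \<theta>) (A z)) v"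
      by (simp only: cinner_op_adj[OF Ao, symmetric] cinner_op_adj'[OF beta_ops[OF t]])
    also have "\<dots> = cinner (A (op_adj (\<beta> \<theta>) z)) v" by (simp only: 3[OF t])
    also have "\<dots> = cinner z (\<beta> \<theta> (op_adj A v))"
      by (simp only: cinner_op_adj[OF Ao] cinner_op_adj'[OF beta_ops[OF t]])
    finally show "cinner z (op_adj A (\<beta> \<theta> v)) = cinner z (\<beta> \<theta> (op_adj A v))" .
  qed
  have "A \<in> commutant (\<rho> ` H)" by (rule commutantI[OF Ao]) (use 1 in blast)
  moreover have "A o\<^sub>L \<beta> \<theta> = \<beta> \<theta> o\<^sub>L A" "op_adj A o\<^sub>L \<beta> \<theta> = \<beta> \<theta> o\<^sub>L op_adj A" if "\<theta> \<in> \<qq>" for \<theta>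
    by (rule blinfun_eqI, simp add: 2[OF that] 4[OF that])+
  ultimately show "A \<in> icomm" unfolding icomm_def involutive_commutant_def by blast
qed

lemma von_neumann_algebra_icomm: "von_neumann_algebra icomm"
  unfolding icomm_eq
proof (rule von_neumann_algebra_commutant)
  show "\<rho> ` H \<union> \<beta> ` \<qq> \<union> op_adj ` \<beta> ` \<qq> \<subseteq> bounded_ops" using rho_ops beta_ops by auto
  fix B assume "B \<in> \<rho> ` H \<union> \<beta> ` \<qq> \<union> op_adj ` \<beta> ` \<qq>"
  then consider h where "h \<in> H" "B = \<rho> h" | \<theta> where "\<theta> \<in> \<qq>" "B = \<beta> \<theta>"
    | \<theta> where "\<theta> \<in> \<qq>" "B = op_adj (\<beta> \<theta>)" by (elim UnE imageE) simp_all
  then show "op_adj B \<in> \<rho> ` H \<union> \<beta> ` \<qq> \<union> op_adj ` \<beta> ` \<qq>"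
    by cases (use rho_adj beta_ops in auto)
qed

definition R :: "('h \<Rightarrow>\<^sub>L 'h) \<Rightarrow> ('v \<Rightarrow>\<^sub>L 'v)" where
  "R = restrict_op emb"

text \<open>On the range of \<open>emb\<close> the inverse occurring in \<open>restrict_op\<close>
  is \<open>ev\<close>, which makes the restricted map visibly bounded and linear.\<close>

lemma R_apply:
  fixes A :: "'h \<Rightarrow>\<^sub>L 'h"
  assumes "range (\<lambda>v. A (emb v)) \<subseteq> range emb"
  shows "R A v = ev (A (emb v))" "emb (R A v) = A (emb v)"
proof -
  have inj: "inj emb" by (rule inj_on_inverseI[where g = ev]) simp
  have inv: "inv_into UNIV emb (A (emb v)) = ev (A (emb v))" for v
  proof -
    obtain w where "A (emb v) = emb w" using assms by blast
    then show ?thesis using inj by simp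
  qed
  have "bounded_linear (\<lambda>v. ev (A (emb v)))"
    by (rule bounded_linear_compose[OF ev_bounded bounded_linear_compose[OF blinfun.bounded_linear_right emb_bounded]])
  then show RA: "R A v = ev (A (emb v))"
    unfolding R_def restrict_op_def inv by (simp add: bounded_linear_Blinfun_apply)
  obtain w where "A (emb v) = emb w" using assms by blast
  then show "emb (R A v) = A (emb v)" unfolding RA by simp
qed

end

locale induced_invariant = induced +
  assumes con: "connected_space (mfd_top M AM)"
    and inv: "\<forall>A\<in>commutant (\<pi> ` carrier G). blinfun_apply A ` range (embed_V G H \<rho> \<Psi>) \<subseteq> range (embed_V G H \<rho> \<Psi>)"
begin

lemma R_GC:
  assumes "A \<in> GC" shows "R A v = ev (A (emb v))" "emb (R A v) = A (emb v)"
proof -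
  have "range (\<lambda>v. A (emb v)) \<subseteq> range emb" using inv assms by blast
  from R_apply[OF this] show "R A v = ev (A (emb v))" "emb (R A v) = A (emb v)" by blast+
qed

lemma GC_ops: "A \<in> GC \<Longrightarrow> A \<in> bounded_ops" by (rule commutant_bounded_ops)

lemma GC_pi: "A \<in> GC \<Longrightarrow> g \<in> carrier G \<Longrightarrow> A (\<pi> g \<xi>) = \<pi> g (A \<xi>)"
  using commutantD by blast

lemma R_ops: "A \<in> GC \<Longrightarrow> R A \<in> bounded_ops"
  unfolding bounded_ops_def
  by (simp add: is_clinear_def R_GC is_clinearD[OF emb_clinear] is_clinearD[OF ev_clinear]
      is_clinearD[OF bounded_opsD[OF GC_ops]])

lemma R_adj: assumes A: "A \<in> GC" shows "op_adj (R A) = R (op_adj A)"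
proof (rule op_adjI[OF R_ops[OF A]])
  fix v w
  have "cinner (R A v) w = cinner (A (emb v)) (emb w)" by (simp add: R_GC[OF A] cinner_ev)
  also have "\<dots> = cinner (emb v) (op_adj A (emb w))" by (rule cinner_op_adj[OF GC_ops[OF A]])
  also have "\<dots> = cinner v (R (op_adj A) w)" by (simp add: R_GC[OF GC_adj[OF A]] cinner_emb)
  finally show "cinner (R A v) w = cinner v (R (op_adj A) w)" .
qed

text \<open>The adjoint of the equation \<open>emb (R A v) = A (emb v)\<close>, written for
  \<open>op_adj A\<close>; this is where invariance of \<open>V\<close> under the adjoints
  enters.\<close>

lemma ev_R: assumes A: "A \<in> GC" shows "ev (A \<xi>) = R A (ev \<xi>)"
proof (rule cinner_eqI_left)
  fix v
  have "cinner (ev (A \<xi>)) v = cinner \<xi> (op_adj A (emb v))" by (simp add: cinner_ev cinner_op_adj[OF GC_ops[OF A]])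
  also have "\<dots> = cinner (ev \<xi>) (op_adj (R A) v)"
    unfolding R_adj[OF A] by (simp only: cinner_ev R_GC(2)[OF GC_adj[OF A]])
  also have "\<dots> = cinner (R A (ev \<xi>)) v" by (rule cinner_op_adj[OF R_ops[OF A], symmetric])
  finally show "cinner (ev (A \<xi>)) v = cinner (R A (ev \<xi>)) v" .
qed

lemma hat_R: "A \<in> GC \<Longrightarrow> g \<in> carrier G \<Longrightarrow> hat (A \<xi>) g = R A (hat \<xi> g)"
  by (simp add: hat_ev GC_pi[symmetric] ev_R)

text \<open>The value of \<open>hat (emb v)\<close> at the unit is \<open>v\<close>, so the
  differential equation of holomorphic sections there reads off \<open>\<beta> \<theta> v\<close>.
  Differentiating \<open>hat_R\<close> at the unit moves \<open>R A\<close> through it.\<close>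

lemma R_beta: assumes A: "A \<in> GC" and t: "\<theta> \<in> \<qq>" shows "R A (\<beta> \<theta> v) = \<beta> \<theta> (R A v)"
proof -
  obtain x y where xy: "\<theta> = (x, y)" by (cases \<theta>)
  let ?f = "hat (emb v)" and ?f' = "hat (A (emb v))"
  note m = sol_mdiff[OF hat_sol one_closed]
  have T: "bounded_linear (blinfun_apply (R A))" by (rule blinfun.bounded_linear_right)
  have gd: "gd ?f' \<one> z = R A (gd ?f \<one> z)" for z
  proof -
    have "\<forall>\<^sub>F p in nhds c0. R A (?f (\<one> \<otimes> ip p)) = ?f' (\<one> \<otimes> ip p)"
      using eventually_c0 by eventually_elim (simp add: hat_R[OF A])
    from has_derivative_transform_eventually_nhds[OF bounded_linear.has_derivative[OF T gd_has_derivative[OF m one_closed]] this]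
    have "((\<lambda>p. ?f' (\<one> \<otimes> ip p)) has_derivative (\<lambda>z. R A (gd ?f \<one> z))) (at c0)" .
    from has_derivative_unique[OF gd_has_derivative[OF m one_closed] this] show ?thesis by (rule fun_cong)
  qed
  have q: "(x, y) \<in> \<qq>" using t xy by simp
  have "- \<beta> (x, y) (R A v) = gd ?f' \<one> x + \<i> *\<^sub>C gd ?f' \<one> y"
    using sol_gd[OF hat_sol one_closed q, of "A (emb v)"] by (simp add: hat_one ev_R[OF A])
  also have "\<dots> = R A (gd ?f \<one> x + \<i> *\<^sub>C gd ?f \<one> y)"
    by (simp only: gd is_clinear_add[OF bounded_opsD[OF R_ops[OF A]]] is_clinear_scaleC[OF bounded_opsD[OF R_ops[OF A]]])
  also have "\<dots> = - R A (\<beta> (x, y) v)"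
    unfolding sol_gd[OF hat_sol one_closed q] by (simp add: hat_one blinfun.minus_right)
  finally show ?thesis unfolding xy by simp
qed

lemma R_icomm: assumes A: "A \<in> GC" shows "R A \<in> icomm"
proof -
  have "R A (\<rho> h v) = \<rho> h (R A v)" if h: "h \<in> H" for h v
  proof -
    have "emb (R A (\<rho> h v)) = emb (\<rho> h (R A v))"
      using h by (simp add: R_GC(2)[OF A] pi_emb[symmetric] GC_pi[OF A])
    then show ?thesis by (metis ev_emb)
  qed
  then have "R A \<in> commutant (\<rho> ` H)" by (intro commutantI[OF R_ops[OF A]]) blast
  moreover have "R A o\<^sub>L \<beta> \<theta> = \<beta> \<theta> o\<^sub>L R A" "op_adj (R A) o\<^sub>L \<beta> \<theta> = \<beta> \<theta> o\<^sub>L op_adj (R A)" if "\<theta> \<in> \<qq>" for \<theta>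
    unfolding R_adj[OF A]
    by (rule blinfun_eqI, simp add: R_beta[OF A that] R_beta[OF GC_adj[OF A] that])+
  ultimately show ?thesis unfolding icomm_def involutive_commutant_def by blast
qed

lemma R_inj: "inj_on R GC"
proof (rule inj_onI)
  fix A B assume A: "A \<in> GC" and B: "B \<in> GC" and eq: "R A = R B"
  show "A = B"
  proof (rule blinfun_eqI, rule hat_inject)
    fix \<xi> g assume "g \<in> carrier G"
    then show "hat (A \<xi>) g = hat (B \<xi>) g" by (simp add: hat_R A B eq)
  qed
qed

lemma R_surj: assumes B: "B \<in> icomm" shows "B \<in> R ` GC"
proof -
  have "C \<in> Comm" if C: "C \<in> icomm" for C
    using Phi_vanishes[OF con C] icommD(1)[OF C] by (simp add: Comm_def Phi_def)
  with B icommD(2)[OF B] have "B \<in> Comm" "op_adj B \<in> Comm" by blast+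
  then obtain A where A: "A \<in> GC" "\<And>v. A (emb v) = emb (B v)" by (rule extension_exists) blast
  have "R A = B" by (rule blinfun_eqI) (simp add: R_GC(1)[OF A(1)] A(2))
  then show ?thesis using A(1) by blast
qed

lemma GC_algebra:
  assumes "A \<in> GC" "B \<in> GC"
  shows "A + B \<in> GC" "op_scaleC c A \<in> GC" "A o\<^sub>L B \<in> GC"
proof -
  have ops: "A + B \<in> bounded_ops" "op_scaleC c A \<in> bounded_ops"
    using GC_ops[OF assms(1)] GC_ops[OF assms(2)]
    by (simp_all add: bounded_ops_def is_clinear_def blinfun.add_left scaleC_add_right scaleC_scaleC mult.commute)
  show "A + B \<in> GC"
    by (rule commutantI[OF ops(1)]) (auto simp: blinfun.add_left blinfun.add_right GC_pi[OF assms(1)] GC_pi[OF assms(2)])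
  show "op_scaleC c A \<in> GC"
    by (rule commutantI[OF ops(2)]) (auto simp: GC_pi[OF assms(1)] is_clinear_scaleC[OF bounded_opsD[OF pi_ops]])
  show "A o\<^sub>L B \<in> GC"
    by (rule commutantI[OF compose_bounded_ops[OF GC_ops[OF assms(1)] GC_ops[OF assms(2)]]])
       (auto simp: GC_pi[OF assms(1)] GC_pi[OF assms(2)])
qed

theorem von_neumann_iso_R: "von_neumann_iso GC icomm R"
  unfolding von_neumann_iso_def
proof (intro conjI ballI allI)
  show "von_neumann_algebra GC" by (rule von_neumann_algebra_commutant[OF pi_set])
  show "von_neumann_algebra icomm" by (rule von_neumann_algebra_icomm)
  show "bij_betw R GC icomm" unfolding bij_betw_def using R_inj R_icomm R_surj by blast
  fix A assume A: "A \<in> GC"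
  show "R (op_adj A) = op_adj (R A)" by (rule R_adj[OF A, symmetric])
  show "R (op_scaleC c A) = op_scaleC c (R A)" for c
    by (rule blinfun_eqI) (simp add: R_GC(1) A GC_algebra(2)[OF A A] is_clinear_scaleC[OF ev_clinear])
  fix B assume B: "B \<in> GC"
  show "R (A + B) = R A + R B"
    by (rule blinfun_eqI)
       (simp add: R_GC(1) A B GC_algebra(1)[OF A B] blinfun.add_left is_clinear_add[OF ev_clinear])
  show "R (A o\<^sub>L B) = R A o\<^sub>L R B"
    by (rule blinfun_eqI) (simp add: R_GC(1)[OF GC_algebra(3)[OF A B]] R_GC(1)[OF A] R_GC(2)[OF B])
qed

end

theorem theorem2p12:
  fixes G :: "('g, 'a::banach) lie_group"
    and H :: "'g set"
    and AH :: "('g, 'b::banach) chart set"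
    and AM :: "('g set, 'm::cbanach) chart set"
    and \<rho> :: "'g \<Rightarrow> 'v::chilbert \<Rightarrow>\<^sub>L 'v"
    and \<beta> :: "'a \<times> 'a \<Rightarrow> 'v \<Rightarrow>\<^sub>L 'v"
    and \<pi> :: "'g \<Rightarrow> 'h::chilbert \<Rightarrow>\<^sub>L 'h"
    and \<Psi> :: "'h \<Rightarrow> 'g set \<Rightarrow> ('g \<times> 'v) set"
  assumes "complex_homogeneous_space G H AH AM"
    and "connected_space (mfd_top (lcosets\<^bsub>G\<^esub> H) AM)"
    and "representation_of_pair G H AH (isotropy_q G H AM) \<rho> \<beta>"
    and "holomorphically_induced_via G H AM \<rho> \<beta> \<pi> \<Psi>"
    and "\<forall>A\<in>commutant (\<pi> ` carrier G).
      blinfun_apply A ` range (embed_V G H \<rho> \<Psi>) \<subseteq> range (embed_V G H \<rho> \<Psi>)"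
  shows "von_neumann_iso (commutant (\<pi> ` carrier G))
    (involutive_commutant H (isotropy_q G H AM) \<rho> \<beta>) (restrict_op (embed_V G H \<rho> \<Psi>))"
proof -
  have "banach_lie_group G" using assms(1) by (simp add: complex_homogeneous_space_def)
  moreover from this have "group G" by (simp add: banach_lie_group_def)
  ultimately interpret induced_invariant G H AH AM \<rho> \<beta> \<pi> \<Psi>
    using assms
    by (intro induced_invariant.intro induced.intro pair_rep.intro homogeneous.intro banach_lie.intro
        banach_lie_axioms.intro homogeneous_axioms.intro pair_rep_axioms.intro induced_axioms.intro
        induced_invariant_axioms.intro)
  show ?thesis using von_neumann_iso_R unfolding icomm_def R_def .
qed

end
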